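(* Let $B$ be an exchange matrix of finite type $D$. The (outer) normal fan of the Minkowski sum $\sum_{\gamma\in\Pi}P_\gamma$ is equal to $\mathcal{N}(B^\vee)$, where $P_\gamma\subset\mathbb{R}^n$ is the Newton polytope of the $F$-polynomial $F_\gamma(\mathbf{y})$ of $B$.
   Context: Cluster set-up. $D$ is a connected finite type Dynkin diagram (simply-laced or multiply-laced) with vertex set $I=\{1,\dots,n\}$ and Cartan matrix $(a_{ij})$. Fix an orientation of the underlying tree of $D$, with edges written $i\to j$; the associated exchange matrix $B$ (of type $D$) has $B_{ij}=-a_{ij}$ if $i\to j$, $B_{ij}=a_{ij}$ if $j\to i$, and $B_{ij}=0$ otherwise. $D^\vee$ is the Dynkin diagram with transposed Cartan matrix and $B^\vee$ is the exchange matrix of type $D^\vee$ for the same orientation. The exchange relation at a seed with (extended) matrix $(b_{ij})$ is $x_kx_k'=\prod_{b_{ik}>0}x_i^{b_{ik}}+\prod_{b_{ik}<0}x_i^{-b_{ik}}$. $\Pi=\Pi(B)$ is a finite indexing set for the mutable cluster variables $x_\gamma$. $F$-polynomials and $\mathbf{g}$-vectors. The principal coefficient cluster algebra of $B$ has $2n\times n$ extended exchange matrix with top half $B$ and bottom half the identity, with initial mutable variables $x_1,\dots,x_n$ and frozen variables $y_1,\dots,y_n$. $F_\gamma(\mathbf{y})$ is obtained from the Laurent expansion of $x_\gamma$ in the initial cluster by setting $x_1=\dots=x_n=1$ (so $F_\gamma=1$ and $P_\gamma=\{0\}$ if $x_\gamma$ is initial). Giving $\deg x_i=e_i$, $\deg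 y_i=-Be_i$, each $x_\gamma$ is homogeneous and its degree is the $\mathbf{g}$-vector $\mathbf{g}_\gamma\in\mathbb{Z}^n$. The cluster fan $\mathcal{N}(B)$ is the collection of cones in $\mathbb{R}^n$ spanned by $\{\mathbf{g}_{\gamma_1},\dots,\mathbf{g}_{\gamma_s}\}$, for sets of cluster variables contained in a common cluster; $\mathcal{N}(B^\vee)$ is the same construction for $B^\vee$. *)

theory Defs
  imports
    "HOL-Analysis.Analysis"
    "HOL-Library.Poly_Mapping"
    "HOL-Computational_Algebra.Fraction_Field"
begin

type_synonym 'n int_vector = "int^'n"
type_synonym 'n int_matrix = "int^'n^'n"

section \<open>Dynkin diagrams and their exchange matrices\<close>

text \<open>
  A finite type Dynkin diagram is represented by its Cartan matrix. The vertex set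
  \<open>I\<close> is (the universe of) a finite, linearly ordered type \<open>'n\<close>, so that
  $n$ is the cardinality of \<open>'n\<close>.
\<close>

definition generalized_cartan_matrix :: "'n::finite int_matrix \<Rightarrow> bool" where
  "generalized_cartan_matrix A \<longleftrightarrow>
     (\<forall>i. A $ i $ i = 2) \<and>
     (\<forall>i j. i \<noteq> j \<longrightarrow> A $ i $ j \<le> 0) \<and>
     (\<forall>i j. A $ i $ j = 0 \<longleftrightarrow> A $ j $ i = 0)"

text \<open>Finite type: some positive diagonal rescaling of the rows is symmetric and positive definite.\<close>

definition finite_type_matrix :: "'n::finite int_matrix \<Rightarrow> bool" where
  "finite_type_matrix A \<longleftrightarrow>
     (\<exists>d :: 'n \<Rightarrow> real.
        (\<forall>i. d i > 0) \<and>
        (\<forall>i j. d i * real_of_int (A $ i $ j) = d j * real_of_int (A $ j $ i)) \<and>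
        (\<forall>v :: real^'n. v \<noteq> 0 \<longrightarrow>
           (\<Sum>i\<in>UNIV. \<Sum>j\<in>UNIV. d i * real_of_int (A $ i $ j) * v $ i * v $ j) > 0))"

definition diagram_edges :: "'n::finite int_matrix \<Rightarrow> ('n \<times> 'n) set" where
  "diagram_edges A = {(i, j). i \<noteq> j \<and> A $ i $ j \<noteq> 0}"

definition finite_type_dynkin :: "'n::finite int_matrix \<Rightarrow> bool" where
  "finite_type_dynkin A \<longleftrightarrow>
     generalized_cartan_matrix A \<and> finite_type_matrix A \<and> (diagram_edges A)\<^sup>* = UNIV"

definition diagram_orientation :: "'n::finite int_matrix \<Rightarrow> ('n \<times> 'n) set \<Rightarrow> bool" where
  "diagram_orientation A E \<longleftrightarrow>
     E \<subseteq> diagram_edges A \<and>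
     (\<forall>(i, j) \<in> diagram_edges A. (i, j) \<in> E \<longleftrightarrow> (j, i) \<notin> E)"

definition exchange_matrix :: "'n::finite int_matrix \<Rightarrow> ('n \<times> 'n) set \<Rightarrow> 'n int_matrix" where
  "exchange_matrix A E =
     (\<chi> i j. if (i, j) \<in> E then - (A $ i $ j) else if (j, i) \<in> E then A $ i $ j else 0)"


section \<open>The ambient field\<close>

text \<open>\<open>MutVar i\<close> is the initial mutable variable $x_i$, and \<open>FrozVar i\<close> the frozen variable $y_i$.\<close>

datatype 'n var = MutVar 'n | FrozVar 'n

instance var :: (finite) finite
proof
  have "v \<in> range MutVar \<union> range FrozVar" for v :: "'a var"
    by (cases v) auto
  then have *: "(UNIV :: 'a var set) = range MutVar \<union> range FrozVar"
    by blast
  show "finite (UNIV :: 'a var set)"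
    unfolding * by simp
qed

text \<open>
  The order on variables has no mathematical significance: it serves only to obtain, from the
  instances of \<open>HOL-Library.Poly_Mapping\<close>, that Laurent polynomials form an integral domain.
\<close>

instantiation var :: (linorder) linorder
begin

fun less_eq_var :: "'a var \<Rightarrow> 'a var \<Rightarrow> bool" where
  "less_eq_var (MutVar i) (MutVar j) \<longleftrightarrow> i \<le> j"
| "less_eq_var (MutVar i) (FrozVar j) \<longleftrightarrow> True"
| "less_eq_var (FrozVar i) (MutVar j) \<longleftrightarrow> False"
| "less_eq_var (FrozVar i) (FrozVar j) \<longleftrightarrow> i \<le> j"

definition less_var :: "'a var \<Rightarrow> 'a var \<Rightarrow> bool" where
  "less_var v w \<longleftrightarrow> v \<le> w \<and> \<not> w \<le> v"

instance
proof
  fix u v w :: "'a var"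
  show "v < w \<longleftrightarrow> v \<le> w \<and> \<not> w \<le> v" by (rule less_var_def)
  show "v \<le> v" by (cases v) auto
  show "u \<le> v \<Longrightarrow> v \<le> w \<Longrightarrow> u \<le> w" by (cases u; cases v; cases w) auto
  show "v \<le> w \<Longrightarrow> w \<le> v \<Longrightarrow> v = w" by (cases v; cases w) auto
  show "v \<le> w \<or> w \<le> v" by (cases v; cases w) auto
qed

end

text \<open>
  Laurent polynomials with integer coefficients in variables \<open>'v\<close>; a monomial is its exponent
  vector \<open>'v \<Rightarrow>\<^sub>0 int\<close>. The ambient field is the field of rational functions, obtained as the
  fraction field of the Laurent polynomial ring in all $2n$ variables.
\<close>

type_synonym 'v laurent = "('v \<Rightarrow>\<^sub>0 int) \<Rightarrow>\<^sub>0 int"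
type_synonym 'n ratfun = "'n var laurent fract"

definition gen :: "'n::linorder var \<Rightarrow> 'n ratfun" where
  "gen v = Fract (Poly_Mapping.single (Poly_Mapping.single v 1) 1) 1"


section \<open>Seeds with principal coefficients and their mutations\<close>

text \<open>
  A labelled seed is a cluster together with its $2n \times n$ extended exchange matrix, whose
  rows are indexed by all variables and whose columns are indexed by the mutable ones.
\<close>

type_synonym 'n extended_matrix = "int^'n^'n var"
type_synonym 'n seed = "('n \<Rightarrow> 'n ratfun) \<times> 'n extended_matrix"

definition principal_seed :: "'n::{finite,linorder} int_matrix \<Rightarrow> 'n seed" where
  "principal_seed B =
     (\<lambda>i. gen (MutVar i),
      \<chi> v j. case v of MutVar i \<Rightarrow> B $ i $ j | FrozVar i \<Rightarrow> (if i = j then 1 else 0))"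

definition matrix_mutation :: "'n::finite \<Rightarrow> 'n extended_matrix \<Rightarrow> 'n extended_matrix" where
  "matrix_mutation k b =
     (\<chi> v j. if v = MutVar k \<or> j = k then - (b $ v $ j)
             else b $ v $ j + max 0 (b $ v $ k) * max 0 (b $ MutVar k $ j)
                            - max 0 (- (b $ v $ k)) * max 0 (- (b $ MutVar k $ j)))"

definition seed_element :: "('n::linorder \<Rightarrow> 'n ratfun) \<Rightarrow> 'n var \<Rightarrow> 'n ratfun" where
  "seed_element x v = (case v of MutVar i \<Rightarrow> x i | FrozVar i \<Rightarrow> gen (FrozVar i))"

definition exchanged_variable :: "'n::{finite,linorder} \<Rightarrow> 'n seed \<Rightarrow> 'n ratfun" where
  "exchanged_variable k s = (case s of (x, b) \<Rightarrow>
     ((\<Prod>v | b $ v $ k > 0. seed_element x v ^ nat (b $ v $ k)) +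
      (\<Prod>v | b $ v $ k < 0. seed_element x v ^ nat (- (b $ v $ k)))) / x k)"

definition seed_mutation :: "'n::{finite,linorder} \<Rightarrow> 'n seed \<Rightarrow> 'n seed" where
  "seed_mutation k s = ((fst s)(k := exchanged_variable k s), matrix_mutation k (snd s))"

inductive_set seeds :: "'n::{finite,linorder} int_matrix \<Rightarrow> 'n seed set"
  for B where
  initial: "principal_seed B \<in> seeds B"
| mutation: "s \<in> seeds B \<Longrightarrow> seed_mutation k s \<in> seeds B"

definition clusters :: "'n::{finite,linorder} int_matrix \<Rightarrow> 'n ratfun set set" where
  "clusters B = {range x | x b. (x, b) \<in> seeds B}"

text \<open>
  The mutable cluster variables, without repetition. This set plays the role of the index
  set \<open>\<Pi>(B)\<close>; it is finite when \<open>B\<close> is of finite type.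
\<close>

definition cluster_variables :: "'n::{finite,linorder} int_matrix \<Rightarrow> 'n ratfun set" where
  "cluster_variables B = \<Union> (clusters B)"


section \<open>\<open>F\<close>-polynomials, \<open>g\<close>-vectors and the cluster fan\<close>

text \<open>
  The Laurent expansion in the initial cluster. It is unique since the Laurent polynomial ring
  embeds in its fraction field, and it exists for cluster variables by the Laurent phenomenon.
\<close>

definition laurent_expansion :: "'n::linorder ratfun \<Rightarrow> 'n var laurent" where
  "laurent_expansion f = (THE L. Fract L 1 = f)"

text \<open>
  Setting every $x_i$ to $1$ keeps only the \<open>y\<close>-part of each monomial, adding up the coefficients
  of monomials with the same \<open>y\<close>-part. The result is typed as a Laurent polynomial, although for
  cluster variables no negative exponents occur.
\<close>

definition F_polynomial :: "'n::linorder ratfun \<Rightarrow> 'n laurent" where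
  "F_polynomial f =
     (let L = laurent_expansion f
      in \<Sum>m\<in>Poly_Mapping.keys L.
           Poly_Mapping.single (Poly_Mapping.map_key FrozVar m) (Poly_Mapping.lookup L m))"

text \<open>The degree of a Laurent monomial for the grading with $\deg x_i = e_i$ and $\deg y_i = -B e_i$.\<close>

definition monomial_degree :: "'n::finite int_matrix \<Rightarrow> ('n var \<Rightarrow>\<^sub>0 int) \<Rightarrow> 'n int_vector" where
  "monomial_degree B m =
     (\<Sum>i\<in>UNIV. Poly_Mapping.lookup m (MutVar i) *s axis i 1) +
     (\<Sum>i\<in>UNIV. Poly_Mapping.lookup m (FrozVar i) *s (- (B *v axis i 1)))"

text \<open>The degree of an element whose Laurent expansion is nonzero and homogeneous for this grading.\<close>

definition g_vector :: "'n::{finite,linorder} int_matrix \<Rightarrow> 'n ratfun \<Rightarrow> 'n int_vector" where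
  "g_vector B f =
     (THE d. \<forall>m\<in>Poly_Mapping.keys (laurent_expansion f). monomial_degree B m = d)"

definition real_vector :: "'n::finite int_vector \<Rightarrow> real^'n" where
  "real_vector v = (\<chi> i. real_of_int (v $ i))"

definition cluster_fan :: "'n::{finite,linorder} int_matrix \<Rightarrow> (real, 'n) vec set set" where
  "cluster_fan B =
     {convex_cone hull ((\<lambda>f. real_vector (g_vector B f)) ` S) | S C. C \<in> clusters B \<and> S \<subseteq> C}"


section \<open>Newton polytopes and normal fans\<close>

definition newton_polytope :: "'n laurent \<Rightarrow> (real^'n) set" where
  "newton_polytope p =
     convex hull ((\<lambda>m. \<chi> i. real_of_int (Poly_Mapping.lookup m i)) ` Poly_Mapping.keys p)"

text \<open>
  The outer normal cone of a face \<open>F\<close> of \<open>P\<close>: all functionals attaining their maximum over \<open>P\<close>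
  at every point of \<open>F\<close>.
\<close>

definition outer_normal_cone :: "'a::euclidean_space set \<Rightarrow> 'a set \<Rightarrow> 'a set" where
  "outer_normal_cone P F = {w. \<forall>x\<in>F. \<forall>y\<in>P. w \<bullet> y \<le> w \<bullet> x}"

definition outer_normal_fan :: "'a::euclidean_space set \<Rightarrow> 'a set set" where
  "outer_normal_fan P = {outer_normal_cone P F | F. F face_of P \<and> F \<noteq> {}}"

end

theory Submission
  imports Defs
begin

text \<open>
  The columns of the lower half of a mutated matrix (the c-vectors) form a tuple of roots that is
  constrained by the Euler form of the orientation. The constraint is invariant under reflection at
  a source of the orientation, and such reflections make any prescribed member of a tuple simple at a
  source, where mutation is transparent. This gives sign coherence, finiteness, and, by duality and
  the dominance of the monomial without frozen variables, the identification of the g-vectors of the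
  dual diagram with the basis dual to the c-vectors of \<open>B\<close>.

  The support function of a Newton polytope \<open>P\<^sub>\<gamma>\<close> is the tropicalisation of the cluster variable \<open>\<gamma>\<close>.
  Along source sequences the tropical exchange relations are explicit: every support function is
  linear on the cone dual to a tuple of c-vectors, and across each wall of such a cone some exchange
  relation bends one of them strictly. Every cluster variable occurs along a source sequence, so the
  domains of linearity of the support function of the Minkowski sum are exactly these cones.
\<close>

section \<open>Euler forms of orientations\<close>

text \<open>A source reflection stands for a change of the initial seed. On c-vectors it acts by one
  of two linear maps, a simple reflection or a sign change of one coordinate, according to whether
  the simple root belongs to the tuple. The same two maps, transposed, are the linear pieces of the
  tropical mutation of coefficients at a source; this coincidence makes the support functions linear
  on the dual cones. The obstacle is that a general mutation offers no direct hold on the Euler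
  form. Commutation with a move is therefore proved backwards: validity of the mutated tuple after
  the move yields validity before it, and the induction starts at the end of a source sequence. That
  the sequence can reach a simple root is a monovariant argument: at a source a dual vector has a
  nonpositive coordinate unless its own partner is the simple root there, so reflecting raises its
  height. Cluster variables are subtraction-free, so addition tropicalises to a maximum without
  cancellation. Since all objects are attached to words of mutations, equal tuples must be shown to
  give equal variables before sums over variables can be compared.\<close>

locale cartan =
  fixes A :: "int^'n::finite^'n" and d :: "'n \<Rightarrow> real"
  assumes d_pos: "d i > 0"
    and sym: "d i * of_int (A $ i $ j) = d j * of_int (A $ j $ i)"
    and posdef: "v \<noteq> 0 \<Longrightarrow> (\<Sum>i\<in>UNIV. \<Sum>j\<in>UNIV. d i * of_int (A $ i $ j) * v $ i * (v :: real^'n) $ j) > 0"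
    and diag: "A $ i $ i = 2"
    and offdiag: "i \<noteq> j \<Longrightarrow> A $ i $ j \<le> 0"
begin

abbreviation orient :: "('n \<times> 'n) set \<Rightarrow> bool" where
  "orient \<equiv> diagram_orientation A"

lemma orient_iff:
  "orient E \<longleftrightarrow> (\<forall>i j. (i, j) \<in> E \<longrightarrow> i \<noteq> j \<and> A $ i $ j \<noteq> 0) \<and>
     (\<forall>i j. i \<noteq> j \<longrightarrow> A $ i $ j \<noteq> 0 \<longrightarrow> ((i, j) \<in> E \<longleftrightarrow> (j, i) \<notin> E))"
proof -
  have 1: "E \<subseteq> diagram_edges A \<longleftrightarrow> (\<forall>i j. (i, j) \<in> E \<longrightarrow> i \<noteq> j \<and> A $ i $ j \<noteq> 0)"
    unfolding diagram_edges_def subset_iff by (simp only: split_paired_All mem_Collect_eq case_prod_conv)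
  have 2: "(\<forall>(i, j) \<in> diagram_edges A. (i, j) \<in> E \<longleftrightarrow> (j, i) \<notin> E) \<longleftrightarrow>
      (\<forall>i j. i \<noteq> j \<longrightarrow> A $ i $ j \<noteq> 0 \<longrightarrow> ((i, j) \<in> E \<longleftrightarrow> (j, i) \<notin> E))"
    unfolding diagram_edges_def Ball_def
    by (simp only: split_paired_All mem_Collect_eq case_prod_conv imp_conjL)
  show ?thesis
    unfolding diagram_orientation_def 1 2 ..
qed

lemma orientD:
  assumes "orient E"
  shows "(i, j) \<in> E \<Longrightarrow> i \<noteq> j" "(i, j) \<in> E \<Longrightarrow> (j, i) \<notin> E"
    "i \<noteq> j \<Longrightarrow> A $ i $ j \<noteq> 0 \<Longrightarrow> (i, j) \<in> E \<or> (j, i) \<in> E"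
    "(i, j) \<in> E \<Longrightarrow> A $ i $ j \<noteq> 0"
  using assms unfolding orient_iff by metis+

lemma A_zero_sym: "A $ i $ j = 0 \<longleftrightarrow> A $ j $ i = 0"
  using sym[of i j] d_pos[of i] d_pos[of j] by auto

text \<open>The Euler form of the hereditary category attached to the orientation:
  \<open>d i\<close> on the diagonal and an Ext contribution along each arrow from \<open>i\<close>
  to \<open>j\<close>. Half of \<open>d i * A $ i $ i\<close> sits on the diagonal and each edge is
  counted in one order only, so symmetrising returns the weighted Cartan form.\<close>

definition coef :: "('n \<times> 'n) set \<Rightarrow> 'n \<Rightarrow> 'n \<Rightarrow> real" where
  "coef E i j = (if i = j then d i else if (i, j) \<in> E then d i * of_int (A $ i $ j) else 0)"

definition euler :: "('n \<times> 'n) set \<Rightarrow> int^'n \<Rightarrow> int^'n \<Rightarrow> real" where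
  "euler E x y = (\<Sum>i\<in>UNIV. \<Sum>j\<in>UNIV. coef E i j * of_int (x $ i) * of_int (y $ j))"

definition sym_form :: "int^'n \<Rightarrow> int^'n \<Rightarrow> real" where
  "sym_form x y = (\<Sum>i\<in>UNIV. \<Sum>j\<in>UNIV. d i * of_int (A $ i $ j) * of_int (x $ i) * of_int (y $ j))"

lemma euler_add_left: "euler E (x + y) z = euler E x z + euler E y z"
  and euler_add_right: "euler E z (x + y) = euler E z x + euler E z y"
  and euler_scale_left: "euler E (c *s x) z = of_int c * euler E x z"
  and euler_scale_right: "euler E z (c *s x) = of_int c * euler E z x"
  by (simp_all add: euler_def algebra_simps sum.distrib sum_distrib_left)

lemma euler_minus_left: "euler E (- x) z = - euler E x z"
  and euler_minus_right: "euler E z (- x) = - euler E z x"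
  by (simp_all add: euler_def sum_negf)

lemma euler_diff_left: "euler E (x - y) z = euler E x z - euler E y z"
  and euler_diff_right: "euler E z (x - y) = euler E z x - euler E z y"
  by (simp_all add: euler_def algebra_simps sum_subtractf)

lemma euler_zero: "euler E 0 z = 0" "euler E z 0 = 0"
  by (simp_all add: euler_def)

lemmas euler_lin = euler_add_left euler_add_right euler_scale_left euler_scale_right
  euler_minus_left euler_minus_right euler_diff_left euler_diff_right euler_zero

lemma euler_sum_left: "euler E (sum f I) z = (\<Sum>l\<in>I. euler E (f l) z)"
  by (induction I rule: infinite_finite_induct) (auto simp: euler_lin)

lemma euler_sum_right: "euler E z (sum f I) = (\<Sum>l\<in>I. euler E z (f l))"
  by (induction I rule: infinite_finite_induct) (auto simp: euler_lin)

lemma coef_sum: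
  assumes "orient E"
  shows "coef E i j + coef E j i = d i * of_int (A $ i $ j)"
proof (cases "i = j")
  case True
  then show ?thesis using diag[of i] by (simp add: coef_def)
next
  case False
  show ?thesis
  proof (cases "A $ i $ j = 0")
    case True
    then have "(i, j) \<notin> E" "(j, i) \<notin> E"
      using orientD(4)[OF assms] A_zero_sym by metis+
    then show ?thesis using False True by (simp add: coef_def)
  next
    case nz: False
    have "(i, j) \<in> E \<longleftrightarrow> (j, i) \<notin> E"
      using orientD(2,3)[OF assms] nz False by metis
    then show ?thesis using False sym[of i j] by (simp add: coef_def)
  qed
qed

lemma sym_form_euler:
  assumes "orient E"
  shows "sym_form x y = euler E x y + euler E y x"
proof -
  have "euler E y x = (\<Sum>i\<in>UNIV. \<Sum>j\<in>UNIV. coef E j i * of_int (x $ i) * of_int (y $ j))"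
    unfolding euler_def by (subst sum.swap) (simp add: mult_ac)
  then have "euler E x y + euler E y x =
      (\<Sum>i\<in>UNIV. \<Sum>j\<in>UNIV. (coef E i j + coef E j i) * of_int (x $ i) * of_int (y $ j))"
    by (simp add: euler_def sum.distrib algebra_simps)
  then show ?thesis
    by (simp add: coef_sum[OF assms] sym_form_def)
qed

lemma sym_form_pos: "x \<noteq> 0 \<Longrightarrow> sym_form x x > 0"
proof -
  assume "x \<noteq> 0"
  then have "(\<chi> i. real_of_int (x $ i)) \<noteq> 0"
    by (auto simp: vec_eq_iff)
  from posdef[OF this] show ?thesis
    by (simp add: sym_form_def)
qed

lemma euler_pos: "orient E \<Longrightarrow> x \<noteq> 0 \<Longrightarrow> euler E x x > 0"
  using sym_form_pos[of x] sym_form_euler[of E x x] by simp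

lemma sym_form_axis: "sym_form x (axis k 1) = d k * of_int (\<Sum>j\<in>UNIV. A $ k $ j * x $ j)"
proof -
  have "sym_form x (axis k 1) = (\<Sum>i\<in>UNIV. \<Sum>j\<in>UNIV. if j = k then d i * of_int (A $ i $ k) * of_int (x $ i) else 0)"
    unfolding sym_form_def by (intro sum.cong refl) (auto simp: axis_def)
  also have "\<dots> = (\<Sum>i\<in>UNIV. d k * of_int (A $ k $ i) * of_int (x $ i))"
    by (simp add: sym[of _ k])
  finally show ?thesis
    by (simp add: sum_distrib_left mult_ac)
qed

definition is_source :: "('n \<times> 'n) set \<Rightarrow> 'n \<Rightarrow> bool" where
  "is_source E k \<longleftrightarrow> (\<forall>j. (j, k) \<notin> E)"

definition is_sink :: "('n \<times> 'n) set \<Rightarrow> 'n \<Rightarrow> bool" where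
  "is_sink E k \<longleftrightarrow> (\<forall>j. (k, j) \<notin> E)"

text \<open>At a source or a sink this is the mutation of the orientation.\<close>

definition flipE :: "'n \<Rightarrow> ('n \<times> 'n) set \<Rightarrow> ('n \<times> 'n) set" where
  "flipE k E = {(i, j). if i = k \<or> j = k then (j, i) \<in> E else (i, j) \<in> E}"

lemma flipE_flipE [simp]: "flipE k (flipE k E) = E"
  by (auto simp: flipE_def)

lemma flipE_iff: "(i, j) \<in> flipE k E \<longleftrightarrow> (if i = k \<or> j = k then (j, i) \<in> E else (i, j) \<in> E)"
  by (simp add: flipE_def)

lemma orient_flipE:
  assumes "orient E"
  shows "orient (flipE k E)"
proof -
  have 1: "i \<noteq> j \<and> A $ i $ j \<noteq> 0" if "(i, j) \<in> flipE k E" for i j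
    using that orientD(1,4)[OF assms, of i j] orientD(1,4)[OF assms, of j i] A_zero_sym[of i j]
    by (auto simp: flipE_iff split: if_splits)
  have 2: "(i, j) \<in> flipE k E \<longleftrightarrow> (j, i) \<notin> flipE k E" if "i \<noteq> j" "A $ i $ j \<noteq> 0" for i j
  proof -
    have e: "(i, j) \<in> E \<longleftrightarrow> (j, i) \<notin> E"
      using orientD(2,3)[OF assms] that by metis
    show ?thesis
      using e by (auto simp: flipE_iff)
  qed
  show ?thesis
    unfolding orient_iff by (intro conjI allI impI) (use 1 2 in blast)+
qed

lemma orient_converse:
  assumes "orient E"
  shows "orient (E\<inverse>)"
proof -
  have 1: "i \<noteq> j \<and> A $ i $ j \<noteq> 0" if "(j, i) \<in> E" for i j
    using that orientD(1,4)[OF assms, of j i] A_zero_sym[of i j] by auto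
  have 2: "(j, i) \<in> E \<longleftrightarrow> (i, j) \<notin> E" if "i \<noteq> j" "A $ i $ j \<noteq> 0" for i j
    using orientD(2,3)[OF assms] that by metis
  show ?thesis
    unfolding orient_iff converse_iff by (intro conjI allI impI) (use 1 2 in blast)+
qed

lemma source_flipE: "is_source E k \<Longrightarrow> is_sink (flipE k E) k"
  by (auto simp: is_source_def is_sink_def flipE_def)

lemma source_converse: "is_source (E\<inverse>) k \<longleftrightarrow> is_sink E k"
  by (auto simp: is_source_def is_sink_def)

lemma flipE_converse: "flipE k (E\<inverse>) = (flipE k E)\<inverse>"
  by (auto simp: flipE_def)

lemma euler_converse:
  assumes "orient E"
  shows "euler (E\<inverse>) x y = euler E y x"
proof -
  have c: "coef (E\<inverse>) i j = coef E j i" for i j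
    using orientD[OF assms, of j i] sym[of i j] by (auto simp: coef_def)
  show ?thesis
    unfolding euler_def c by (subst sum.swap) (simp add: mult_ac)
qed

text \<open>Column \<open>k\<close> of the coefficients has only its diagonal entry at a source.
  Pairing with the simple root on the right therefore reads off a coordinate, which is the main use
  made of sources.\<close>

lemma euler_source:
  assumes "is_source E k"
  shows "euler E x (axis k 1) = d k * of_int (x $ k)"
proof -
  have "euler E x (axis k 1) = (\<Sum>i\<in>UNIV. \<Sum>j\<in>UNIV. if j = k then (if i = k then d k * of_int (x $ k) else 0) else 0)"
    unfolding euler_def using assms
    by (intro sum.cong refl) (auto simp: axis_def coef_def is_source_def)
  then show ?thesis by simp
qed

lemma euler_sink:
  assumes "orient E" "is_sink E k"
  shows "euler E (axis k 1) x = d k * of_int (x $ k)"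
  using euler_source[of "E\<inverse>" k x] euler_converse[OF assms(1)] assms(2) source_converse by metis

definition refl_at :: "'n \<Rightarrow> int^'n \<Rightarrow> int^'n" where
  "refl_at k x = x - (\<Sum>j\<in>UNIV. A $ k $ j * x $ j) *s axis k 1"

definition neg_at :: "'n \<Rightarrow> int^'n \<Rightarrow> int^'n" where
  "neg_at k x = x - (2 * x $ k) *s axis k 1"

lemma refl_at_nth: "refl_at k x $ j = (if j = k then x $ k - (\<Sum>j\<in>UNIV. A $ k $ j * x $ j) else x $ j)"
  by (simp add: refl_at_def axis_def)

lemma neg_at_nth: "neg_at k x $ j = (if j = k then - x $ k else x $ j)"
  by (simp add: neg_at_def axis_def)

lemma refl_at_add: "refl_at k (x + y) = refl_at k x + refl_at k y"
  and refl_at_scale: "refl_at k (c *s x) = c *s refl_at k x"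
  and refl_at_minus: "refl_at k (- x) = - refl_at k x"
  by (auto simp: vec_eq_iff refl_at_nth algebra_simps sum.distrib sum_distrib_left sum_negf)

lemma refl_at_sum: "refl_at k (sum f I) = (\<Sum>l\<in>I. refl_at k (f l))"
proof (induction I rule: infinite_finite_induct)
  case empty
  then show ?case by (simp add: refl_at_def)
qed (auto simp: refl_at_add, simp add: refl_at_def)

lemma sum_A_axis: "(\<Sum>j\<in>UNIV. A $ k $ j * (axis l 1 :: int^'n) $ j) = A $ k $ l"
proof -
  have "(\<Sum>j\<in>UNIV. A $ k $ j * (axis l 1 :: int^'n) $ j) = (\<Sum>j\<in>UNIV. if j = l then A $ k $ l else 0)"
    by (intro sum.cong) (auto simp: axis_def)
  then show ?thesis by simp
qed

lemma refl_at_axis_same: "refl_at k (axis k 1) = - axis k 1"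
  by (simp add: refl_at_def sum_A_axis diag vec_eq_iff)

lemma refl_at_refl_at [simp]: "refl_at k (refl_at k x) = x"
proof -
  have "refl_at k (refl_at k x) = refl_at k x - (\<Sum>j\<in>UNIV. A $ k $ j * x $ j) *s refl_at k (axis k 1)"
    unfolding refl_at_def[of k x] diff_conv_add_uminus refl_at_add refl_at_minus refl_at_scale ..
  also have "\<dots> = refl_at k x + (\<Sum>j\<in>UNIV. A $ k $ j * x $ j) *s axis k 1"
    unfolding refl_at_axis_same by (simp add: vec_eq_iff)
  also have "\<dots> = x"
    by (simp add: refl_at_def)
  finally show ?thesis .
qed

lemma neg_at_neg_at [simp]: "neg_at k (neg_at k x) = x"
  by (simp add: vec_eq_iff neg_at_nth)

text \<open>Numerical form of the reflection functor at a source. The Euler forms of the two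
  orientations differ by an antisymmetric term supported in row and column \<open>k\<close>; the
  corrections by multiples of the simple root, evaluated at the sink of the new orientation, cancel
  that term.\<close>

lemma euler_refl_at:
  assumes "orient E" "is_source E k"
  shows "euler (flipE k E) (refl_at k x) (refl_at k y) = euler E x y"
proof -
  let ?E = "flipE k E" and ?a = "axis k 1 :: int^'n"
  define s where "s x = (\<Sum>j\<in>UNIV. A $ k $ j * x $ j)" for x :: "int^'n"
  have o: "orient ?E" "is_sink ?E k"
    using assms orient_flipE source_flipE by auto
  have 1: "euler ?E ?a y = d k * of_int (y $ k)" for y
    using euler_sink[OF o] .
  have 2: "euler ?E x ?a = d k * of_int (s x) - d k * of_int (x $ k)" for x
    using sym_form_euler[OF o(1), of x ?a] sym_form_axis[of x k] 1[of x] by (simp add: s_def)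
  have s_a: "s ?a = 2"
    by (simp add: s_def sum_A_axis diag)
  have c: "coef E i j - coef ?E i j =
      (if i = k then d k * of_int (A $ k $ j) else 0) - (if j = k then d k * of_int (A $ k $ i) else 0)" for i j
  proof -
    have k: "(k, l) \<in> E \<longleftrightarrow> A $ k $ l \<noteq> 0" if "l \<noteq> k" for l
      using orientD(3,4)[OF assms(1)] assms(2) that unfolding is_source_def by metis
    have k': "(l, k) \<notin> E" for l
      using assms(2) by (simp add: is_source_def)
    show ?thesis
      using k[of i] k[of j] diag[of k] sym[of k i] by (auto simp: coef_def flipE_iff k')
  qed
  have "euler E x y - euler ?E x y =
     (\<Sum>i\<in>UNIV. \<Sum>j\<in>UNIV. (coef E i j - coef ?E i j) * of_int (x $ i) * of_int (y $ j))"
    by (simp add: euler_def algebra_simps sum_subtractf)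
  also have "\<dots> = (\<Sum>i\<in>UNIV. \<Sum>j\<in>UNIV. (if i = k then d k * of_int (A $ k $ j) * of_int (x $ k) * of_int (y $ j) else 0))
      - (\<Sum>i\<in>UNIV. \<Sum>j\<in>UNIV. (if j = k then d k * of_int (A $ k $ i) * of_int (x $ i) * of_int (y $ k) else 0))"
    unfolding c sum_subtractf[symmetric] by (intro sum.cong refl) (auto simp: algebra_simps)
  also have "(\<Sum>i\<in>UNIV. \<Sum>j\<in>UNIV. (if i = k then d k * of_int (A $ k $ j) * of_int (x $ k) * of_int (y $ j) else 0))
      = (\<Sum>j\<in>UNIV. d k * of_int (A $ k $ j) * of_int (x $ k) * of_int (y $ j))"
    by (subst sum.swap) simp
  also have "(\<Sum>i\<in>UNIV. \<Sum>j\<in>UNIV. (if j = k then d k * of_int (A $ k $ i) * of_int (x $ i) * of_int (y $ k) else 0))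
      = (\<Sum>i\<in>UNIV. d k * of_int (A $ k $ i) * of_int (x $ i) * of_int (y $ k))"
    by simp
  finally have 3: "euler E x y - euler ?E x y = d k * of_int (x $ k) * of_int (s y) - d k * of_int (s x) * of_int (y $ k)"
    by (simp add: s_def sum_distrib_left sum_distrib_right mult_ac)
  show ?thesis
    using 3 unfolding refl_at_def s_def[symmetric]
    by (simp add: euler_lin 1 2 s_a) (simp add: algebra_simps)
qed

section \<open>Roots\<close>

definition posv :: "int^'n \<Rightarrow> bool" where "posv x \<longleftrightarrow> (\<forall>j. 0 \<le> x $ j)"
definition negv :: "int^'n \<Rightarrow> bool" where "negv x \<longleftrightarrow> (\<forall>j. x $ j \<le> 0)"

text \<open>When \<open>x\<close> has the length of the simple root \<open>i\<close>, the quotient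
  \<open>d j * x $ j / d i\<close> is the coefficient of the coroot of \<open>x\<close> at the
  simple coroot \<open>j\<close>. The condition is integrality of that coroot, and it makes all
  Euler pairings with \<open>x\<close> integer multiples of \<open>d i\<close>.\<close>

definition in_lat :: "'n \<Rightarrow> int^'n \<Rightarrow> bool" where
  "in_lat i x \<longleftrightarrow> (\<forall>j. \<exists>z::int. d j * of_int (x $ j) = d i * of_int z)"

text \<open>Roots are captured by length and integrality, without the Weyl group. The index
  \<open>i\<close> records the length of the root; the sign dichotomy, stability under simple
  reflections and finiteness all follow from these two conditions.\<close>

definition isroot :: "'n \<Rightarrow> int^'n \<Rightarrow> bool" where
  "isroot i x \<longleftrightarrow> in_lat i x \<and> sym_form x x = 2 * d i"

lemma posv_minus [simp]: "posv (- x) = negv x"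
  and negv_minus [simp]: "negv (- x) = posv x"
  by (auto simp: posv_def negv_def)

lemma pos_neg_zero: "posv x \<Longrightarrow> negv x \<Longrightarrow> x = 0"
  by (auto simp: posv_def negv_def vec_eq_iff intro: antisym)

lemma euler_lat_left:
  assumes "in_lat i x"
  shows "\<exists>z::int. euler E x y = d i * of_int z"
proof -
  obtain f where f: "\<And>j. d j * of_int (x $ j) = d i * of_int (f j)"
    using assms unfolding in_lat_def by metis
  have "coef E p q * of_int (x $ p) = d i * of_int (f p * (if p = q then 1 else if (p, q) \<in> E then A $ p $ q else 0))" for p q
    using f[of p] by (auto simp: coef_def)
  then have "euler E x y = d i * of_int (\<Sum>p\<in>UNIV. \<Sum>q\<in>UNIV. f p * (if p = q then 1 else if (p, q) \<in> E then A $ p $ q else 0) * y $ q)"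
    unfolding euler_def by (simp add: sum_distrib_left mult_ac)
  then show ?thesis by blast
qed

lemma euler_lat_right:
  assumes "orient E" "in_lat i y"
  shows "\<exists>z::int. euler E x y = d i * of_int z"
  using euler_lat_left[OF assms(2), of "E\<inverse>"] euler_converse[OF assms(1)] by simp

text \<open>A positive value among the integer multiples of \<open>d i\<close> is at least
  \<open>d i\<close>: no nonzero vector of the lattice is shorter than a root.\<close>

lemma lat_norm:
  assumes "orient E" "in_lat i x" "x \<noteq> 0"
  shows "euler E x x \<ge> d i"
proof -
  obtain z :: int where z: "euler E x x = d i * of_int z"
    using euler_lat_left[OF assms(2)] by blast
  then have "z > 0"
    using euler_pos[OF assms(1,3)] d_pos[of i] by (simp add: zero_less_mult_iff)
  then show ?thesis
    using z d_pos[of i] by simp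
qed

lemma euler_root: "orient E \<Longrightarrow> isroot i x \<Longrightarrow> euler E x x = d i"
  using sym_form_euler[of E x x] by (simp add: isroot_def)

lemma sym_form_disjoint_nonpos:
  assumes "posv p" "posv n" "\<And>j. p $ j = 0 \<or> n $ j = 0"
  shows "sym_form p n \<le> 0"
  unfolding sym_form_def
proof (intro sum_nonpos)
  fix i j
  have "0 \<le> real_of_int (p $ i)" "0 \<le> real_of_int (n $ j)"
    using assms(1,2) by (simp_all add: posv_def)
  moreover have "0 \<le> - real_of_int (A $ i $ j)" if "i \<noteq> j"
    using offdiag[OF that] by simp
  ultimately have "real_of_int (p $ i) * of_int (n $ j) * (- of_int (A $ i $ j)) \<ge> 0" if "i \<noteq> j"
    using that by (intro mult_nonneg_nonneg)
  then have "d i * (real_of_int (p $ i) * of_int (n $ j) * (- of_int (A $ i $ j))) \<ge> 0" if "i \<noteq> j"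
    using that mult_nonneg_nonneg[OF less_imp_le[OF d_pos[of i]]] by blast
  then show "d i * of_int (A $ i $ j) * of_int (p $ i) * of_int (n $ j) \<le> 0"
    using assms(3)[of i] by (cases "i = j") (auto simp: mult_ac)
qed

lemma root_nonzero: "isroot i x \<Longrightarrow> x \<noteq> 0"
  using d_pos[of i] by (auto simp: isroot_def sym_form_def)

text \<open>The disjoint positive and negative parts of a root pair nonpositively, and each of them,
  if nonzero, is already as long as the root itself.\<close>

lemma root_sign:
  assumes E: "orient E" and r: "isroot i x"
  shows "posv x \<or> negv x"
proof -
  define p where "p = (\<chi> j. max 0 (x $ j))"
  define n where "n = (\<chi> j. max 0 (- x $ j))"
  have x: "x = p - n"
    by (auto simp: p_def n_def vec_eq_iff max_def)
  have lat: "in_lat i (\<chi> j. if P j then c * x $ j else 0)" for P and c :: int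
  proof -
    obtain f where f: "\<And>j. d j * of_int (x $ j) = d i * of_int (f j)"
      using r unfolding isroot_def in_lat_def by metis
    have "d j * of_int (if P j then c * x $ j else 0) = d i * of_int (if P j then c * f j else 0)" for j
      using f[of j] by (simp add: mult.left_commute)
    then show ?thesis unfolding in_lat_def vec_lambda_beta by blast
  qed
  have "p = (\<chi> j. if 0 \<le> x $ j then 1 * x $ j else 0)" "n = (\<chi> j. if x $ j \<le> 0 then (-1) * x $ j else 0)"
    by (simp_all add: p_def n_def vec_eq_iff max_def)
  then have lat: "in_lat i p" "in_lat i n"
    using lat[of "\<lambda>j. 0 \<le> x $ j" 1] lat[of "\<lambda>j. x $ j \<le> 0" "-1"] by simp_all
  have "sym_form p n \<le> 0"
    by (rule sym_form_disjoint_nonpos) (auto simp: posv_def p_def n_def)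
  then have le: "euler E p n + euler E n p \<le> 0"
    using sym_form_euler[OF E] by simp
  have "d i = euler E p p + euler E n n - (euler E p n + euler E n p)"
    using euler_root[OF E r] unfolding x by (simp add: euler_lin)
  then have "euler E p p + euler E n n \<le> d i"
    using le by linarith
  then have "\<not> (p \<noteq> 0 \<and> n \<noteq> 0)"
    using lat_norm[OF E lat(1)] lat_norm[OF E lat(2)] d_pos[of i] by linarith
  moreover have "posv p" "posv n"
    by (simp_all add: posv_def p_def n_def)
  ultimately show ?thesis
    unfolding x by (cases "n = 0") auto
qed

lemma root_not_both: "isroot i x \<Longrightarrow> posv x \<Longrightarrow> \<not> negv x"
  using pos_neg_zero root_nonzero by blast

lemma isroot_minus: "isroot i x \<Longrightarrow> isroot i (- x)"
  unfolding isroot_def in_lat_def sym_form_def by auto (metis mult_minus_right of_int_minus)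

lemma isroot_axis: "isroot k (axis k 1)"
proof -
  have "sym_form (axis k 1) (axis k 1) = 2 * d k"
    unfolding sym_form_axis sum_A_axis by (simp add: diag)
  moreover have "in_lat k (axis k 1)"
    unfolding in_lat_def
  proof
    fix j
    show "\<exists>z::int. d j * of_int (axis k 1 $ j) = d k * of_int z"
      by (rule exI[of _ "if j = k then 1 else 0"]) (simp add: axis_def)
  qed
  ultimately show ?thesis by (simp add: isroot_def)
qed

text \<open>For a multiple of the simple root, the length gives the square of the coefficient, while
  coroot integrality gives an integer \<open>c\<close> with \<open>x $ k * c = 1\<close>; so the
  coefficient is a unit.\<close>

lemma root_multiple_axis:
  assumes E: "orient E" and r: "isroot i x" and z: "\<And>j. j \<noteq> k \<Longrightarrow> x $ j = 0"
  shows "x = axis k 1 \<or> x = - axis k 1"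
proof -
  have x: "x = (x $ k) *s axis k 1"
    using z by (auto simp: vec_eq_iff axis_def)
  have "d i = of_int (x $ k) * of_int (x $ k) * d k"
    using euler_root[OF E r] euler_root[OF E isroot_axis[of k]] by (subst (asm) (1 2) x) (simp add: euler_lin)
  moreover obtain c :: int where "d k * of_int (x $ k) = d i * of_int c"
    using r unfolding isroot_def in_lat_def by blast
  ultimately have "d i * (of_int (x $ k) * of_int c) = d i * 1"
    by (simp add: mult_ac)
  then have "real_of_int (x $ k * c) = 1"
    using d_pos[of i] by (metis mult_left_cancel less_irrefl of_int_mult)
  then have "x $ k * c = 1" by linarith
  then have "x $ k = 1 \<or> x $ k = -1"
    using zmult_eq_1_iff by blast
  then show ?thesis using x by (metis vector_smult_lid vector_sneg_minus1)
qed

text \<open>Coroot integrality survives because \<open>d k * A $ k $ j = d j * A $ j $ k\<close>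
  moves the weight of the reflected coordinate onto the coordinates where integrality is
  known.\<close>

lemma isroot_refl_at:
  assumes r: "isroot i x"
  shows "isroot i (refl_at k x)"
proof -
  obtain f where f: "\<And>j. d j * of_int (x $ j) = d i * of_int (f j)"
    using r unfolding isroot_def in_lat_def by metis
  have "in_lat i (refl_at k x)"
    unfolding in_lat_def
  proof
    fix j
    have "d k * of_int (\<Sum>j\<in>UNIV. A $ k $ j * x $ j) = (\<Sum>j\<in>UNIV. (d k * of_int (A $ k $ j)) * of_int (x $ j))"
      by (simp add: sum_distrib_left mult_ac)
    also have "\<dots> = (\<Sum>j\<in>UNIV. of_int (A $ j $ k) * (d j * of_int (x $ j)))"
      unfolding sym[of k] by (simp add: mult_ac)
    also have "\<dots> = d i * of_int (\<Sum>j\<in>UNIV. A $ j $ k * f j)"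
      unfolding f by (simp add: sum_distrib_left mult_ac)
    finally have k: "d k * of_int (refl_at k x $ k) = d i * of_int (f k - (\<Sum>j\<in>UNIV. A $ j $ k * f j))"
      using f[of k] by (simp add: refl_at_nth algebra_simps)
    show "\<exists>z::int. d j * of_int (refl_at k x $ j) = d i * of_int z"
    proof (cases "j = k")
      case True
      then show ?thesis using k by blast
    next
      case False
      then show ?thesis using f[of j] by (auto simp: refl_at_nth)
    qed
  qed
  moreover have "sym_form (refl_at k x) (refl_at k x) = sym_form x x"
  proof -
    define s where "s = (\<Sum>j\<in>UNIV. A $ k $ j * x $ j)"
    have sym_form_lin: "sym_form (u - c *s v) w = sym_form u w - of_int c * sym_form v w" "sym_form w (u - c *s v) = sym_form w u - of_int c * sym_form w v" for u v w c
      by (simp_all add: sym_form_def algebra_simps sum_subtractf sum_distrib_left)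
    have sym': "sym_form u v = sym_form v u" for u v
    proof -
      have "sym_form u v = (\<Sum>j\<in>UNIV. \<Sum>i\<in>UNIV. d i * of_int (A $ i $ j) * of_int (u $ i) * of_int (v $ j))"
        unfolding sym_form_def by (rule sum.swap)
      also have "\<dots> = (\<Sum>j\<in>UNIV. \<Sum>i\<in>UNIV. d j * of_int (A $ j $ i) * of_int (v $ j) * of_int (u $ i))"
        by (intro sum.cong refl) (metis (no_types, lifting) mult.assoc mult.commute sym)
      finally show ?thesis unfolding sym_form_def .
    qed
    have "sym_form x (axis k 1) = d k * of_int s"
      unfolding sym_form_axis s_def ..
    moreover have "sym_form (axis k 1) (axis k 1) = 2 * d k"
      using isroot_axis[of k] by (simp add: isroot_def)
    ultimately show ?thesis
      unfolding refl_at_def s_def[symmetric] by (simp add: sym_form_lin sym'[of "axis k 1" x] algebra_simps)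
  qed
  ultimately show ?thesis
    using r by (simp add: isroot_def)
qed

text \<open>Only coordinate \<open>k\<close> changes, so a positive root whose image is negative is
  supported at \<open>k\<close> alone and equals the simple root.\<close>

lemma posv_refl_at:
  assumes E: "orient E" and r: "isroot i x" and p: "posv x" and ne: "x \<noteq> axis k 1"
  shows "posv (refl_at k x)"
proof (rule ccontr)
  assume "\<not> ?thesis"
  then have n: "negv (refl_at k x)"
    using root_sign[OF E isroot_refl_at[OF r]] by blast
  have "x $ j = 0" if "j \<noteq> k" for j
  proof -
    have "0 \<le> x $ j" "refl_at k x $ j \<le> 0"
      using p n by (simp_all add: posv_def negv_def)
    then show ?thesis using that by (simp add: refl_at_nth)
  qed
  then have "x = axis k 1 \<or> x = - axis k 1"
    using root_multiple_axis[OF E r] by blast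
  then show False
    using ne p by (auto simp: posv_def axis_def dest: spec[of _ k])
qed

lemma negv_refl_at:
  assumes E: "orient E" and r: "isroot i x" and p: "negv x" and ne: "x \<noteq> - axis k 1"
  shows "negv (refl_at k x)"
proof -
  have "- x \<noteq> axis k 1"
    using ne by (metis minus_minus)
  then show ?thesis
    using posv_refl_at[OF E isroot_minus[OF r], of k] p by (simp add: refl_at_minus)
qed

end

section \<open>Tuples of roots\<close>

definition lincomb :: "('n \<Rightarrow> int) \<Rightarrow> ('n \<Rightarrow> int^'n) \<Rightarrow> int^'n::finite" where
  "lincomb x X = (\<Sum>l\<in>UNIV. x l *s X l)"

definition spans :: "('n::finite \<Rightarrow> int^'n) \<Rightarrow> bool" where
  "spans X \<longleftrightarrow> (\<forall>v. \<exists>x. v = lincomb x X)"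

definition pairing :: "int^'n \<Rightarrow> int^'n::finite \<Rightarrow> int" where
  "pairing g v = (\<Sum>i\<in>UNIV. g $ i * v $ i)"

lemma lincomb_nth: "lincomb x X $ i = (\<Sum>l\<in>UNIV. x l * X l $ i)"
  by (simp add: lincomb_def)

lemma pairing_lincomb: "pairing g (lincomb x X) = (\<Sum>l\<in>UNIV. x l * pairing g (X l))"
proof -
  have "pairing g (lincomb x X) = (\<Sum>i\<in>UNIV. \<Sum>l\<in>UNIV. g $ i * (x l * X l $ i))"
    unfolding pairing_def lincomb_nth by (simp add: sum_distrib_left)
  also have "\<dots> = (\<Sum>l\<in>UNIV. \<Sum>i\<in>UNIV. g $ i * (x l * X l $ i))"
    by (rule sum.swap)
  finally show ?thesis
    by (simp add: pairing_def sum_distrib_left mult.left_commute)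
qed

lemma pairing_axis: "pairing g (axis k 1) = g $ k"
proof -
  have "pairing g (axis k 1) = (\<Sum>i\<in>UNIV. if i = k then g $ k else 0)"
    unfolding pairing_def by (intro sum.cong) (auto simp: axis_def)
  then show ?thesis by simp
qed

lemma pairing_lin: "pairing g (x + y) = pairing g x + pairing g y" "pairing g (x - y) = pairing g x - pairing g y"
  "pairing g (- x) = - pairing g x" "pairing g (c *s x) = c * pairing g x"
  by (simp_all add: pairing_def algebra_simps sum.distrib sum_subtractf sum_negf sum_distrib_left)

definition dual_to :: "('n::finite \<Rightarrow> int^'n) \<Rightarrow> ('n \<Rightarrow> int^'n) \<Rightarrow> bool" where
  "dual_to G X \<longleftrightarrow> (\<forall>i j. pairing (G i) (X j) = (if i = j then 1 else 0)) \<and> (\<forall>v. lincomb (\<lambda>l. pairing (G l) v) X = v)"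

text \<open>Expanding the unit vectors in the spanning family gives an integral right inverse of a
  square matrix. Over the reals it is a two-sided inverse, which is the biorthogonality, and
  integrality is kept.\<close>

lemma dual_basis:
  assumes "spans X"
  shows "\<exists>G. dual_to G X"
proof -
  have "\<forall>j. \<exists>x. axis j 1 = lincomb x X"
    using assms by (simp add: spans_def)
  from choice[OF this] obtain f where f: "\<And>j. axis j 1 = lincomb (f j) X"
    by blast
  define N where "N l j = f j l" for l j
  have N: "axis j 1 = lincomb (\<lambda>l. N l j) X" for j
    using f[of j] by (simp add: N_def)
  define G where "G l = (\<chi> j. N l j)" for l
  have ax: "(\<Sum>l\<in>UNIV. N l j * X l $ i) = (if i = j then 1 else 0)" for i j
  proof -
    have "(axis j 1 :: int^'a) $ i = lincomb (\<lambda>l. N l j) X $ i"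
      by (simp only: N)
    then show ?thesis by (simp add: lincomb_nth axis_def split: if_splits)
  qed
  have 1: "lincomb (\<lambda>l. pairing (G l) v) X = v" for v
  proof -
    have "lincomb (\<lambda>l. pairing (G l) v) X $ i = (\<Sum>l\<in>UNIV. \<Sum>j\<in>UNIV. N l j * v $ j * X l $ i)" for i
      by (simp add: lincomb_nth pairing_def G_def sum_distrib_right)
    also have "\<dots> i = (\<Sum>j\<in>UNIV. v $ j * (\<Sum>l\<in>UNIV. N l j * X l $ i))" for i
      by (subst sum.swap) (simp add: sum_distrib_left mult_ac)
    also have "\<dots> i = (\<Sum>j\<in>UNIV. if j = i then v $ i else 0)" for i
      unfolding ax by (intro sum.cong) auto
    finally show ?thesis by (simp add: vec_eq_iff)
  qed
  define M P :: "real^'a^'a" where "M = (\<chi> i l. of_int (X l $ i))" and "P = (\<chi> l j. of_int (N l j))"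
  have "M ** P = mat 1"
  proof -
    have "(M ** P) $ i $ j = of_int (\<Sum>l\<in>UNIV. N l j * X l $ i)" for i j
      by (simp add: M_def P_def matrix_matrix_mult_def mult.commute)
    then show ?thesis
      unfolding ax by (simp add: vec_eq_iff mat_def)
  qed
  then have "P ** M = mat 1"
    by (simp add: matrix_left_right_inverse)
  moreover have "(P ** M) $ i $ j = of_int (pairing (G i) (X j))" for i j
    by (simp add: M_def P_def matrix_matrix_mult_def pairing_def G_def)
  ultimately have "real_of_int (pairing (G i) (X j)) = (if i = j then 1 else 0)" for i j
    by (simp add: mat_def)
  then have "pairing (G i) (X j) = (if i = j then 1 else 0)" for i j
    by (metis of_int_0 of_int_1 of_int_eq_iff)
  then show ?thesis
    unfolding dual_to_def using 1 by blast
qed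

lemma pairing_lincomb_dual:
  assumes "dual_to G X"
  shows "pairing (G i) (lincomb x X) = x i"
proof -
  have "pairing (G i) (lincomb x X) = (\<Sum>l\<in>UNIV. if l = i then x i else 0)"
    unfolding pairing_lincomb using assms by (intro sum.cong) (auto simp: dual_to_def)
  then show ?thesis by simp
qed

lemma lincomb_inject:
  assumes "spans X" "lincomb x X = lincomb y X"
  shows "x = y"
proof -
  obtain G where G: "dual_to G X"
    using dual_basis[OF assms(1)] by blast
  have "x i = y i" for i
    using pairing_lincomb_dual[OF G, of i x] pairing_lincomb_dual[OF G, of i y] assms(2) by simp
  then show ?thesis ..
qed

lemma dual_to_unique:
  assumes "dual_to G X" "dual_to H X"
  shows "G = H"
proof -
  have "G l $ k = H l $ k" for l k
  proof -
    have "lincomb (\<lambda>l. pairing (H l) (axis k 1)) X = axis k 1"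
      using assms(2) unfolding dual_to_def by blast
    then have "pairing (G l) (axis k 1) = pairing (H l) (axis k 1)"
      using pairing_lincomb_dual[OF assms(1), of l "\<lambda>l. pairing (H l) (axis k 1)"] by simp
    then show ?thesis by (simp add: pairing_axis)
  qed
  then show ?thesis by (simp add: fun_eq_iff vec_eq_iff)
qed

lemma spans_inj:
  assumes "spans X" "i \<noteq> j"
  shows "X i \<noteq> X j" "X i \<noteq> - X j"
proof -
  obtain G where G: "dual_to G X"
    using dual_basis[OF assms(1)] by blast
  then have g: "pairing (G i) (X i) = 1" "pairing (G i) (X j) = 0"
    using assms(2) by (auto simp: dual_to_def)
  show "X i \<noteq> X j" using g by auto
  show "X i \<noteq> - X j" using g by (auto simp: pairing_lin)
qed

lemma spans_uminus: "spans X \<Longrightarrow> spans (\<lambda>i. - X i)"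
proof -
  assume X: "spans X"
  have "lincomb x X = lincomb (\<lambda>i. - x i) (\<lambda>i. - X i)" for x
    by (simp add: lincomb_def vec_eq_iff)
  moreover have "\<exists>x. v = lincomb x X" for v
    using X by (simp add: spans_def)
  ultimately have "\<exists>x. v = lincomb x (\<lambda>i. - X i)" for v
    by metis
  then show ?thesis by (simp add: spans_def)
qed

lemma spans_linear:
  assumes X: "spans X" and inv: "\<And>v. T (T v) = v" and lin: "\<And>x. T (lincomb x X) = lincomb x (\<lambda>i. T (X i))"
  shows "spans (\<lambda>i. T (X i))"
  unfolding spans_def
proof
  fix v
  obtain x where "T v = lincomb x X"
    using X unfolding spans_def by blast
  then have "v = lincomb x (\<lambda>i. T (X i))"
    using inv[of v] lin[of x] by simp
  then show "\<exists>x. v = lincomb x (\<lambda>i. T (X i))"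
    by blast
qed

lemma spans_mutate:
  assumes X: "spans X" and l: "Y l = - X l" and j: "\<And>j. j \<noteq> l \<Longrightarrow> Y j = X j + m j *s X l"
  shows "spans Y"
  unfolding spans_def
proof
  fix v
  obtain x where v: "v = lincomb x X" using X unfolding spans_def by blast
  \<comment> \<open>The value at \<open>l\<close> solves the comparison of coefficients at
    \<open>X l\<close>: minus \<open>y l\<close> plus the sum of all \<open>x j * m j\<close> must
    be \<open>x l\<close>.\<close>
  define y where "y = x(l := (\<Sum>j\<in>UNIV-{l}. x j * m j) - x l)"
  have "lincomb y Y = y l *s Y l + (\<Sum>j\<in>UNIV-{l}. y j *s Y j)"
    unfolding lincomb_def by (rule sum.remove) auto
  also have "(\<Sum>j\<in>UNIV-{l}. y j *s Y j) = (\<Sum>j\<in>UNIV-{l}. x j *s X j) + (\<Sum>j\<in>UNIV-{l}. x j * m j) *s X l"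
  proof -
    have "(\<Sum>j\<in>UNIV-{l}. y j *s Y j) = (\<Sum>j\<in>UNIV-{l}. x j *s X j + (x j * m j) *s X l)"
      by (intro sum.cong refl) (auto simp: y_def j vec_eq_iff algebra_simps)
    then show ?thesis by (simp add: sum.distrib vec_eq_iff sum_distrib_right)
  qed
  also have "y l *s Y l = x l *s X l - (\<Sum>j\<in>UNIV-{l}. x j * m j) *s X l"
    by (simp add: y_def l vec_eq_iff algebra_simps)
  finally have "lincomb y Y = x l *s X l + (\<Sum>j\<in>UNIV-{l}. x j *s X j)" by simp
  also have "\<dots> = v" unfolding v lincomb_def by (rule sum.remove[symmetric]) auto
  finally show "\<exists>y. v = lincomb y Y" by metis
qed

context cartan begin

text \<open>The numerical constraint known for c-vectors of an acyclic initial seed. Orthogonality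
  across signs is one-sided: from a positive to a negative member the form is free, and that value
  carries the exchange number between members of opposite sign.\<close>

definition valid :: "('n \<times> 'n) set \<Rightarrow> ('n \<Rightarrow> int^'n) \<Rightarrow> bool" where
  "valid E X \<longleftrightarrow> (\<forall>i. isroot i (X i)) \<and>
     (\<forall>i j. negv (X i) \<longrightarrow> posv (X j) \<longrightarrow> euler E (X i) (X j) = 0) \<and>
     (\<forall>i j. i \<noteq> j \<longrightarrow> posv (X i) \<longrightarrow> posv (X j) \<longrightarrow> euler E (X i) (X j) \<le> 0) \<and>
     (\<forall>i j. i \<noteq> j \<longrightarrow> negv (X i) \<longrightarrow> negv (X j) \<longrightarrow> euler E (X i) (X j) \<le> 0) \<and>
     spans X"

lemma validD:
  assumes "valid E X"
  shows "isroot i (X i)" "spans X"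
    "negv (X i) \<Longrightarrow> posv (X j) \<Longrightarrow> euler E (X i) (X j) = 0"
    "i \<noteq> j \<Longrightarrow> posv (X i) \<Longrightarrow> posv (X j) \<Longrightarrow> euler E (X i) (X j) \<le> 0"
    "i \<noteq> j \<Longrightarrow> negv (X i) \<Longrightarrow> negv (X j) \<Longrightarrow> euler E (X i) (X j) \<le> 0"
  using assms by (simp_all add: valid_def)

lemma valid_sign: "orient E \<Longrightarrow> valid E X \<Longrightarrow> posv (X i) \<or> negv (X i)"
  using root_sign[OF _ validD(1)] by simp

text \<open>Reversing all arrows transposes the Euler form, and negation exchanges the two sign
  classes, so each axiom goes to itself. Statements about sinks are obtained from statements about
  sources this way.\<close>

lemma valid_converse:
  assumes "orient E" "valid E X"
  shows "valid (E\<inverse>) (\<lambda>i. - X i)"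
  using assms(2) unfolding valid_def euler_converse[OF assms(1)] euler_lin posv_minus negv_minus
  by (auto intro: isroot_minus spans_uminus)

lemma posv_axis: "posv (axis k 1)" and negv_axis: "negv (- axis k 1)"
  by (auto simp: posv_def negv_def axis_def)

text \<open>With \<open>x $ k = 0\<close> the other order of the pairing vanishes at a source, so
  the value is the symmetric form, a combination of the nonpositive off-diagonal entries in row
  \<open>k\<close>.\<close>

lemma euler_axis_sign:
  assumes o: "orient E" and s: "is_source E k" and z: "x $ k = 0"
  shows "posv x \<Longrightarrow> euler E (axis k 1) x \<le> 0" "negv x \<Longrightarrow> euler E (axis k 1) x \<ge> 0"
proof -
  have e: "euler E (axis k 1) x = d k * of_int (\<Sum>j\<in>UNIV. A $ k $ j * x $ j)"
    using sym_form_euler[OF o, of x "axis k 1"] sym_form_axis[of x k] euler_source[OF s, of x] z by simp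
  show "posv x \<Longrightarrow> euler E (axis k 1) x \<le> 0"
  proof -
    assume "posv x"
    then have "(\<Sum>j\<in>UNIV. A $ k $ j * x $ j) \<le> 0"
      using z offdiag[of k] by (intro sum_nonpos) (metis mult_nonpos_nonneg mult_zero_right order_refl posv_def)
    then show ?thesis
      unfolding e using d_pos[of k] by (simp add: mult_nonneg_nonpos less_imp_le del: of_int_sum)
  qed
  show "negv x \<Longrightarrow> euler E (axis k 1) x \<ge> 0"
  proof -
    assume "negv x"
    then have "(\<Sum>j\<in>UNIV. A $ k $ j * x $ j) \<ge> 0"
      using z offdiag[of k] by (intro sum_nonneg) (metis mult_nonpos_nonpos mult_zero_right order_refl negv_def)
    then show ?thesis
      unfolding e using d_pos[of k] by (simp add: less_imp_le del: of_int_sum)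
  qed
qed

text \<open>Pairing with the simple root at a source reads coordinate \<open>k\<close>. For a
  positive member validity bounds it by \<open>0\<close> from above, for a negative member it forces
  \<open>0\<close>.\<close>

lemma source_axis_zero:
  assumes o: "orient E" and s: "is_source E k" and v: "valid E X" and i: "X i = axis k 1" and j: "j \<noteq> i"
  shows "X j $ k = 0"
proof (cases "posv (X j)")
  case True
  then have "d k * of_int (X j $ k) \<le> 0"
    using validD(4)[OF v j] euler_source[OF s, of "X j"] i posv_axis by metis
  then have "X j $ k \<le> 0"
    using d_pos[of k] by (simp add: mult_le_0_iff)
  then show ?thesis using True by (metis posv_def antisym)
next
  case False
  then have "d k * of_int (X j $ k) = 0"
    using validD(3)[OF v, of j i] euler_source[OF s, of "X j"] i posv_axis valid_sign[OF o v] by metis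
  then show ?thesis using d_pos[of k] by simp
qed

lemma sink_axis_zero:
  assumes o: "orient E" and s: "is_sink E k" and v: "valid E X" and i: "X i = - axis k 1" and j: "j \<noteq> i"
  shows "X j $ k = 0"
  using source_axis_zero[OF orient_converse[OF o] _ valid_converse[OF o v], of k i j] s i j source_converse by simp

lemma refl_at_eq_axis: "refl_at k x = axis k 1 \<longleftrightarrow> x = - axis k 1" "refl_at k x = - axis k 1 \<longleftrightarrow> x = axis k 1"
  by (metis refl_at_refl_at refl_at_axis_same refl_at_minus minus_minus)+

lemma neg_at_eq_axis: "neg_at k x = - axis k 1 \<longleftrightarrow> x = axis k 1" "neg_at k x = axis k 1 \<longleftrightarrow> x = - axis k 1"
proof -
  have n: "neg_at k (axis k 1) = - axis k 1" "neg_at k (- axis k 1) = axis k 1"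
    by (auto simp: vec_eq_iff neg_at_nth axis_def)
  show "neg_at k x = - axis k 1 \<longleftrightarrow> x = axis k 1" "neg_at k x = axis k 1 \<longleftrightarrow> x = - axis k 1"
    by (metis n neg_at_neg_at)+
qed

lemma refl_at_lincomb: "refl_at k (lincomb x X) = lincomb x (\<lambda>i. refl_at k (X i))"
  by (simp add: lincomb_def refl_at_sum refl_at_scale)

lemma neg_at_lincomb: "neg_at k (lincomb x X) = lincomb x (\<lambda>i. neg_at k (X i))"
  by (auto simp: vec_eq_iff neg_at_nth lincomb_nth sum_negf)

text \<open>Euler values are carried over by \<open>euler_refl_at\<close>, and with the simple root
  excluded the only vector that changes sign is its negative. Only pairs containing that vector call
  for a new argument.\<close>

lemma valid_refl_at:
  assumes o: "orient E" and s: "is_source E k" and v: "valid E X" and ne: "\<And>i. X i \<noteq> axis k 1"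
  shows "valid (flipE k E) (\<lambda>i. refl_at k (X i))"
proof -
  have r: "isroot i (X i)" for i using validD(1)[OF v] .
  have sgn: "posv (refl_at k (X i)) \<longleftrightarrow> posv (X i) \<or> X i = - axis k 1"
      "negv (refl_at k (X i)) \<longleftrightarrow> negv (X i) \<and> X i \<noteq> - axis k 1" for i
  proof -
    have nb: "\<not> (posv (refl_at k (X i)) \<and> negv (refl_at k (X i)))" "\<not> (posv (X i) \<and> negv (X i))"
      using root_not_both[OF isroot_refl_at[OF r]] root_not_both[OF r] by auto
    consider "X i = - axis k 1" | "X i \<noteq> - axis k 1" "posv (X i)" | "X i \<noteq> - axis k 1" "negv (X i)"
      using valid_sign[OF o v, of i] by auto
    then have "(posv (refl_at k (X i)) \<longleftrightarrow> posv (X i) \<or> X i = - axis k 1) \<and>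
        (negv (refl_at k (X i)) \<longleftrightarrow> negv (X i) \<and> X i \<noteq> - axis k 1)"
    proof cases
      case 1
      then have "refl_at k (X i) = axis k 1"
        by (simp add: refl_at_minus refl_at_axis_same)
      then show ?thesis using 1 nb posv_axis[of k] by simp
    next
      case 2
      then show ?thesis using nb posv_refl_at[OF o r _ ne] by simp
    next
      case 3
      then show ?thesis using nb negv_refl_at[OF o r] by simp
    qed
    then show "posv (refl_at k (X i)) \<longleftrightarrow> posv (X i) \<or> X i = - axis k 1"
      "negv (refl_at k (X i)) \<longleftrightarrow> negv (X i) \<and> X i \<noteq> - axis k 1" by simp_all
  qed
  have e: "euler (flipE k E) (refl_at k (X i)) (refl_at k (X j)) = euler E (X i) (X j)" for i j
    using euler_refl_at[OF o s] .
  have ax: "euler E x (- axis k 1) \<le> 0" if "posv x" for x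
    using that d_pos[of k] euler_source[OF s, of x] by (simp add: euler_lin posv_def)
  have ax': "euler E x (- axis k 1) \<ge> 0" if "negv x" for x
    using that d_pos[of k] euler_source[OF s, of x] by (simp add: euler_lin negv_def mult_nonneg_nonpos)
  \<comment> \<open>When \<open>X j\<close> turns from negative to positive, equality is required
    where validity gave \<open><= 0\<close>; negativity of \<open>X i\<close> supplies the opposite
    inequality.\<close>
  have "euler E (X i) (X j) = 0" if "negv (X i)" "X i \<noteq> - axis k 1" "posv (X j) \<or> X j = - axis k 1" for i j
  proof (cases "X j = - axis k 1")
    case True
    then have "i \<noteq> j" using that(2) by auto
    then have "euler E (X i) (- axis k 1) \<le> 0"
      using validD(5)[OF v, of i j] True that(1) negv_axis[of k] by simp
    then show ?thesis using ax'[OF that(1)] True by simp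
  next
    case False
    then show ?thesis using validD(3)[OF v that(1)] that(3) by simp
  qed
  moreover have "euler E (X i) (X j) \<le> 0"
    if "i \<noteq> j" "posv (X i) \<or> X i = - axis k 1" "posv (X j) \<or> X j = - axis k 1" for i j
  proof (cases "X i = - axis k 1")
    case True
    then have "posv (X j)"
      using spans_inj(1)[OF validD(2)[OF v] that(1)] that(3) by simp
    then show ?thesis
      using validD(3)[OF v, of i j] True negv_axis[of k] by simp
  next
    case False
    then show ?thesis
      using that(2,3) ax[of "X i"] validD(4)[OF v that(1)] by auto
  qed
  moreover have "spans (\<lambda>i. refl_at k (X i))"
    by (rule spans_linear[OF validD(2)[OF v]]) (auto simp: refl_at_lincomb)
  ultimately show ?thesis
    unfolding valid_def e sgn using validD(5)[OF v] isroot_refl_at[OF r] by simp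
qed

lemma euler_flip_zero:
  assumes "x $ k = 0" "y $ k = 0"
  shows "euler (flipE k E) x y = euler E x y"
  unfolding euler_def
proof (intro sum.cong refl)
  fix i j
  show "coef (flipE k E) i j * of_int (x $ i) * of_int (y $ j) = coef E i j * of_int (x $ i) * of_int (y $ j)"
    using assms by (cases "i = k"; cases "j = k") (auto simp: coef_def flipE_iff)
qed

lemma neg_at_id: "x $ k = 0 \<Longrightarrow> neg_at k x = x"
  by (simp add: neg_at_def)

lemma neg_at_axis: "neg_at k (axis k 1) = - axis k 1"
  by (simp add: neg_at_eq_axis)

text \<open>All other members vanish at \<open>k\<close>, so the map only negates the simple root,
  and the Euler form between the others does not see the reversed arrows.\<close>

lemma valid_neg_at:
  assumes o: "orient E" and s: "is_source E k" and v: "valid E X" and i: "X i = axis k 1"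
  shows "valid (flipE k E) (\<lambda>i. neg_at k (X i))"
proof -
  let ?E = "flipE k E"
  have o': "orient ?E" and s': "is_sink ?E k"
    using orient_flipE[OF o] source_flipE[OF s] by auto
  have z: "X j $ k = 0" if "j \<noteq> i" for j
    using source_axis_zero[OF o s v i that] .
  define Y where "Y = X(i := - axis k 1)"
  have Y: "(\<lambda>i. neg_at k (X i)) = Y"
    using z by (auto simp: Y_def fun_eq_iff i neg_at_axis neg_at_id)
  have dimin: "d i = d k"
    using euler_root[OF o validD(1)[OF v, of i]] euler_root[OF o isroot_axis, of k] i by simp
  have "isroot j (Y j)" for j
    using validD(1)[OF v] i isroot_minus by (auto simp: Y_def) (metis)
  moreover have neg: "euler ?E (- axis k 1) (X b) = 0" if "b \<noteq> i" for b
    using euler_sink[OF o' s', of "X b"] z[OF that] by (simp add: euler_lin)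
  moreover have "euler ?E (X a) (- axis k 1) \<le> 0" if "a \<noteq> i" "negv (X a)" for a
  proof -
    have "euler ?E (X a) (axis k 1) = euler E (axis k 1) (X a)"
      using sym_form_euler[OF o, of "X a" "axis k 1"] sym_form_euler[OF o', of "X a" "axis k 1"]
        euler_sink[OF o' s', of "X a"] euler_source[OF s, of "X a"] z[OF that(1)] by simp
    then show ?thesis
      using euler_axis_sign(2)[OF o s z[OF that(1)] that(2)] by (simp add: euler_lin)
  qed
  moreover have "euler ?E (X a) (X b) = euler E (X a) (X b)" if "a \<noteq> i" "b \<noteq> i" for a b
    using euler_flip_zero z that by blast
  moreover have "\<not> posv (- axis k 1)"
    using root_not_both[OF isroot_axis[of k]] posv_axis[of k] by simp
  moreover have "spans Y"
    unfolding Y[symmetric] by (rule spans_linear[OF validD(2)[OF v]]) (auto simp: neg_at_lincomb)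
  ultimately show ?thesis
    unfolding Y valid_def using validD(3-5)[OF v] by (simp add: Y_def)
qed

text \<open>Models the change of the initial seed by mutation at the source \<open>k\<close>, as
  seen on c-vectors. If the simple root is a member of a valid tuple, it is negated and the others,
  which vanish at \<open>k\<close>, stay; otherwise every member is reflected.\<close>

definition move :: "'n \<Rightarrow> ('n \<Rightarrow> int^'n) \<Rightarrow> 'n \<Rightarrow> int^'n" where
  "move k X = (if \<exists>i. X i = axis k 1 then (\<lambda>i. neg_at k (X i)) else (\<lambda>i. refl_at k (X i)))"

lemma valid_move:
  assumes "orient E" "is_source E k" "valid E X"
  shows "valid (flipE k E) (move k X)"
  unfolding move_def using valid_neg_at[OF assms] valid_refl_at[OF assms] by auto

text \<open>The sink version, obtained from the source version through
  \<open>valid_converse\<close>.\<close>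

lemma valid_back_refl_at:
  assumes o: "orient E" and s: "is_sink E k" and v: "valid E X" and ne: "\<And>i. X i \<noteq> - axis k 1"
  shows "valid (flipE k E) (\<lambda>i. refl_at k (X i))"
proof -
  have "valid (flipE k (E\<inverse>)) (\<lambda>i. refl_at k (- X i))"
    using ne s by (intro valid_refl_at orient_converse o valid_converse v) (auto simp: source_converse, metis minus_minus)
  then have "valid (((flipE k E)\<inverse>)\<inverse>) (\<lambda>i. - refl_at k (- X i))"
    unfolding flipE_converse by (rule valid_converse[OF orient_converse[OF orient_flipE[OF o]]])
  then show ?thesis by (simp add: refl_at_minus)
qed

lemma valid_back_neg_at:
  assumes o: "orient E" and s: "is_sink E k" and v: "valid E X" and i: "X i = - axis k 1"
  shows "valid (flipE k E) (\<lambda>i. neg_at k (X i))"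
proof -
  have "valid (flipE k (E\<inverse>)) (\<lambda>i. neg_at k (- X i))"
    using i s by (intro valid_neg_at[of _ _ _ i] orient_converse o valid_converse v) (auto simp: source_converse)
  then have "valid (((flipE k E)\<inverse>)\<inverse>) (\<lambda>i. - neg_at k (- X i))"
    unfolding flipE_converse by (rule valid_converse[OF orient_converse[OF orient_flipE[OF o]]])
  moreover have "- neg_at k (- x) = neg_at k x" for x
    by (simp add: vec_eq_iff neg_at_nth)
  ultimately show ?thesis by simp
qed

section \<open>Mutation of tuples\<close>

definition skew_form :: "('n \<times> 'n) set \<Rightarrow> int^'n \<Rightarrow> int^'n \<Rightarrow> real" where
  "skew_form E x y = euler E y x - euler E x y"

text \<open>For valid tuples the quotient is already an integer (\<open>exch_eq\<close>); the floor
  only provides the type.\<close>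

definition exch :: "('n \<times> 'n) set \<Rightarrow> ('n \<Rightarrow> int^'n) \<Rightarrow> 'n \<Rightarrow> 'n \<Rightarrow> int" where
  "exch E X l j = \<lfloor>skew_form E (X l) (X j) / d l\<rfloor>"

text \<open>The positive part of the exchange number twisted by the sign of \<open>X l\<close>: the
  multiplicity in the mutation rule for c-vectors when columns are sign-coherent.\<close>

definition mult :: "('n \<times> 'n) set \<Rightarrow> ('n \<Rightarrow> int^'n) \<Rightarrow> 'n \<Rightarrow> 'n \<Rightarrow> int" where
  "mult E X l j = max 0 (if posv (X l) then exch E X l j else - exch E X l j)"

definition mut :: "('n \<times> 'n) set \<Rightarrow> 'n \<Rightarrow> ('n \<Rightarrow> int^'n) \<Rightarrow> 'n \<Rightarrow> int^'n" where
  "mut E l X j = (if j = l then - X l else X j + mult E X l j *s X l)"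

lemma skew_form_lin: "skew_form E (x + y) z = skew_form E x z + skew_form E y z" "skew_form E z (x + y) = skew_form E z x + skew_form E z y"
  "skew_form E (c *s x) z = of_int c * skew_form E x z" "skew_form E z (c *s x) = of_int c * skew_form E z x"
  "skew_form E (- x) z = - skew_form E x z" "skew_form E z (- x) = - skew_form E z x"
  by (simp_all add: skew_form_def euler_lin algebra_simps)

lemma skew_form_self [simp]: "skew_form E x x = 0" and skew_form_swap: "skew_form E y x = - skew_form E x y"
  by (simp_all add: skew_form_def)

lemma exch_eq:
  assumes o: "orient E" and r: "in_lat l (X l)"
  shows "d l * of_int (exch E X l j) = skew_form E (X l) (X j)"
proof -
  obtain z1 z2 :: int where "euler E (X j) (X l) = d l * of_int z1" "euler E (X l) (X j) = d l * of_int z2"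
    using euler_lat_left[OF r, of E "X j"] euler_lat_right[OF o r, of "X j"] by blast
  then have "skew_form E (X l) (X j) = d l * of_int (z1 - z2)"
    by (simp add: skew_form_def algebra_simps)
  then show ?thesis
    using d_pos[of l] by (simp add: exch_def)
qed

lemma exch_valid: "orient E \<Longrightarrow> valid E X \<Longrightarrow> d l * of_int (exch E X l j) = skew_form E (X l) (X j)"
  using exch_eq[of E l X j] validD(1)[of E X l] by (simp add: isroot_def)

lemma exch_cong: "skew_form E (X l) (X j) = skew_form E' (Y l) (Y j) \<Longrightarrow> exch E X l j = exch E' Y l j"
  by (simp add: exch_def)

lemma exch_self [simp]: "exch E X l l = 0"
  by (simp add: exch_def)

lemma mult_nonneg: "mult E X l j \<ge> 0"
  by (simp add: mult_def)

lemma mult_cong: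
  "exch E X l j = exch E' Y l j \<Longrightarrow> (posv (X l) \<longleftrightarrow> posv (Y l)) \<Longrightarrow> mult E X l j = mult E' Y l j"
  by (simp add: mult_def)

lemma spans_mut: "spans X \<Longrightarrow> spans (mut E l X)"
  by (rule spans_mutate[of X _ l "mult E X l"]) (auto simp: mut_def)

text \<open>At the simple root of a source the exchange number is, up to the factor
  \<open>d k\<close>, minus the Euler pairing with \<open>X j\<close>, whose sign is governed by
  \<open>euler_axis_sign\<close>.\<close>

lemma mult_source:
  assumes o: "orient E" and s: "is_source E k" and v: "valid E X" and i: "X l = axis k 1" and j: "j \<noteq> l"
  shows "posv (X j) \<Longrightarrow> d k * of_int (mult E X l j) = - euler E (axis k 1) (X j)"
    "negv (X j) \<Longrightarrow> mult E X l j = 0"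
proof -
  have dl: "d l = d k"
    using euler_root[OF o validD(1)[OF v, of l]] euler_root[OF o isroot_axis, of k] i by simp
  have z: "X j $ k = 0"
    using source_axis_zero[OF o s v i j] .
  have b: "d k * of_int (exch E X l j) = - euler E (axis k 1) (X j)"
    using exch_valid[OF o v, of l j] euler_source[OF s, of "X j"] z by (simp add: skew_form_def i dl)
  have m: "mult E X l j = max 0 (exch E X l j)"
    using posv_axis[of k] by (simp add: mult_def i)
  have dk: "d k > 0" by (rule d_pos)
  show "d k * of_int (mult E X l j) = - euler E (axis k 1) (X j)" if "posv (X j)"
  proof -
    have "0 \<le> d k * of_int (exch E X l j)"
      using b euler_axis_sign(1)[OF o s z that] by simp
    then have "exch E X l j \<ge> 0"
      using dk by (simp add: zero_le_mult_iff)
    then show ?thesis using b m by simp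
  qed
  show "mult E X l j = 0" if "negv (X j)"
  proof -
    have "d k * of_int (exch E X l j) \<le> 0"
      using b euler_axis_sign(2)[OF o s z that] by simp
    then have "exch E X l j \<le> 0"
      using dk by (simp add: mult_le_0_iff)
    then show ?thesis using m by simp
  qed
qed

text \<open>If the mutated vector is the simple root at a source, all other vectors avoid that vertex, and
  the mutation replaces the positive ones by their images under the simple reflection.\<close>

lemma valid_mut_source:
  assumes o: "orient E" and s: "is_source E k" and v: "valid E X" and i: "X l = axis k 1"
  shows "valid E (mut E l X)"
proof -
  let ?a = "axis k 1 :: int^'n"
  let ?Y = "mut E l X"
  have Yl: "?Y l = - ?a" by (simp add: mut_def i)
  have Yj: "?Y j = X j + mult E X l j *s ?a" if "j \<noteq> l" for j
    using that by (simp add: mut_def i)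
  have z: "X j $ k = 0" if "j \<noteq> l" for j
    using source_axis_zero[OF o s v i that] .
  have zz: "euler E (X j) ?a = 0" if "j \<noteq> l" for j
    using euler_source[OF s, of "X j"] z[OF that] by simp
  have aa: "euler E ?a ?a = d k" by (rule euler_root[OF o isroot_axis])
  have dl: "d l = d k"
    using euler_root[OF o validD(1)[OF v, of l]] aa i by simp
  have mp: "d k * of_int (mult E X l j) = - euler E ?a (X j)" if "j \<noteq> l" "posv (X j)" for j
    using mult_source(1)[OF o s v i that] .
  have mn: "mult E X l j = 0" if "j \<noteq> l" "negv (X j)" for j
    using mult_source(2)[OF o s v i that] .
  have Yn: "?Y j = X j" if "j \<noteq> l" "negv (X j)" for j
    using Yj[OF that(1)] mn[OF that] by simp
  have Yp: "?Y j = refl_at k (X j)" if "j \<noteq> l" "posv (X j)" for j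
  proof -
    have "d k * of_int (mult E X l j) = - (d k * of_int (\<Sum>i\<in>UNIV. A $ k $ i * X j $ i))"
      using mp[OF that] sym_form_euler[OF o, of "X j" ?a] sym_form_axis[of "X j" k] zz[OF that(1)] by simp
    then have "d k * of_int (mult E X l j) = d k * of_int (- (\<Sum>i\<in>UNIV. A $ k $ i * X j $ i))"
      by simp
    then have "mult E X l j = - (\<Sum>i\<in>UNIV. A $ k $ i * X j $ i)"
      unfolding mult_cancel_left of_int_eq_iff using d_pos[of k] by auto
    then show ?thesis
      by (simp add: Yj[OF that(1)] refl_at_def vec_eq_iff)
  qed
  have sgp: "posv (?Y j)" if "j \<noteq> l" "posv (X j)" for j
    unfolding Yj[OF that(1)] using that mult_nonneg[of E X l j] by (auto simp: posv_def axis_def)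
  have root: "isroot j (?Y j)" for j
  proof -
    consider "j = l" | "j \<noteq> l" "posv (X j)" | "j \<noteq> l" "negv (X j)"
      using valid_sign[OF o v, of j] by auto
    then show ?thesis
    proof cases
      case 1
      then show ?thesis using isroot_minus[OF validD(1)[OF v, of l]] by (simp add: mut_def)
    next
      case 2
      show ?thesis unfolding Yp[OF 2] by (rule isroot_refl_at[OF validD(1)[OF v]])
    next
      case 3
      show ?thesis unfolding Yn[OF 3] by (rule validD(1)[OF v])
    qed
  qed
  have sg: "posv (?Y j) \<longleftrightarrow> j \<noteq> l \<and> posv (X j)" "negv (?Y j) \<longleftrightarrow> j = l \<or> negv (X j) \<and> j \<noteq> l" for j
  proof -
    have "(posv (?Y j) \<longleftrightarrow> j \<noteq> l \<and> posv (X j)) \<and> (negv (?Y j) \<longleftrightarrow> j = l \<or> negv (X j) \<and> j \<noteq> l)"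
    proof (cases "j = l")
      case True
      then show ?thesis
        using root_not_both[OF root[of l]] negv_axis[of k] by (auto simp: Yl)
    next
      case False
      have nb: "\<not> (posv (?Y j) \<and> negv (?Y j))" "\<not> (posv (X j) \<and> negv (X j))"
        using root_not_both[OF root] root_not_both[OF validD(1)[OF v]] by auto
      show ?thesis
        using valid_sign[OF o v, of j] sgp[OF False] Yn[OF False] nb False by auto
    qed
    then show "posv (?Y j) \<longleftrightarrow> j \<noteq> l \<and> posv (X j)" "negv (?Y j) \<longleftrightarrow> j = l \<or> negv (X j) \<and> j \<noteq> l" by auto
  qed
  \<comment> \<open>The correction terms cancel: by \<open>mp\<close>, the multiplicity of
    \<open>b\<close> times \<open>d k\<close> is minus the pairing of the simple root with
    \<open>X b\<close>.\<close>
  have pp: "euler E (?Y a) (?Y b) = euler E (X a) (X b)" if "a \<noteq> l" "b \<noteq> l" "posv (X a)" "posv (X b)" for a b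
  proof -
    have "euler E (?Y a) (?Y b) = euler E (X a) (X b) + of_int (mult E X l a) * euler E ?a (X b)
        + of_int (mult E X l a) * (d k * of_int (mult E X l b))"
      unfolding Yj[OF that(1)] Yj[OF that(2)] by (simp add: euler_lin zz that aa algebra_simps)
    then show ?thesis using mp[OF that(2,4)] by simp
  qed
  have np: "euler E (?Y a) (?Y b) = euler E (X a) (X b)" if "a \<noteq> l" "b \<noteq> l" "negv (X a)" for a b
    unfolding Yn[OF that(1,3)] Yj[OF that(2)] by (simp add: euler_lin zz that)
  have lp: "euler E (?Y l) (?Y b) = 0" if "b \<noteq> l" "posv (X b)" for b
    unfolding Yl Yj[OF that(1)] using mp[OF that] by (simp add: euler_lin aa mult.commute)
  have ln: "euler E (?Y l) (?Y b) \<le> 0" "euler E (?Y b) (?Y l) \<le> 0" if "b \<noteq> l" "negv (X b)" for b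
    unfolding Yl Yn[OF that] using euler_axis_sign(2)[OF o s z[OF that(1)] that(2)] zz[OF that(1)]
    by (simp_all add: euler_lin)
  have 1: "euler E (?Y a) (?Y b) = 0" if "negv (?Y a)" "posv (?Y b)" for a b
    using that np[of a b] lp[of b] validD(3)[OF v, of a b] by (cases "a = l") (simp_all add: sg)
  have 2: "euler E (?Y a) (?Y b) \<le> 0" if "a \<noteq> b" "posv (?Y a)" "posv (?Y b)" for a b
    using that pp[of a b] validD(4)[OF v, of a b] by (simp add: sg)
  have 3: "euler E (?Y a) (?Y b) \<le> 0" if "a \<noteq> b" "negv (?Y a)" "negv (?Y b)" for a b
    using that np[of a b] ln[of a] ln[of b] validD(5)[OF v, of a b] by (cases "a = l"; cases "b = l") (simp_all add: sg)
  show ?thesis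
    unfolding valid_def using root 1 2 3 spans_mut[OF validD(2)[OF v]] by simp
qed

lemma skew_form_refl_at: "orient E \<Longrightarrow> is_source E k \<Longrightarrow> skew_form (flipE k E) (refl_at k x) (refl_at k y) = skew_form E x y"
  by (simp add: skew_form_def euler_refl_at)

text \<open>On vectors vanishing at \<open>k\<close> one of the two pairings with the simple root is
  zero, before and after reversing the arrows, so the other one equals the symmetric form in both
  cases.\<close>

lemma skew_form_neg_at:
  assumes o: "orient E" and s: "is_source E k" and x: "x = axis k 1 \<or> x $ k = 0" and y: "y = axis k 1 \<or> y $ k = 0"
  shows "skew_form (flipE k E) (neg_at k x) (neg_at k y) = skew_form E x y"
proof -
  have o': "orient (flipE k E)" and s': "is_sink (flipE k E) k"
    using orient_flipE[OF o] source_flipE[OF s] by auto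
  have 1: "skew_form (flipE k E) (- axis k 1) z = skew_form E (axis k 1) z" if "z $ k = 0" for z
  proof -
    have "euler (flipE k E) z (axis k 1) = euler E (axis k 1) z"
      using sym_form_euler[OF o, of z "axis k 1"] sym_form_euler[OF o', of z "axis k 1"]
        euler_sink[OF o' s', of z] euler_source[OF s, of z] that by simp
    then show ?thesis
      using euler_sink[OF o' s', of z] euler_source[OF s, of z] that by (simp add: skew_form_def euler_lin)
  qed
  consider "x = axis k 1" "y = axis k 1" | "x = axis k 1" "y $ k = 0" | "x $ k = 0" "y = axis k 1"
    | "x $ k = 0" "y $ k = 0"
    using x y by blast
  then show ?thesis
  proof cases
    case 1
    then show ?thesis by simp
  next
    case 2
    then show ?thesis using 1[of y] by (simp add: neg_at_axis neg_at_id)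
  next
    case 3
    then show ?thesis using 1[of x] skew_form_swap[of _ _ x] by (simp add: neg_at_axis neg_at_id)
  next
    case 4
    then show ?thesis by (simp add: skew_form_def euler_flip_zero neg_at_id)
  qed
qed

text \<open>A move thus leaves all exchange numbers alone, as a change of the initial seed
  must.\<close>

lemma skew_form_move:
  assumes o: "orient E" and s: "is_source E k" and v: "valid E X"
  shows "skew_form (flipE k E) (move k X i) (move k X j) = skew_form E (X i) (X j)"
proof (cases "\<exists>i. X i = axis k 1")
  case True
  then obtain p where p: "X p = axis k 1" by blast
  have "X q = axis k 1 \<or> X q $ k = 0" for q
    using source_axis_zero[OF o s v p, of q] p by (cases "q = p") auto
  then show ?thesis
    using True skew_form_neg_at[OF o s] by (simp add: move_def)
next
  case False
  then show ?thesis using skew_form_refl_at[OF o s] by (simp add: move_def)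
qed

text \<open>The exchange number towards the simple root has sign opposite to \<open>X l\<close>, so
  its twisted positive part vanishes. A simple root at a source survives mutations at all other
  indices, which later permits walks through clusters that keep one variable.\<close>

lemma mult_source_zero:
  assumes o: "orient E" and s: "is_source E k" and v: "valid E X" and i: "X i = axis k 1" and l: "l \<noteq> i"
  shows "mult E X l i = 0"
proof -
  have z: "X l $ k = 0"
    using source_axis_zero[OF o s v i l] .
  have b: "d l * of_int (exch E X l i) = euler E (axis k 1) (X l)"
    using exch_valid[OF o v, of l i] euler_source[OF s, of "X l"] z by (simp add: skew_form_def i)
  have "d l > 0" by (rule d_pos)
  then have p: "posv (X l) \<Longrightarrow> exch E X l i \<le> 0" and n: "negv (X l) \<Longrightarrow> exch E X l i \<ge> 0"
    using euler_axis_sign[OF o s z] unfolding b[symmetric] by (simp_all add: mult_le_0_iff zero_le_mult_iff)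
  show ?thesis
    using p n valid_sign[OF o v, of l] by (auto simp: mult_def)
qed

lemma mut_source_fixed:
  assumes "orient E" "is_source E k" "valid E X" "X i = axis k 1" "l \<noteq> i"
  shows "mut E l X i = axis k 1"
  using mult_source_zero[OF assms] assms(4,5) by (simp add: mut_def)

lemma isroot_same_length:
  assumes "orient E" "isroot l x" "x = axis k 1 \<or> x = - axis k 1"
  shows "d l = d k"
  using euler_root[OF assms(1,2)] euler_root[OF assms(1) isroot_axis, of k] assms(3) by (auto simp: euler_lin)

lemma move_refl_at: "(\<And>i. X i \<noteq> axis k 1) \<Longrightarrow> move k X = (\<lambda>i. refl_at k (X i))"
  and move_neg_at: "X i = axis k 1 \<Longrightarrow> move k X = (\<lambda>i. neg_at k (X i))"
  by (auto simp: move_def)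

lemma refl_at_coeff:
  assumes o: "orient E" and s: "is_source E k"
  shows "d k * of_int (\<Sum>j\<in>UNIV. A $ k $ j * x $ j) = d k * of_int (x $ k) + euler E (axis k 1) x"
  using sym_form_euler[OF o, of x "axis k 1"] sym_form_axis[of x k] euler_source[OF s, of x] by simp

lemma dk_cancel: "d k * of_int x = d k * of_int y \<longleftrightarrow> x = y"
  using d_pos[of k] by auto

text \<open>Validity is assumed on the far side because that is what the induction along a source
  sequence has at hand. Away from the simple root and its negative, signs and multiplicities agree
  on both sides and a linear map commutes with the mutation formula. The other cases are those where
  the branch of the move or the sign of the mutated vector changes.\<close>

lemma move_mut_back:
  assumes o: "orient E" and s: "is_source E k" and v: "valid E X"
    and v': "valid (flipE k E) (mut (flipE k E) l (move k X))"
  shows "valid E (mut E l X) \<and> move k (mut E l X) = mut (flipE k E) l (move k X)"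
proof -
  define E' where "E' = flipE k E"
  define X' where "X' = move k X"
  define Y where "Y = mut E l X"
  define Y' where "Y' = mut E' l X'"
  have o': "orient E'" and s': "is_sink E' k" and EE: "flipE k E' = E"
    using orient_flipE[OF o] source_flipE[OF s] by (auto simp: E'_def)
  have vX': "valid E' X'"
    unfolding E'_def X'_def by (rule valid_move[OF o s v])
  have vY': "valid E' Y'"
    using v' by (simp add: E'_def X'_def Y'_def)
  have b: "exch E' X' p q = exch E X p q" for p q
    unfolding E'_def X'_def by (rule exch_cong) (rule skew_form_move[OF o s v])
  have Yl: "Y l = - X l" "Y' l = - X' l"
    by (simp_all add: Y_def Y'_def mut_def)
  have Yj: "Y j = X j + mult E X l j *s X l" "Y' j = X' j + mult E' X' l j *s X' l" if "j \<noteq> l" for j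
    using that by (simp_all add: Y_def Y'_def mut_def)
  have "valid E Y \<and> move k Y = Y'"
  proof (cases "\<exists>i. X i = axis k 1")
    case False
    then have X': "X' i = refl_at k (X i)" for i
      by (simp add: X'_def move_def)
    show ?thesis
    proof (cases "X l = - axis k 1")
      case False2: False
      have "posv (X' l) \<longleftrightarrow> posv (X l)"
      proof -
        consider "posv (X l)" | "negv (X l)"
          using valid_sign[OF o v] by blast
        then show ?thesis
        proof cases
          case 1
          then show ?thesis
            using posv_refl_at[OF o validD(1)[OF v] 1] False by (simp add: X')
        next
          case 2
          then show ?thesis
            using negv_refl_at[OF o validD(1)[OF v] 2 False2] root_not_both[OF validD(1)[OF v], of l]
              root_not_both[OF validD(1)[OF vX'], of l] by (auto simp: X')
        qed
      qed
      then have m: "mult E' X' l j = mult E X l j" for j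
        by (intro mult_cong b)
      have Y': "Y' j = refl_at k (Y j)" for j
        by (cases "j = l") (simp_all add: Yl Yj m X' refl_at_add refl_at_scale refl_at_minus)
      \<comment> \<open>If the negative simple root occurred after the mutation, moving back would
        take the other branch. It would have to arise from \<open>X' j\<close> by adding a positive
        multiple of \<open>X' l\<close>, which contradicts the signs.\<close>
      have ne: "Y' j \<noteq> - axis k 1" for j
      proof
        assume a: "Y' j = - axis k 1"
        then have "Y j = axis k 1"
          unfolding Y' refl_at_eq_axis .
        then have jl: "j \<noteq> l"
          using False2 Yl(1) by (metis minus_minus)
        define c where "c = mult E' X' l j"
        have c0: "c \<ge> 0" by (simp add: c_def mult_nonneg)
        have e: "X' j = - axis k 1 - c *s X' l"
          using a Yj(2)[OF jl] by (simp add: c_def algebra_simps)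
        have "c \<noteq> 0"
          using e False by (auto simp: X' refl_at_eq_axis)
        then have c: "c > 0" using c0 by simp
        have z: "X' l $ k = 0"
          using sink_axis_zero[OF o' s' vY' a, of l] jl by (simp add: Yl)
        have "X' j $ k = - 1"
          unfolding e using z by simp
        then have nj: "negv (X' j)"
          using valid_sign[OF o' vX', of j] by (auto simp: posv_def dest: spec[of _ k])
        show False
        proof (cases "posv (X' l)")
          case True
          have "euler E' (X' j) (X' l) = - (of_int c * d l)"
            using euler_sink[OF o' s', of "X' l"] z euler_root[OF o' validD(1)[OF vX', of l]]
            unfolding e by (simp add: euler_lin)
          then show False
            using validD(3)[OF vX' nj True] c d_pos[of l] by simp
        next
          case neg: False
          then have n: "negv (X' l)"
            using valid_sign[OF o' vX'] by blast
          have "X' l $ q = 0" for q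
          proof (cases "q = k")
            case True
            then show ?thesis using z by simp
          next
            case False
            then have "X' j $ q = - (c * X' l $ q)"
              unfolding e by (simp add: axis_def)
            moreover have "X' j $ q \<le> 0" "X' l $ q \<le> 0"
              using nj n by (simp_all add: negv_def)
            ultimately show ?thesis
              using c by (simp add: zero_le_mult_iff)
          qed
          then show False
            using root_nonzero[OF validD(1)[OF vX', of l]] by (simp add: vec_eq_iff)
        qed
      qed
      have "valid E (\<lambda>j. refl_at k (Y' j))"
        using valid_back_refl_at[OF o' s' vY' ne] by (simp add: EE)
      moreover have "(\<lambda>j. refl_at k (Y' j)) = Y"
        by (simp add: Y')
      moreover have "move k Y = Y'"
        using ne by (subst move_refl_at) (auto simp: Y' refl_at_eq_axis)
      ultimately show ?thesis by simp
    next
      case True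
      then have Xl: "X' l = axis k 1"
        by (simp add: X' refl_at_minus refl_at_axis_same)
      have dl: "d l = d k"
        using isroot_same_length[OF o validD(1)[OF v, of l]] True by blast
      have Y'l: "Y' l = - axis k 1" "Y l = axis k 1"
        by (simp_all add: Yl Xl True)
      have z: "Y' j $ k = 0" if "j \<noteq> l" for j
        using sink_axis_zero[OF o' s' vY' Y'l(1) that] .
      have "Y j = Y' j" if jl: "j \<noteq> l" for j
      proof -
        define S where "S = (\<Sum>i\<in>UNIV. A $ k $ i * X j $ i)"
        define B where "B = exch E X l j"
        have S: "d k * of_int S = d k * of_int (X j $ k) + euler E (axis k 1) (X j)"
          unfolding S_def by (rule refl_at_coeff[OF o s])
        have B: "d k * of_int B = - (d k * of_int (X j $ k)) + euler E (axis k 1) (X j)"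
          using exch_valid[OF o v, of l j] euler_source[OF s, of "X j"] by (simp add: B_def skew_form_def True euler_lin dl)
        have m: "mult E X l j = max 0 (- B)" "mult E' X' l j = max 0 B"
          using posv_axis[of k] root_not_both[OF isroot_axis[of k]] by (simp_all add: mult_def B_def b True Xl)
        \<comment> \<open>The mutated vector changes sign under the move, so the multiplicities on
          the two sides are the positive parts of \<open>- B\<close> and of \<open>B\<close>. Their
          sum has to be the coefficient \<open>S\<close> of the reflection.\<close>
        have "S = max 0 B + max 0 (- B)"
        proof (cases "posv (X j)")
          case pos: True
          then have "euler E (axis k 1) (X j) = 0"
            using validD(3)[OF v, of l j] True negv_axis[of k] by (simp add: euler_lin)
          then have "d k * of_int S = d k * of_int (X j $ k)" "d k * of_int B = d k * of_int (- X j $ k)"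
            using S B by simp_all
          then have "S = X j $ k" "B = - X j $ k"
            unfolding dk_cancel by simp_all
          moreover have "X j $ k \<ge> 0" using pos by (simp add: posv_def)
          ultimately show ?thesis by simp
        next
          case False
          then have n: "negv (X j)" using valid_sign[OF o v] by blast
          have "euler E (X j) (X l) \<le> 0"
            using validD(5)[OF v jl n] True negv_axis[of k] by simp
          then have "d k * of_int (X j $ k) \<ge> 0"
            using euler_source[OF s, of "X j"] by (simp add: True euler_lin)
          then have xk: "X j $ k = 0"
            using n d_pos[of k] by (simp add: zero_le_mult_iff negv_def order_antisym)
          then have "d k * of_int S = d k * of_int B"
            using S B by simp
          then have SB: "S = B" unfolding dk_cancel .
          have "d k * of_int B \<ge> 0"
            using B xk euler_axis_sign(2)[OF o s xk n] by simp
          then have "B \<ge> 0"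
            using d_pos[of k] by (simp add: zero_le_mult_iff)
          then show ?thesis using SB by simp
        qed
        moreover have "X' j = X j - S *s axis k 1"
          by (simp add: X' refl_at_def S_def)
        ultimately show ?thesis
          unfolding Yj[OF jl] m True Xl by (simp add: vec_eq_iff algebra_simps)
      qed
      then have Y: "Y j = neg_at k (Y' j)" for j
        using z[of j] Y'l neg_at_eq_axis(2)[of k "- axis k 1"] by (cases "j = l") (simp_all add: neg_at_id)
      have "valid E (\<lambda>j. neg_at k (Y' j))"
        using valid_back_neg_at[OF o' s' vY' Y'l(1)] by (simp add: EE)
      moreover have "(\<lambda>j. neg_at k (Y' j)) = Y" by (rule ext) (simp add: Y)
      moreover have "move k Y = Y'"
        unfolding move_neg_at[of Y l k, OF Y'l(2)] by (simp add: Y)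
      ultimately show ?thesis by simp
    qed
  next
    case True
    then obtain i where i: "X i = axis k 1" by blast
    have X': "X' j = neg_at k (X j)" for j
      unfolding X'_def move_neg_at[of X i k, OF i] ..
    have zX: "X j $ k = 0" "X' j = X j" if "j \<noteq> i" for j
      using source_axis_zero[OF o s v i that] by (simp_all add: X' neg_at_id)
    have X'i: "X' i = - axis k 1"
      by (simp add: X' i neg_at_axis)
    show ?thesis
    proof (cases "i = l")
      \<comment> \<open>Mutation replaces the simple root by its negative, so the move negates a
        coordinate before the mutation and reflects after it.\<close>
      case il: True
      have vY: "valid E Y"
        unfolding Y_def using valid_mut_source[OF o s v] i il by blast
      have dl: "d l = d k"
        using isroot_same_length[OF o validD(1)[OF v, of l]] i il by blast
      have "Y j \<noteq> axis k 1" for j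
      proof (cases "j = l")
        case True
        then show ?thesis
          using Yl(1) i il root_not_both[OF isroot_axis[of k]] posv_axis[of k] posv_minus by metis
      next
        case False
        then show ?thesis
          using spans_inj(2)[OF validD(2)[OF vY] False] Yl(1) i il by simp
      qed
      then have "move k Y = (\<lambda>j. refl_at k (Y j))"
        by (rule move_refl_at)
      moreover have "refl_at k (Y j) = Y' j" for j
      proof (cases "j = l")
        case True
        then show ?thesis
          using Yl X'i i il by (simp add: refl_at_minus refl_at_axis_same)
      next
        case jl: False
        define S where "S = (\<Sum>i\<in>UNIV. A $ k $ i * X j $ i)"
        define B where "B = exch E X l j"
        have xk: "X j $ k = 0" using zX(1)[of j] jl il by simp
        have S: "d k * of_int S = euler E (axis k 1) (X j)"
          unfolding S_def using refl_at_coeff[OF o s, of "X j"] xk by simp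
        have "d k * of_int B = - euler E (axis k 1) (X j)"
          using exch_valid[OF o v, of l j] euler_source[OF s, of "X j"] xk i il by (simp add: B_def skew_form_def euler_lin dl)
        then have "d k * of_int S = d k * of_int (- B)" using S by simp
        then have SB: "S = - B" unfolding dk_cancel .
        have m: "mult E X l j = max 0 B" "mult E' X' l j = max 0 (- B)"
          using posv_axis[of k] root_not_both[OF isroot_axis[of k]] X'i i il by (simp_all add: mult_def B_def b)
        have 1: "refl_at k (X j) = X j + B *s axis k 1"
          using SB by (simp add: refl_at_def S_def vec_eq_iff)
        have 2: "max 0 B = B + max 0 (- B)" by simp
        have 3: "Y j = X j + max 0 B *s axis k 1" and 4: "Y' j = X j - max 0 (- B) *s axis k 1"
          using i il X'i zX(2)[of j] jl by (simp_all add: Yj m)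
        show ?thesis
          unfolding 3 4 refl_at_add refl_at_scale refl_at_axis_same 1
          by (subst 2) (simp add: vec_eq_iff algebra_simps)
      qed
      ultimately show ?thesis using vY by simp
    next
      case il: False
      have m: "mult E' X' l j = mult E X l j" for j
        using zX(2)[of l] il by (intro mult_cong b) simp
      have Yi: "Y i = axis k 1"
        unfolding Y_def by (rule mut_source_fixed[OF o s v i]) (use il in simp)
      have Y'i: "Y' i = - axis k 1"
        using Yj(2)[of i] il m[of i] mult_source_zero[OF o s v i, of l] by (simp add: X'i)
      have Y': "Y' j = neg_at k (Y j)" for j
      proof (cases "j = i")
        case True
        then show ?thesis by (simp add: Yi Y'i neg_at_axis)
      next
        case False
        have "Y' j = Y j" "Y j $ k = 0"
          using zX[OF False] zX[of l] il False by (cases "j = l"; simp add: Yl Yj m)+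
        then show ?thesis by (simp add: neg_at_id)
      qed
      have "valid E (\<lambda>j. neg_at k (Y' j))"
        using valid_back_neg_at[OF o' s' vY' Y'i] by (simp add: EE)
      moreover have "(\<lambda>j. neg_at k (Y' j)) = Y" by (simp add: Y')
      moreover have "move k Y = Y'"
        unfolding move_neg_at[of Y i k, OF Yi] by (rule ext) (simp add: Y')
      ultimately show ?thesis by simp
    qed
  qed
  then show ?thesis by (simp add: Y_def Y'_def E'_def X'_def)
qed

text \<open>Let \<open>V\<close> be the part of the expansion with positive coefficients at negative
  members. One-sided orthogonality and the sign axioms give
  \<open>euler E V V <= euler E V (axis k 1)\<close>; the right side is nonpositive at a source, so
  positive definiteness forces \<open>V = 0\<close>.\<close>

lemma row_sign_neg:
  assumes o: "orient E" and s: "is_source E k" and v: "valid E X" and x: "axis k 1 = lincomb x X" and l: "negv (X l)"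
  shows "x l \<le> 0"
proof -
  define N where "N = {l. negv (X l)}"
  define y where "y l = (if l \<in> N then max 0 (x l) else 0)" for l
  have y0: "y l \<ge> 0" for l by (simp add: y_def)
  define V where "V = lincomb y X"
  have V: "euler E V z = (\<Sum>m\<in>N. of_int (y m) * euler E (X m) z)" for z
  proof -
    have "euler E V z = (\<Sum>m\<in>UNIV. of_int (y m) * euler E (X m) z)"
      by (simp add: V_def lincomb_def euler_sum_left euler_lin)
    also have "\<dots> = (\<Sum>m\<in>N. of_int (y m) * euler E (X m) z)"
      by (rule sum.mono_neutral_right) (auto simp: y_def)
    finally show ?thesis .
  qed
  have "euler E (X m) (axis k 1) \<le> 0" if "m \<in> N" for m
    using that euler_source[OF s, of "X m"] d_pos[of k] by (simp add: N_def negv_def mult_nonneg_nonpos)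
  then have "euler E V (axis k 1) \<le> 0"
    unfolding V by (intro sum_nonpos mult_nonneg_nonpos) (auto simp: y0)
  have le: "euler E (X m) V \<le> euler E (X m) (axis k 1)" if m: "m \<in> N" and ym: "y m > 0" for m
  proof -
    have 1: "euler E (X m) V = (\<Sum>l\<in>UNIV. of_int (y l) * euler E (X m) (X l))"
      by (simp add: V_def lincomb_def euler_sum_right euler_lin)
    have 2: "euler E (X m) (axis k 1) = (\<Sum>l\<in>UNIV. of_int (x l) * euler E (X m) (X l))"
      by (simp add: x lincomb_def euler_sum_right euler_lin)
    have "of_int (y l) * euler E (X m) (X l) \<le> of_int (x l) * euler E (X m) (X l)" for l
    proof (cases "l \<in> N")
      case False
      then have "euler E (X m) (X l) = 0"
        using validD(3)[OF v, of m l] m valid_sign[OF o v, of l] by (auto simp: N_def)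
      then show ?thesis by simp
    next
      case True
      show ?thesis
      proof (cases "x l \<ge> 0")
        case True2: True
        then show ?thesis using True by (simp add: y_def)
      next
        case False
        then have "l \<noteq> m" using ym by (auto simp: y_def split: if_splits)
        then have "euler E (X m) (X l) \<le> 0"
          using validD(5)[OF v, of m l] m True by (auto simp: N_def)
        then show ?thesis using False True
          by (simp add: y_def mult_nonpos_nonpos)
      qed
    qed
    then show ?thesis unfolding 1 2 by (rule sum_mono)
  qed
  have "euler E V V \<le> euler E V (axis k 1)"
    unfolding V[of V] V[of "axis k 1"]
  proof (rule sum_mono)
    fix m assume "m \<in> N"
    then show "of_int (y m) * euler E (X m) V \<le> of_int (y m) * euler E (X m) (axis k 1)"
      using le[of m] y0[of m] by (cases "y m = 0") (simp_all add: mult_left_mono)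
  qed
  then have "euler E V V \<le> 0"
    using \<open>euler E V (axis k 1) \<le> 0\<close> by simp
  then have "V = 0"
    using euler_pos[OF o, of V] by linarith
  moreover have "lincomb (\<lambda>_. 0) X = 0"
    by (simp add: lincomb_def vec_eq_iff)
  ultimately have "y = (\<lambda>_. 0)"
    unfolding V_def using lincomb_inject[OF validD(2)[OF v]] by metis
  then have "y l = 0" by simp
  then show ?thesis using l by (simp add: y_def N_def split: if_splits)
qed

lemma lincomb_uminus: "lincomb (\<lambda>i. - x i) (\<lambda>i. - X i) = lincomb x X"
  "lincomb (\<lambda>i. - x i) X = - lincomb x X"
  by (simp_all add: lincomb_def vec_eq_iff sum_negf)

lemma row_sign_pos_sink:
  assumes o: "orient E" and s: "is_sink E k" and v: "valid E X" and x: "axis k 1 = lincomb x X" and l: "posv (X l)"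
  shows "0 \<le> x l"
  using row_sign_neg[OF orient_converse[OF o] _ valid_converse[OF o v], of k "\<lambda>i. - x i" l] s x l
  by (simp add: source_converse lincomb_uminus)

text \<open>Negative members are covered directly. For a positive member, reflect: the simple root
  becomes its negative, positivity is kept because the simple root is not in the tuple, and
  \<open>k\<close> is now a sink. The coefficients are the \<open>k\<close>-coordinates of the dual
  basis.\<close>

lemma row_sign:
  assumes o: "orient E" and s: "is_source E k" and v: "valid E X" and ne: "\<And>i. X i \<noteq> axis k 1"
    and x: "axis k 1 = lincomb x X"
  shows "x l \<le> 0"
proof (cases "negv (X l)")
  case True
  then show ?thesis by (rule row_sign_neg[OF o s v x])
next
  case False
  then have p: "posv (X l)" using valid_sign[OF o v] by blast
  have v': "valid (flipE k E) (\<lambda>i. refl_at k (X i))"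
    by (rule valid_refl_at[OF o s v ne])
  have "axis k 1 = - refl_at k (axis k 1)" by (simp add: refl_at_axis_same)
  also have "\<dots> = lincomb (\<lambda>i. - x i) (\<lambda>i. refl_at k (X i))"
    unfolding x refl_at_lincomb lincomb_uminus ..
  finally have "0 \<le> - x l"
    by (rule row_sign_pos_sink[OF orient_flipE[OF o] source_flipE[OF s] v' _ posv_refl_at[OF o validD(1)[OF v] p ne]])
  then show ?thesis by simp
qed

section \<open>Reaching a simple root at a source\<close>

text \<open>A directed cycle would give a nonzero vector on which the form is nonpositive.\<close>

lemma no_cycle:
  assumes o: "orient E" and S: "S \<noteq> {}"
  shows "\<exists>j\<in>S. \<forall>i\<in>S. (i, j) \<notin> E"
proof (rule ccontr)
  assume "\<not> ?thesis"
  then have "\<forall>j. \<exists>i. j \<in> S \<longrightarrow> i \<in> S \<and> (i, j) \<in> E" by blast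
  from choice[OF this] obtain p where p: "\<And>j. j \<in> S \<Longrightarrow> p j \<in> S" "\<And>j. j \<in> S \<Longrightarrow> (p j, j) \<in> E"
    by blast
  \<comment> \<open>The weights normalise diagonal terms to \<open>1\<close>; an edge then
    contributes at most \<open>-1\<close>, because the product of its two Cartan entries is at least
    \<open>1\<close>.\<close>
  define v :: "real^'n" where "v = (\<chi> i. if i \<in> S then 1 / sqrt (d i) else 0)"
  have v0: "v $ i \<ge> 0" for i using d_pos[of i] by (simp add: v_def)
  have "v \<noteq> 0"
  proof -
    obtain i where "i \<in> S" using S by blast
    then have "v $ i \<noteq> 0" using d_pos[of i] by (simp add: v_def)
    then show ?thesis by auto
  qed
  define t where "t i j = coef E i j * v $ i * v $ j" for i j
  have t_nonpos: "t i j \<le> 0" if "i \<noteq> j" for i j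
  proof -
    have "coef E i j \<le> 0"
      using that offdiag[OF that] d_pos[of i] by (simp add: coef_def mult_nonneg_nonpos)
    then show ?thesis unfolding t_def using v0 by (intro mult_nonpos_nonneg) auto
  qed
  have col: "(\<Sum>i\<in>UNIV. t i j) \<le> 0" for j
  proof (cases "j \<in> S")
    case False
    then show ?thesis by (simp add: t_def v_def)
  next
    case True
    define i where "i = p j"
    have i: "i \<in> S" "(i, j) \<in> E" using p True by (auto simp: i_def)
    then have ij: "i \<noteq> j" "A $ i $ j \<noteq> 0" using orientD(1,4)[OF o] by auto
    define a where "a = - (d i * of_int (A $ i $ j))"
    have A1: "A $ i $ j \<le> - 1" "A $ j $ i \<le> - 1"
      using offdiag[OF ij(1)] offdiag[of j i] ij A_zero_sym[of i j] by auto
    have "d i * d j * 1 \<le> d i * d j * of_int (A $ i $ j * A $ j $ i)"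
    proof (intro mult_left_mono)
      have "1 \<le> A $ i $ j * A $ j $ i"
        using A1 mult_mono[of 1 "- A $ i $ j" 1 "- A $ j $ i"] by simp
      then show "1 \<le> real_of_int (A $ i $ j * A $ j $ i)" by (simp only: of_int_1_le_iff)
      show "0 \<le> d i * d j" using d_pos[of i] d_pos[of j] by simp
    qed
    also have "\<dots> = (d i * of_int (A $ i $ j)) * (d j * of_int (A $ j $ i))" by simp
    also have "\<dots> = a\<^sup>2"
      unfolding sym[of j i] a_def by (simp add: power2_eq_square)
    finally have "sqrt (d i * d j) \<le> a"
    proof -
      assume "d i * d j * 1 \<le> a\<^sup>2"
      moreover have "a \<ge> 0"
        using offdiag[OF ij(1)] d_pos[of i] by (simp add: a_def mult_nonneg_nonpos)
      ultimately show ?thesis by (simp add: real_le_lsqrt)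
    qed
    moreover have "t i j = - a / sqrt (d i * d j)"
      using i ij True by (simp add: t_def coef_def a_def v_def real_sqrt_mult)
    moreover have "sqrt (d i * d j) > 0" using d_pos[of i] d_pos[of j] by simp
    ultimately have tij: "t i j \<le> - 1"
      by (simp add: divide_le_eq)
    have tjj: "t j j = 1"
      using True d_pos[of j] by (simp add: t_def coef_def v_def)
    have "(\<Sum>i\<in>UNIV. t i j) = t j j + (\<Sum>i\<in>UNIV-{j}. t i j)"
      by (rule sum.remove) auto
    also have "(\<Sum>i\<in>UNIV-{j}. t i j) = t i j + (\<Sum>i\<in>UNIV-{j}-{i}. t i j)"
      using ij by (intro sum.remove) auto
    also have "(\<Sum>i\<in>UNIV-{j}-{i}. t i j) \<le> 0"
      by (intro sum_nonpos t_nonpos) auto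
    finally show ?thesis using tij tjj by simp
  qed
  have "(\<Sum>i\<in>UNIV. \<Sum>j\<in>UNIV. t i j) = (\<Sum>j\<in>UNIV. \<Sum>i\<in>UNIV. t i j)"
    by (rule sum.swap)
  also have "\<dots> \<le> 0"
    by (intro sum_nonpos col)
  finally have le: "(\<Sum>i\<in>UNIV. \<Sum>j\<in>UNIV. t i j) \<le> 0" .
  have "(\<Sum>i\<in>UNIV. \<Sum>j\<in>UNIV. d i * of_int (A $ i $ j) * v $ i * v $ j)
      = (\<Sum>i\<in>UNIV. \<Sum>j\<in>UNIV. t i j + t j i)"
    unfolding coef_sum[OF o, symmetric] by (intro sum.cong refl) (simp add: t_def algebra_simps)
  also have "\<dots> = (\<Sum>i\<in>UNIV. \<Sum>j\<in>UNIV. t i j) + (\<Sum>i\<in>UNIV. \<Sum>j\<in>UNIV. t j i)"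
    by (simp add: sum.distrib)
  also have "(\<Sum>i\<in>UNIV. \<Sum>j\<in>UNIV. t j i) = (\<Sum>i\<in>UNIV. \<Sum>j\<in>UNIV. t i j)"
    by (rule sum.swap)
  finally show False
    using posdef[OF \<open>v \<noteq> 0\<close>] le by simp
qed

definition anc :: "('n \<times> 'n) set \<Rightarrow> 'n \<Rightarrow> 'n set" where
  "anc E k = {j. (j, k) \<in> E\<^sup>+}"

lemma anc_source:
  assumes o: "orient E" and k: "\<not> is_source E k"
  shows "\<exists>j\<in>anc E k. is_source E j"
proof -
  have "anc E k \<noteq> {}" using k by (auto simp: anc_def is_source_def)
  then obtain j where j: "j \<in> anc E k" "\<forall>i\<in>anc E k. (i, j) \<notin> E"
    using no_cycle[OF o] by blast
  have "(i, j) \<notin> E" for i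
    using j by (auto simp: anc_def intro: trancl_into_trancl2)
  then show ?thesis using j(1) by (auto simp: is_source_def)
qed

text \<open>Once its arrows are reversed \<open>j\<close> is a sink, so no path to \<open>k\<close>
  passes through it and none is new. The ancestors of \<open>k\<close> can be used up one source at
  a time.\<close>

lemma anc_flip:
  assumes o: "orient E" and s: "is_source E j" and jk: "j \<noteq> k"
  shows "anc (flipE j E) k \<subseteq> anc E k - {j}"
proof -
  have "(i, k) \<in> E\<^sup>+ \<and> i \<noteq> j" if "(i, k) \<in> (flipE j E)\<^sup>+" for i
    using that
  proof (induction rule: converse_trancl_induct)
    case (base y)
    then show ?case using jk s by (auto simp: flipE_iff is_source_def split: if_splits)
  next
    case (step y z)
    then have "(y, z) \<in> E" "y \<noteq> j"
      using s by (auto simp: flipE_iff is_source_def split: if_splits)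
    then show ?case using step.IH by (auto intro: trancl_into_trancl2)
  qed
  then show ?thesis by (auto simp: anc_def)
qed

fun admissible :: "('n \<times> 'n) set \<Rightarrow> 'n list \<Rightarrow> bool" where
  "admissible E [] \<longleftrightarrow> True"
| "admissible E (k # u) \<longleftrightarrow> is_source E k \<and> admissible (flipE k E) u"

lemma admissible_append: "admissible E (u @ w) \<longleftrightarrow> admissible E u \<and> admissible (fold flipE u E) w"
  by (induction u arbitrary: E) auto

lemma orient_fold: "orient E \<Longrightarrow> orient (fold flipE u E)"
  by (induction u arbitrary: E) (auto intro: orient_flipE)

lemma valid_moves: "orient E \<Longrightarrow> admissible E u \<Longrightarrow> valid E X \<Longrightarrow> valid (fold flipE u E) (fold move u X)"
  by (induction u arbitrary: E X) (auto intro: orient_flipE valid_move)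

text \<open>The form has a positive minimum on the unit sphere, so vectors of given length are
  bounded, and bounded integral vectors are finite in number.\<close>

lemma finite_roots: "finite {x. isroot i x}"
proof -
  define Q where "Q v = (\<Sum>i\<in>UNIV. \<Sum>j\<in>UNIV. d i * of_int (A $ i $ j) * v $ i * (v :: real^'n) $ j)" for v
  have cont: "continuous_on (sphere 0 1) Q"
    unfolding Q_def by (intro continuous_intros)
  have "compact (sphere 0 (1::real) :: (real^'n) set)" "sphere 0 (1::real) \<noteq> ({} :: (real^'n) set)"
    by auto
  then obtain v0 where v0: "v0 \<in> sphere 0 1" "\<And>v. v \<in> sphere 0 1 \<Longrightarrow> Q v0 \<le> Q v"
    using continuous_attains_inf[OF _ _ cont] by blast
  have "v0 \<noteq> 0" using v0(1) by auto
  then have m: "Q v0 > 0" unfolding Q_def by (rule posdef)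
  have low: "Q v0 * (norm v)\<^sup>2 \<le> Q v" for v
  proof (cases "v = 0")
    case True
    then show ?thesis by (simp add: Q_def)
  next
    case False
    then have "Q v0 \<le> Q ((1 / norm v) *\<^sub>R v)"
      by (intro v0(2)) simp
    also have "\<dots> = Q v / (norm v)\<^sup>2"
      unfolding Q_def sum_divide_distrib by (intro sum.cong refl) (simp add: power2_eq_square)
    finally show ?thesis using False by (simp add: le_divide_eq)
  qed
  define N :: int where "N = \<lceil>2 * d i / Q v0\<rceil>"
  have b: "x $ j \<in> {- N..N}" if x: "isroot i x" for x j
  proof -
    define v :: "real^'n" where "v = (\<chi> i. of_int (x $ i))"
    have "Q v = 2 * d i"
      using x by (simp add: isroot_def sym_form_def Q_def v_def)
    then have "(norm v)\<^sup>2 \<le> 2 * d i / Q v0"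
      using low[of v] m by (simp add: le_divide_eq mult.commute)
    moreover have "\<bar>v $ j\<bar>\<^sup>2 \<le> (norm v)\<^sup>2"
      by (intro power_mono component_le_norm_cart) auto
    ultimately have "(real_of_int (x $ j))\<^sup>2 \<le> 2 * d i / Q v0"
      by (simp add: v_def)
    then have "(x $ j)\<^sup>2 \<le> N"
      unfolding N_def by (simp add: le_ceiling_iff)
    moreover have "\<bar>x $ j\<bar> \<le> (x $ j)\<^sup>2"
    proof (cases "x $ j = 0")
      case False
      then have "\<bar>x $ j\<bar> * 1 \<le> \<bar>x $ j\<bar> * \<bar>x $ j\<bar>"
        by (intro mult_left_mono) auto
      then show ?thesis by (simp add: power2_eq_square)
    qed simp
    ultimately show ?thesis by auto
  qed
  have "{x. isroot i x} \<subseteq> (\<lambda>f. \<chi> j. f j) ` (UNIV \<rightarrow>\<^sub>E {- N..N})"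
  proof
    fix x assume "x \<in> {x. isroot i x}"
    then have "(\<lambda>j. x $ j) \<in> UNIV \<rightarrow>\<^sub>E {- N..N}" using b by blast
    moreover have "x = (\<chi> j. (\<lambda>j. x $ j) j)" by simp
    ultimately show "x \<in> (\<lambda>f. \<chi> j. f j) ` (UNIV \<rightarrow>\<^sub>E {- N..N})" by blast
  qed
  then show ?thesis
    by (rule finite_subset) (intro finite_imageI finite_PiE, auto)
qed

lemma finite_valid: "finite {X. valid E X}"
proof -
  have "{X. valid E X} \<subseteq> (UNIV \<rightarrow>\<^sub>E (\<Union>i. {x. isroot i x}))"
    using validD(1) by blast
  then show ?thesis
    by (rule finite_subset) (intro finite_PiE, auto simp: finite_roots)
qed

end

section \<open>Dual bases under moves, and the height of a dual vector\<close>

lemma dual_to_linear: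
  assumes G: "dual_to G X" and inv: "\<And>v. T (T v) = v" and lin: "\<And>x. T (lincomb x X) = lincomb x (\<lambda>i. T (X i))"
    and adj: "\<And>g v. pairing (adj g) v = pairing g (T v)"
  shows "dual_to (\<lambda>l. adj (G l)) (\<lambda>i. T (X i))"
proof -
  have "lincomb (\<lambda>l. pairing (adj (G l)) v) (\<lambda>i. T (X i)) = v" for v
  proof -
    have "lincomb (\<lambda>l. pairing (adj (G l)) v) (\<lambda>i. T (X i)) = T (lincomb (\<lambda>l. pairing (G l) (T v)) X)"
      by (simp add: adj lin)
    also have "lincomb (\<lambda>l. pairing (G l) (T v)) X = T v"
      using G unfolding dual_to_def by blast
    finally show ?thesis by (simp add: inv)
  qed
  then show ?thesis
    using G by (simp add: dual_to_def adj inv)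
qed

definition dual :: "('n::finite \<Rightarrow> int^'n) \<Rightarrow> 'n \<Rightarrow> int^'n" where
  "dual X = (SOME G. dual_to G X)"

lemma dual_spec: "spans X \<Longrightarrow> dual_to (dual X) X"
  unfolding dual_def using dual_basis by (rule someI_ex)

lemma dual_eqI: "dual_to G X \<Longrightarrow> dual X = G"
  unfolding dual_def by (rule some_equality) (auto intro: dual_to_unique)

lemma spans_axis: "spans (\<lambda>i. axis i 1)"
  unfolding spans_def
proof
  fix v :: "int^'a"
  have "(\<Sum>l\<in>UNIV. v $ l * (axis l 1 :: int^'a) $ i) = (\<Sum>l\<in>UNIV. if l = i then v $ i else 0)" for i
    by (intro sum.cong) (auto simp: axis_def)
  then have "v = lincomb (\<lambda>l. v $ l) (\<lambda>i. axis i 1)"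
    by (simp add: vec_eq_iff lincomb_nth)
  then show "\<exists>x. v = lincomb x (\<lambda>i. axis i 1)" by blast
qed

context cartan begin

text \<open>Definiteness makes the Cartan matrix invertible. The solution is the Weyl vector in
  simple root coordinates: each simple reflection subtracts its simple root from it.\<close>

lemma rho_exists: "\<exists>r :: real^'n. \<forall>k. (\<Sum>j\<in>UNIV. of_int (A $ k $ j) * r $ j) = 1"
proof -
  define M :: "real^'n^'n" where "M = (\<chi> i j. of_int (A $ i $ j))"
  have "v = 0" if v: "M *v v = 0" for v
  proof (rule ccontr)
    assume "v \<noteq> 0"
    have "(\<Sum>i\<in>UNIV. \<Sum>j\<in>UNIV. d i * of_int (A $ i $ j) * v $ i * v $ j) = (\<Sum>i\<in>UNIV. d i * v $ i * (M *v v) $ i)"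
      by (simp add: matrix_vector_mult_def M_def sum_distrib_left mult_ac)
    then show False using posdef[OF \<open>v \<noteq> 0\<close>] v by simp
  qed
  then have "inj ((*v) M)"
    by (metis matrix_left_invertible_injective matrix_left_invertible_ker)
  then have "surj ((*v) M)"
    by (intro linear_injective_imp_surjective) auto
  then obtain r where "M *v r = (\<chi> i. 1)"
    by (metis surjD)
  then have "(M *v r) $ k = 1" for k by simp
  then show ?thesis
    by (intro exI[of _ r]) (simp add: matrix_vector_mult_def M_def)
qed

definition rho :: "real^'n" where
  "rho = (SOME r. \<forall>k. (\<Sum>j\<in>UNIV. of_int (A $ k $ j) * r $ j) = 1)"

lemma rho: "(\<Sum>j\<in>UNIV. of_int (A $ k $ j) * rho $ j) = 1"
  using someI_ex[OF rho_exists] unfolding rho_def by blast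

definition height :: "('n \<Rightarrow> int^'n) \<Rightarrow> 'n \<Rightarrow> real" where
  "height X l = (\<Sum>j\<in>UNIV. of_int (dual X l $ j) * rho $ j)"

definition adj_refl_at :: "'n \<Rightarrow> int^'n \<Rightarrow> int^'n" where
  "adj_refl_at k g = (\<chi> j. g $ j - A $ k $ j * g $ k)"

lemma pairing_adj_refl_at: "pairing (adj_refl_at k g) v = pairing g (refl_at k v)"
proof -
  have "pairing g (refl_at k v) = pairing g v - (\<Sum>j\<in>UNIV. A $ k $ j * v $ j) * g $ k"
    by (simp add: refl_at_def pairing_lin pairing_axis)
  then show ?thesis
    by (simp add: adj_refl_at_def pairing_def algebra_simps sum_subtractf sum_distrib_left)
qed

lemma pairing_adj_neg_at: "pairing (\<chi> j. if j = k then - g $ k else g $ j) v = pairing g (neg_at k v)"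
  unfolding pairing_def by (intro sum.cong refl) (simp add: neg_at_nth)

text \<open>Both branches of a move look alike from a dual vector. If the simple root is another
  member of the tuple, the \<open>k\<close>-coordinate is zero and nothing happens; otherwise
  \<open>row_sign\<close> gives the sign and the adjoint reflection applies.\<close>

lemma dual_step:
  assumes o: "orient E" and s: "is_source E k" and v: "valid E X" and ne: "X l \<noteq> axis k 1"
  shows "dual X l $ k \<le> 0" "dual (move k X) l = adj_refl_at k (dual X l)"
proof -
  have G: "dual_to (dual X) X"
    by (rule dual_spec[OF validD(2)[OF v]])
  have "dual X l $ k \<le> 0 \<and> dual (move k X) l = adj_refl_at k (dual X l)"
  proof (cases "\<exists>i. X i = axis k 1")
    case True
    then obtain i where i: "X i = axis k 1" by blast
    then have "pairing (dual X l) (X i) = 0"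
      using G ne unfolding dual_to_def by metis
    then have z: "dual X l $ k = 0"
      by (simp add: i pairing_axis)
    have "dual_to (\<lambda>l. \<chi> j. if j = k then - dual X l $ k else dual X l $ j) (\<lambda>i. neg_at k (X i))"
      by (rule dual_to_linear[OF G]) (simp_all add: neg_at_lincomb pairing_adj_neg_at)
    then have "dual (move k X) l = (\<chi> j. if j = k then - dual X l $ k else dual X l $ j)"
      unfolding move_neg_at[of X i k, OF i] by (simp add: dual_eqI)
    also have "\<dots> = adj_refl_at k (dual X l)"
      using z by (simp add: vec_eq_iff adj_refl_at_def)
    finally show ?thesis using z by simp
  next
    case False
    have "axis k 1 = lincomb (\<lambda>l. pairing (dual X l) (axis k 1)) X"
      using G unfolding dual_to_def by metis
    from row_sign[OF o s v _ this, of l] have "dual X l $ k \<le> 0"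
      using False unfolding pairing_axis by blast
    moreover have "dual_to (\<lambda>l. adj_refl_at k (dual X l)) (\<lambda>i. refl_at k (X i))"
      by (rule dual_to_linear[OF G]) (simp_all add: refl_at_lincomb pairing_adj_refl_at)
    ultimately show ?thesis
      using False by (simp add: move_def dual_eqI)
  qed
  then show "dual X l $ k \<le> 0" "dual (move k X) l = adj_refl_at k (dual X l)" by simp_all
qed

text \<open>By the defining property of \<open>rho\<close> the change is minus one coordinate of the
  dual vector, hence nonnegative by \<open>dual_step\<close>.\<close>

lemma height_step:
  assumes "orient E" "is_source E k" "valid E X" "X l \<noteq> axis k 1"
  shows "height (move k X) l = height X l - of_int (dual X l $ k)"
proof -
  have "height (move k X) l = (\<Sum>j\<in>UNIV. of_int (dual X l $ j) * rho $ j
      - of_int (dual X l $ k) * (of_int (A $ k $ j) * rho $ j))"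
    unfolding height_def dual_step(2)[OF assms] by (simp add: adj_refl_at_def algebra_simps)
  also have "\<dots> = height X l - of_int (dual X l $ k) * (\<Sum>j\<in>UNIV. of_int (A $ k $ j) * rho $ j)"
    by (simp add: height_def sum_subtractf sum_distrib_left)
  finally show ?thesis by (simp add: rho)
qed

definition hits :: "('n \<times> 'n) set \<Rightarrow> ('n \<Rightarrow> int^'n) \<Rightarrow> 'n \<Rightarrow> bool" where
  "hits E X l \<longleftrightarrow> (\<exists>u k. admissible E u \<and> is_source (fold flipE u E) k \<and> fold move u X l = axis k 1)"

lemma hits_append:
  assumes "admissible E u" "hits (fold flipE u E) (fold move u X) l"
  shows "hits E X l"
proof -
  obtain w k where "admissible (fold flipE u E) w" "is_source (fold flipE w (fold flipE u E)) k"
    "fold move w (fold move u X) l = axis k 1"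
    using assms(2) unfolding hits_def by blast
  then show ?thesis
    unfolding hits_def using assms(1) by (intro exI[of _ "u @ w"] exI[of _ k]) (simp add: admissible_append)
qed

lemma hits_source: "is_source E k \<Longrightarrow> X l = axis k 1 \<Longrightarrow> hits E X l"
  unfolding hits_def by (intro exI[of _ "[]"] exI[of _ k]) simp

text \<open>Ancestors of \<open>k\<close> are treated as they become sources. While the dual vector
  vanishes at them it does not change, and the set of ancestors shrinks; a nonzero coordinate met on
  the way serves equally well.\<close>

lemma reach_source:
  assumes "orient E" "valid E X" "dual X l $ k \<noteq> 0"
  shows "hits E X l \<or> (\<exists>u k'. admissible E u \<and> is_source (fold flipE u E) k' \<and>
    dual (fold move u X) l = dual X l \<and> dual X l $ k' \<noteq> 0)"
  using assms
proof (induction "card (anc E k)" arbitrary: E X rule: less_induct)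
  case less
  note o = less.prems(1) and v = less.prems(2)
  show ?case
  proof (cases "is_source E k")
    case True
    then show ?thesis
      using less.prems by (intro disjI2 exI[of _ "[]"] exI[of _ k]) simp
  next
    case False
    then obtain j where j: "j \<in> anc E k" and s: "is_source E j"
      using anc_source[OF o] by blast
    have jk: "j \<noteq> k" using False s by blast
    consider "X l = axis j 1" | "X l \<noteq> axis j 1" "dual X l $ j \<noteq> 0" | "X l \<noteq> axis j 1" "dual X l $ j = 0"
      by blast
    then show ?thesis
    proof cases
      case 1
      then show ?thesis using hits_source[OF s] by blast
    next
      case 2
      then show ?thesis
        using s by (intro disjI2 exI[of _ "[]"] exI[of _ j]) simp
    next
      case 3
      have d: "dual (move j X) l = dual X l"
        using dual_step(2)[OF o s v 3(1)] 3(2) by (simp add: adj_refl_at_def vec_eq_iff)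
      have "anc (flipE j E) k \<subset> anc E k"
        using anc_flip[OF o s jk] j by blast
      then have "card (anc (flipE j E) k) < card (anc E k)"
        by (intro psubset_card_mono) simp_all
      then have IH: "hits (flipE j E) (move j X) l \<or> (\<exists>u k'. admissible (flipE j E) u \<and>
          is_source (fold flipE u (flipE j E)) k' \<and>
          dual (fold move u (move j X)) l = dual (move j X) l \<and> dual (move j X) l $ k' \<noteq> 0)"
        using less.hyps[of "flipE j E" "move j X"] orient_flipE[OF o] valid_move[OF o s v] less.prems(3) d by simp
      then show ?thesis
      proof
        assume "hits (flipE j E) (move j X) l"
        then show ?thesis using hits_append[of E "[j]" X l] s by simp
      next
        assume "\<exists>u k'. admissible (flipE j E) u \<and> is_source (fold flipE u (flipE j E)) k' \<and>
          dual (fold move u (move j X)) l = dual (move j X) l \<and> dual (move j X) l $ k' \<noteq> 0"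
        then obtain u k' where u: "admissible (flipE j E) u" "is_source (fold flipE u (flipE j E)) k'"
          "dual (fold move u (move j X)) l = dual X l" "dual X l $ k' \<noteq> 0"
          unfolding d by blast
        show ?thesis
          using u s by (intro disjI2 exI[of _ "j # u"] exI[of _ k']) simp
      qed
    qed
  qed
qed

lemma finite_root_tuples: "finite {X. \<forall>i. isroot i (X i)}"
proof -
  have "{X. \<forall>i. isroot i (X i)} \<subseteq> (UNIV \<rightarrow>\<^sub>E (\<Union>i. {x. isroot i x}))" by blast
  then show ?thesis
    by (rule finite_subset) (intro finite_PiE, auto simp: finite_roots)
qed

text \<open>Moving at sources, the pairing of the dual vector with the half sum of positive coroots never
  decreases, and it cannot stay constant while every vertex gets its turn as a source.\<close>

lemma hits_simple_root:
  assumes "orient E" "valid E X"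
  shows "hits E X l"
  using assms
\<comment> \<open>There are finitely many root tuples, so counting those of larger height bounds how
  often the height can grow.\<close>
proof (induction "card {Y. (\<forall>i. isroot i (Y i)) \<and> height Y l > height X l}" arbitrary: E X rule: less_induct)
  case less
  note o = less.prems(1) and v = less.prems(2)
  have "pairing (dual X l) (X l) = 1"
    using dual_spec[OF validD(2)[OF v]] by (simp add: dual_to_def)
  then have "\<exists>k. dual X l $ k \<noteq> 0"
    by (auto simp: pairing_def intro: ccontr)
  then obtain k where "dual X l $ k \<noteq> 0" by blast
  from reach_source[OF o v this] show ?case
  proof
    assume "\<exists>u k'. admissible E u \<and> is_source (fold flipE u E) k' \<and> dual (fold move u X) l = dual X l \<and> dual X l $ k' \<noteq> 0"
    then obtain u k' where u: "admissible E u" "is_source (fold flipE u E) k'" "dual (fold move u X) l = dual X l" "dual X l $ k' \<noteq> 0"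
      by blast
    define E' where "E' = fold flipE u E"
    define X' where "X' = fold move u X"
    have o': "orient E'" and v': "valid E' X'" and s': "is_source E' k'"
      using orient_fold[OF o] valid_moves[OF o u(1) v] u(2) by (auto simp: E'_def X'_def)
    show ?thesis
    proof (cases "X' l = axis k' 1")
      case True
      then show ?thesis
        using hits_append[OF u(1), of X l] hits_source[of E' k' X' l] s' by (simp add: E'_def X'_def)
    next
      case False
      have "dual X' l $ k' \<le> 0" by (rule dual_step(1)[OF o' s' v' False])
      then have "dual X' l $ k' < 0"
        using u(3,4) by (simp add: X'_def)
      then have "height (move k' X') l > height X' l"
        using height_step[OF o' s' v' False] by simp
      moreover have hX: "height X' l = height X l"
        using u(3) by (simp add: height_def X'_def)
      ultimately have gt: "height (move k' X') l > height X l" by simp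
      have vm: "valid (flipE k' E') (move k' X')" by (rule valid_move[OF o' s' v'])
      have "{Y. (\<forall>i. isroot i (Y i)) \<and> height Y l > height (move k' X') l}
          \<subset> {Y. (\<forall>i. isroot i (Y i)) \<and> height Y l > height X l}"
        using gt validD(1)[OF vm] by (intro psubsetI) auto
      moreover have "finite {Y. (\<forall>i. isroot i (Y i)) \<and> height Y l > height X l}"
        by (rule finite_subset[OF _ finite_root_tuples]) auto
      ultimately have "hits (flipE k' E') (move k' X') l"
        using less.hyps[OF psubset_card_mono orient_flipE[OF o'] vm] by blast
      then have "hits E' X' l"
        using hits_append[of E' "[k']" X' l] s' by simp
      then show ?thesis
        using hits_append[OF u(1), of X l] by (simp add: E'_def X'_def)
    qed
  qed
qed

text \<open>Sign coherence of c-vectors. The source sequence of \<open>hits_simple_root\<close>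
  leads to a mutation at a simple root, and \<open>move_mut_back\<close> carries validity back along
  it.\<close>

theorem valid_mut:
  assumes "orient E" "valid E X"
  shows "valid E (mut E l X)"
proof -
  obtain u k where u: "admissible E u" "is_source (fold flipE u E) k" "fold move u X l = axis k 1"
    using hits_simple_root[OF assms] unfolding hits_def by blast
  then show ?thesis
    using assms
  proof (induction u arbitrary: E X)
    case Nil
    then show ?case using valid_mut_source[of E k X l] by simp
  next
    case (Cons j u)
    then have s: "is_source E j" and o: "orient E" and v: "valid E X" by simp_all
    have "valid (flipE j E) (mut (flipE j E) l (move j X))"
      using Cons.IH[of "flipE j E" "move j X"] Cons.prems orient_flipE[OF o] valid_move[OF o s v] by simp
    then show ?case
      using move_mut_back[OF o s v] by blast
  qed
qed

lemma move_mut: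
  assumes o: "orient E" and s: "is_source E k" and v: "valid E X"
  shows "move k (mut E l X) = mut (flipE k E) l (move k X)"
  using move_mut_back[OF assms valid_mut[OF orient_flipE[OF o] valid_move[OF assms]]] by blast

lemma moves_mut:
  assumes "orient E" "admissible E u" "valid E X"
  shows "fold move u (mut E l X) = mut (fold flipE u E) l (fold move u X)"
  using assms
  by (induction u arbitrary: E X) (simp_all add: move_mut orient_flipE valid_move)

text \<open>The branch taken is visible in the result, namely in whether the negative simple root
  occurs, and both maps are involutions.\<close>

lemma move_inj:
  assumes o: "orient E" and s: "is_source E k" and X: "valid E X" and Y: "valid E Y" and eq: "move k X = move k Y"
  shows "X = Y"
proof -
  have ax: "(\<exists>i. Z i = axis k 1) \<longleftrightarrow> (\<exists>i. move k Z i = - axis k 1)" for Z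
    by (auto simp: move_def neg_at_eq_axis refl_at_eq_axis)
  have inv: "(if \<exists>i. move k Z i = - axis k 1 then (\<lambda>i. neg_at k (move k Z i)) else (\<lambda>i. refl_at k (move k Z i))) = Z" for Z
    unfolding ax[symmetric] by (simp add: move_def)
  show ?thesis
    using inv[of X, unfolded eq] inv[of Y] by (rule trans[OF HOL.sym])
qed

lemma moves_inj:
  assumes "orient E" "admissible E u" "valid E X" "valid E Y" "fold move u X = fold move u Y"
  shows "X = Y"
  using assms
proof (induction u arbitrary: E X Y)
  case (Cons k u)
  then have s: "is_source E k" and o: "orient E" and v: "valid E X" "valid E Y" by simp_all
  have "move k X = move k Y"
    using Cons.IH[of "flipE k E" "move k X" "move k Y"] Cons.prems orient_flipE[OF o] valid_move[OF o s] v by simp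
  then show ?case by (rule move_inj[OF o s v])
qed simp

lemma move_comp:
  assumes "bij p"
  shows "move k (\<lambda>i. X (p i)) = (\<lambda>i. move k X (p i))"
proof -
  have "(\<exists>i. X (p i) = axis k 1) \<longleftrightarrow> (\<exists>i. X i = axis k 1)"
    using assms by (metis bij_pointE)
  then show ?thesis by (simp add: move_def)
qed

lemma moves_comp: "bij p \<Longrightarrow> fold move u (\<lambda>i. X (p i)) = (\<lambda>i. fold move u X (p i))"
proof (induction u arbitrary: X)
  case (Cons k u)
  then show ?case using Cons.IH[OF Cons.prems, of "move k X"] by (simp add: move_comp)
qed simp

section \<open>The initial tuple and the mutation of exchange numbers\<close>

lemma euler_axis_axis: "euler E (axis i 1) (axis j 1) = coef E i j"
proof -
  have "euler E (axis i 1) (axis j 1) = (\<Sum>p\<in>UNIV. \<Sum>q\<in>UNIV. if q = j then (if p = i then coef E i j else 0) else 0)"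
    unfolding euler_def by (intro sum.cong refl) (auto simp: axis_def)
  then show ?thesis by simp
qed

lemma valid_initial:
  assumes "orient E"
  shows "valid E (\<lambda>i. axis i 1)"
proof -
  have "coef E i j \<le> 0" if "i \<noteq> j" for i j
    using that offdiag[OF that] d_pos[of i] by (simp add: coef_def mult_nonneg_nonpos)
  moreover have "\<not> negv (axis i 1 :: int^'n)" for i
    using root_not_both[OF isroot_axis posv_axis] .
  ultimately show ?thesis
    unfolding valid_def euler_axis_axis by (simp add: isroot_axis posv_axis spans_axis)
qed

lemma exch_initial:
  assumes o: "orient E"
  shows "exch E (\<lambda>i. axis i 1) i j = exchange_matrix A E $ i $ j"
proof -
  have "d i * of_int (exch E (\<lambda>i. axis i 1) i j) = coef E j i - coef E i j"
    using exch_valid[OF o valid_initial[OF o], of i j] by (simp add: skew_form_def euler_axis_axis)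
  also have "\<dots> = d i * of_int (exchange_matrix A E $ i $ j)"
  proof (cases "i = j")
    case True
    then have "(i, j) \<notin> E" "(j, i) \<notin> E" using orientD(1)[OF o] by auto
    then show ?thesis using True by (simp add: exchange_matrix_def)
  next
    case False
    then show ?thesis
      using orientD(2)[OF o, of i j] sym[of i j] by (auto simp: exchange_matrix_def coef_def)
  qed
  finally show ?thesis unfolding dk_cancel .
qed

text \<open>Skew-symmetrisability trades the twisted positive part in row \<open>l\<close> for one
  in column \<open>l\<close>. Matrix mutation and the recursion for g-vectors both rely on
  it.\<close>

lemma mult_skew:
  assumes o: "orient E" and v: "valid E X"
  shows "of_int (mult E X l i) * d l = d i * of_int (max 0 (if posv (X l) then - exch E X i l else exch E X i l))"
proof -
  let ?b = "exch E X"
  have sk: "d p * of_int (?b p q) = - (d q * of_int (?b q p))" for p q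
    unfolding exch_valid[OF o v] by (rule skew_form_swap)
  have m: "d l * max 0 (real_of_int c) = max 0 (d l * of_int c)" "d i * max 0 (real_of_int c) = max 0 (d i * of_int c)" for c
    using d_pos[of l] d_pos[of i] by (simp_all add: max_def mult_le_0_iff not_less order_antisym zero_le_mult_iff)
  show ?thesis
    using sk[of l i] m[of "?b l i"] m[of "- ?b l i"] m[of "?b i l"] m[of "- ?b i l"]
    by (simp add: mult_def mult.commute of_int_max)
qed

text \<open>Bilinearity of the skew form expands to the sign-dependent form of matrix mutation,
  which agrees with the symmetric rule for either sign of \<open>X l\<close>.\<close>

lemma exch_mut:
  assumes o: "orient E" and v: "valid E X"
  shows "exch E (mut E l X) i j = (if i = l \<or> j = l then - exch E X i j
    else exch E X i j + max 0 (exch E X i l) * max 0 (exch E X l j) - max 0 (- exch E X i l) * max 0 (- exch E X l j))"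
proof -
  let ?b = "exch E X"
  have b: "d p * of_int (?b p q) = skew_form E (X p) (X q)" for p q
    by (rule exch_valid[OF o v])
  have "d i * of_int (exch E (mut E l X) i j) = skew_form E (mut E l X i) (mut E l X j)"
    by (rule exch_valid[OF o valid_mut[OF o v]])
  also have "\<dots> = d i * of_int (if i = l \<or> j = l then - ?b i j
    else ?b i j + max 0 (?b i l) * max 0 (?b l j) - max 0 (- ?b i l) * max 0 (- ?b l j))"
  proof (cases "i = l \<or> j = l")
    case True
    then show ?thesis
      by (cases "i = l"; cases "j = l") (auto simp: mut_def skew_form_lin b)
  next
    case False
    then have "skew_form E (mut E l X i) (mut E l X j) = d i * of_int (?b i j)
        + of_int (mult E X l j) * (d i * of_int (?b i l)) + of_int (mult E X l i) * d l * of_int (?b l j)"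
      by (simp add: mut_def skew_form_lin b[symmetric] algebra_simps)
    also have "of_int (mult E X l i) * d l = d i * of_int (max 0 (if posv (X l) then - ?b i l else ?b i l))"
      by (rule mult_skew[OF o v])
    also have "d i * of_int (?b i j) + of_int (mult E X l j) * (d i * of_int (?b i l))
        + d i * of_int (max 0 (if posv (X l) then - ?b i l else ?b i l)) * of_int (?b l j)
      = d i * of_int (?b i j + mult E X l j * ?b i l + max 0 (if posv (X l) then - ?b i l else ?b i l) * ?b l j)"
      by (simp add: algebra_simps)
    also have "?b i j + mult E X l j * ?b i l + max 0 (if posv (X l) then - ?b i l else ?b i l) * ?b l j
      = ?b i j + max 0 (?b i l) * max 0 (?b l j) - max 0 (- ?b i l) * max 0 (- ?b l j)"
      by (auto simp: mult_def max_def)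
    finally show ?thesis using False by simp
  qed
  finally show ?thesis unfolding dk_cancel .
qed

section \<open>Valid tuples without negative members\<close>

lemma wf_orient: "orient E \<Longrightarrow> wf E"
  unfolding wf_eq_minimal
proof (intro allI impI)
  fix Q :: "'n set" and x assume o: "orient E" and "x \<in> Q"
  then have "Q \<noteq> {}" by auto
  from no_cycle[OF o this] show "\<exists>z\<in>Q. \<forall>y. (y, z) \<in> E \<longrightarrow> y \<notin> Q" by auto
qed

lemma euler_axis_right: "euler E x (axis k 1) = (\<Sum>i\<in>UNIV. coef E i k * of_int (x $ i))"
proof -
  have "euler E x (axis k 1) = (\<Sum>i\<in>UNIV. \<Sum>j\<in>UNIV. if j = k then coef E i k * of_int (x $ i) else 0)"
    unfolding euler_def by (intro sum.cong refl) (auto simp: axis_def)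
  then show ?thesis by simp
qed

text \<open>Induction along the orientation. At the predecessors the simple roots are present and
  isolated, so pairing with the simple root at \<open>k\<close> on the right again reads a
  coordinate on the vectors that matter. The negative part of the expansion of that simple root then
  has nonpositive length and vanishes; a nonnegative expansion forces a member supported at
  \<open>k\<close> alone.\<close>

lemma all_pos_simple:
  assumes o: "orient E" and v: "valid E X" and pos: "\<And>i. posv (X i)"
  shows "\<exists>l. X l = axis k 1 \<and> (\<forall>m. m \<noteq> l \<longrightarrow> X m $ k = 0)"
proof (induction k rule: wf_induct_rule[OF wf_orient[OF o]])
  case (1 k)
  have pos': "X m $ i \<ge> 0" for m i
    using pos by (simp add: posv_def)
  have pred: "X m $ i = 0" if "(i, k) \<in> E" "X m \<noteq> axis i 1" for i m
    using 1[OF that(1)] that(2) by metis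
  have euler_k: "euler E (X m) (axis k 1) = d k * of_int (X m $ k)"
    if "\<And>i. (i, k) \<in> E \<Longrightarrow> X m $ i = 0" for m
  proof -
    have "euler E (X m) (axis k 1) = (\<Sum>i\<in>UNIV. if i = k then d k * of_int (X m $ k) else 0)"
      unfolding euler_axis_right using that by (intro sum.cong) (auto simp: coef_def)
    then show ?thesis by simp
  qed
  define x where "x l = pairing (dual X l) (axis k 1)" for l
  have x: "axis k 1 = lincomb x X"
    using dual_spec[OF validD(2)[OF v]] unfolding dual_to_def x_def by metis
  have xpred: "x l = 0" if i: "(i, k) \<in> E" and l: "X l = axis i 1" for i l
  proof -
    have ik: "i \<noteq> k" using orientD(1)[OF o i] .
    have "X m $ i = 0" if "m \<noteq> l" for m
      using pred[OF i, of m] spans_inj(1)[OF validD(2)[OF v] that] l by simp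
    then have "(\<Sum>m\<in>UNIV. x m * X m $ i) = (\<Sum>m\<in>UNIV. if m = l then x l else 0)"
      using l by (intro sum.cong) (auto simp: axis_def)
    moreover have "(\<Sum>m\<in>UNIV. x m * X m $ i) = 0"
      unfolding lincomb_nth[symmetric] x[symmetric] using ik by (simp add: axis_def)
    ultimately show ?thesis by simp
  qed
  define y where "y l = max 0 (- x l)" for l
  have y0: "y l \<ge> 0" for l by (simp add: y_def)
  define V where "V = lincomb y X"
  have V: "euler E V z = (\<Sum>m\<in>UNIV. of_int (y m) * euler E (X m) z)" for z
    by (simp add: V_def lincomb_def euler_sum_left euler_lin)
  have ge: "euler E (X m) (axis k 1) \<ge> 0" if "y m > 0" for m
  proof -
    have "X m $ i = 0" if i: "(i, k) \<in> E" for i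
    proof -
      have "x m \<noteq> 0" using \<open>y m > 0\<close> by (auto simp: y_def)
      then show ?thesis using pred[OF i, of m] xpred[OF i, of m] by blast
    qed
    then show ?thesis
      using euler_k[of m] pos'[of m k] d_pos[of k] by simp
  qed
  have "0 \<le> euler E V (axis k 1)"
    unfolding V
  proof (intro sum_nonneg)
    fix m show "0 \<le> of_int (y m) * euler E (X m) (axis k 1)"
      using ge[of m] y0[of m] by (cases "y m = 0") simp_all
  qed
  also have "\<dots> \<le> - euler E V V"
  proof -
    have le: "euler E (X m) (axis k 1) \<le> - euler E (X m) V" if ym: "y m > 0" for m
    proof -
      have "euler E (X m) (axis k 1) = (\<Sum>l\<in>UNIV. of_int (x l) * euler E (X m) (X l))"
        by (simp add: x lincomb_def euler_sum_right euler_lin)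
      also have "\<dots> \<le> (\<Sum>l\<in>UNIV. - (of_int (y l) * euler E (X m) (X l)))"
      proof (rule sum_mono)
        fix l
        show "of_int (x l) * euler E (X m) (X l) \<le> - (of_int (y l) * euler E (X m) (X l))"
        proof (cases "x l \<le> 0")
          case True
          then show ?thesis by (simp add: y_def)
        next
          case False
          then have "l \<noteq> m" using ym by (auto simp: y_def)
          then have "euler E (X m) (X l) \<le> 0"
            using validD(4)[OF v, of m l] pos by auto
          then show ?thesis using False by (simp add: y_def mult_nonneg_nonpos)
        qed
      qed
      also have "\<dots> = - euler E (X m) V"
        by (simp add: V_def lincomb_def euler_sum_right euler_lin sum_negf)
      finally show ?thesis .
    qed
    show ?thesis
      unfolding V[of V] V[of "axis k 1"] sum_negf[symmetric]
    proof (rule sum_mono)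
      fix m
      show "of_int (y m) * euler E (X m) (axis k 1) \<le> - (of_int (y m) * euler E (X m) V)"
        using mult_left_mono[OF le[of m], of "of_int (y m)"] y0[of m] by (cases "y m = 0") simp_all
    qed
  qed
  finally have "V = 0"
    using euler_pos[OF o, of V] by linarith
  moreover have "lincomb (\<lambda>_. 0) X = 0"
    by (simp add: lincomb_def vec_eq_iff)
  ultimately have "y = (\<lambda>_. 0)"
    unfolding V_def using lincomb_inject[OF validD(2)[OF v]] by metis
  then have x0: "x l \<ge> 0" for l
  proof -
    have "y l = 0" using \<open>y = (\<lambda>_. 0)\<close> by simp
    then show ?thesis by (simp add: y_def max_def split: if_splits)
  qed
  have "\<exists>l. x l > 0"
  proof (rule ccontr)
    assume "\<not> ?thesis"
    then have "x = (\<lambda>_. 0)" using x0 by (simp add: fun_eq_iff order_antisym not_less)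
    then have "(axis k 1 :: int^'n) = 0" unfolding x by (simp add: lincomb_def vec_eq_iff)
    then show False by (simp add: axis_eq_0_iff)
  qed
  then obtain l where l: "x l > 0" by blast
  have "X l $ j = 0" if "j \<noteq> k" for j
  proof -
    have "(\<Sum>m\<in>UNIV. x m * X m $ j) = 0"
      unfolding lincomb_nth[symmetric] x[symmetric] using that by (simp add: axis_def)
    then have "\<forall>m\<in>UNIV. x m * X m $ j = 0"
      by (subst (asm) sum_nonneg_eq_0_iff) (auto simp: x0 pos')
    then show ?thesis using l by (metis UNIV_I less_irrefl mult_eq_0_iff)
  qed
  then have Xl: "X l = axis k 1"
    using root_multiple_axis[OF o validD(1)[OF v, of l], of k] pos[of l]
      root_not_both[OF isroot_axis[of k] posv_axis] by auto
  have "X m $ k = 0" if m: "m \<noteq> l" for m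
  proof (cases "\<exists>i. (i, k) \<in> E \<and> X m = axis i 1")
    case True
    then obtain i where "(i, k) \<in> E" "X m = axis i 1" by blast
    then show ?thesis using orientD(1)[OF o] by (auto simp: axis_def)
  next
    case False
    then have "d k * of_int (X m $ k) \<le> 0"
      using euler_k[of m] pred validD(4)[OF v m pos pos] Xl by auto
    then show ?thesis
      using pos'[of m k] d_pos[of k] by (simp add: mult_le_0_iff)
  qed
  then show ?case using Xl by blast
qed

lemma all_pos_permutation:
  assumes o: "orient E" and v: "valid E X" and pos: "\<And>i. posv (X i)"
  shows "\<exists>p. bij p \<and> (\<forall>l. X l = axis (p l) 1)"
proof -
  have "\<forall>k. \<exists>l. X l = axis k 1"
    using all_pos_simple[OF assms] by blast
  from choice[OF this] obtain L where L: "\<And>k. X (L k) = axis k 1" by blast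
  have "inj L"
  proof (rule injI)
    fix a b assume "L a = L b"
    then have "(axis a 1 :: int^'n) = axis b 1" using L by metis
    then show "a = b" by (simp add: axis_eq_axis)
  qed
  then have b: "bij L" by (simp add: bij_def finite_UNIV_inj_surj)
  then have "X l = axis (inv L l) 1" for l
    using L[of "inv L l"] by (simp add: bij_inv_eq_iff surj_f_inv_f bij_is_surj)
  then show ?thesis using b bij_imp_bij_inv by blast
qed

end

section \<open>Weights of Laurent polynomials\<close>

definition additive :: "('m::ab_group_add \<Rightarrow> real) \<Rightarrow> bool" where
  "additive w \<longleftrightarrow> (\<forall>a b. w (a + b) = w a + w b)"

lemma additive_add: "additive w \<Longrightarrow> w (a + b) = w a + w b"
  by (simp add: additive_def)

lemma additive_zero: "additive w \<Longrightarrow> w 0 = 0"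
  using additive_add[of w 0 0] by simp

abbreviation lkp :: "('a \<Rightarrow>\<^sub>0 'b::zero) \<Rightarrow> 'a \<Rightarrow> 'b" where "lkp \<equiv> Poly_Mapping.lookup"

abbreviation mono1 :: "'m \<Rightarrow> ('m \<Rightarrow>\<^sub>0 int)" where "mono1 m \<equiv> Poly_Mapping.single m 1"

lemma poly_expand: "P = (\<Sum>k\<in>Poly_Mapping.keys P. Poly_Mapping.single k (lkp P k))"
proof (rule poly_mapping_eqI)
  fix k
  have "lkp (\<Sum>k\<in>Poly_Mapping.keys P. Poly_Mapping.single k (lkp P k)) k =
     (\<Sum>j\<in>Poly_Mapping.keys P. if j = k then lkp P k else 0)"
    unfolding lookup_sum by (intro sum.cong) (auto simp: lookup_single)
  then show "lkp P k = lkp (\<Sum>k\<in>Poly_Mapping.keys P. Poly_Mapping.single k (lkp P k)) k"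
    by (auto simp: in_keys_iff)
qed

lemma lookup_times:
  fixes P Q :: "'m::ab_group_add \<Rightarrow>\<^sub>0 int"
  shows "lkp (P * Q) k = (\<Sum>a\<in>Poly_Mapping.keys P. \<Sum>b\<in>Poly_Mapping.keys Q. if a + b = k then lkp P a * lkp Q b else 0)"
proof -
  have "P * Q = (\<Sum>a\<in>Poly_Mapping.keys P. \<Sum>b\<in>Poly_Mapping.keys Q. Poly_Mapping.single (a + b) (lkp P a * lkp Q b))"
    by (subst poly_expand[of P], subst poly_expand[of Q]) (simp add: sum_product mult_single)
  then show ?thesis
    by (simp add: lookup_sum lookup_single when_def)
qed

lemma lookup_times_unique:
  fixes P Q :: "'m::ab_group_add \<Rightarrow>\<^sub>0 int"
  assumes "\<And>a b. a \<in> Poly_Mapping.keys P \<Longrightarrow> b \<in> Poly_Mapping.keys Q \<Longrightarrow> a + b = m + n \<Longrightarrow> a = m \<and> b = n"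
  shows "lkp (P * Q) (m + n) = lkp P m * lkp Q n"
proof -
  have "lkp (P * Q) (m + n) = (\<Sum>a\<in>Poly_Mapping.keys P. \<Sum>b\<in>Poly_Mapping.keys Q.
      if b = n then (if a = m then lkp P m * lkp Q n else 0) else 0)"
    unfolding lookup_times using assms by (intro sum.cong refl) auto
  also have "\<dots> = lkp P m * lkp Q n"
    by (cases "lkp Q n = 0") (auto simp: in_keys_iff)
  finally show ?thesis .
qed

definition maxw :: "('m \<Rightarrow> real) \<Rightarrow> ('m \<Rightarrow>\<^sub>0 int) \<Rightarrow> real" where
  "maxw w P = Max (w ` Poly_Mapping.keys P)"

lemma maxw_ge: "a \<in> Poly_Mapping.keys P \<Longrightarrow> w a \<le> maxw w P"
  unfolding maxw_def by (intro Max_ge) auto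

lemma maxw_attained:
  assumes "P \<noteq> 0"
  shows "\<exists>a\<in>Poly_Mapping.keys P. w a = maxw w P"
proof -
  have "maxw w P \<in> w ` Poly_Mapping.keys P"
    unfolding maxw_def using assms by (intro Max_in) auto
  then show ?thesis by auto
qed

lemma maxw_eqI:
  assumes "a \<in> Poly_Mapping.keys P" "w a = r" "\<And>b. b \<in> Poly_Mapping.keys P \<Longrightarrow> w b \<le> r"
  shows "maxw w P = r"
  unfolding maxw_def using assms by (intro Max_eqI) auto

lemma keys_timesE:
  fixes P Q :: "'m::ab_group_add \<Rightarrow>\<^sub>0 int"
  assumes "k \<in> Poly_Mapping.keys (P * Q)"
  obtains a b where "a \<in> Poly_Mapping.keys P" "b \<in> Poly_Mapping.keys Q" "k = a + b"
  using keys_mult[of P Q] assms by blast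

text \<open>Ties between monomials of maximal weight are broken by the order on exponents.\<close>

lemma maxw_mult:
  fixes P Q :: "('v::linorder \<Rightarrow>\<^sub>0 int) \<Rightarrow>\<^sub>0 int"
  assumes w: "additive w" and "P \<noteq> 0" "Q \<noteq> 0"
  shows "maxw w (P * Q) = maxw w P + maxw w Q"
proof -
  define T where "T R = {a \<in> Poly_Mapping.keys R. w a = maxw w R}" for R
  have T: "finite (T R)" "T R \<noteq> {}" if "R \<noteq> 0" for R
    using maxw_attained[OF that, of w] by (auto simp: T_def)
  define m n where "m = Max (T P)" and "n = Max (T Q)"
  have m: "m \<in> T P" and n: "n \<in> T Q"
    using Max_in[OF T[OF assms(2)]] Max_in[OF T[OF assms(3)]] by (auto simp: m_def n_def)
  have "a = m \<and> b = n" if ab: "a \<in> Poly_Mapping.keys P" "b \<in> Poly_Mapping.keys Q" "a + b = m + n" for a b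
  proof -
    have le: "w a \<le> maxw w P" "w b \<le> maxw w Q" using ab by (auto intro: maxw_ge)
    have "w a + w b = maxw w P + maxw w Q"
      using m n arg_cong[OF ab(3), of w] by (simp add: T_def additive_add[OF w])
    then have "a \<in> T P" "b \<in> T Q" using le ab by (auto simp: T_def)
    then have "a \<le> m" "b \<le> n"
      using T[OF assms(2)] T[OF assms(3)] by (auto simp: m_def n_def)
    then show ?thesis using ab(3)
      by (metis add_le_cancel_left add_le_cancel_right order_antisym)
  qed
  then have "lkp (P * Q) (m + n) = lkp P m * lkp Q n"
    by (rule lookup_times_unique)
  then have k: "m + n \<in> Poly_Mapping.keys (P * Q)"
    using m n by (simp add: T_def in_keys_iff)
  show ?thesis
  proof (rule maxw_eqI[OF k])
    show "w (m + n) = maxw w P + maxw w Q"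
      using m n by (simp add: T_def additive_add[OF w])
    fix c assume "c \<in> Poly_Mapping.keys (P * Q)"
    then obtain a b where "a \<in> Poly_Mapping.keys P" "b \<in> Poly_Mapping.keys Q" "c = a + b"
      by (rule keys_timesE)
    then show "w c \<le> maxw w P + maxw w Q"
      using maxw_ge[of a P w] maxw_ge[of b Q w] by (simp add: additive_add[OF w])
  qed
qed

lemma maxw_single: "c \<noteq> 0 \<Longrightarrow> maxw w (Poly_Mapping.single m c) = w m"
  by (simp add: maxw_def)

text \<open>Coefficient one together with strict maximality makes the notion stable under products,
  quotients and the addition of lower terms.\<close>

definition lead :: "('m \<Rightarrow> real) \<Rightarrow> ('m \<Rightarrow>\<^sub>0 int) \<Rightarrow> 'm \<Rightarrow> bool" where
  "lead w P m \<longleftrightarrow> lkp P m = 1 \<and> (\<forall>a\<in>Poly_Mapping.keys P. a \<noteq> m \<longrightarrow> w a < w m)"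

lemma lead_keys: "lead w P m \<Longrightarrow> m \<in> Poly_Mapping.keys P"
  by (simp add: lead_def in_keys_iff)

lemma lead_le: "lead w P m \<Longrightarrow> a \<in> Poly_Mapping.keys P \<Longrightarrow> w a \<le> w m"
  unfolding lead_def by (cases "a = m") auto

lemma lead_maxw: "lead w P m \<Longrightarrow> maxw w P = w m"
  by (rule maxw_eqI) (auto intro: lead_keys lead_le)

lemma lead_single: "lead w (mono1 m) m"
  by (simp add: lead_def)

lemma lead_mult:
  fixes P Q :: "'m::ab_group_add \<Rightarrow>\<^sub>0 int"
  assumes w: "additive w" and P: "lead w P m" and Q: "lead w Q n"
  shows "lead w (P * Q) (m + n)"
proof -
  have u: "a = m \<and> b = n" if "a \<in> Poly_Mapping.keys P" "b \<in> Poly_Mapping.keys Q" "w m + w n \<le> w (a + b)" for a b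
    using that P Q unfolding lead_def additive_add[OF w] by (smt (verit))
  have "lkp (P * Q) (m + n) = lkp P m * lkp Q n"
  proof (rule lookup_times_unique)
    fix a b assume ab: "a \<in> Poly_Mapping.keys P" "b \<in> Poly_Mapping.keys Q" "a + b = m + n"
    show "a = m \<and> b = n"
      using u[OF ab(1,2)] unfolding ab(3) additive_add[OF w] by simp
  qed
  moreover have "w c < w (m + n)" if c: "c \<in> Poly_Mapping.keys (P * Q)" "c \<noteq> m + n" for c
  proof -
    obtain a b where ab: "a \<in> Poly_Mapping.keys P" "b \<in> Poly_Mapping.keys Q" "c = a + b"
      using c(1) by (rule keys_timesE)
    then show ?thesis using u[OF ab(1,2)] c(2) by (fastforce simp: additive_add[OF w])
  qed
  ultimately show ?thesis
    using P Q by (simp add: lead_def)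
qed

text \<open>A monomial of maximal weight in \<open>Q\<close>, shifted by \<open>m\<close>, cannot
  cancel in the product, so it must be the leading monomial there. This makes it unique and gives it
  coefficient one.\<close>

lemma lead_div:
  fixes P Q :: "('v::linorder \<Rightarrow>\<^sub>0 int) \<Rightarrow>\<^sub>0 int"
  assumes w: "additive w" and PQ: "lead w (P * Q) k" and P: "lead w P m"
  shows "lead w Q (k - m)"
proof -
  have "P * Q \<noteq> 0" using lead_keys[OF PQ] by auto
  then have "P \<noteq> 0" "Q \<noteq> 0" by auto
  have k: "w k = w m + maxw w Q"
    using maxw_mult[OF w \<open>P \<noteq> 0\<close> \<open>Q \<noteq> 0\<close>] lead_maxw[OF PQ] lead_maxw[OF P] by simp
  have top: "b = k - m \<and> lkp Q b = 1" if b: "b \<in> Poly_Mapping.keys Q" "w b = maxw w Q" for b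
  proof -
    have "lkp (P * Q) (m + b) = lkp P m * lkp Q b"
    proof (rule lookup_times_unique)
      fix a c assume ac: "a \<in> Poly_Mapping.keys P" "c \<in> Poly_Mapping.keys Q" "a + c = m + b"
      have "w a + w c = w m + w b"
        using arg_cong[OF ac(3), of w] by (simp add: additive_add[OF w])
      then have "w a = w m"
        using lead_le[OF P ac(1)] maxw_ge[OF ac(2), of w] b(2) by linarith
      then have "a = m" using P ac(1) unfolding lead_def by force
      then show "a = m \<and> c = b" using ac(3) by simp
    qed
    then have l: "lkp (P * Q) (m + b) = lkp Q b"
      using P by (simp add: lead_def)
    then have "m + b \<in> Poly_Mapping.keys (P * Q)"
      using b(1) by (simp add: in_keys_iff)
    moreover have "\<not> w (m + b) < w k"
      using k b(2) by (simp add: additive_add[OF w])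
    ultimately have "m + b = k" using PQ unfolding lead_def by blast
    then show ?thesis using l PQ unfolding lead_def by (auto simp: algebra_simps)
  qed
  obtain b where b: "b \<in> Poly_Mapping.keys Q" "w b = maxw w Q"
    using maxw_attained[OF \<open>Q \<noteq> 0\<close>] by blast
  have "w a < w b" if "a \<in> Poly_Mapping.keys Q" "a \<noteq> b" for a
    using top[OF b] top[OF that(1)] maxw_ge[OF that(1), of w] that(2) b(2) by force
  then show ?thesis
    using top[OF b] unfolding lead_def by blast
qed

lemma lead_add:
  assumes P: "lead w P m" and Q: "\<And>a. a \<in> Poly_Mapping.keys Q \<Longrightarrow> w a < w m"
  shows "lead w (P + Q) m"
proof -
  have "lkp Q m = 0" using Q[of m] by (auto simp: in_keys_iff)
  moreover have "w a < w m" if "a \<in> Poly_Mapping.keys (P + Q)" "a \<noteq> m" for a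
    using that keys_add[of P Q] P Q unfolding lead_def by blast
  ultimately show ?thesis
    using P by (simp add: lead_def lookup_add)
qed

lemma lead_prod:
  fixes P :: "'i \<Rightarrow> 'm::ab_group_add \<Rightarrow>\<^sub>0 int"
  assumes w: "additive w" and "\<And>i. i \<in> I \<Longrightarrow> lead w (P i) (m i)"
  shows "lead w (\<Prod>i\<in>I. P i) (\<Sum>i\<in>I. m i)"
  using assms(2)
proof (induction I rule: infinite_finite_induct)
  case (insert i I)
  then show ?case using lead_mult[OF w] by simp
qed (simp_all add: lead_def)

definition nonneg_coeffs :: "('m \<Rightarrow>\<^sub>0 int) \<Rightarrow> bool" where
  "nonneg_coeffs P \<longleftrightarrow> P \<noteq> 0 \<and> (\<forall>m. 0 \<le> lkp P m)"

lemma nonneg_coeffs_keys_add: "nonneg_coeffs P \<Longrightarrow> nonneg_coeffs Q \<Longrightarrow> Poly_Mapping.keys (P + Q) = Poly_Mapping.keys P \<union> Poly_Mapping.keys Q"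
  by (auto simp: in_keys_iff lookup_add nonneg_coeffs_def add_nonneg_eq_0_iff)

lemma nonneg_coeffs_add: "nonneg_coeffs P \<Longrightarrow> nonneg_coeffs Q \<Longrightarrow> nonneg_coeffs (P + Q)"
  using nonneg_coeffs_keys_add[of P Q] by (auto simp: nonneg_coeffs_def lookup_add simp flip: keys_eq_empty)

lemma nonneg_coeffs_mult:
  fixes P Q :: "('v::linorder \<Rightarrow>\<^sub>0 int) \<Rightarrow>\<^sub>0 int"
  shows "nonneg_coeffs P \<Longrightarrow> nonneg_coeffs Q \<Longrightarrow> nonneg_coeffs (P * Q)"
  unfolding nonneg_coeffs_def lookup_times by (auto intro!: sum_nonneg)

lemma maxw_add:
  assumes "nonneg_coeffs P" "nonneg_coeffs Q"
  shows "maxw w (P + Q) = max (maxw w P) (maxw w Q)"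
  unfolding maxw_def nonneg_coeffs_keys_add[OF assms] image_Un using assms
  by (intro Max_Un) (auto simp: nonneg_coeffs_def)

section \<open>Valuations of rational functions and subtraction-free elements\<close>

type_synonym 'v laurent_fract = "(('v \<Rightarrow>\<^sub>0 int) \<Rightarrow>\<^sub>0 int) fract"

text \<open>The maximal weight extends to quotients as a max-plus valuation; independence of the
  chosen fraction is \<open>maxw_mult\<close>.\<close>

definition val :: "(('v::linorder \<Rightarrow>\<^sub>0 int) \<Rightarrow> real) \<Rightarrow> 'v laurent_fract \<Rightarrow> real" where
  "val w f = (THE r. \<exists>a b. a \<noteq> 0 \<and> b \<noteq> 0 \<and> f = Fract a b \<and> r = maxw w a - maxw w b)"

lemma val_Fract:
  assumes w: "additive w" and "a \<noteq> 0" "b \<noteq> 0"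
  shows "val w (Fract a b) = maxw w a - maxw w b"
  unfolding val_def
proof (rule the_equality)
  show "\<exists>a' b'. a' \<noteq> 0 \<and> b' \<noteq> 0 \<and> Fract a b = Fract a' b' \<and> maxw w a - maxw w b = maxw w a' - maxw w b'"
    using assms by blast
  fix r assume "\<exists>a' b'. a' \<noteq> 0 \<and> b' \<noteq> 0 \<and> Fract a b = Fract a' b' \<and> r = maxw w a' - maxw w b'"
  then obtain a' b' where *: "a' \<noteq> 0" "b' \<noteq> 0" "Fract a b = Fract a' b'" "r = maxw w a' - maxw w b'" by blast
  then have "a * b' = a' * b" using assms by (simp add: eq_fract)
  then have "maxw w a + maxw w b' = maxw w a' + maxw w b"
    using maxw_mult[OF w] assms * by metis
  then show "r = maxw w a - maxw w b" using * by simp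
qed

lemma fract_nonzeroE:
  fixes f :: "'a::idom fract"
  assumes "f \<noteq> 0"
  obtains a b where "a \<noteq> 0" "b \<noteq> 0" "f = Fract a b"
proof (cases f)
  case (Fract a b)
  then show ?thesis using that[of a b] assms by (auto simp: Zero_fract_def eq_fract)
qed

lemma val_mult:
  assumes w: "additive w" and "f \<noteq> 0" "g \<noteq> 0"
  shows "val w (f * g) = val w f + val w g"
proof -
  obtain a b c e where "a \<noteq> 0" "b \<noteq> 0" "f = Fract a b" "c \<noteq> 0" "e \<noteq> 0" "g = Fract c e"
    using assms(2,3) fract_nonzeroE by metis
  then show ?thesis by (simp add: val_Fract[OF w] maxw_mult[OF w])
qed

lemma val_one: "additive w \<Longrightarrow> val w 1 = 0"
  by (simp add: One_fract_def val_Fract)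

lemma val_divide:
  assumes w: "additive w" and "f \<noteq> 0" "g \<noteq> 0"
  shows "val w (f / g) = val w f - val w g"
  using val_mult[OF w, of "f / g" g] assms by simp

lemma val_power: "additive w \<Longrightarrow> f \<noteq> 0 \<Longrightarrow> val w (f ^ n) = of_nat n * val w f"
  by (induction n) (auto simp: val_one val_mult algebra_simps)

lemma val_prod:
  assumes "additive w" "\<And>i. i \<in> I \<Longrightarrow> f i \<noteq> 0"
  shows "val w (prod f I) = (\<Sum>i\<in>I. val w (f i))"
  using assms(2)
  by (induction I rule: infinite_finite_induct) (auto simp: val_one[OF assms(1)] val_mult[OF assms(1)])

text \<open>The semifield of subtraction-free fractions. Sums in it do not cancel, so
  \<open>val\<close> sends them to maxima.\<close>

definition Pos :: "'v::linorder laurent_fract set" where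
  "Pos = {Fract a b | a b. nonneg_coeffs a \<and> nonneg_coeffs b}"

lemma Pos_nonzero: "f \<in> Pos \<Longrightarrow> f \<noteq> 0"
  by (auto simp: Pos_def nonneg_coeffs_def Zero_fract_def eq_fract)

lemma Pos_mult: "f \<in> Pos \<Longrightarrow> g \<in> Pos \<Longrightarrow> f * g \<in> Pos"
  unfolding Pos_def by (auto, metis mult_fract nonneg_coeffs_mult)

lemma Pos_divide: "f \<in> Pos \<Longrightarrow> g \<in> Pos \<Longrightarrow> f / g \<in> Pos"
  unfolding Pos_def by (auto, metis divide_fract nonneg_coeffs_mult)

lemma Pos_add: "f \<in> Pos \<Longrightarrow> g \<in> Pos \<Longrightarrow> f + g \<in> Pos"
proof -
  assume "f \<in> Pos" "g \<in> Pos"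
  then obtain a b c e where *: "nonneg_coeffs a" "nonneg_coeffs b" "nonneg_coeffs c" "nonneg_coeffs e" "f = Fract a b" "g = Fract c e"
    by (auto simp: Pos_def)
  then have "f + g = Fract (a * e + c * b) (b * e)" by (simp add: nonneg_coeffs_def)
  then show ?thesis using * unfolding Pos_def by (blast intro: nonneg_coeffs_add nonneg_coeffs_mult)
qed

lemma nonneg_coeffs_one: "nonneg_coeffs 1"
  by (simp add: nonneg_coeffs_def lookup_one when_def)

lemma Pos_one: "1 \<in> Pos"
  unfolding Pos_def One_fract_def using nonneg_coeffs_one by blast

lemma Pos_power: "f \<in> Pos \<Longrightarrow> f ^ n \<in> Pos"
  by (induction n) (auto intro: Pos_one Pos_mult)

lemma Pos_prod: "(\<And>i. i \<in> I \<Longrightarrow> f i \<in> Pos) \<Longrightarrow> prod f I \<in> Pos"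
  by (induction I rule: infinite_finite_induct) (auto intro: Pos_one Pos_mult)

lemma val_add:
  assumes w: "additive w" and "f \<in> Pos" "g \<in> Pos"
  shows "val w (f + g) = max (val w f) (val w g)"
proof -
  obtain a b c e where *: "nonneg_coeffs a" "nonneg_coeffs b" "nonneg_coeffs c" "nonneg_coeffs e" "f = Fract a b" "g = Fract c e"
    using assms by (auto simp: Pos_def)
  then have nz: "a \<noteq> 0" "b \<noteq> 0" "c \<noteq> 0" "e \<noteq> 0" by (auto simp: nonneg_coeffs_def)
  have "f + g = Fract (a * e + c * b) (b * e)" using * nz by simp
  moreover have "nonneg_coeffs (a * e)" "nonneg_coeffs (c * b)" "nonneg_coeffs (a * e + c * b)"
    using * by (auto intro: nonneg_coeffs_mult nonneg_coeffs_add)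
  ultimately show ?thesis
    using * nz by (simp add: val_Fract[OF w] maxw_add maxw_mult[OF w] nonneg_coeffs_def)
qed

definition emb :: "(('v::linorder \<Rightarrow>\<^sub>0 int) \<Rightarrow>\<^sub>0 int) \<Rightarrow> 'v laurent_fract" where
  "emb L = Fract L 1"

lemma emb_inject [simp]: "emb L = emb M \<longleftrightarrow> L = M"
  by (simp add: emb_def eq_fract)

lemma emb_add: "emb (L + M) = emb L + emb M"
  and emb_mult: "emb (L * M) = emb L * emb M"
  and emb_zero: "emb 0 = 0"
  and emb_one: "emb 1 = 1"
  by (simp_all add: emb_def Zero_fract_def One_fract_def)

lemma emb_power: "emb (L ^ n) = emb L ^ n"
  by (induction n) (simp_all add: emb_one emb_mult)

lemma emb_prod: "emb (prod f I) = (\<Prod>i\<in>I. emb (f i))"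
  by (induction I rule: infinite_finite_induct) (simp_all add: emb_one emb_mult)

lemma val_emb: "additive w \<Longrightarrow> L \<noteq> 0 \<Longrightarrow> val w (emb L) = maxw w L"
  by (simp add: emb_def val_Fract maxw_def)  (simp add: additive_zero)

lemma emb_Pos: "nonneg_coeffs L \<Longrightarrow> emb L \<in> Pos"
  unfolding emb_def Pos_def using nonneg_coeffs_one by blast

lemma laurent_expansion_emb: "laurent_expansion (emb L) = L"
  unfolding laurent_expansion_def emb_def[symmetric] by simp

section \<open>Ring homomorphisms from Laurent polynomials\<close>

definition hom_ext :: "(('v \<Rightarrow>\<^sub>0 int) \<Rightarrow> 'r::comm_ring_1) \<Rightarrow> 'v laurent \<Rightarrow> 'r" where
  "hom_ext f L = (\<Sum>m\<in>Poly_Mapping.keys L. of_int (lkp L m) * f m)"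

definition character :: "(('v \<Rightarrow>\<^sub>0 int) \<Rightarrow> 'r::comm_ring_1) \<Rightarrow> bool" where
  "character f \<longleftrightarrow> f 0 = 1 \<and> (\<forall>a b. f (a + b) = f a * f b)"

lemma hom_ext_superset:
  assumes "finite S" "Poly_Mapping.keys L \<subseteq> S"
  shows "hom_ext f L = (\<Sum>m\<in>S. of_int (lkp L m) * f m)"
  unfolding hom_ext_def using assms by (intro sum.mono_neutral_left) (auto simp: in_keys_iff)

lemma hom_ext_add: "hom_ext f (L + M) = hom_ext f L + hom_ext f M"
proof -
  let ?S = "Poly_Mapping.keys L \<union> Poly_Mapping.keys M"
  have "hom_ext f (L + M) = (\<Sum>m\<in>?S. of_int (lkp (L + M) m) * f m)"
    by (rule hom_ext_superset) (auto dest: subsetD[OF keys_add])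
  also have "\<dots> = (\<Sum>m\<in>?S. of_int (lkp L m) * f m) + (\<Sum>m\<in>?S. of_int (lkp M m) * f m)"
    by (simp add: lookup_add algebra_simps sum.distrib)
  also have "\<dots> = hom_ext f L + hom_ext f M"
    by (simp add: hom_ext_superset[of ?S])
  finally show ?thesis .
qed

lemma hom_ext_zero [simp]: "hom_ext f 0 = 0"
  by (simp add: hom_ext_def)

lemma hom_ext_sum: "hom_ext f (sum F I) = (\<Sum>i\<in>I. hom_ext f (F i))"
  by (induction I rule: infinite_finite_induct) (simp_all add: hom_ext_add)

lemma hom_ext_single: "hom_ext f (Poly_Mapping.single m c) = of_int c * f m"
  by (simp add: hom_ext_def)

lemma hom_ext_mult:
  assumes f: "character f"
  shows "hom_ext f (L * M) = hom_ext f L * hom_ext f M"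
proof -
  have "L * M = (\<Sum>a\<in>Poly_Mapping.keys L. \<Sum>b\<in>Poly_Mapping.keys M. Poly_Mapping.single (a + b) (lkp L a * lkp M b))"
    by (subst poly_expand[of L], subst poly_expand[of M]) (simp add: sum_product mult_single)
  then have "hom_ext f (L * M) = (\<Sum>a\<in>Poly_Mapping.keys L. \<Sum>b\<in>Poly_Mapping.keys M.
      (of_int (lkp L a) * f a) * (of_int (lkp M b) * f b))"
    using f by (simp add: hom_ext_sum hom_ext_single character_def mult_ac)
  then show ?thesis
    by (simp add: hom_ext_def sum_product)
qed

lemma hom_ext_one: "character f \<Longrightarrow> hom_ext f 1 = 1"
  by (simp add: hom_ext_single character_def flip: single_one)

lemma hom_ext_power: "character f \<Longrightarrow> hom_ext f (L ^ n) = hom_ext f L ^ n"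
  by (induction n) (simp_all add: hom_ext_one hom_ext_mult)

lemma hom_ext_prod: "character f \<Longrightarrow> hom_ext f (prod F I) = (\<Prod>i\<in>I. hom_ext f (F i))"
  by (induction I rule: infinite_finite_induct) (simp_all add: hom_ext_one hom_ext_mult)

text \<open>Setting a unimodular monomial to \<open>-1\<close>, realised as an endomorphism of the Laurent ring; its
  kernel is generated by the binomial \<open>1 + mono1 e\<close>, which is therefore prime.\<close>

definition at_minus_one :: "('v \<Rightarrow>\<^sub>0 int) \<Rightarrow> (('v \<Rightarrow>\<^sub>0 int) \<Rightarrow> int) \<Rightarrow> ('v \<Rightarrow>\<^sub>0 int) \<Rightarrow> 'v laurent" where
  "at_minus_one e g m = Poly_Mapping.single (m - frag_cmul (g m) e) (if even (g m) then 1 else - 1)"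

lemma character_at_minus_one:
  assumes "\<And>a b. g (a + b) = g a + g b"
  shows "character (at_minus_one e g)"
proof -
  have "g 0 = 0" using assms[of 0 0] by simp
  then show ?thesis
    unfolding character_def at_minus_one_def assms
    by (auto simp: mult_single frag_cmul_distrib algebra_simps)
qed

text \<open>Modulo \<open>1 + t\<close> one has \<open>t = - 1\<close>, so powers of
  \<open>t\<close> become signs.\<close>

lemma binomial_dvd_power: "(1 + mono1 e) dvd (mono1 (frag_cmul (int n) e) - (if even n then 1 else - 1) :: 'v laurent)"
proof (induction n)
  case (Suc n)
  have e: "frag_cmul (int (Suc n)) e = e + frag_cmul (int n) e"
    by (simp add: frag_cmul_distrib algebra_simps)
  have "mono1 (frag_cmul (int (Suc n)) e) - (if even (Suc n) then 1 else - 1) =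
     mono1 e * (mono1 (frag_cmul (int n) e) - (if even n then 1 else - 1)) + (if even n then 1 else - 1) * (1 + mono1 e)"
    unfolding e by (simp add: algebra_simps mult_single)
  then show ?case
    using Suc.IH by (metis dvd_add dvd_mult dvd_mult2 dvd_refl)
qed simp

lemma binomial_dvd_power_int: "(1 + mono1 e) dvd (mono1 (frag_cmul z e) - (if even z then 1 else - 1) :: 'v laurent)"
proof (cases "z \<ge> 0")
  case True
  then show ?thesis using binomial_dvd_power[of e "nat z"] by (simp add: even_nat_iff)
next
  case False
  define n where "n = nat (- z)"
  have z: "z = - int n" using False by (simp add: n_def)
  let ?s = "(if even n then 1 else - 1) :: 'v laurent"
  have "?s * ?s = 1" by simp
  moreover have "mono1 (frag_cmul z e) * mono1 (frag_cmul (int n) e) = (1 :: 'v laurent)"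
    using frag_cmul_distrib[of "- int n" "int n" e] by (simp add: mult_single z)
  ultimately have "mono1 (frag_cmul z e) - ?s = - ?s * mono1 (frag_cmul z e) * (mono1 (frag_cmul (int n) e) - ?s)"
    by (simp add: algebra_simps)
  then have "(1 + mono1 e) dvd (mono1 (frag_cmul z e) - ?s)"
    using binomial_dvd_power[of e n] by (metis dvd_mult)
  then show ?thesis by (simp add: z)
qed

text \<open>Modulo the binomial each monomial is congruent to its image, which gives the nontrivial
  direction.\<close>

lemma binomial_dvd_iff:
  assumes g: "\<And>a b. g (a + b) = g a + g b" and ge: "g e = 1"
  shows "(1 + mono1 e) dvd L \<longleftrightarrow> hom_ext (at_minus_one e g) L = 0"
proof
  note ch = character_at_minus_one[of g e, OF g]
  have "hom_ext (at_minus_one e g) (1 + mono1 e) = 0"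
    unfolding hom_ext_add hom_ext_one[OF ch] hom_ext_single by (simp add: at_minus_one_def ge single_uminus)
  then show "(1 + mono1 e) dvd L \<Longrightarrow> hom_ext (at_minus_one e g) L = 0"
    by (auto simp: dvd_def hom_ext_mult[OF ch])
  assume 0: "hom_ext (at_minus_one e g) L = 0"
  have "(1 + mono1 e) dvd (mono1 m - at_minus_one e g m)" for m
  proof -
    have "mono1 m = mono1 (m - frag_cmul (g m) e) * mono1 (frag_cmul (g m) e)"
      by (simp add: mult_single)
    then have "mono1 m - at_minus_one e g m = mono1 (m - frag_cmul (g m) e) *
        (mono1 (frag_cmul (g m) e) - (if even (g m) then 1 else - 1))"
      by (auto simp: at_minus_one_def algebra_simps single_uminus)
    then show ?thesis using binomial_dvd_power_int by (metis dvd_mult)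
  qed
  then have "(1 + mono1 e) dvd (\<Sum>m\<in>Poly_Mapping.keys L. of_int (lkp L m) * (mono1 m - at_minus_one e g m))"
    by (intro dvd_sum) (simp add: dvd_mult)
  also have "(\<Sum>m\<in>Poly_Mapping.keys L. of_int (lkp L m) * (mono1 m - at_minus_one e g m))
     = (\<Sum>m\<in>Poly_Mapping.keys L. of_int (lkp L m) * mono1 m) - hom_ext (at_minus_one e g) L"
    by (simp add: hom_ext_def algebra_simps sum_subtractf)
  also have "(\<Sum>m\<in>Poly_Mapping.keys L. of_int (lkp L m) * mono1 m) = L"
    by (subst (3) poly_expand[of L]) (simp add: mult_single flip: single_of_int)
  finally show "(1 + mono1 e) dvd L" using 0 by simp
qed

text \<open>The image of \<open>U\<close> is nonzero in an integral domain, so factors of the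
  binomial can be split off from \<open>L\<close> one at a time.\<close>

lemma binomial_power_dvd:
  fixes e :: "'v::linorder \<Rightarrow>\<^sub>0 int"
  assumes g: "\<And>a b. g (a + b) = g a + g b" and ge: "g e = 1"
    and U: "hom_ext (at_minus_one e g) U \<noteq> 0" and eq: "(1 + mono1 e) ^ a * M = L * U ^ n"
  shows "(1 + mono1 e) ^ a dvd L"
  using eq
proof (induction a arbitrary: L)
  case (Suc a)
  note ch = character_at_minus_one[of g e, OF g]
  have nz: "1 + mono1 e \<noteq> (0 :: 'v laurent)"
    using nonneg_coeffs_add[OF nonneg_coeffs_one, of "mono1 e"] by (auto simp: nonneg_coeffs_def lookup_single when_def)
  have "(1 + mono1 e) dvd L * U ^ n"
    unfolding Suc.prems[symmetric] by simp
  then have "hom_ext (at_minus_one e g) L * hom_ext (at_minus_one e g) U ^ n = 0"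
    unfolding binomial_dvd_iff[of g e, OF g ge] hom_ext_mult[OF ch] hom_ext_power[OF ch] .
  then have "hom_ext (at_minus_one e g) L = 0" using U by simp
  then obtain L' where L: "L = (1 + mono1 e) * L'"
    unfolding binomial_dvd_iff[of g e, OF g ge, symmetric] by blast
  have "(1 + mono1 e) * ((1 + mono1 e) ^ a * M) = (1 + mono1 e) * (L' * U ^ n)"
    using Suc.prems unfolding L by (simp add: mult_ac)
  then have "(1 + mono1 e) ^ a * M = L' * U ^ n"
    using nz by simp
  then show ?case using Suc.IH L by simp
qed simp

section \<open>Runs of seed mutations and the evaluation of Laurent expansions\<close>

lemma exchanged_variable_alt:
  "exchanged_variable k (x, b) = ((\<Prod>v\<in>UNIV. seed_element x v ^ nat (b $ v $ k)) +
     (\<Prod>v\<in>UNIV. seed_element x v ^ nat (- (b $ v $ k)))) / x k"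
proof -
  have "(\<Prod>v | b $ v $ k > 0. seed_element x v ^ nat (b $ v $ k)) = (\<Prod>v\<in>UNIV. seed_element x v ^ nat (b $ v $ k))"
    by (rule prod.mono_neutral_left) auto
  moreover have "(\<Prod>v | b $ v $ k < 0. seed_element x v ^ nat (- (b $ v $ k))) = (\<Prod>v\<in>UNIV. seed_element x v ^ nat (- (b $ v $ k)))"
    by (rule prod.mono_neutral_left) auto
  ultimately show ?thesis by (simp add: exchanged_variable_def)
qed

definition gvar :: "'n var \<Rightarrow> 'n var laurent" where
  "gvar v = mono1 (Poly_Mapping.single v 1)"

lemma gen_emb: "gen v = emb (gvar v)"
  by (simp add: gen_def emb_def gvar_def)

lemma nonneg_coeffs_single: "c > 0 \<Longrightarrow> nonneg_coeffs (Poly_Mapping.single m c)"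
  by (simp add: nonneg_coeffs_def lookup_single when_def flip: keys_eq_empty)

lemma gen_Pos: "gen v \<in> Pos"
  unfolding gen_emb gvar_def by (intro emb_Pos nonneg_coeffs_single) simp

lemma seed_element_Pos: "(\<And>i. x i \<in> Pos) \<Longrightarrow> seed_element x v \<in> Pos"
  by (cases v) (auto simp: seed_element_def gen_Pos)

lemma exchanged_Pos: "(\<And>i. x i \<in> Pos) \<Longrightarrow> exchanged_variable k (x, b) \<in> Pos"
  unfolding exchanged_variable_alt
  by (intro Pos_divide Pos_add Pos_prod Pos_power seed_element_Pos)

abbreviation run :: "'n list \<Rightarrow> 'n::{finite,linorder} seed \<Rightarrow> 'n seed" where
  "run v s \<equiv> fold seed_mutation v s"

lemma seed_mutation_pair:
  "seed_mutation k (x, b) = (x(k := exchanged_variable k (x, b)), matrix_mutation k b)"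
  by (simp add: seed_mutation_def)

lemma seed_mutation_Pos: "(\<And>i. fst s i \<in> Pos) \<Longrightarrow> fst (seed_mutation k s) i \<in> Pos"
  by (cases s) (auto simp: seed_mutation_def exchanged_Pos)

lemma run_Pos: "(\<And>i. fst s i \<in> Pos) \<Longrightarrow> fst (run v s) i \<in> Pos"
  by (induction v arbitrary: s i) (auto simp: seed_mutation_Pos)

lemma snd_run: "snd (run v s) = fold matrix_mutation v (snd s)"
  by (induction v arbitrary: s) (auto simp: seed_mutation_def)

lemma matrix_mutation_nth: "matrix_mutation k b $ v $ j = (if v = MutVar k \<or> j = k then - (b $ v $ j)
   else b $ v $ j + max 0 (b $ v $ k) * max 0 (b $ MutVar k $ j) - max 0 (- (b $ v $ k)) * max 0 (- (b $ MutVar k $ j)))"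
  by (simp add: matrix_mutation_def)

lemma matrix_mutation_involution:
  assumes "b $ MutVar k $ k = 0"
  shows "matrix_mutation k (matrix_mutation k b) = b"
  by (auto simp: vec_eq_iff matrix_mutation_nth assms)

lemma matrix_mutation_uminus: "matrix_mutation k (- b) = - matrix_mutation k b"
  by (auto simp: vec_eq_iff matrix_mutation_nth)

lemma exchanged_variable_uminus: "exchanged_variable k (x, - b) = exchanged_variable k (x, b)"
  by (simp add: exchanged_variable_alt add.commute)

lemma run_uminus: "fst (run v (x, - b)) = fst (run v (x, b))"
proof (induction v arbitrary: x b)
  case (Cons k v)
  have "seed_mutation k (x, - b) = (fst (seed_mutation k (x, b)), - snd (seed_mutation k (x, b)))"
    by (simp add: seed_mutation_def exchanged_variable_uminus matrix_mutation_uminus)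
  then show ?case by (simp add: Cons.IH)
qed simp

text \<open>The variable \<open>x k\<close> does not occur in its own exchange numerator, and
  negating the column swaps the two monomials, so the numerator is the same both times. Membership
  in \<open>Pos\<close> supplies nonzero denominators.\<close>

lemma seed_mutation_involution:
  assumes "b $ MutVar k $ k = 0" and x: "\<And>i. x i \<in> Pos"
  shows "seed_mutation k (seed_mutation k (x, b)) = (x, b)"
proof -
  define z where "z = exchanged_variable k (x, b)"
  have e: "seed_element (x(k := z)) v ^ nat c = seed_element x v ^ nat c" if "v = MutVar k \<Longrightarrow> c = 0" for v c
    using that by (cases v) (auto simp: seed_element_def)
  define N where "N = (\<Prod>v\<in>UNIV. seed_element x v ^ nat (b $ v $ k)) +
     (\<Prod>v\<in>UNIV. seed_element x v ^ nat (- (b $ v $ k)))"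
  have N: "N \<in> Pos"
    unfolding N_def by (intro Pos_add Pos_prod Pos_power seed_element_Pos x)
  have z: "z = N / x k"
    by (simp add: z_def exchanged_variable_alt N_def)
  have "(\<Prod>v\<in>UNIV. seed_element (x(k := z)) v ^ nat (b $ v $ k)) = (\<Prod>v\<in>UNIV. seed_element x v ^ nat (b $ v $ k))"
    "(\<Prod>v\<in>UNIV. seed_element (x(k := z)) v ^ nat (- (b $ v $ k))) = (\<Prod>v\<in>UNIV. seed_element x v ^ nat (- (b $ v $ k)))"
    using assms(1) by (auto intro!: prod.cong e)
  then have "exchanged_variable k (x(k := z), matrix_mutation k b) = N / z"
    by (simp add: exchanged_variable_alt matrix_mutation_nth N_def add.commute)
  also have "\<dots> = x k"
    using Pos_nonzero[OF N] Pos_nonzero[OF x[of k]] by (simp add: z)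
  finally show ?thesis
    by (simp add: seed_mutation_def z_def[symmetric] matrix_mutation_involution[OF assms(1)])
qed

definition evmon :: "('v::finite \<Rightarrow> 'k::field) \<Rightarrow> ('v \<Rightarrow>\<^sub>0 int) \<Rightarrow> 'k" where
  "evmon X m = (\<Prod>v\<in>UNIV. X v powi lkp m v)"

lemma character_evmon: "(\<And>v. X v \<noteq> 0) \<Longrightarrow> character (evmon X)"
  by (simp add: character_def evmon_def lookup_add power_int_add prod.distrib)

lemma hom_ext_gvar: "hom_ext (evmon X) (gvar v) = X v"
proof -
  have "evmon X (Poly_Mapping.single v 1) = (\<Prod>u\<in>UNIV. if u = v then X v else 1)"
    unfolding evmon_def by (intro prod.cong) (auto simp: lookup_single when_def)
  then show ?thesis by (simp add: gvar_def hom_ext_single)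
qed

abbreviation gens :: "'n::linorder \<Rightarrow> 'n ratfun" where "gens \<equiv> \<lambda>i. gen (MutVar i)"

definition laurent_word :: "'n::{finite,linorder} extended_matrix \<Rightarrow> 'n list \<Rightarrow> bool" where
  "laurent_word b v \<longleftrightarrow> (\<forall>i. fst (run v (gens, b)) i \<in> range emb)"

lemma emb_laurent_expansion: "f \<in> range emb \<Longrightarrow> emb (laurent_expansion f) = f"
  using laurent_expansion_emb by auto

text \<open>Exchange relations hold in the Laurent ring itself, hence survive evaluation at any cluster.\<close>

lemma run_evaluate:
  fixes X :: "'n::{finite,linorder} \<Rightarrow> 'n ratfun"
  assumes X: "\<And>i. X i \<in> Pos" and l: "\<And>u w. v = u @ w \<Longrightarrow> laurent_word b u"
  shows "fst (run v (X, b)) i = hom_ext (evmon (seed_element X)) (laurent_expansion (fst (run v (gens, b)) i))"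
  using l
proof (induction v arbitrary: i rule: rev_induct)
  case Nil
  show ?case by (simp add: gen_emb laurent_expansion_emb hom_ext_gvar seed_element_def)
next
  case (snoc k v)
  let ?H = "hom_ext (evmon (seed_element X))"
  have ch: "character (evmon (seed_element X))"
    by (intro character_evmon Pos_nonzero seed_element_Pos X)
  have IH: "fst (run v (X, b)) i = ?H (laurent_expansion (fst (run v (gens, b)) i))" for i
  proof (rule snoc.IH)
    fix u w assume "v = u @ w"
    then show "laurent_word b u" using snoc.prems[of u "w @ [k]"] by simp
  qed
  define L where "L i = laurent_expansion (fst (run v (gens, b)) i)" for i
  define L' where "L' = laurent_expansion (fst (run (v @ [k]) (gens, b)) k)"
  define c where "c = snd (run v (gens, b))"
  have c': "snd (run v (X, b)) = c" by (simp add: c_def snd_run)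
  have L: "fst (run v (gens, b)) i = emb (L i)" for i
    using snoc.prems[of v "[k]"] emb_laurent_expansion[of "fst (run v (gens, b)) i"]
    by (simp add: L_def laurent_word_def)
  have L': "fst (run (v @ [k]) (gens, b)) k = emb L'"
    using snoc.prems[of "v @ [k]" "[]"] emb_laurent_expansion[of "fst (run (v @ [k]) (gens, b)) k"]
    unfolding L'_def laurent_word_def by simp
  have runv: "run v (gens, b) = (\<lambda>i. emb (L i), c)" "run v (X, b) = (\<lambda>i. ?H (L i), c)"
    using L IH c' by (auto simp: prod_eq_iff c_def L_def)
  define S where "S u = (case u of MutVar i \<Rightarrow> L i | FrozVar i \<Rightarrow> gvar (FrozVar i))" for u
  have S: "seed_element (\<lambda>i. emb (L i)) u = emb (S u)" "seed_element (\<lambda>i. ?H (L i)) u = ?H (S u)" for u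
    by (cases u; simp add: S_def seed_element_def gen_emb hom_ext_gvar)+
  have nzL: "emb (L k) \<noteq> 0"
    using run_Pos[of "(gens, b)" v k] gen_Pos Pos_nonzero runv by fastforce
  have nzH: "?H (L k) \<noteq> 0"
    using run_Pos[of "(X, b)" v k] X Pos_nonzero runv by fastforce
  have "emb L' = ((\<Prod>u\<in>UNIV. emb (S u) ^ nat (c $ u $ k)) + (\<Prod>u\<in>UNIV. emb (S u) ^ nat (- (c $ u $ k)))) / emb (L k)"
    using L' by (simp add: runv seed_mutation_pair exchanged_variable_alt S)
  then have "emb (L' * L k) = emb ((\<Prod>u\<in>UNIV. S u ^ nat (c $ u $ k)) + (\<Prod>u\<in>UNIV. S u ^ nat (- (c $ u $ k))))"
    using nzL by (simp add: emb_add emb_mult emb_prod emb_power)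
  then have eq: "L' * L k = (\<Prod>u\<in>UNIV. S u ^ nat (c $ u $ k)) + (\<Prod>u\<in>UNIV. S u ^ nat (- (c $ u $ k)))"
    by simp
  have "?H L' * ?H (L k) = (\<Prod>u\<in>UNIV. ?H (S u) ^ nat (c $ u $ k)) + (\<Prod>u\<in>UNIV. ?H (S u) ^ nat (- (c $ u $ k)))"
    unfolding hom_ext_mult[OF ch, symmetric] eq
    by (simp add: hom_ext_add hom_ext_prod[OF ch] hom_ext_power[OF ch])
  then have "?H L' = exchanged_variable k (\<lambda>i. ?H (L i), c)"
    using nzH by (simp add: exchanged_variable_alt S eq_divide_eq)
  then show ?case
    using IH[of i] L'_def by (cases "i = k") (simp_all add: runv seed_mutation_pair laurent_expansion_emb L)
qed

section \<open>The Laurent phenomenon\<close>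

definition expvec :: "('v::finite \<Rightarrow> int) \<Rightarrow> 'v \<Rightarrow>\<^sub>0 int" where "expvec f = Abs_poly_mapping f"

lemma lkp_expvec [simp]: "lkp (expvec f) v = f v"
  by (simp add: expvec_def)

lemma expvec_eqI: "(\<And>v. lkp m v = f v) \<Longrightarrow> expvec f = m"
  by (rule poly_mapping_eqI) simp

lemma gvar_power: "gvar v ^ n = mono1 (frag_cmul (int n) (Poly_Mapping.single v 1))"
proof (induction n)
  case (Suc n)
  then show ?case by (simp add: gvar_def mult_single frag_cmul_distrib)
qed simp

lemma mono1_sum: "mono1 (sum f I) = (\<Prod>i\<in>I. mono1 (f i) :: 'v laurent)"
proof (induction I rule: infinite_finite_induct)
  case (insert i I)
  have "mono1 (f i + sum f I) = (mono1 (f i) * mono1 (sum f I) :: 'v laurent)"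
    by (simp add: mult_single)
  then show ?case using insert by simp
qed simp_all

lemma prod_gvar:
  fixes f :: "'n::finite var \<Rightarrow> nat"
  shows "(\<Prod>v\<in>UNIV. gvar v ^ f v) = mono1 (expvec (\<lambda>v. int (f v)))"
proof -
  have "(\<Sum>v\<in>UNIV. frag_cmul (int (f v)) (Poly_Mapping.single v 1)) = expvec (\<lambda>v. int (f v))"
  proof (rule poly_mapping_eqI)
    fix u
    have "lkp (\<Sum>v\<in>UNIV. frag_cmul (int (f v)) (Poly_Mapping.single v 1)) u = (\<Sum>v\<in>UNIV. if v = u then int (f u) else 0)"
      unfolding lookup_sum by (intro sum.cong) (auto simp: lookup_single when_def)
    then show "lkp (\<Sum>v\<in>UNIV. frag_cmul (int (f v)) (Poly_Mapping.single v 1)) u = lkp (expvec (\<lambda>v. int (f v))) u"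
      by simp
  qed
  then show ?thesis
    unfolding gvar_power mono1_sum[symmetric] by simp
qed

lemma prod_gvar_upd:
  fixes f :: "'n::finite var \<Rightarrow> nat"
  shows "(\<Prod>v\<in>UNIV. (gvar(w := z)) v ^ f v) = z ^ f w * mono1 (expvec (\<lambda>v. if v = w then 0 else int (f v)))"
proof -
  have "(\<Prod>v\<in>UNIV. (gvar(w := z)) v ^ f v) = z ^ f w * (\<Prod>v\<in>UNIV-{w}. gvar v ^ f v)"
    by (subst prod.remove[of UNIV w]) (auto intro!: prod.cong)
  also have "(\<Prod>v\<in>UNIV-{w}. gvar v ^ f v) = (\<Prod>v\<in>UNIV. gvar v ^ (if v = w then 0 else f v))"
    by (subst prod.remove[of UNIV w]) (auto intro!: prod.cong)
  also have "\<dots> = mono1 (expvec (\<lambda>v. if v = w then 0 else int (f v)))"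
    unfolding prod_gvar by (simp add: if_distrib cong: if_cong)
  finally show ?thesis .
qed

lemma prod_gvar_upd2:
  fixes f :: "'n::finite var \<Rightarrow> nat"
  assumes "w \<noteq> w'"
  shows "(\<Prod>v\<in>UNIV. (gvar(w := z, w' := z')) v ^ f v) =
    z ^ f w * z' ^ f w' * mono1 (expvec (\<lambda>v. if v = w \<or> v = w' then 0 else int (f v)))"
proof -
  have "(\<Prod>v\<in>UNIV. (gvar(w := z, w' := z')) v ^ f v) = z' ^ f w' * (\<Prod>v\<in>UNIV-{w'}. (gvar(w := z)) v ^ f v)"
    by (subst prod.remove[of UNIV w']) (auto intro!: prod.cong)
  also have "(\<Prod>v\<in>UNIV-{w'}. (gvar(w := z)) v ^ f v) = (\<Prod>v\<in>UNIV. (gvar(w := z)) v ^ (if v = w' then 0 else f v))"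
    by (rule prod.mono_neutral_cong_left) auto
  also have "\<dots> = z ^ f w * mono1 (expvec (\<lambda>v. if v = w \<or> v = w' then 0 else int (f v)))"
  proof -
    have "(\<lambda>v. if v = w then 0 else int (if v = w' then 0 else f v)) = (\<lambda>v. if v = w \<or> v = w' then 0 else int (f v))"
      by auto
    then show ?thesis unfolding prod_gvar_upd using assms by simp
  qed
  finally show ?thesis by (simp only: mult_ac)
qed

text \<open>Polymorphic, so that the numerator can be formed both in the Laurent ring and in the
  field, and compared by \<open>exch_num_emb\<close>.\<close>

definition exch_num :: "'n::finite \<Rightarrow> 'n extended_matrix \<Rightarrow> ('n var \<Rightarrow> 'r) \<Rightarrow> 'r::comm_semiring_1" where
  "exch_num k b y = (\<Prod>v\<in>UNIV. y v ^ nat (b $ v $ k)) + (\<Prod>v\<in>UNIV. y v ^ nat (- (b $ v $ k)))"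

lemma exchanged_exch_num: "exchanged_variable k (x, b) = exch_num k b (seed_element x) / x k"
  by (simp add: exchanged_variable_alt exch_num_def)

lemma exch_num_emb: "exch_num k b (\<lambda>v. emb (y v)) = emb (exch_num k b y)"
  by (simp add: exch_num_def emb_add emb_prod emb_power)

lemma exch_num_uminus: "exch_num k (- b) y = exch_num k b y"
  by (simp add: exch_num_def add.commute)

definition ginv :: "'n var \<Rightarrow> 'n var laurent" where
  "ginv v = mono1 (Poly_Mapping.single v (- 1))"

lemma ginv_gvar: "ginv v * gvar v = 1"
  by (simp add: ginv_def gvar_def mult_single flip: single_add)

lemma emb_ginv: "emb (ginv v) = 1 / gen v"
proof -
  have "emb (ginv v) * gen v = 1"
    by (simp add: gen_emb ginv_gvar emb_one flip: emb_mult)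
  then show ?thesis using Pos_nonzero[OF gen_Pos, of v] by (simp add: eq_divide_eq)
qed

text \<open>A monomial, hence a unit of the Laurent ring, times the binomial of column
  \<open>k\<close>.\<close>

lemma exch_num_gvar:
  fixes b :: "'n::finite extended_matrix"
  shows "exch_num k b gvar = mono1 (expvec (\<lambda>v. int (nat (- (b $ v $ k))))) * (1 + mono1 (expvec (\<lambda>v. b $ v $ k)))"
proof -
  have "expvec (\<lambda>v. int (nat (b $ v $ k))) = expvec (\<lambda>v. int (nat (- (b $ v $ k)))) + expvec (\<lambda>v. b $ v $ k)"
    by (rule expvec_eqI) (simp add: lookup_add)
  then show ?thesis
    by (simp add: exch_num_def prod_gvar algebra_simps mult_single)
qed

text \<open>Binomial expansion modulo the square of \<open>z\<close>. The linear term matters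
  because the third variable arises by a division by \<open>z\<close>.\<close>

lemma power_two_terms:
  fixes a t z :: "'a::comm_ring_1"
  shows "\<exists>r. (a + z * t) ^ c = a ^ c + z * (of_nat c * a ^ (c - 1) * t + z * r)"
proof (induction c)
  case 0
  show ?case by (rule exI[of _ 0]) simp
next
  case (Suc c)
  then obtain r where r: "(a + z * t) ^ c = a ^ c + z * (of_nat c * a ^ (c - 1) * t + z * r)" by blast
  have p: "of_nat c * a ^ (c - 1) * a = of_nat c * a ^ c"
    by (cases c) simp_all
  have "(a + z * t) ^ Suc c = a ^ Suc c + z * (a ^ c * t + (of_nat c * a ^ (c - 1) * a) * t
      + z * (a * r + t * (of_nat c * a ^ (c - 1) * t + z * r)))"
    unfolding power_Suc r by (simp add: algebra_simps)
  also have "\<dots> = a ^ Suc c + z * (of_nat (Suc c) * a ^ (Suc c - 1) * t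
      + z * (a * r + t * (of_nat c * a ^ (c - 1) * t + z * r)))"
    unfolding p by (simp add: algebra_simps)
  finally show ?case by blast
qed

lemma at_minus_one_nonzero: "at_minus_one e g m \<noteq> 0"
  by (simp add: at_minus_one_def flip: keys_eq_empty)

lemma hom_at_minus_one_mono: "hom_ext (at_minus_one e g) (mono1 m) \<noteq> 0"
  by (simp add: hom_ext_single at_minus_one_nonzero)

text \<open>The images of the two monomials still differ in the exponent of \<open>w\<close>, so
  they cannot cancel.\<close>

lemma hom_at_minus_one_two:
  assumes "lkp e w = 0" "lkp m w \<noteq> lkp n w"
  shows "hom_ext (at_minus_one e g) (mono1 m + of_nat c * mono1 n) \<noteq> 0"
proof -
  have "of_nat c * mono1 n = Poly_Mapping.single n (int c)"
    by (simp add: mult_single flip: single_of_nat)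
  then have eq: "hom_ext (at_minus_one e g) (mono1 m + of_nat c * mono1 n) =
      at_minus_one e g m + of_nat c * at_minus_one e g n"
    by (simp add: hom_ext_add hom_ext_single)
  have "lkp (m - frag_cmul (g m) e) w \<noteq> lkp (n - frag_cmul (g n) e) w"
    using assms by (simp add: lookup_minus)
  then have ne: "n - frag_cmul (g n) e \<noteq> m - frag_cmul (g m) e" by metis
  have "of_nat c * at_minus_one e g n = Poly_Mapping.single (n - frag_cmul (g n) e) (int c * (if even (g n) then 1 else - 1))"
    by (simp add: at_minus_one_def mult_single flip: single_of_nat)
  then have "lkp (at_minus_one e g m + of_nat c * at_minus_one e g n) (m - frag_cmul (g m) e) \<noteq> 0"
    using ne by (simp add: lookup_add at_minus_one_def lookup_single when_def)
  then show ?thesis unfolding eq by (metis lookup_zero)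
qed

lemma mono1_power: "(mono1 m :: 'v laurent) ^ n = mono1 (frag_cmul (int n) m)"
  by (induction n) (simp_all add: mult_single frag_cmul_distrib)

text \<open>\<open>z\<close> and \<open>U\<close> are the variables created by mutating at
  \<open>j\<close> and then at \<open>k\<close>, computed in the Laurent ring; mutating at
  \<open>j\<close> again gives the \<open>W\<close> obtained below. The functional \<open>g\<close>
  separates column \<open>j\<close> from column \<open>k\<close> and makes the binomial of column
  \<open>j\<close> prime.\<close>

context
  fixes b b1 b2 :: "'n::{finite,linorder} extended_matrix" and j k :: 'n
    and g :: "('n var \<Rightarrow>\<^sub>0 int) \<Rightarrow> int" and z U :: "'n var laurent"
  assumes jk: "j \<noteq> k" and bjj: "b $ MutVar j $ j = 0" and bkk: "b $ MutVar k $ k = 0"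
    and g: "\<And>m n. g (m + n) = g m + g n" and gj: "g (expvec (\<lambda>v. b $ v $ j)) = 1"
    and gk: "g (expvec (\<lambda>v. b $ v $ k)) = 0"
    and sgn: "b $ MutVar j $ k = 0 \<and> b $ MutVar k $ j = 0 \<or> b $ MutVar j $ k > 0 \<and> b $ MutVar k $ j < 0"
  defines "b1 \<equiv> matrix_mutation j b" and "b2 \<equiv> matrix_mutation k b1"
    and "z \<equiv> ginv (MutVar j) * exch_num j b gvar"
    and "U \<equiv> ginv (MutVar k) * exch_num k b1 (gvar(MutVar j := z))"
begin

text \<open>Modulo the binomial of column \<open>j\<close> the variable \<open>z\<close> vanishes,
  so only the lowest terms in \<open>z\<close> survive. \<open>U\<close> reduces to a monomial, or
  to a multiple of another binomial if the vertices are not joined; \<open>W\<close> reduces to a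
  monomial plus possibly the linear term of the expansion.\<close>

lemma three_step_aux:
  defines "\<phi> \<equiv> hom_ext (at_minus_one (expvec (\<lambda>v. b $ v $ j)) g)"
  shows "\<exists>W. W * z = exch_num j b2 (gvar(MutVar j := z, MutVar k := U)) \<and> \<phi> U \<noteq> 0 \<and> \<phi> W \<noteq> 0"
proof -
  let ?J = "MutVar j" and ?K = "MutVar k"
  define e where "e = expvec (\<lambda>v. b $ v $ j)"
  have JK: "?J \<noteq> ?K" using jk by simp
  note ch = character_at_minus_one[of g e, OF g]
  have \<phi>: "\<phi> (x * y) = \<phi> x * \<phi> y" "\<phi> (x + y) = \<phi> x + \<phi> y" "\<phi> (x ^ n) = \<phi> x ^ n" for x y n
    by (simp_all add: \<phi>_def hom_ext_mult[OF ch[unfolded e_def]] hom_ext_add hom_ext_power[OF ch[unfolded e_def]])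
  have \<phi>m: "\<phi> (mono1 m) \<noteq> 0" for m
    unfolding \<phi>_def by (rule hom_at_minus_one_mono)
  have \<phi>g: "\<phi> (ginv v) \<noteq> 0" for v unfolding ginv_def by (rule \<phi>m)
  have \<phi>e: "\<phi> (1 + mono1 e) = 0"
    unfolding \<phi>_def e_def using binomial_dvd_iff[of g "expvec (\<lambda>v. b $ v $ j)" "1 + mono1 (expvec (\<lambda>v. b $ v $ j))", OF g gj] by simp
  define neg where "neg = expvec (\<lambda>v. int (nat (- (b $ v $ j))))"
  have P: "exch_num j b gvar = mono1 neg * (1 + mono1 e)"
    unfolding exch_num_gvar neg_def e_def ..
  have z: "z = ginv ?J * mono1 neg * (1 + mono1 e)"
    by (simp add: z_def P mult_ac)
  have \<phi>z: "\<phi> z = 0"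
    unfolding z \<phi>(1) \<phi>e by simp
  have gz: "gvar ?J * z = mono1 neg * (1 + mono1 e)"
    unfolding z using ginv_gvar[of ?J] by (simp add: mult.assoc[symmetric] mult.commute[of "gvar ?J"])
  have b1: "b1 $ v $ j = - (b $ v $ j)" "b1 $ ?J $ l = - (b $ ?J $ l)" for v l
    by (simp_all add: b1_def matrix_mutation_nth)
  have b1kk: "b1 $ ?K $ k = 0"
    using jk bkk sgn by (auto simp: b1_def matrix_mutation_nth)
  have b2kj: "b2 $ ?K $ j = b $ ?K $ j" and b2jj: "b2 $ ?J $ j = 0"
    using jk sgn bjj by (auto simp: b2_def matrix_mutation_nth b1)
  have Unum: "exch_num k b1 (gvar(?J := z)) =
      z ^ nat (- (b $ ?J $ k)) * mono1 (expvec (\<lambda>v. if v = ?J then 0 else int (nat (b1 $ v $ k)))) +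
      z ^ nat (b $ ?J $ k) * mono1 (expvec (\<lambda>v. if v = ?J then 0 else int (nat (- (b1 $ v $ k)))))"
    unfolding exch_num_def prod_gvar_upd by (simp add: b1)
  define qp where "qp = expvec (\<lambda>v. if v = ?J \<or> v = ?K then 0 else int (nat (b2 $ v $ j)))"
  define qm where "qm = expvec (\<lambda>v. if v = ?J \<or> v = ?K then 0 else int (nat (- (b2 $ v $ j))))"
  have Wnum: "exch_num j b2 (gvar(?J := z, ?K := U)) =
      U ^ nat (b $ ?K $ j) * mono1 qp + U ^ nat (- (b $ ?K $ j)) * mono1 qm"
    unfolding exch_num_def prod_gvar_upd2[OF JK] qp_def qm_def by (simp add: b2jj b2kj)
  show ?thesis
    using sgn
  proof
    \<comment> \<open>For vertices that are not joined the two mutations commute, and the third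
      variable is the initial one at \<open>j\<close> again.\<close>
    assume s0: "b $ ?J $ k = 0 \<and> b $ ?K $ j = 0"
    have b1k: "b1 $ v $ k = b $ v $ k" if "v \<noteq> ?J" for v
      using that jk s0 by (simp add: b1_def matrix_mutation_nth)
    have b2j: "b2 $ v $ j = - (b $ v $ j)" for v
      using jk s0 by (cases "v = ?K") (auto simp: b2_def matrix_mutation_nth b1)
    have "exch_num k b1 (gvar(?J := z)) = exch_num k b gvar"
      unfolding Unum using s0
      by (simp add: exch_num_def prod_gvar b1k cong: if_cong)
         (intro arg_cong2[of _ _ _ _ "(+)"] arg_cong[of _ _ mono1] expvec_eqI; simp add: b1k s0)
    then have "U = ginv ?K * (mono1 (expvec (\<lambda>v. int (nat (- (b $ v $ k))))) * (1 + mono1 (expvec (\<lambda>v. b $ v $ k))))"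
      by (simp add: U_def exch_num_gvar)
    moreover have "\<phi> (1 + mono1 (expvec (\<lambda>v. b $ v $ k))) \<noteq> 0"
    proof -
      have "\<phi> (1 + mono1 (expvec (\<lambda>v. b $ v $ k))) = 1 + mono1 (expvec (\<lambda>v. b $ v $ k))"
        unfolding \<phi>_def hom_ext_add hom_ext_one[OF ch[unfolded e_def]] hom_ext_single
        by (simp add: at_minus_one_def gk)
      also have "\<dots> \<noteq> 0"
        using nonneg_coeffs_add[OF nonneg_coeffs_one nonneg_coeffs_single[of 1 "expvec (\<lambda>v. b $ v $ k)"]] unfolding nonneg_coeffs_def by simp
      finally show ?thesis .
    qed
    ultimately have U0: "\<phi> U \<noteq> 0"
      using \<phi>m \<phi>g by (simp add: \<phi>(1))
    have "expvec (\<lambda>v. if v = ?J \<or> v = ?K then 0 else int (nat (b2 $ v $ j))) = neg"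
      unfolding neg_def by (rule expvec_eqI) (auto simp: b2j s0 bjj)
    then have 1: "qp = neg" by (simp add: qp_def)
    have 2: "qm = neg + e"
      unfolding qm_def neg_def e_def by (rule expvec_eqI) (auto simp: lookup_add b2j s0 bjj)
    have "gvar ?J * z = exch_num j b2 (gvar(?J := z, ?K := U))"
      unfolding Wnum gz 1 2 using s0 by (simp add: algebra_simps mult_single)
    moreover have "\<phi> (gvar ?J) \<noteq> 0" unfolding gvar_def by (rule \<phi>m)
    ultimately show ?thesis using U0 by blast
  next
    assume s1: "b $ ?J $ k > 0 \<and> b $ ?K $ j < 0"
    define c where "c = nat (- (b $ ?K $ j))"
    define \<beta> where "\<beta> = nat (b $ ?J $ k)"
    have c: "int c = - (b $ ?K $ j)" "c > 0" and \<beta>: "\<beta> > 0" "int \<beta> = b $ ?J $ k"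
      using s1 by (auto simp: c_def \<beta>_def)
    define fp where "fp = expvec (\<lambda>v. if v = ?J then 0 else int (nat (b1 $ v $ k)))"
    define fm where "fm = expvec (\<lambda>v. if v = ?J then 0 else int (nat (- (b1 $ v $ k))))"
    have U: "U = ginv ?K * (mono1 fp + z * (z ^ (\<beta> - 1) * mono1 fm))"
    proof -
      have "z ^ \<beta> = z * z ^ (\<beta> - 1)" using \<beta>(1) by (metis power_eq_if less_irrefl)
      moreover have "nat (- (b $ ?J $ k)) = 0" using s1 by simp
      ultimately show ?thesis
        unfolding U_def Unum fp_def[symmetric] fm_def[symmetric] \<beta>_def[symmetric] by (simp add: mult_ac)
    qed
    define t where "t = z ^ (\<beta> - 1) * mono1 fm"
    obtain r where r: "(mono1 fp + z * t) ^ c = mono1 fp ^ c + z * (of_nat c * mono1 fp ^ (c - 1) * t + z * r)"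
      using power_two_terms[of "mono1 fp" z t c] by blast
    have "\<phi> U = \<phi> (ginv ?K) * \<phi> (mono1 fp)"
      unfolding U \<phi> \<phi>z by simp
    then have U0: "\<phi> U \<noteq> 0" using \<phi>m \<phi>g by simp
    have b2j: "b2 $ v $ j = - (b $ v $ j) + max 0 (b1 $ v $ k) * int c" if "v \<noteq> ?K" for v
      using that jk s1 c by (simp add: b2_def matrix_mutation_nth b1 max_def)
    define kc where "kc = Poly_Mapping.single ?K (- 1 :: int)"
    have gc: "ginv ?K ^ c = mono1 (frag_cmul (int c) kc)"
      by (simp add: ginv_def kc_def mono1_power)
    \<comment> \<open>This balance of exponents is the mutation rule for column \<open>j\<close>. It
      shows that, up to multiples of \<open>z\<close>, the numerator of \<open>W\<close> is a
      monomial times the same binomial, and so divisible by \<open>z\<close>.\<close>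
    have expo: "frag_cmul (int c) kc + frag_cmul (int c) fp + qm = qp + e"
    proof (rule poly_mapping_eqI)
      fix v
      consider "v = ?J" | "v = ?K" | "v \<noteq> ?J" "v \<noteq> ?K" by blast
      then show "lkp (frag_cmul (int c) kc + frag_cmul (int c) fp + qm) v = lkp (qp + e) v"
      proof cases
        case 1
        then show ?thesis
          using JK bjj by (simp add: lookup_add kc_def lookup_single when_def fp_def qm_def qp_def e_def)
      next
        case 2
        then show ?thesis
          using JK c b1kk by (simp add: lookup_add kc_def lookup_single when_def fp_def qm_def qp_def e_def)
      next
        case 3
        have "int (nat (- (b2 $ v $ j))) = int (nat (b2 $ v $ j)) - b2 $ v $ j" by simp
        then show ?thesis
          using 3 b2j[OF 3(2)] by (simp add: lookup_add kc_def lookup_single when_def fp_def qm_def qp_def e_def mult.commute)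
      qed
    qed
    define m1 where "m1 = qp - neg + Poly_Mapping.single ?J 1"
    define W where "W = mono1 m1 + ginv ?K ^ c * mono1 qm * (of_nat c * mono1 fp ^ (c - 1) * t + z * r)"
    have "ginv ?K ^ c * mono1 fp ^ c * mono1 qm = mono1 (qp + e)"
      unfolding gc mono1_power mult_single expo[symmetric] by simp
    moreover have "mono1 qp + mono1 (qp + e) = mono1 m1 * z"
    proof -
      have "mono1 m1 * z = mono1 (qp - neg) * (gvar ?J * z)"
        by (simp add: m1_def gvar_def mult_single flip: mult.assoc)
      also have "\<dots> = mono1 qp * (1 + mono1 e)"
        unfolding gz by (simp add: mult_single flip: mult.assoc)
      finally show ?thesis by (simp add: algebra_simps mult_single)
    qed
    moreover have "U ^ c = ginv ?K ^ c * (mono1 fp ^ c + z * (of_nat c * mono1 fp ^ (c - 1) * t + z * r))"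
      unfolding U t_def[symmetric] power_mult_distrib r ..
    moreover have "exch_num j b2 (gvar(?J := z, ?K := U)) = mono1 qp + U ^ c * mono1 qm"
      unfolding Wnum using s1 by (simp add: c_def)
    ultimately have W: "W * z = exch_num j b2 (gvar(?J := z, ?K := U))"
      by (simp add: W_def algebra_simps)
    have eJ: "lkp e ?J = 0" by (simp add: e_def bjj)
    have m1J: "lkp m1 ?J = 1"
      by (simp add: m1_def lookup_add lookup_minus qp_def neg_def bjj)
    have "\<phi> W \<noteq> 0"
    \<comment> \<open>Only for exponent one does the linear term survive modulo the binomial. It
      cannot cancel the first monomial, since the two have exponents \<open>0\<close> and
      \<open>1\<close> in the initial variable at \<open>j\<close>.\<close>
    proof (cases "\<beta> = 1")
      case True
      define m2 where "m2 = frag_cmul (int c) kc + qm + frag_cmul (int (c - 1)) fp + fm"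
      have "\<phi> W = \<phi> (mono1 m1 + of_nat c * mono1 m2)"
      proof -
        have "ginv ?K ^ c * mono1 qm * (of_nat c * mono1 fp ^ (c - 1) * t) = of_nat c * mono1 m2"
          unfolding t_def True gc mono1_power m2_def
          by (simp add: mult_single mult_ac flip: mult.assoc) (simp add: add_ac)
        then have "W = (mono1 m1 + of_nat c * mono1 m2) + z * (ginv ?K ^ c * mono1 qm * r)"
          by (simp add: W_def algebra_simps)
        then show ?thesis by (simp only: \<phi> \<phi>z mult_zero_left add_0_right)
      qed
      moreover have "lkp m2 ?J = 0"
        using JK by (simp add: m2_def lookup_add kc_def lookup_single when_def qm_def fp_def fm_def)
      ultimately show ?thesis
        using hom_at_minus_one_two[OF eJ, of m1 m2 g c] m1J by (simp add: \<phi>_def e_def)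
    next
      case False
      then obtain l where "\<beta> - 1 = Suc l" using \<beta>(1) by (metis Suc_diff_1 not0_implies_Suc One_nat_def)
      then have "\<phi> t = 0" by (simp add: t_def \<phi> \<phi>z)
      then have "\<phi> W = \<phi> (mono1 m1)"
        unfolding W_def by (simp add: \<phi> \<phi>z)
      then show ?thesis using \<phi>m by simp
    qed
    then show ?thesis using W U0 by blast
  qed
qed

text \<open>The last clause is coprimality in the form used for the induction: powers of the first
  exchange numerator pass through a product with powers of \<open>U * W\<close> to the other
  factor.\<close>

lemma three_step:
  "\<exists>W. fst (run [j] (gens, b)) = gens(j := emb z) \<and>
     fst (run [j, k] (gens, b)) = gens(j := emb z, k := emb U) \<and>
     fst (run [j, k, j] (gens, b)) = gens(j := emb W, k := emb U) \<and>
     (\<forall>L M a n. exch_num j b gvar ^ a * M = L * (U * W) ^ n \<longrightarrow> exch_num j b gvar ^ a dvd L)"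
proof -
  obtain W where W: "W * z = exch_num j b2 (gvar(MutVar j := z, MutVar k := U))"
    and U0: "hom_ext (at_minus_one (expvec (\<lambda>v. b $ v $ j)) g) U \<noteq> 0"
    and W0: "hom_ext (at_minus_one (expvec (\<lambda>v. b $ v $ j)) g) W \<noteq> 0"
    using three_step_aux by blast
  have g0: "seed_element gens = (\<lambda>v. emb (gvar v))"
    by (rule ext, case_tac v) (simp_all add: seed_element_def gen_emb)
  have 1: "seed_mutation j (gens, b) = (gens(j := emb z), b1)"
  proof -
    have "exchanged_variable j (gens, b) = emb z"
      unfolding exchanged_exch_num g0 exch_num_emb by (simp add: z_def emb_mult emb_ginv)
    then show ?thesis by (simp add: seed_mutation_pair b1_def)
  qed
  have g1: "seed_element (gens(j := emb z)) = (\<lambda>v. emb ((gvar(MutVar j := z)) v))"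
    by (rule ext, case_tac v) (simp_all add: seed_element_def gen_emb)
  have 2: "seed_mutation k (gens(j := emb z), b1) = (gens(j := emb z, k := emb U), b2)"
  proof -
    have "exchanged_variable k (gens(j := emb z), b1) = emb U"
    proof -
      have "exch_num k b1 (seed_element (gens(j := emb z))) = emb (exch_num k b1 (gvar(MutVar j := z)))"
        unfolding g1 by (rule exch_num_emb)
      then show ?thesis using jk by (simp add: exchanged_exch_num U_def emb_mult emb_ginv)
    qed
    then show ?thesis by (simp add: seed_mutation_pair b2_def)
  qed
  have g2: "seed_element (gens(j := emb z, k := emb U)) = (\<lambda>v. emb ((gvar(MutVar j := z, MutVar k := U)) v))"
    by (rule ext, case_tac v) (simp_all add: seed_element_def gen_emb)
  have "z \<noteq> 0"
  proof
    assume "z = 0"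
    have "fst (seed_mutation j (gens, b)) j \<in> Pos"
      by (rule seed_mutation_Pos) (simp add: gen_Pos)
    then show False using Pos_nonzero by (force simp: 1 \<open>z = 0\<close> emb_zero)
  qed
  then have "emb z \<noteq> 0" by (metis emb_inject emb_zero)
  have 3: "seed_mutation j (gens(j := emb z, k := emb U), b2) =
      (gens(j := emb W, k := emb U), matrix_mutation j b2)"
  proof -
    have "exchanged_variable j (gens(j := emb z, k := emb U), b2) = emb W"
      unfolding exchanged_exch_num g2 exch_num_emb W[symmetric] using jk \<open>emb z \<noteq> 0\<close> by (simp add: emb_mult)
    then show ?thesis using jk by (simp add: seed_mutation_pair fun_upd_twist)
  qed
  have "exch_num j b gvar ^ a dvd L" if eq: "exch_num j b gvar ^ a * M = L * (U * W) ^ n" for L M a n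
  proof -
    let ?e = "expvec (\<lambda>v. b $ v $ j)" and ?m = "expvec (\<lambda>v. int (nat (- (b $ v $ j))))"
    note ch = character_at_minus_one[of g ?e, OF g]
    have "(1 + mono1 ?e) ^ a * (mono1 ?m ^ a * M) = L * (U * W) ^ n"
      using eq by (simp add: exch_num_gvar power_mult_distrib mult_ac)
    then have "(1 + mono1 ?e) ^ a dvd L"
      by (intro binomial_power_dvd[of g ?e, OF g gj, of "U * W"]) (simp_all add: hom_ext_mult[OF ch] U0 W0)
    then obtain L' where "L = (1 + mono1 ?e) ^ a * L'" by (auto simp: dvd_def)
    moreover have "mono1 ?m * mono1 (- ?m) = (1 :: 'n var laurent)"
      by (simp add: mult_single)
    then have "(mono1 ?m * mono1 (- ?m)) ^ a = (1 :: 'n var laurent)" by simp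
    ultimately have "L = exch_num j b gvar ^ a * (mono1 (- ?m) ^ a * L')"
      by (simp add: exch_num_gvar power_mult_distrib mult_ac)
    then show ?thesis by simp
  qed
  then show ?thesis
    using 1 2 3 by (intro exI[of _ W]) simp
qed

end

text \<open>The localisation of the Laurent ring at the powers of \<open>D\<close>, as a subset of
  the fraction field.\<close>

definition frac_over :: "'v::linorder laurent \<Rightarrow> 'v laurent_fract set" where
  "frac_over D = {f. \<exists>a R. f * emb D ^ a = emb R}"

lemma frac_over_emb: "emb L \<in> frac_over D"
proof -
  have "emb L * emb D ^ 0 = emb L" by simp
  then show ?thesis unfolding frac_over_def by blast
qed

lemma frac_over_mult:
  assumes "f \<in> frac_over D" "g \<in> frac_over D"
  shows "f * g \<in> frac_over D"
proof -
  obtain a R c S where eq: "f * emb D ^ a = emb R" "g * emb D ^ c = emb S"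
    using assms by (auto simp: frac_over_def)
  have "(f * g) * emb D ^ (a + c) = (f * emb D ^ a) * (g * emb D ^ c)"
    by (simp only: power_add mult_ac)
  then have "(f * g) * emb D ^ (a + c) = emb (R * S)"
    unfolding eq emb_mult .
  then show ?thesis unfolding frac_over_def by blast
qed

lemma frac_over_add:
  assumes "f \<in> frac_over D" "g \<in> frac_over D"
  shows "f + g \<in> frac_over D"
proof -
  obtain a R c S where eq: "f * emb D ^ a = emb R" "g * emb D ^ c = emb S"
    using assms by (auto simp: frac_over_def)
  have "(f + g) * emb D ^ (a + c) = (f * emb D ^ a) * emb D ^ c + (g * emb D ^ c) * emb D ^ a"
    by (simp only: power_add distrib_right mult_ac)
  then have "(f + g) * emb D ^ (a + c) = emb (R * D ^ c + S * D ^ a)"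
    unfolding eq emb_mult emb_add emb_power .
  then show ?thesis unfolding frac_over_def by blast
qed

lemma frac_over_power: "f \<in> frac_over D \<Longrightarrow> f ^ n \<in> frac_over D"
  using frac_over_emb[of 1 D] by (induction n) (auto simp: emb_one intro: frac_over_mult)

lemma frac_over_prod: "(\<And>i. i \<in> I \<Longrightarrow> f i \<in> frac_over D) \<Longrightarrow> prod f I \<in> frac_over D"
  using frac_over_emb[of 1 D]
  by (induction I rule: infinite_finite_induct) (auto simp: emb_one intro: frac_over_mult)

lemma frac_over_sum: "(\<And>i. i \<in> I \<Longrightarrow> f i \<in> frac_over D) \<Longrightarrow> sum f I \<in> frac_over D"
  using frac_over_emb[of 0 D]
  by (induction I rule: infinite_finite_induct) (auto simp: emb_zero intro: frac_over_add)

lemma frac_over_powi: "f \<in> frac_over D \<Longrightarrow> 1 / f \<in> frac_over D \<Longrightarrow> f powi c \<in> frac_over D"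
  by (auto simp: power_int_def inverse_eq_divide intro: frac_over_power)

lemma of_int_emb: "(of_int c :: 'v::linorder laurent_fract) = emb (Poly_Mapping.single 0 c)"
proof -
  have n: "(of_nat n :: 'v laurent_fract) = emb (of_nat n)" for n
    by (induction n) (simp_all add: emb_zero emb_one emb_add)
  have m: "emb (- L) = - emb L" for L :: "'v laurent"
    using emb_add[of L "- L"] by (simp add: emb_zero eq_neg_iff_add_eq_0 add.commute)
  have "(of_int c :: 'v laurent_fract) = emb (of_int c)"
    by (cases c rule: int_cases) (simp_all add: n m emb_add emb_one flip: of_nat_Suc)
  also have "(of_int c :: 'v laurent) = Poly_Mapping.single 0 c"
    by (rule poly_mapping_eqI) (simp add: lookup_of_int lookup_single when_def)
  finally show ?thesis .
qed

lemma hom_ext_frac_over: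
  fixes X :: "'n::{finite,linorder} var \<Rightarrow> 'n ratfun"
  assumes "\<And>v. X v \<in> frac_over D" "\<And>v. 1 / X v \<in> frac_over D"
  shows "hom_ext (evmon X) L \<in> frac_over D"
  unfolding hom_ext_def evmon_def of_int_emb
  by (intro frac_over_sum frac_over_mult frac_over_emb frac_over_prod frac_over_powi assms)

lemma frac_over_inverse_factor:
  assumes "D = Y * Z" "Y \<noteq> 0"
  shows "1 / emb Y \<in> frac_over D"
proof -
  have "emb Y \<noteq> 0" using assms(2) by (metis emb_inject emb_zero)
  then have "1 / emb Y * emb D ^ 1 = emb Z" by (simp add: assms(1) emb_mult)
  then show ?thesis unfolding frac_over_def by blast
qed

text \<open>By the last condition every column is a unimodular exponent, so that the binomials of the exchange
  relations are prime.\<close>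

definition good_matrix :: "'n::finite extended_matrix \<Rightarrow> bool" where
  "good_matrix b \<longleftrightarrow> (\<forall>j. b $ MutVar j $ j = 0) \<and>
     (\<forall>j k. b $ MutVar j $ k = 0 \<and> b $ MutVar k $ j = 0 \<or> b $ MutVar j $ k > 0 \<and> b $ MutVar k $ j < 0
        \<or> b $ MutVar j $ k < 0 \<and> b $ MutVar k $ j > 0) \<and>
     (\<forall>j. \<exists>g :: ('n var \<Rightarrow>\<^sub>0 int) \<Rightarrow> int. (\<forall>m n. g (m + n) = g m + g n) \<and>
        (\<forall>k. g (expvec (\<lambda>v. b $ v $ k)) = (if k = j then 1 else 0)))"

text \<open>Negating the matrix leaves every cluster variable unchanged and reverses the sign
  pattern, which reduces the remaining case to \<open>three_step\<close>.\<close>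

lemma three_step_good:
  fixes b :: "'n::{finite,linorder} extended_matrix"
  assumes b: "good_matrix b" and jk: "j \<noteq> k"
  shows "\<exists>U W. fst (run [j] (gens, b)) = gens(j := emb (ginv (MutVar j) * exch_num j b gvar)) \<and>
     fst (run [j, k, j] (gens, b)) = gens(j := emb W, k := emb U) \<and>
     (\<forall>L M a n. exch_num j b gvar ^ a * M = L * (U * W) ^ n \<longrightarrow> exch_num j b gvar ^ a dvd L)"
proof -
  obtain g :: "('n var \<Rightarrow>\<^sub>0 int) \<Rightarrow> int" where g: "\<And>m n. g (m + n) = g m + g n"
    "\<And>l. g (expvec (\<lambda>v. b $ v $ l)) = (if l = j then 1 else 0)"
    using b unfolding good_matrix_def by metis
  have diag: "b $ MutVar l $ l = 0" for l
    using b unfolding good_matrix_def by blast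
  have "b $ MutVar j $ k = 0 \<and> b $ MutVar k $ j = 0 \<or> b $ MutVar j $ k > 0 \<and> b $ MutVar k $ j < 0
        \<or> b $ MutVar j $ k < 0 \<and> b $ MutVar k $ j > 0"
    using b unfolding good_matrix_def by blast
  then consider "b $ MutVar j $ k = 0 \<and> b $ MutVar k $ j = 0 \<or> b $ MutVar j $ k > 0 \<and> b $ MutVar k $ j < 0"
    | "b $ MutVar j $ k < 0" "b $ MutVar k $ j > 0" by blast
  then show ?thesis
  proof cases
    case 1
    show ?thesis
      using three_step[of j k b g, OF jk diag diag g(1) _ _ 1] g(2) jk by auto
  next
    case 2
    define c where "c = - b"
    define h where "h m = - g m" for m
    have run: "fst (run v (gens, c)) = fst (run v (gens, b))" for v
      unfolding c_def by (rule run_uminus)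
    have ex: "exch_num j c gvar = exch_num j b gvar"
      unfolding c_def by (rule exch_num_uminus)
    have h: "h (m + n) = h m + h n" for m n by (simp add: h_def g(1))
    have g0: "g 0 = 0" using g(1)[of 0 0] by simp
    have gm: "g (- m) = - g m" for m using g(1)[of m "- m"] g0 by simp
    have "expvec (\<lambda>v. c $ v $ l) = - expvec (\<lambda>v. b $ v $ l)" for l
      by (rule expvec_eqI) (simp add: c_def)
    then have hc: "h (expvec (\<lambda>v. c $ v $ l)) = (if l = j then 1 else 0)" for l
      by (simp add: h_def gm g(2))
    have cc: "c $ MutVar l $ l = 0" for l by (simp add: c_def diag)
    have s: "c $ MutVar j $ k = 0 \<and> c $ MutVar k $ j = 0 \<or> c $ MutVar j $ k > 0 \<and> c $ MutVar k $ j < 0"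
      using 2 by (simp add: c_def)
    show ?thesis
      using three_step[of j k c h, OF jk cc cc h _ _ s] hc jk unfolding run ex by auto
  qed
qed

text \<open>The expansion of a cluster variable in the seed after the first step has a power of the first
  exchange binomial as denominator, the expansion after three steps \<open>j, k, j\<close> has one prime to it.\<close>

theorem laurent_phenomenon:
  fixes M :: "'n::{finite,linorder} extended_matrix set"
  assumes good: "\<And>b. b \<in> M \<Longrightarrow> good_matrix b" and closed: "\<And>b k. b \<in> M \<Longrightarrow> matrix_mutation k b \<in> M"
    and b: "b \<in> M"
  shows "laurent_word b v"
  using b
proof (induction "length v" arbitrary: v b rule: less_induct)
  case less
  note b = less.prems
  have diag: "c $ MutVar l $ l = 0" if "c \<in> M" for c l
    using good[OF that] unfolding good_matrix_def by blast
  have Pos: "fst (run u (gens, c)) i \<in> Pos" for u c i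
    by (rule run_Pos) (simp add: gen_Pos)
  have inM: "fold matrix_mutation u c \<in> M" if "c \<in> M" for u c
    using that by (induction u arbitrary: c) (auto intro: closed)
  have pre: "laurent_word c u" if "length u < length v" "c \<in> M" for c u
    using less.hyps that by blast
  have ev: "fst (run u (X, c)) i = hom_ext (evmon (seed_element X)) (laurent_expansion (fst (run u (gens, c)) i))"
    if "length u < length v" "c \<in> M" "\<And>i. X i \<in> Pos" for X c u i
    using that by (intro run_evaluate pre) auto
  show ?case
  proof (cases v)
    case Nil
    then show ?thesis by (simp add: laurent_word_def gen_emb)
  next
    case (Cons j v1)
    show ?thesis
    proof (cases v1)
      case Nil
      have "exchanged_variable j (gens, b) = emb (ginv (MutVar j) * exch_num j b gvar)"
      proof -
        have g0: "seed_element gens = (\<lambda>v. emb (gvar v))"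
          by (rule ext, case_tac v) (simp_all add: seed_element_def gen_emb)
        show ?thesis
          unfolding exchanged_exch_num g0 exch_num_emb emb_mult emb_ginv by simp
      qed
      then show ?thesis
        using Cons Nil by (simp add: laurent_word_def seed_mutation_pair gen_emb)
    next
      case (Cons k v2)
      then have v: "v = j # k # v2" using \<open>v = j # v1\<close> by simp
      show ?thesis
      proof (cases "j = k")
        case True
        have "run v (gens, b) = run v2 (gens, b)"
          unfolding v True using seed_mutation_involution[OF diag[OF b, of k], of gens, OF gen_Pos] by simp
        then show ?thesis
          using pre[of v2 b] b v by (simp add: laurent_word_def)
      next
        case jk: False
        obtain U W where UW: "fst (run [j] (gens, b)) = gens(j := emb (ginv (MutVar j) * exch_num j b gvar))"
          "fst (run [j, k, j] (gens, b)) = gens(j := emb W, k := emb U)"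
          and dvd: "\<And>L M a n. exch_num j b gvar ^ a * M = L * (U * W) ^ n \<Longrightarrow> exch_num j b gvar ^ a dvd L"
          using three_step_good[OF good[OF b] jk] by blast
        define z where "z = ginv (MutVar j) * exch_num j b gvar"
        define X1 where "X1 = fst (run [j] (gens, b))"
        define X3 where "X3 = fst (run [j, k, j] (gens, b))"
        define b1 where "b1 = snd (run [j] (gens, b))"
        define b3 where "b3 = snd (run [j, k, j] (gens, b))"
        have b1M: "b1 \<in> M" and b3M: "b3 \<in> M"
          unfolding b1_def b3_def snd_run by (intro inM; simp add: b)+
        have X1: "X1 i \<in> Pos" and X3: "X3 i \<in> Pos" for i
          unfolding X1_def X3_def by (rule Pos)+
        have s1: "run v (gens, b) = run (k # v2) (X1, b1)"
          by (simp add: v X1_def b1_def)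
        \<comment> \<open>Mutating once more at \<open>j\<close> undoes the third step, so from the
          seed after \<open>j\<close>, \<open>k\<close>, \<open>j\<close> the word
          \<open>j # v2\<close> remains, which is still shorter than \<open>v\<close>.\<close>
        have s3: "run v (gens, b) = run (j # v2) (X3, b3)"
        proof -
          define s where "s = run [j, k] (gens, b)"
          have "snd s \<in> M" unfolding s_def snd_run by (rule inM) (simp add: b)
          then have "seed_mutation j (seed_mutation j (fst s, snd s)) = (fst s, snd s)"
          proof (rule seed_mutation_involution[OF diag])
            show "fst s i \<in> Pos" for i unfolding s_def by (rule Pos)
          qed
          moreover have "(X3, b3) = seed_mutation j s"
            by (simp add: X3_def b3_def s_def)
          ultimately show ?thesis by (simp add: v s_def)
        qed
        have X1_eq: "X1 = gens(j := emb z)"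
          unfolding X1_def z_def by (rule UW(1))
        have X3_eq: "X3 = gens(j := emb W, k := emb U)"
          unfolding X3_def by (rule UW(2))
        have nz: "z \<noteq> 0" "U \<noteq> 0" "W \<noteq> 0"
        proof -
          have "emb z = X1 j" "emb U = X3 k" "emb W = X3 j"
            using jk by (simp_all add: X1_eq X3_eq)
          then have "emb z \<noteq> 0" "emb U \<noteq> 0" "emb W \<noteq> 0"
            using X1 X3 Pos_nonzero by metis+
          then show "z \<noteq> 0" "U \<noteq> 0" "W \<noteq> 0" by (auto simp: emb_zero)
        qed
        have gen_inv: "1 / gen w = emb (ginv w)" for w by (simp add: emb_ginv)
        have F1: "seed_element X1 w \<in> frac_over z \<and> 1 / seed_element X1 w \<in> frac_over z" for w
          by (cases w) (auto simp: seed_element_def X1_eq frac_over_emb gen_inv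
              frac_over_inverse_factor[of z z 1] nz, auto simp: gen_emb frac_over_emb)
        have F3: "seed_element X3 w \<in> frac_over (U * W) \<and> 1 / seed_element X3 w \<in> frac_over (U * W)" for w
          using frac_over_inverse_factor[of "U * W" U W] frac_over_inverse_factor[of "U * W" W U] nz
          by (cases w) (auto simp: seed_element_def X3_eq frac_over_emb gen_inv mult.commute,
              auto simp: gen_emb frac_over_emb)
        show ?thesis
          unfolding laurent_word_def
        proof
          fix i
          define f where "f = fst (run v (gens, b)) i"
          have "f \<in> frac_over z"
            unfolding f_def s1 using F1 by (subst ev[OF _ b1M X1]) (auto simp: v intro: hom_ext_frac_over)
          then obtain a R where R: "f * emb z ^ a = emb R" by (auto simp: frac_over_def)
          have "f \<in> frac_over (U * W)"
            unfolding f_def s3 using F3 by (subst ev[OF _ b3M X3]) (auto simp: v intro: hom_ext_frac_over)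
          then obtain n S where S: "f * emb (U * W) ^ n = emb S" by (auto simp: frac_over_def)
          define P where "P = exch_num j b gvar"
          have P: "P = gvar (MutVar j) * z"
            by (simp add: P_def z_def ginv_gvar mult.commute[of "gvar _"] flip: mult.assoc)
          have P0: "P \<noteq> 0"
            using nz(1) by (simp add: z_def P_def)
          define L where "L = gvar (MutVar j) ^ a * R"
          have fP: "f * emb (P ^ a) = emb L"
            by (simp add: L_def P emb_mult emb_power power_mult_distrib R[symmetric] mult_ac)
          \<comment> \<open>The two descriptions of \<open>f\<close>, with denominators
            \<open>P ^ a\<close> and \<open>(U * W) ^ n\<close>, are compared; coprimality then
            removes the first denominator.\<close>
          have "emb (P ^ a * S) = emb (L * (U * W) ^ n)"
            unfolding emb_mult fP[symmetric] S[symmetric] by (simp add: emb_power emb_mult mult_ac)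
          then have "P ^ a * S = L * (U * W) ^ n" by simp
          then have "P ^ a dvd L" unfolding P_def by (rule dvd)
          then obtain L' where "L = P ^ a * L'" by (auto simp: dvd_def)
          then have "f * emb (P ^ a) = emb L' * emb (P ^ a)"
            using fP by (simp add: emb_mult mult.commute)
          moreover have "emb (P ^ a) \<noteq> 0"
            using P0 by (metis emb_inject emb_zero power_not_zero)
          ultimately have "f = emb L'" by simp
          then show "fst (run v (gens, b)) i \<in> range emb" by (simp add: f_def)
        qed
      qed
    qed
  qed
qed

lemma UNIV_var: "(UNIV :: 'n var set) = range MutVar \<union> range FrozVar"
proof -
  have "v \<in> range MutVar \<union> range FrozVar" for v :: "'n var" by (cases v) auto
  then show ?thesis by blast
qed

lemma sum_var:
  fixes f :: "'n::finite var \<Rightarrow> 'a::comm_monoid_add"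
  shows "(\<Sum>v\<in>UNIV. f v) = (\<Sum>i\<in>UNIV. f (MutVar i)) + (\<Sum>i\<in>UNIV. f (FrozVar i))"
proof -
  have "(\<Sum>v\<in>UNIV. f v) = sum f (range MutVar) + sum f (range FrozVar)"
    unfolding UNIV_var by (rule sum.union_disjoint) auto
  also have "\<dots> = (\<Sum>i\<in>UNIV. f (MutVar i)) + (\<Sum>i\<in>UNIV. f (FrozVar i))"
    by (simp add: sum.reindex inj_on_def)
  finally show ?thesis .
qed

section \<open>Tropical evaluation of the exchange relations\<close>

text \<open>Max-plus value of one of the two exchange monomials; negating the matrix gives the
  other.\<close>

definition tside :: "('n::finite \<Rightarrow> real) \<Rightarrow> ('n \<Rightarrow> real) \<Rightarrow> 'n extended_matrix \<Rightarrow> 'n \<Rightarrow> real" where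
  "tside y a b k = (\<Sum>i\<in>UNIV. max 0 (of_int (b $ MutVar i $ k)) * a i) + (\<Sum>i\<in>UNIV. max 0 (of_int (b $ FrozVar i $ k)) * y i)"

definition tmut :: "('n::finite \<Rightarrow> real) \<Rightarrow> 'n \<Rightarrow> ('n \<Rightarrow> real) \<times> 'n extended_matrix \<Rightarrow> ('n \<Rightarrow> real) \<times> 'n extended_matrix" where
  "tmut y k s = (case s of (a, b) \<Rightarrow>
     (a(k := max (tside y a b k) (tside y a (- b) k) - a k), matrix_mutation k b))"

definition yval :: "(('n var \<Rightarrow>\<^sub>0 int) \<Rightarrow> real) \<Rightarrow> 'n \<Rightarrow> real" where
  "yval w i = w (Poly_Mapping.single (FrozVar i) 1)"

lemma val_gen: "additive w \<Longrightarrow> val w (gen v) = w (Poly_Mapping.single v 1)"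
  unfolding gen_emb gvar_def by (subst val_emb) (auto simp: maxw_single simp flip: keys_eq_empty)

lemma val_prod_side:
  fixes x :: "'n::{finite,linorder} \<Rightarrow> 'n ratfun"
  assumes w: "additive w" and x: "\<And>i. x i \<in> Pos"
  shows "val w (\<Prod>v\<in>UNIV. seed_element x v ^ nat (b $ v $ k)) = tside (yval w) (\<lambda>i. val w (x i)) b k"
proof -
  have nz: "seed_element x v \<noteq> 0" for v
    using Pos_nonzero seed_element_Pos x by blast
  have "val w (\<Prod>v\<in>UNIV. seed_element x v ^ nat (b $ v $ k)) = (\<Sum>v\<in>UNIV. real (nat (b $ v $ k)) * val w (seed_element x v))"
    by (subst val_prod[OF w]) (auto simp: nz val_power[OF w])
  also have "\<dots> = tside (yval w) (\<lambda>i. val w (x i)) b k"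
    unfolding sum_var tside_def
    by (intro arg_cong2[of _ _ _ _ "(+)"] sum.cong refl)
       (simp_all add: seed_element_def yval_def val_gen[OF w] max_def)
  finally show ?thesis .
qed

lemma val_exchanged:
  fixes x :: "'n::{finite,linorder} \<Rightarrow> 'n ratfun"
  assumes w: "additive w" and x: "\<And>i. x i \<in> Pos"
  shows "val w (exchanged_variable k (x, b)) =
    max (tside (yval w) (\<lambda>i. val w (x i)) b k) (tside (yval w) (\<lambda>i. val w (x i)) (- b) k) - val w (x k)"
proof -
  let ?P = "\<Prod>v\<in>UNIV. seed_element x v ^ nat (b $ v $ k)"
  let ?N = "\<Prod>v\<in>UNIV. seed_element x v ^ nat ((- b) $ v $ k)"
  have PN: "?P \<in> Pos" "?N \<in> Pos"
    by (intro Pos_prod Pos_power seed_element_Pos x)+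
  have "exchanged_variable k (x, b) = (?P + ?N) / x k"
    by (simp add: exchanged_variable_alt)
  then have "val w (exchanged_variable k (x, b)) = val w (?P + ?N) - val w (x k)"
    using val_divide[OF w Pos_nonzero[OF Pos_add[OF PN]] Pos_nonzero[OF x]] by simp
  also have "val w (?P + ?N) = max (val w ?P) (val w ?N)"
    by (rule val_add[OF w PN])
  finally show ?thesis
    unfolding val_prod_side[of w x, OF w x] .
qed

text \<open>Clusters stay subtraction-free, so the valuation turns every exchange relation into its
  tropical version.\<close>

lemma val_run:
  fixes s :: "'n::{finite,linorder} seed"
  assumes w: "additive w" and s: "\<And>i. fst s i \<in> Pos"
  shows "((\<lambda>i. val w (fst (run v s) i)), snd (run v s)) = fold (tmut (yval w)) v ((\<lambda>i. val w (fst s i)), snd s)"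
  using s
proof (induction v arbitrary: s)
  case (Cons k v)
  obtain x b where seed_exp: "s = (x, b)" by (cases s)
  have x: "x i \<in> Pos" for i using Cons.prems by (simp add: seed_exp)
  have 1: "fst (seed_mutation k s) i \<in> Pos" for i
    by (rule seed_mutation_Pos) (rule Cons.prems)
  have "((\<lambda>i. val w (fst (seed_mutation k s) i)), snd (seed_mutation k s)) = tmut (yval w) k ((\<lambda>i. val w (fst s i)), snd s)"
    by (auto simp: seed_exp seed_mutation_pair tmut_def val_exchanged[of w x, OF w x])
  then show ?case
    using Cons.IH[of "seed_mutation k s", OF 1] by simp
qed simp

section \<open>Words, seeds and tuples of roots\<close>

locale lcartan = cartan A d for A :: "((int, 'n::{finite,linorder}) vec, 'n) vec" and d :: "'n \<Rightarrow> real"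
begin

definition mat0 :: "('n \<times> 'n) set \<Rightarrow> 'n extended_matrix" where
  "mat0 E = snd (principal_seed (exchange_matrix A E))"

definition ematrix :: "('n \<times> 'n) set \<Rightarrow> 'n list \<Rightarrow> 'n extended_matrix" where
  "ematrix E v = fold matrix_mutation v (mat0 E)"

definition clvar :: "('n \<times> 'n) set \<Rightarrow> 'n list \<Rightarrow> 'n \<Rightarrow> 'n ratfun" where
  "clvar E v = fst (run v (principal_seed (exchange_matrix A E)))"

definition ctuple :: "('n \<times> 'n) set \<Rightarrow> 'n list \<Rightarrow> 'n \<Rightarrow> 'n int_vector" where
  "ctuple E v k = (\<chi> i. ematrix E v $ FrozVar i $ k)"

lemma principal_seed_eq: "principal_seed (exchange_matrix A E) = (gens, mat0 E)"
  by (simp add: principal_seed_def mat0_def)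

lemma ematrix_Nil: "ematrix E [] = mat0 E" and ematrix_snoc: "ematrix E (v @ [k]) = matrix_mutation k (ematrix E v)"
  by (simp_all add: ematrix_def)

lemma ematrix_append: "ematrix E (v @ w) = fold matrix_mutation w (ematrix E v)"
  by (simp add: ematrix_def)

lemma run_eq: "run v (gens, mat0 E) = (clvar E v, ematrix E v)"
  by (simp add: clvar_def ematrix_def principal_seed_eq prod_eq_iff snd_run)

lemma clvar_Nil: "clvar E [] = gens" by (simp add: clvar_def principal_seed_eq)

lemma clvar_snoc: "clvar E (v @ [k]) = (clvar E v)(k := exchanged_variable k (clvar E v, ematrix E v))"
proof -
  have "clvar E (v @ [k]) = fst (seed_mutation k (run v (gens, mat0 E)))"
    by (simp add: clvar_def principal_seed_eq)
  then show ?thesis by (simp add: run_eq seed_mutation_pair)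
qed

lemma clvar_Pos: "clvar E v i \<in> Pos"
  unfolding clvar_def by (rule run_Pos) (simp add: principal_seed_eq gen_Pos)

lemma mat0_nth: "mat0 E $ MutVar i $ j = exchange_matrix A E $ i $ j"
  "mat0 E $ FrozVar i $ j = (if i = j then 1 else 0)"
  by (simp_all add: mat0_def principal_seed_def)

lemma ctuple_Nil: "ctuple E [] = (\<lambda>i. axis i 1)"
  by (auto simp: fun_eq_iff vec_eq_iff ctuple_def ematrix_Nil mat0_nth axis_def)

lemma link_step:
  assumes o: "orient E" and v: "valid E (ctuple E v)"
    and b: "\<And>i j. ematrix E v $ MutVar i $ j = exch E (ctuple E v) i j"
  shows "ctuple E (v @ [k]) = mut E k (ctuple E v)"
    "ematrix E (v @ [k]) $ MutVar i $ j = exch E (ctuple E (v @ [k])) i j"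
proof -
  have X: "ematrix E v $ FrozVar i $ j = ctuple E v j $ i" for i j by (simp add: ctuple_def)
  show t: "ctuple E (v @ [k]) = mut E k (ctuple E v)"
  proof
    fix j
    have "ematrix E (v @ [k]) $ FrozVar i $ j = mut E k (ctuple E v) j $ i" for i
    proof (cases "j = k")
      case True
      then show ?thesis by (simp add: ematrix_snoc matrix_mutation_nth X mut_def)
    next
      case False
      have "posv (ctuple E v k) \<or> negv (ctuple E v k)" by (rule valid_sign[OF o v])
      then show ?thesis
      proof
        assume p: "posv (ctuple E v k)"
        then have "ctuple E v k $ i \<ge> 0" by (simp add: posv_def)
        then show ?thesis using False p by (simp add: ematrix_snoc matrix_mutation_nth X mut_def mult_def b)
      next
        assume n: "negv (ctuple E v k)"
        then have "ctuple E v k $ i \<le> 0" by (simp add: negv_def)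
        moreover have "\<not> posv (ctuple E v k)" using n root_not_both[OF validD(1)[OF v]] by blast
        ultimately show ?thesis using False by (simp add: ematrix_snoc matrix_mutation_nth X mut_def mult_def b)
      qed
    qed
    then show "ctuple E (v @ [k]) j = mut E k (ctuple E v) j"
      by (simp add: vec_eq_iff ctuple_def)
  qed
  show "ematrix E (v @ [k]) $ MutVar i $ j = exch E (ctuple E (v @ [k])) i j"
    unfolding t exch_mut[OF o v] ematrix_snoc matrix_mutation_nth b by simp
qed

lemma link:
  assumes o: "orient E"
  shows "valid E (ctuple E v)" "ematrix E v $ MutVar i $ j = exch E (ctuple E v) i j"
    "ctuple E (v @ [k]) = mut E k (ctuple E v)"
proof -
  have "valid E (ctuple E v) \<and> (\<forall>i j. ematrix E v $ MutVar i $ j = exch E (ctuple E v) i j)"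
  proof (induction v rule: rev_induct)
    case Nil
    show ?case
      unfolding ctuple_Nil ematrix_Nil mat0_nth exch_initial[OF o] using valid_initial[OF o] by simp
  next
    case (snoc k v)
    then have v: "valid E (ctuple E v)" and b: "\<And>i j. ematrix E v $ MutVar i $ j = exch E (ctuple E v) i j" by auto
    show ?case
      using link_step[OF o v b, of k] valid_mut[OF o v, of k] by simp
  qed
  then show "valid E (ctuple E v)" "ematrix E v $ MutVar i $ j = exch E (ctuple E v) i j"
    "ctuple E (v @ [k]) = mut E k (ctuple E v)"
    using link_step(1)[OF o] by auto
qed

lemma exch_skew:
  assumes "orient E" "valid E X"
  shows "d i * of_int (exch E X i j) = - (d j * of_int (exch E X j i))"
  unfolding exch_valid[OF assms] by (rule skew_form_swap)

text \<open>The sign pattern comes from skew-symmetrisability; the functional separating column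
  \<open>j\<close> is the dual vector of the tuple, applied to frozen exponents.\<close>

lemma good_mat:
  assumes o: "orient E"
  shows "good_matrix (ematrix E v)"
proof -
  have "ematrix E v $ MutVar j $ k = 0 \<and> ematrix E v $ MutVar k $ j = 0 \<or> ematrix E v $ MutVar j $ k > 0 \<and> ematrix E v $ MutVar k $ j < 0
        \<or> ematrix E v $ MutVar j $ k < 0 \<and> ematrix E v $ MutVar k $ j > 0" for j k
  proof -
    let ?b = "exch E (ctuple E v)"
    have s: "d j * of_int (?b j k) = - (d k * of_int (?b k j))"
      by (rule exch_skew[OF o link(1)[OF o]])
    have dj: "d j > 0" and dk: "d k > 0" by (rule d_pos)+
    consider "?b j k = 0" | "?b j k > 0" | "?b j k < 0" by linarith
    then show ?thesis
    proof cases
      case 1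
      then show ?thesis using s dk by (simp add: link(2)[OF o])
    next
      case 2
      then have "d j * of_int (?b j k) > 0" using dj by simp
      then have "d k * of_int (?b k j) < 0" using s by simp
      then show ?thesis using 2 dk by (simp add: link(2)[OF o] mult_less_0_iff)
    next
      case 3
      then have "d j * of_int (?b j k) < 0" using dj by (simp add: mult_less_0_iff)
      then have "d k * of_int (?b k j) > 0" using s by simp
      then show ?thesis using 3 dk by (simp add: link(2)[OF o] zero_less_mult_iff)
    qed
  qed
  moreover have "\<exists>g :: ('n var \<Rightarrow>\<^sub>0 int) \<Rightarrow> int. (\<forall>m n. g (m + n) = g m + g n) \<and>
        (\<forall>k. g (expvec (\<lambda>u. ematrix E v $ u $ k)) = (if k = j then 1 else 0))" for j
  proof -
    define g :: "('n var \<Rightarrow>\<^sub>0 int) \<Rightarrow> int" where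
      "g m = (\<Sum>i\<in>UNIV. dual (ctuple E v) j $ i * lkp m (FrozVar i))" for m
    have "g (m + n) = g m + g n" for m n
      by (simp add: g_def lookup_add algebra_simps sum.distrib)
    moreover have "g (expvec (\<lambda>u. ematrix E v $ u $ k)) = pairing (dual (ctuple E v) j) (ctuple E v k)" for k
      by (simp add: g_def pairing_def ctuple_def)
    moreover have "pairing (dual (ctuple E v) j) (ctuple E v k) = (if k = j then 1 else 0)" for k
      using dual_spec[OF validD(2)[OF link(1)[OF o]]] unfolding dual_to_def by auto
    ultimately show ?thesis by (intro exI[of _ g]) simp
  qed
  ultimately show ?thesis
    unfolding good_matrix_def by (simp add: link(2)[OF o])
qed

lemma clvar_laurent:
  assumes o: "orient E"
  shows "clvar E v i \<in> range emb"
proof -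
  have "laurent_word (mat0 E) v"
  proof (rule laurent_phenomenon[of "range (ematrix E)"])
    show "good_matrix b" if "b \<in> range (ematrix E)" for b using that good_mat[OF o] by auto
    show "matrix_mutation k b \<in> range (ematrix E)" if b: "b \<in> range (ematrix E)" for b k
    proof -
      obtain u where "b = ematrix E u" using b by blast
      then have "matrix_mutation k b = ematrix E (u @ [k])" by (simp add: ematrix_snoc)
      then show ?thesis by blast
    qed
    show "mat0 E \<in> range (ematrix E)" using ematrix_Nil[of E] by (metis rangeI)
  qed
  then show ?thesis
    by (simp add: laurent_word_def run_eq)
qed

definition clexp :: "('n \<times> 'n) set \<Rightarrow> 'n list \<Rightarrow> 'n \<Rightarrow> 'n var laurent" where
  "clexp E v i = laurent_expansion (clvar E v i)"

lemma emb_clexp: "orient E \<Longrightarrow> emb (clexp E v i) = clvar E v i"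
  unfolding clexp_def by (rule emb_laurent_expansion[OF clvar_laurent])

lemma clexp_nonzero: "orient E \<Longrightarrow> clexp E v i \<noteq> 0"
  using emb_clexp[of E v i] Pos_nonzero[OF clvar_Pos, of E v i] by (auto simp: emb_zero)

lemma val_clvar: "orient E \<Longrightarrow> additive w \<Longrightarrow> val w (clvar E v i) = maxw w (clexp E v i)"
  using val_emb[of w "clexp E v i"] by (simp add: emb_clexp clexp_nonzero)

definition seed_exp :: "('n \<times> 'n) set \<Rightarrow> 'n list \<Rightarrow> 'n var \<Rightarrow> 'n var laurent" where
  "seed_exp E v u = (case u of MutVar i \<Rightarrow> clexp E v i | FrozVar i \<Rightarrow> gvar (FrozVar i))"

lemma exchange_relation:
  assumes o: "orient E"
  shows "clexp E (v @ [k]) k * clexp E v k = exch_num k (ematrix E v) (seed_exp E v)"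
proof -
  have s: "seed_element (clvar E v) = (\<lambda>u. emb (seed_exp E v u))"
    by (rule ext, case_tac u) (simp_all add: seed_element_def seed_exp_def emb_clexp[OF o] gen_emb)
  have "clvar E (v @ [k]) k = emb (exch_num k (ematrix E v) (seed_exp E v)) / clvar E v k"
    unfolding clvar_snoc fun_upd_same exchanged_exch_num s exch_num_emb ..
  then have "emb (clexp E (v @ [k]) k * clexp E v k) = emb (exch_num k (ematrix E v) (seed_exp E v))"
    using Pos_nonzero[OF clvar_Pos, of E v k] by (simp add: emb_mult emb_clexp[OF o])
  then show ?thesis by simp
qed

lemma clexp_other: "i \<noteq> k \<Longrightarrow> clexp E (v @ [k]) i = clexp E v i"
  by (simp add: clexp_def clvar_snoc)

end

section \<open>Dominant monomials and g-vectors\<close>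

lemma lead_power:
  assumes w: "additive w" and P: "lead w P m"
  shows "lead w (P ^ n) (frag_cmul (int n) m)"
proof (induction n)
  case 0
  show ?case by (simp add: lead_def)
next
  case (Suc n)
  have "frag_cmul (int (Suc n)) m = m + frag_cmul (int n) m"
    by (simp add: frag_cmul_distrib)
  then show ?case using lead_mult[OF w P Suc.IH] by simp
qed

text \<open>Minus the total frozen degree: a leading monomial without frozen variables expresses
  that the F-polynomial has constant term \<open>1\<close>.\<close>

definition fro :: "('n::finite var \<Rightarrow>\<^sub>0 int) \<Rightarrow> real" where
  "fro m = - (\<Sum>i\<in>UNIV. of_int (lkp m (FrozVar i)))"

definition xmono :: "'n::finite int_vector \<Rightarrow> 'n var \<Rightarrow>\<^sub>0 int" where
  "xmono g = expvec (\<lambda>u. case u of MutVar j \<Rightarrow> g $ j | FrozVar _ \<Rightarrow> 0)"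

lemma additive_fro: "additive fro"
  by (simp add: additive_def fro_def lookup_add sum.distrib)

lemma xmono_nth [simp]: "lkp (xmono g) (MutVar j) = g $ j" "lkp (xmono g) (FrozVar j) = 0"
  by (simp_all add: xmono_def)

lemma fro_xmono [simp]: "fro (xmono g) = 0"
  by (simp add: fro_def)

lemma exponent_eqI:
  "(\<And>i. lkp m (MutVar i) = lkp n (MutVar i)) \<Longrightarrow> (\<And>i. lkp m (FrozVar i) = lkp n (FrozVar i)) \<Longrightarrow> m = n"
  by (rule poly_mapping_eqI, case_tac k) simp_all

lemma lookup_sum_cmul: "lkp (\<Sum>u\<in>I. frag_cmul (c u) (s u)) x = (\<Sum>u\<in>I. c u * lkp (s u) x)"
  by (simp add: lookup_sum)

context cartan begin

text \<open>With the weights \<open>d\<close> the g-vectors of a matrix are dual to its own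
  c-vectors; the plain pairing belongs to the g-vectors of the transposed diagram instead.\<close>

definition dpairing :: "int^'n \<Rightarrow> int^'n \<Rightarrow> real" where
  "dpairing g c = (\<Sum>a\<in>UNIV. d a * of_int (g $ a) * of_int (c $ a))"

lemma dpairing_lin: "dpairing (g + h) c = dpairing g c + dpairing h c" "dpairing (g - h) c = dpairing g c - dpairing h c"
  "dpairing (z *s g) c = of_int z * dpairing g c" "dpairing g (c + e) = dpairing g c + dpairing g e" "dpairing g (- c) = - dpairing g c"
  "dpairing g (z *s c) = of_int z * dpairing g c"
  by (simp_all add: dpairing_def algebra_simps sum.distrib sum_subtractf sum_negf sum_distrib_left)

lemma dpairing_sum: "dpairing (sum f I) c = (\<Sum>i\<in>I. dpairing (f i) c)"
  by (induction I rule: infinite_finite_induct) (simp_all add: dpairing_lin, simp_all add: dpairing_def)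

lemma dpairing_lincomb: "dpairing g (lincomb x X) = (\<Sum>l\<in>UNIV. of_int (x l) * dpairing g (X l))"
proof -
  have "dpairing g (\<Sum>l\<in>I. x l *s X l) = (\<Sum>l\<in>I. of_int (x l) * dpairing g (X l))" for I
    by (induction I rule: infinite_finite_induct) (simp_all add: dpairing_lin, simp_all add: dpairing_def)
  then show ?thesis by (simp add: lincomb_def)
qed

lemma dpairing_axis: "dpairing g (axis k 1) = d k * of_int (g $ k)"
proof -
  have "dpairing g (axis k 1) = (\<Sum>a\<in>UNIV. if a = k then d k * of_int (g $ k) else 0)"
    unfolding dpairing_def by (intro sum.cong) (auto simp: axis_def)
  then show ?thesis by simp
qed

lemma skew_form_exchange:
  assumes o: "orient E"
  shows "skew_form E x y = (\<Sum>r\<in>UNIV. \<Sum>a\<in>UNIV. d r * of_int (exchange_matrix A E $ r $ a) * of_int (x $ r) * of_int (y $ a))"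
proof -
  have b: "d i * of_int (exchange_matrix A E $ i $ j) = coef E j i - coef E i j" for i j
    using exch_valid[OF o valid_initial[OF o], of i j] unfolding exch_initial[OF o]
    by (simp add: skew_form_def euler_axis_axis)
  have "euler E y x = (\<Sum>r\<in>UNIV. \<Sum>a\<in>UNIV. coef E a r * of_int (x $ r) * of_int (y $ a))"
    unfolding euler_def by (subst sum.swap) (simp add: mult_ac)
  then show ?thesis
    unfolding b skew_form_def by (simp add: euler_def algebra_simps sum_subtractf)
qed

text \<open>This makes the two monomials of an exchange relation have the same degree.\<close>

lemma degree_balance:
  assumes o: "orient E" and v: "valid E X" and G: "\<And>i j. dpairing (G i) (X j) = (if i = j then d j else 0)"
  shows "(\<Sum>i\<in>UNIV. exch E X i k * G i $ r) = (\<Sum>a\<in>UNIV. X k $ a * exchange_matrix A E $ r $ a)"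
proof -
  \<comment> \<open>The two sides have the same weighted pairing with every member of a spanning
    tuple, so their difference \<open>u\<close> vanishes.\<close>
  define u :: "int^'n" where "u = (\<Sum>i\<in>UNIV. exch E X i k *s G i) - (\<chi> r. \<Sum>a\<in>UNIV. X k $ a * exchange_matrix A E $ r $ a)"
  have "dpairing u (X j) = 0" for j
  proof -
    have "(\<Sum>i\<in>UNIV. dpairing (exch E X i k *s G i) (X j)) = (\<Sum>i\<in>UNIV. if i = j then d j * of_int (exch E X j k) else 0)"
      by (intro sum.cong) (auto simp: dpairing_lin G)
    then have 1: "dpairing (\<Sum>i\<in>UNIV. exch E X i k *s G i) (X j) = skew_form E (X j) (X k)"
      by (simp add: dpairing_sum exch_valid[OF o v])
    have "dpairing (\<chi> r. \<Sum>a\<in>UNIV. X k $ a * exchange_matrix A E $ r $ a) (X j) = skew_form E (X j) (X k)"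
      unfolding skew_form_exchange[OF o] dpairing_def by (simp add: sum_distrib_left sum_distrib_right mult_ac)
    then show ?thesis using 1 by (simp add: u_def dpairing_lin)
  qed
  then have z: "dpairing u (lincomb x X) = 0" for x
    by (simp add: dpairing_lincomb)
  obtain x where "axis r 1 = lincomb x X"
    using validD(2)[OF v] unfolding spans_def by blast
  then have "d r * of_int (u $ r) = 0"
    using z[of x] dpairing_axis[of u r] by simp
  then have "u $ r = 0" using d_pos[of r] by simp
  then show ?thesis by (simp add: u_def)
qed

text \<open>Coordinate \<open>r\<close> of the degree as a real weight. Taken with its negative, it
  expresses homogeneity as equality of the maximum and the minimum over an expansion.\<close>

definition degw :: "('n \<times> 'n) set \<Rightarrow> 'n \<Rightarrow> ('n var \<Rightarrow>\<^sub>0 int) \<Rightarrow> real" where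
  "degw E r m = of_int (lkp m (MutVar r)) - (\<Sum>i\<in>UNIV. of_int (lkp m (FrozVar i)) * of_int (exchange_matrix A E $ r $ i))"

lemma additive_degw: "additive (degw E r)" "additive (\<lambda>m. - degw E r m)"
  by (simp_all add: additive_def degw_def lookup_add algebra_simps sum.distrib)

lemma degw_monomial_degree: "degw E r m = of_int (monomial_degree (exchange_matrix A E) m $ r)"
proof -
  have B: "(B *v axis i 1) $ r = B $ r $ i" for B :: "'n int_matrix" and i
  proof -
    have "(B *v axis i 1) $ r = (\<Sum>j\<in>UNIV. if j = i then B $ r $ i else 0)"
      unfolding matrix_vector_mult_def vec_lambda_beta by (intro sum.cong) (auto simp: axis_def)
    then show ?thesis by simp
  qed
  have "(\<Sum>i\<in>UNIV. lkp m (MutVar i) *s axis i 1) $ r = (\<Sum>i\<in>UNIV. if i = r then lkp m (MutVar r) else 0)"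
    unfolding sum_component by (intro sum.cong) (auto simp: axis_def)
  then show ?thesis
    by (simp add: degw_def monomial_degree_def B sum_negf)
qed

end

context lcartan begin

text \<open>Homogeneity is encoded through the valuations of two opposite weights, which pass
  through exchange relations without inspecting the monomials of an expansion.\<close>

definition gdata :: "('n \<times> 'n) set \<Rightarrow> 'n list \<Rightarrow> ('n \<Rightarrow> 'n int_vector) \<Rightarrow> bool" where
  "gdata E v G \<longleftrightarrow> (\<forall>i. lead fro (clexp E v i) (xmono (G i))) \<and>
     (\<forall>i j. dpairing (G i) (ctuple E v j) = (if i = j then d j else 0)) \<and>
     (\<forall>i r. val (degw E r) (clvar E v i) = of_int (G i $ r)) \<and>
     (\<forall>i r. val (\<lambda>m. - degw E r m) (clvar E v i) = - of_int (G i $ r))"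

lemma gdata_Nil:
  assumes o: "orient E"
  shows "gdata E [] (\<lambda>i. axis i 1)"
proof -
  have "clexp E [] i = gvar (MutVar i)" for i
    by (simp add: clexp_def clvar_Nil gen_emb laurent_expansion_emb)
  moreover have x: "xmono (axis i 1) = Poly_Mapping.single (MutVar i) 1" for i :: 'n
    by (rule exponent_eqI) (simp_all add: lookup_single when_def axis_def)
  moreover have "degw E r (Poly_Mapping.single (MutVar i) 1) = of_int ((axis i 1 :: 'n int_vector) $ r)" for i r
    by (simp add: degw_def lookup_single when_def axis_def)
  ultimately show ?thesis
    unfolding gdata_def clvar_Nil ctuple_Nil
    by (simp add: val_gen additive_degw gvar_def lead_single dpairing_axis) (simp add: axis_def)
qed

text \<open>The column is normalised to have nonnegative frozen entries, so exactly one exchange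
  monomial carries frozen variables and the other one leads. Division by the old variable yields the
  recursion for g-vectors; \<open>mult_skew\<close> matches it with the mutation of the dual
  c-vectors.\<close>

lemma gdata_step:
  assumes o: "orient E" and G: "gdata E v G"
  shows "\<exists>G'. gdata E (v @ [k]) G'"
proof -
  define X where "X = ctuple E v"
  define b where "b = ematrix E v"
  define c where "c = (if posv (X k) then b else - b)"
  define n where "n i = max 0 (- (c $ MutVar i $ k))" for i
  define G' where "G' = G(k := (\<Sum>i\<in>UNIV. n i *s G i) - G k)"
  have vX: "valid E X" unfolding X_def by (rule link(1)[OF o])
  have lead: "lead fro (clexp E v i) (xmono (G i))" and dual: "dpairing (G i) (X j) = (if i = j then d j else 0)"
    and dg: "val (degw E r) (clvar E v i) = of_int (G i $ r)" "val (\<lambda>m. - degw E r m) (clvar E v i) = - of_int (G i $ r)" for i j r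
    using G by (simp_all add: gdata_def X_def)
  have b: "b $ MutVar i $ j = exch E X i j" "b $ FrozVar i $ j = X j $ i" for i j
    using link(2)[OF o] by (simp_all add: b_def X_def ctuple_def)
  have cF: "c $ FrozVar i $ k \<ge> 0" for i
    using valid_sign[OF o vX, of k] by (auto simp: c_def b posv_def negv_def)
  have cF1: "\<exists>i. c $ FrozVar i $ k \<noteq> 0"
    using root_nonzero[OF validD(1)[OF vX, of k]] by (auto simp: c_def b vec_eq_iff)
  have ckk: "c $ MutVar k $ k = 0" by (simp add: c_def b)
  have nk: "n k = 0" by (simp add: n_def ckk)
  have ex: "exch_num k b y = exch_num k c y" for y :: "'n var \<Rightarrow> 'n var laurent"
    by (simp add: c_def exch_num_uminus)
  text \<open>The monomial without frozen variables dominates.\<close>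
  define su where "su u = (case u of MutVar i \<Rightarrow> xmono (G i) | FrozVar i \<Rightarrow> Poly_Mapping.single (FrozVar i) 1)" for u
  have su: "lead fro (seed_exp E v u) (su u)" for u
    by (cases u) (simp_all add: seed_exp_def su_def lead gvar_def lead_single)
  define MP where "MP = (\<Sum>u\<in>UNIV. frag_cmul (int (nat (c $ u $ k))) (su u))"
  define MN where "MN = (\<Sum>u\<in>UNIV. frag_cmul (int (nat (- (c $ u $ k)))) (su u))"
  have lP: "lead fro (\<Prod>u\<in>UNIV. seed_exp E v u ^ nat (c $ u $ k)) MP"
    and lN: "lead fro (\<Prod>u\<in>UNIV. seed_exp E v u ^ nat (- (c $ u $ k))) MN"
    unfolding MP_def MN_def by (intro lead_prod lead_power additive_fro su)+
  have suF: "lkp (su (MutVar i)) (FrozVar j) = 0" "lkp (su (FrozVar i)) (FrozVar j) = (if i = j then 1 else 0)"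
    "lkp (su (FrozVar i)) (MutVar j) = 0" "lkp (su (MutVar i)) (MutVar j) = G i $ j" for i j
    by (simp_all add: su_def lookup_single when_def)
  have MN: "MN = xmono (\<Sum>i\<in>UNIV. n i *s G i)"
  proof -
    have "lkp MN x = (\<Sum>u\<in>UNIV. int (nat (- (c $ u $ k))) * lkp (su u) x)" for x
      unfolding MN_def by (rule lookup_sum_cmul)
    moreover have "int (nat (- (c $ FrozVar i $ k))) = 0" for i using cF[of i] by simp
    moreover have "int (nat (- (c $ MutVar i $ k))) = n i" for i by (simp add: n_def)
    ultimately show ?thesis
      by (intro exponent_eqI) (simp_all only: sum_var suF xmono_nth sum_component vector_smult_component
          mult_zero_left mult_zero_right sum.neutral_const add_0_right)
  qed
  have "lkp MP (FrozVar j) = c $ FrozVar j $ k" for j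
  proof -
    have "lkp MP (FrozVar j) = (\<Sum>u\<in>UNIV. int (nat (c $ u $ k)) * lkp (su u) (FrozVar j))"
      unfolding MP_def by (rule lookup_sum_cmul)
    then have "lkp MP (FrozVar j) = (\<Sum>i\<in>UNIV. int (nat (c $ FrozVar i $ k)) * (if i = j then 1 else 0))"
      unfolding sum_var suF by simp
    also have "\<dots> = (\<Sum>i\<in>UNIV. if i = j then c $ FrozVar j $ k else 0)"
      using cF by (intro sum.cong) auto
    finally show ?thesis by simp
  qed
  then have "fro MP = - (\<Sum>j\<in>UNIV. of_int (c $ FrozVar j $ k))"
    by (simp add: fro_def)
  also have "\<dots> < 0"
  proof -
    obtain i where i: "c $ FrozVar i $ k \<noteq> 0" using cF1 by blast
    then have "0 < c $ FrozVar i $ k" using cF[of i] by simp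
    then have "0 < (\<Sum>j\<in>UNIV. real_of_int (c $ FrozVar j $ k))"
      using cF by (intro sum_pos2[of _ i]) auto
    then show ?thesis by simp
  qed
  finally have "fro MP < fro MN" unfolding MN by simp
  then have "lead fro ((\<Prod>u\<in>UNIV. seed_exp E v u ^ nat (- (c $ u $ k))) + (\<Prod>u\<in>UNIV. seed_exp E v u ^ nat (c $ u $ k))) MN"
    using lead_le[OF lP] by (intro lead_add[OF lN]) fastforce
  then have "lead fro (clexp E v k * clexp E (v @ [k]) k) MN"
    using exchange_relation[OF o, of v k] ex[of "seed_exp E v"] by (simp add: b_def exch_num_def add.commute mult.commute)
  then have "lead fro (clexp E (v @ [k]) k) (MN - xmono (G k))"
    by (rule lead_div[OF additive_fro _ lead])
  moreover have "MN - xmono (G k) = xmono (G' k)"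
    unfolding MN by (rule exponent_eqI) (simp_all add: lookup_minus G'_def)
  ultimately have lead': "lead fro (clexp E (v @ [k]) i) (xmono (G' i))" for i
    using lead[of i] by (cases "i = k") (simp_all add: clexp_other G'_def)
  have nd: "d j * of_int (n j) = of_int (mult E X k j) * d k" for j
    unfolding mult_skew[OF o vX] n_def c_def b by (simp add: b)
  have sumdual: "dpairing (\<Sum>i\<in>UNIV. n i *s G i) (X j) = d j * of_int (n j)" for j
  proof -
    have "dpairing (\<Sum>i\<in>UNIV. n i *s G i) (X j) = (\<Sum>i\<in>UNIV. if i = j then d j * of_int (n j) else 0)"
      unfolding dpairing_sum by (intro sum.cong) (auto simp: dpairing_lin dual)
    then show ?thesis by simp
  qed
  have dual': "dpairing (G' i) (ctuple E (v @ [k]) j) = (if i = j then d j else 0)" for i j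
    unfolding link(3)[OF o] X_def[symmetric]
    by (cases "i = k"; cases "j = k")
       (simp_all add: G'_def mut_def dpairing_lin dual sumdual nd nk)
  \<comment> \<open>The degree weight and its negative are treated together through the sign
    \<open>s\<close>. By \<open>degree_balance\<close> both exchange monomials have the same value,
    so the maximum may be read from either.\<close>
  have deg': "val w (clvar E (v @ [k]) i) = s * of_int (G' i $ r)"
    if w: "additive w" and s: "\<And>m. w m = s * degw E r m" and sv: "\<And>i. val w (clvar E v i) = s * of_int (G i $ r)"
    for w i r and s :: real
  proof (cases "i = k")
    case False
    then show ?thesis using sv by (simp add: clvar_snoc G'_def)
  next
    case True
    let ?a = "\<lambda>i. val w (clvar E v i)"
    have y: "yval w i = - s * of_int (exchange_matrix A E $ r $ i)" for i
    proof -
      have "(\<Sum>j\<in>UNIV. of_int (if j = i then 1 else 0) * real_of_int (exchange_matrix A E $ r $ j)) =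
          (\<Sum>j\<in>UNIV. if j = i then real_of_int (exchange_matrix A E $ r $ i) else 0)"
        by (intro sum.cong) auto
      then show ?thesis
        by (simp add: yval_def s degw_def lookup_single when_def eq_commute[of _ i])
    qed
    have "tside (yval w) ?a b k - tside (yval w) ?a (- b) k =
        (\<Sum>i\<in>UNIV. of_int (b $ MutVar i $ k) * ?a i) + (\<Sum>i\<in>UNIV. of_int (b $ FrozVar i $ k) * yval w i)"
    proof -
      have "max 0 x * t - max 0 (- x) * t = x * t" for x t :: real
        by (simp add: max_def)
      then show ?thesis
        by (simp add: tside_def add_diff_add sum_subtractf[symmetric])
    qed
    also have "\<dots> = s * of_int ((\<Sum>i\<in>UNIV. exch E X i k * G i $ r) - (\<Sum>a\<in>UNIV. X k $ a * exchange_matrix A E $ r $ a))"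
      by (simp add: sv y b sum_distrib_left algebra_simps sum_negf)
    also have "\<dots> = 0"
      unfolding degree_balance[OF o vX dual] by simp
    finally have eq: "tside (yval w) ?a b k = tside (yval w) ?a (- b) k" by simp
    then have "val w (exchanged_variable k (clvar E v, b)) = tside (yval w) ?a (- c) k - ?a k"
      using val_exchanged[of w "clvar E v" k b, OF w clvar_Pos] by (simp add: c_def)
    also have "tside (yval w) ?a (- c) k = (\<Sum>i\<in>UNIV. of_int (n i) * ?a i)"
      using cF by (simp add: tside_def n_def of_int_max)
    also have "\<dots> = s * of_int ((\<Sum>i\<in>UNIV. n i *s G i) $ r)"
      by (simp add: sv sum_distrib_left mult_ac)
    finally show ?thesis
      using True by (simp add: clvar_snoc b_def G'_def sv algebra_simps)
  qed
  have "val (degw E r) (clvar E (v @ [k]) i) = 1 * of_int (G' i $ r)" for i r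
    by (rule deg'[OF additive_degw(1)]) (simp_all add: dg)
  moreover have "val (\<lambda>m. - degw E r m) (clvar E (v @ [k]) i) = (- 1) * of_int (G' i $ r)" for i r
    by (rule deg'[OF additive_degw(2)]) (simp_all add: dg)
  ultimately have "gdata E (v @ [k]) G'"
    unfolding gdata_def using lead' dual' by simp
  then show ?thesis by blast
qed

lemma gdata_exists: "orient E \<Longrightarrow> \<exists>G. gdata E v G"
proof (induction v rule: rev_induct)
  case Nil
  then show ?case using gdata_Nil by blast
next
  case (snoc k v)
  then show ?case using gdata_step by blast
qed

lemma gdata_keys:
  assumes o: "orient E" and G: "gdata E v G" and m: "m \<in> Poly_Mapping.keys (clexp E v i)"
  shows "monomial_degree (exchange_matrix A E) m = G i"
proof -
  have "degw E r m = of_int (G i $ r)" for r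
  proof (rule antisym)
    have "maxw (degw E r) (clexp E v i) = of_int (G i $ r)" "maxw (\<lambda>m. - degw E r m) (clexp E v i) = - of_int (G i $ r)"
      using G val_clvar[OF o additive_degw(1), of E r v i] val_clvar[OF o additive_degw(2), of E r v i]
      by (simp_all add: gdata_def)
    then show "degw E r m \<le> of_int (G i $ r)" "of_int (G i $ r) \<le> degw E r m"
      using maxw_ge[OF m, of "degw E r"] maxw_ge[OF m, of "\<lambda>m. - degw E r m"] by simp_all
  qed
  then show ?thesis
    unfolding degw_monomial_degree by (simp add: vec_eq_iff)
qed

lemma g_vector_clvar:
  assumes o: "orient E" and G: "gdata E v G"
  shows "g_vector (exchange_matrix A E) (clvar E v i) = G i"
  unfolding g_vector_def clexp_def[symmetric]
proof (rule the_equality)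
  show "\<forall>m\<in>Poly_Mapping.keys (clexp E v i). monomial_degree (exchange_matrix A E) m = G i"
    using gdata_keys[OF o G] by blast
  obtain m where m: "m \<in> Poly_Mapping.keys (clexp E v i)"
    using clexp_nonzero[OF o, of v i] by (metis keys_eq_empty ex_in_conv)
  fix g assume "\<forall>m\<in>Poly_Mapping.keys (clexp E v i). monomial_degree (exchange_matrix A E) m = g"
  then have "monomial_degree (exchange_matrix A E) m = g" using m by blast
  then show "g = G i" using gdata_keys[OF o G m] by simp
qed

lemma keys_frozen_inj:
  assumes o: "orient E" and m: "m \<in> Poly_Mapping.keys (clexp E v i)" "n \<in> Poly_Mapping.keys (clexp E v i)"
    and eq: "\<And>j. lkp m (FrozVar j) = lkp n (FrozVar j)"
  shows "m = n"
proof (rule exponent_eqI[OF _ eq])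
  fix r
  obtain G where G: "gdata E v G" using gdata_exists[OF o] by blast
  have "degw E r m = degw E r n"
    unfolding degw_monomial_degree using gdata_keys[OF o G m(1)] gdata_keys[OF o G m(2)] by simp
  then show "lkp m (MutVar r) = lkp n (MutVar r)"
    by (simp add: degw_def eq)
qed

definition yvec :: "('n var \<Rightarrow>\<^sub>0 int) \<Rightarrow> (real, 'n) vec" where
  "yvec m = (\<chi> i. real_of_int (lkp m (FrozVar i)))"

lemma lookup_map_key_FrozVar: "lkp (Poly_Mapping.map_key FrozVar m) i = lkp m (FrozVar i)"
  by (simp add: map_key.rep_eq inj_def)

lemma newton_polytope_clvar:
  assumes o: "orient E"
  shows "newton_polytope (F_polynomial (clvar E v i)) = convex hull (yvec ` Poly_Mapping.keys (clexp E v i))"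
proof -
  let ?L = "clexp E v i" and ?p = "Poly_Mapping.map_key FrozVar :: _ \<Rightarrow> 'n \<Rightarrow>\<^sub>0 int"
  have inj: "m = n" if "m \<in> Poly_Mapping.keys ?L" "n \<in> Poly_Mapping.keys ?L" "?p m = ?p n" for m n
  proof (rule keys_frozen_inj[OF o that(1,2)])
    fix j
    have "lkp (?p m) j = lkp (?p n) j" using that(3) by simp
    then show "lkp m (FrozVar j) = lkp n (FrozVar j)" by (simp add: lookup_map_key_FrozVar)
  qed
  have F: "F_polynomial (clvar E v i) = (\<Sum>m\<in>Poly_Mapping.keys ?L. Poly_Mapping.single (?p m) (lkp ?L m))"
    by (simp add: F_polynomial_def clexp_def Let_def)
  have look: "lkp (F_polynomial (clvar E v i)) k = (\<Sum>m\<in>Poly_Mapping.keys ?L. if ?p m = k then lkp ?L m else 0)" for k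
    unfolding F lookup_sum by (intro sum.cong) (auto simp: lookup_single when_def)
  have "Poly_Mapping.keys (F_polynomial (clvar E v i)) = ?p ` Poly_Mapping.keys ?L"
  proof
    show "Poly_Mapping.keys (F_polynomial (clvar E v i)) \<subseteq> ?p ` Poly_Mapping.keys ?L"
    proof
      fix k assume "k \<in> Poly_Mapping.keys (F_polynomial (clvar E v i))"
      then have nz: "(\<Sum>m\<in>Poly_Mapping.keys ?L. if ?p m = k then lkp ?L m else 0) \<noteq> 0"
        by (simp add: in_keys_iff look)
      show "k \<in> ?p ` Poly_Mapping.keys ?L"
      proof (rule ccontr)
        assume "k \<notin> ?p ` Poly_Mapping.keys ?L"
        then have "(\<Sum>m\<in>Poly_Mapping.keys ?L. if ?p m = k then lkp ?L m else 0) = 0"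
          by (intro sum.neutral) auto
        then show False using nz by simp
      qed
    qed
    show "?p ` Poly_Mapping.keys ?L \<subseteq> Poly_Mapping.keys (F_polynomial (clvar E v i))"
    proof
      fix k assume "k \<in> ?p ` Poly_Mapping.keys ?L"
      then obtain n where n: "n \<in> Poly_Mapping.keys ?L" "k = ?p n" by blast
      have "lkp (F_polynomial (clvar E v i)) k = (\<Sum>m\<in>Poly_Mapping.keys ?L. if m = n then lkp ?L n else 0)"
        unfolding look using inj n by (intro sum.cong) auto
      then show "k \<in> Poly_Mapping.keys (F_polynomial (clvar E v i))"
        using n by (simp add: in_keys_iff)
    qed
  qed
  then show ?thesis
    by (simp add: newton_polytope_def image_image lookup_map_key_FrozVar yvec_def)
qed

text \<open>The weight whose maximum over a Laurent expansion is the support function of the Newton polytope.\<close>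

definition frow :: "(real, 'n) vec \<Rightarrow> ('n var \<Rightarrow>\<^sub>0 int) \<Rightarrow> real" where
  "frow w m = w \<bullet> yvec m"

lemma frow_alt: "frow w m = (\<Sum>i\<in>UNIV. w $ i * of_int (lkp m (FrozVar i)))"
  by (simp add: frow_def inner_vec_def yvec_def)

lemma additive_frow: "additive (frow w)"
  by (simp add: additive_def frow_alt lookup_add algebra_simps sum.distrib)

end

section \<open>Relabelling seeds\<close>

text \<open>Frozen rows keep their labels, since only the members of the cluster are
  permuted.\<close>

definition relabel :: "('n \<Rightarrow> 'n) \<Rightarrow> 'n::finite extended_matrix \<Rightarrow> 'n extended_matrix" where
  "relabel p b = (\<chi> u j. case u of MutVar i \<Rightarrow> b $ MutVar (p i) $ p j | FrozVar i \<Rightarrow> b $ FrozVar i $ p j)"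

lemma relabel_nth [simp]: "relabel p b $ MutVar i $ j = b $ MutVar (p i) $ p j"
  "relabel p b $ FrozVar i $ j = b $ FrozVar i $ p j"
  by (simp_all add: relabel_def)

lemma extended_eqI:
  "(\<And>i j. b $ MutVar i $ j = c $ MutVar i $ j) \<Longrightarrow> (\<And>i j. b $ FrozVar i $ j = c $ FrozVar i $ j) \<Longrightarrow> b = c"
  unfolding vec_eq_iff by (intro allI, case_tac i) simp_all

lemma relabel_mutation:
  assumes p: "inj p"
  shows "matrix_mutation k (relabel p b) = relabel p (matrix_mutation (p k) b)"
  using inj_eq[OF p] by (intro extended_eqI) (simp_all add: matrix_mutation_nth)

lemma relabel_relabel: "relabel p (relabel q b) = relabel (q \<circ> p) b"
  by (rule extended_eqI) simp_all

lemma relabel_id [simp]: "relabel id b = b"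
  by (rule extended_eqI) simp_all

lemma sum_bij: "bij p \<Longrightarrow> (\<Sum>i\<in>UNIV. f (p i)) = (\<Sum>i\<in>UNIV. f i)"
  using sum.reindex_bij_betw[of p UNIV UNIV f] by (simp add: bij_def bij_betw_def)

lemma prod_bij: "bij p \<Longrightarrow> (\<Prod>i\<in>UNIV. f (p i)) = (\<Prod>i\<in>UNIV. f i)"
  using prod.reindex_bij_betw[of p UNIV UNIV f] by (simp add: bij_def bij_betw_def)

lemma tside_relabel: "bij p \<Longrightarrow> tside y (a \<circ> p) (relabel p b) k = tside y a b (p k)"
  using sum_bij[of p "\<lambda>i. max 0 (of_int (b $ MutVar i $ p k)) * a i"] by (simp add: tside_def)

lemma tside_relabel_uminus: "bij p \<Longrightarrow> tside y (a \<circ> p) (- relabel p b) k = tside y a (- b) (p k)"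
  using sum_bij[of p "\<lambda>i. max 0 (- of_int (b $ MutVar i $ p k)) * a i"] by (simp add: tside_def)

lemma tmut_relabel:
  assumes p: "bij p"
  shows "tmut y k (a \<circ> p, relabel p b) = (fst (tmut y (p k) (a, b)) \<circ> p, relabel p (snd (tmut y (p k) (a, b))))"
  using inj_eq[OF bij_is_inj[OF p]]
  by (auto simp: tmut_def tside_relabel[OF p] tside_relabel_uminus[OF p] relabel_mutation[OF bij_is_inj[OF p]] fun_eq_iff)

lemma tmut_fold_relabel:
  assumes p: "bij p"
  shows "fold (tmut y) v (a \<circ> p, relabel p b) =
    (fst (fold (tmut y) (map p v) (a, b)) \<circ> p, relabel p (snd (fold (tmut y) (map p v) (a, b))))"
proof (induction v arbitrary: a b)
  case (Cons k v)
  have "fold (tmut y) (k # v) (a \<circ> p, relabel p b) = fold (tmut y) v (fst (tmut y (p k) (a, b)) \<circ> p, relabel p (snd (tmut y (p k) (a, b))))"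
    unfolding fold_simps tmut_relabel[OF p] ..
  then show ?case unfolding Cons.IH prod.collapse list.map fold_simps .
qed (simp del: o_apply)

lemma prod_var:
  fixes f :: "'n::finite var \<Rightarrow> 'a::comm_monoid_mult"
  shows "(\<Prod>v\<in>UNIV. f v) = (\<Prod>i\<in>UNIV. f (MutVar i)) * (\<Prod>i\<in>UNIV. f (FrozVar i))"
proof -
  have "(\<Prod>v\<in>UNIV. f v) = prod f (range MutVar) * prod f (range FrozVar)"
    unfolding UNIV_var by (rule prod.union_disjoint) auto
  also have "\<dots> = (\<Prod>i\<in>UNIV. f (MutVar i)) * (\<Prod>i\<in>UNIV. f (FrozVar i))"
    by (simp add: prod.reindex inj_on_def)
  finally show ?thesis .
qed

lemma exchanged_relabel:
  assumes p: "bij p"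
  shows "exchanged_variable k (x \<circ> p, relabel p b) = exchanged_variable (p k) (x, b)"
  using prod_bij[OF p, of "\<lambda>i. x i ^ nat (b $ MutVar i $ p k)"] prod_bij[OF p, of "\<lambda>i. x i ^ nat (- b $ MutVar i $ p k)"]
  by (simp add: exchanged_variable_alt prod_var seed_element_def)

lemma seed_relabel:
  assumes p: "bij p"
  shows "seed_mutation k (x \<circ> p, relabel p b) =
    (fst (seed_mutation (p k) (x, b)) \<circ> p, relabel p (snd (seed_mutation (p k) (x, b))))"
  using inj_eq[OF bij_is_inj[OF p]]
  by (auto simp: seed_mutation_pair exchanged_relabel[OF p] relabel_mutation[OF bij_is_inj[OF p]] fun_eq_iff)

lemma run_relabel:
  assumes p: "bij p"
  shows "run v (x \<circ> p, relabel p b) = (fst (run (map p v) (x, b)) \<circ> p, relabel p (snd (run (map p v) (x, b))))"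
proof (induction v arbitrary: x b)
  case (Cons k v)
  have "run (k # v) (x \<circ> p, relabel p b) = run v (fst (seed_mutation (p k) (x, b)) \<circ> p, relabel p (snd (seed_mutation (p k) (x, b))))"
    unfolding fold_simps seed_relabel[OF p] ..
  then show ?case unfolding Cons.IH prod.collapse list.map fold_simps .
qed (simp del: o_apply)

lemma mutations_relabel:
  "bij p \<Longrightarrow> fold matrix_mutation v (relabel p b) = relabel p (fold matrix_mutation (map p v) b)"
  by (induction v arbitrary: b) (simp_all add: relabel_mutation bij_is_inj)

lemma snd_tmut: "snd (tmut y k s) = matrix_mutation k (snd s)"
  by (cases s) (simp add: tmut_def)

lemma tmut_involution:
  assumes "b $ MutVar k $ k = 0"
  shows "tmut y k (tmut y k (a, b)) = (a, b)"
proof -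
  have t: "tside y (a(k := z)) (matrix_mutation k b) k = tside y a (- b) k"
    "tside y (a(k := z)) (- matrix_mutation k b) k = tside y a b k" for z
    using assms by (auto simp: tside_def matrix_mutation_nth intro!: arg_cong2[of _ _ _ _ "(+)"] sum.cong)
  show ?thesis
    by (simp add: tmut_def t matrix_mutation_involution[OF assms] max.commute)
qed

section \<open>The tuple of c-vectors determines the cluster\<close>

context lcartan begin

lemma ematrix_diag: "orient E \<Longrightarrow> ematrix E v $ MutVar k $ k = 0"
  by (simp add: link(2))

lemma run_back:
  assumes o: "orient E"
  shows "run (rev w) (clvar E (v @ w), ematrix E (v @ w)) = (clvar E v, ematrix E v)"
proof (induction w rule: rev_induct)
  case (snoc k w)
  have "(clvar E (v @ w @ [k]), ematrix E (v @ w @ [k])) = seed_mutation k (clvar E (v @ w), ematrix E (v @ w))"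
    using clvar_snoc[of E "v @ w" k] ematrix_snoc[of E "v @ w" k] by (simp add: seed_mutation_pair)
  then have "seed_mutation k (clvar E (v @ w @ [k]), ematrix E (v @ w @ [k])) = (clvar E (v @ w), ematrix E (v @ w))"
    by (simp only: seed_mutation_involution[OF ematrix_diag[OF o] clvar_Pos])
  then show ?case using snoc.IH by simp
qed simp

lemma mutations_back:
  assumes o: "orient E"
  shows "fold matrix_mutation (rev w) (ematrix E (v @ w)) = ematrix E v"
  using arg_cong[OF run_back[OF o, of w v], of snd] by (simp add: snd_run)

lemma tmut_back:
  assumes o: "orient E"
  shows "fold (tmut y) (rev v) (fold (tmut y) v (a, mat0 E)) = (a, mat0 E)"
proof (induction v rule: rev_induct)
  case (snoc k v)
  have s: "snd (fold (tmut y) v (a, mat0 E)) = ematrix E v" for v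
  proof (induction v rule: rev_induct)
    case (snoc k v)
    then show ?case by (simp add: snd_tmut ematrix_snoc)
  qed (simp add: ematrix_Nil)
  obtain a' where a': "fold (tmut y) v (a, mat0 E) = (a', ematrix E v)"
    using s[of v] by (metis prod.collapse)
  then show ?case
    using snoc.IH by (simp add: tmut_involution[OF ematrix_diag[OF o]])
qed simp

lemma gdata_permutation:
  assumes o: "orient E" and G: "gdata E v G" and p: "inj p" and t: "ctuple E v = (\<lambda>j. axis (p j) 1)"
  shows "G i = axis (p i) 1"
proof -
  have g: "d (p j) * of_int (G i $ p j) = (if i = j then d j else 0)" for j
    using G unfolding gdata_def t dpairing_axis by blast
  have dd: "d j = d (p j)" for j
    using isroot_same_length[OF o validD(1)[OF link(1)[OF o, of v], of j], of "p j"] by (simp add: t)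
  have "bij p" using p by (simp add: bij_def finite_UNIV_inj_surj)
  have "G i $ r = (axis (p i) 1 :: 'n int_vector) $ r" for r
  proof -
    obtain j where r: "r = p j" using \<open>bij p\<close> by (metis bij_pointE)
    show ?thesis
    proof (cases "i = j")
      case True
      then have "d (p j) * of_int (G i $ p j) = d (p j) * of_int 1" using g[of j] dd[of j] by simp
      then have "G i $ p j = 1" unfolding dk_cancel .
      then show ?thesis using r True by (simp add: axis_def)
    next
      case False
      then have "G i $ p j = 0" using g[of j] d_pos[of "p j"] by simp
      then show ?thesis using r False inj_eq[OF p] by (simp add: axis_def)
    qed
  qed
  then show ?thesis by (simp add: vec_eq_iff)
qed

lemma ctuple_relabel_mat0:
  assumes "ematrix E v = relabel p (mat0 E)"
  shows "ctuple E v = (\<lambda>j. axis (p j) 1)"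
  using assms by (auto simp: fun_eq_iff vec_eq_iff ctuple_def mat0_nth axis_def)

text \<open>Permuted simple roots have permuted unit vectors as g-vectors, so the leading monomial
  is a single initial variable.\<close>

lemma lead_permutation:
  assumes o: "orient E" and p: "bij p" and m: "ematrix E v = relabel p (mat0 E)"
  shows "lead fro (clexp E v i) (Poly_Mapping.single (MutVar (p i)) 1)"
proof -
  obtain G where G: "gdata E v G" using gdata_exists[OF o] by blast
  have "G i = axis (p i) 1"
    by (rule gdata_permutation[OF o G bij_is_inj[OF p] ctuple_relabel_mat0[OF m]])
  then have "xmono (G i) = Poly_Mapping.single (MutVar (p i)) 1"
    by (intro exponent_eqI) (simp_all add: lookup_single when_def axis_def)
  moreover have "lead fro (clexp E v i) (xmono (G i))" using G unfolding gdata_def by blast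
  ultimately show ?thesis by simp
qed

lemma val_clvar_fold:
  assumes w: "additive w"
  shows "((\<lambda>i. val w (clvar E v i)), ematrix E v) = fold (tmut (yval w)) v ((\<lambda>i. w (Poly_Mapping.single (MutVar i) 1)), mat0 E)"
proof -
  have "fst (gens, mat0 E) i \<in> Pos" for i by (simp add: gen_Pos)
  note val_run[OF w this, of v]
  then show ?thesis by (simp add: run_eq val_gen[OF w])
qed

text \<open>A seed with the initial matrix has nonnegative tropical values, because the initial monomial
  occurs in each Laurent expansion. Running the path backwards returns to the initial values, so the
  same argument applied to the reversed path shows that the values are also nonpositive.\<close>

lemma clvar_permutation:
  assumes o: "orient E" and p: "bij p" and m: "ematrix E v = relabel p (mat0 E)"
  shows "clvar E v i = gens (p i)"
proof -
  have zero: "val (frow w) (clvar E v j) = 0" for w j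
  proof -
    define a where "a j = val (frow w) (clvar E v j)" for j
    have a0: "a j \<ge> 0" for j
    proof -
      have "frow w (Poly_Mapping.single (MutVar (p j)) 1) \<le> maxw (frow w) (clexp E v j)"
        by (rule maxw_ge) (rule lead_keys[OF lead_permutation[OF o p m]])
      then show ?thesis
        by (simp add: a_def val_clvar[OF o additive_frow] frow_alt lookup_single when_def)
    qed
    define q where "q = inv p"
    have q: "bij q" and pq: "p (q i) = i" "q (p i) = i" for i
      using p by (simp_all add: q_def bij_imp_bij_inv surj_f_inv_f[OF bij_is_surj] inv_f_f[OF bij_is_inj])
    define a' where "a' = a \<circ> q"
    define u where "u = map p (rev v)"
    define l where "l m = (\<Sum>i\<in>UNIV. a' i * of_int (lkp m (MutVar i))) + frow w m" for m
    have l: "additive l"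
      by (simp add: additive_def l_def additive_add[OF additive_frow] lookup_add algebra_simps sum.distrib)
    have lM: "l (Poly_Mapping.single (MutVar j) 1) = a' j" for j
    proof -
      have "(\<Sum>i\<in>UNIV. a' i * of_int (lkp (Poly_Mapping.single (MutVar j) (1::int)) (MutVar i))) = (\<Sum>i\<in>UNIV. if i = j then a' j else 0)"
        by (intro sum.cong) (auto simp: lookup_single when_def)
      then show ?thesis by (simp add: l_def frow_alt lookup_single when_def)
    qed
    have yl: "yval l = yval (frow w)"
      by (rule ext) (simp add: yval_def l_def lookup_single when_def)
    have f0: "(\<lambda>i. frow w (Poly_Mapping.single (MutVar i) 1)) = (\<lambda>_. 0)"
      by (rule ext) (simp add: frow_alt lookup_single when_def)
    have "a = (\<lambda>j. val (frow w) (clvar E v j))" by (rule ext) (simp add: a_def)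
    then have "(a, ematrix E v) = fold (tmut (yval (frow w))) v ((\<lambda>_. 0), mat0 E)"
      using val_clvar_fold[OF additive_frow, of w E v] unfolding f0 by simp
    then have "fold (tmut (yval (frow w))) (rev v) (a, ematrix E v) = ((\<lambda>_. 0), mat0 E)"
      by (simp only: tmut_back[OF o])
    moreover have "(a, ematrix E v) = (a' \<circ> p, relabel p (mat0 E))"
      using m by (simp add: a'_def o_assoc[symmetric] fun_eq_iff pq)
    ultimately have b: "fst (fold (tmut (yval (frow w))) u (a', mat0 E)) \<circ> p = (\<lambda>_. 0)"
      "relabel p (snd (fold (tmut (yval (frow w))) u (a', mat0 E))) = mat0 E"
      by (simp_all add: tmut_fold_relabel[OF p] u_def)
    have fu: "fold (tmut (yval (frow w))) u (a', mat0 E) = ((\<lambda>i. val l (clvar E u i)), ematrix E u)"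
      using val_clvar_fold[OF l, of E u] by (simp add: lM yl)
    have "ematrix E u = relabel q (relabel p (ematrix E u))"
      unfolding relabel_relabel by (simp add: pq o_def flip: id_def)
    then have mu: "ematrix E u = relabel q (mat0 E)"
      using b(2) fu by simp
    have "a' k \<le> 0" for k
    proof -
      have "val l (clvar E u (p k)) = 0"
        using fun_cong[OF b(1), of k] fu by simp
      moreover have "l (Poly_Mapping.single (MutVar (q (p k))) 1) \<le> maxw l (clexp E u (p k))"
        by (rule maxw_ge) (rule lead_keys[OF lead_permutation[OF o q mu]])
      ultimately show ?thesis
        by (simp add: val_clvar[OF o l] lM pq)
    qed
    from this[of "p j"] have "a j \<le> 0" by (simp add: a'_def pq)
    then show ?thesis using a0[of j] by (simp add: a_def)
  qed
  \<comment> \<open>The valuation vanishes for opposite weights, which leaves no room for a nonzero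
    frozen exponent.\<close>
  have F0: "lkp m (FrozVar j) = 0" if m: "m \<in> Poly_Mapping.keys (clexp E v i)" for m j
  proof -
    have le: "frow w m \<le> 0" for w
      using maxw_ge[OF m, of "frow w"] zero[of w i] by (simp add: val_clvar[OF o additive_frow])
    have "frow (axis j 1) m = of_int (lkp m (FrozVar j))" "frow (- axis j 1) m = - of_int (lkp m (FrozVar j))"
      by (simp_all add: frow_def inner_axis' yvec_def)
    then show ?thesis using le[of "axis j 1"] le[of "- axis j 1"] by simp
  qed
  have ld: "lead fro (clexp E v i) (Poly_Mapping.single (MutVar (p i)) 1)"
    by (rule lead_permutation[OF o p m])
  have "m = Poly_Mapping.single (MutVar (p i)) 1" if m: "m \<in> Poly_Mapping.keys (clexp E v i)" for m
  proof (rule ccontr)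
    assume "m \<noteq> Poly_Mapping.single (MutVar (p i)) 1"
    then have "fro m < fro (Poly_Mapping.single (MutVar (p i)) 1)"
      using ld m unfolding lead_def by blast
    then show False by (simp add: fro_def F0[OF m] lookup_single when_def)
  qed
  then have k: "Poly_Mapping.keys (clexp E v i) = {Poly_Mapping.single (MutVar (p i)) 1}"
    using lead_keys[OF ld] by blast
  have "clexp E v i = gvar (MutVar (p i))"
  proof (rule poly_mapping_eqI)
    fix m
    show "lkp (clexp E v i) m = lkp (gvar (MutVar (p i))) m"
    proof (cases "m = Poly_Mapping.single (MutVar (p i)) 1")
      case True
      then show ?thesis using ld by (simp add: gvar_def lead_def)
    next
      case False
      then have "m \<notin> Poly_Mapping.keys (clexp E v i)" by (simp add: k)
      then show ?thesis using False by (simp add: gvar_def lookup_single when_def in_keys_iff)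
    qed
  qed
  then show ?thesis
    using emb_clexp[OF o, of v i] by (simp add: gen_emb)
qed

text \<open>Appending to \<open>v\<close> the relabelled reverse of \<open>u\<close> produces the
  initial matrix up to a permutation, where \<open>clvar_permutation\<close> applies; running back
  gives the claim.\<close>

lemma clvar_relabel:
  assumes o: "orient E" and p: "bij p" and m: "ematrix E v = relabel p (ematrix E u)"
  shows "clvar E v i = clvar E u (p i)"
proof -
  define q where "q = inv p"
  have q: "bij q" and pq: "p \<circ> q = id" "q \<circ> p = id"
    using p by (simp_all add: q_def bij_imp_bij_inv surj_iff[symmetric] inj_iff[symmetric] bij_is_surj bij_is_inj)
  define w where "w = map q (rev u)"
  have pw: "map p w = rev u" "map p (rev w) = u"
    unfolding w_def rev_map[symmetric] by (simp_all add: pq)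
  have "fold matrix_mutation (map p w) (ematrix E u) = mat0 E"
    using mutations_back[OF o, of u "[]"] by (simp add: pw ematrix_Nil)
  then have vw: "ematrix E (v @ w) = relabel p (mat0 E)"
    unfolding ematrix_append m mutations_relabel[OF p] by simp
  have "clvar E (v @ w) = gens \<circ> p"
    using clvar_permutation[OF o p vw] by (simp add: fun_eq_iff)
  then have "(clvar E v, ematrix E v) = run (rev w) (gens \<circ> p, relabel p (mat0 E))"
    using run_back[OF o, of w v] vw by simp
  also have "\<dots> = (clvar E u \<circ> p, relabel p (ematrix E u))"
    unfolding run_relabel[OF p] pw run_eq by simp
  finally show ?thesis by simp
qed

text \<open>The tuple determines the whole extended matrix, its mutable rows through
  \<open>exch\<close>, so \<open>clvar_relabel\<close> applies.\<close>

theorem same_tuple: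
  assumes o: "orient E" and p: "bij p" and t: "ctuple E v = (\<lambda>j. ctuple E u (p j))"
  shows "clvar E v i = clvar E u (p i)"
proof (rule clvar_relabel[OF o p])
  have dd: "d j = d (p j)" for j
    using validD(1)[OF link(1)[OF o, of v], of j] validD(1)[OF link(1)[OF o, of u], of "p j"]
    by (simp add: isroot_def t)
  show "ematrix E v = relabel p (ematrix E u)"
  proof (rule extended_eqI)
    fix i j
    have "d i * of_int (exch E (ctuple E v) i j) = d i * of_int (exch E (ctuple E u) (p i) (p j))"
      using exch_valid[OF o link(1)[OF o, of v], of i j] exch_valid[OF o link(1)[OF o, of u], of "p i" "p j"] dd[of i]
      by (simp add: t)
    then show "ematrix E v $ MutVar i $ j = relabel p (ematrix E u) $ MutVar i $ j"
      unfolding dk_cancel by (simp add: link(2)[OF o])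
    show "ematrix E v $ FrozVar i $ j = relabel p (ematrix E u) $ FrozVar i $ j"
      using fun_cong[OF t, of j] by (simp add: ctuple_def vec_eq_iff)
  qed
qed

section \<open>Words, clusters and finiteness\<close>

lemma finite_tuples:
  assumes o: "orient E"
  shows "finite (range (ctuple E))"
  by (rule finite_subset[OF _ finite_valid[of E]]) (use link(1)[OF o] in auto)

lemma seeds_words: "seeds (exchange_matrix A E) = range (\<lambda>v. (clvar E v, ematrix E v))"
proof
  show "seeds (exchange_matrix A E) \<subseteq> range (\<lambda>v. (clvar E v, ematrix E v))"
  proof
    fix s assume "s \<in> seeds (exchange_matrix A E)"
    then show "s \<in> range (\<lambda>v. (clvar E v, ematrix E v))"
    proof induction
      case initial
      show ?case
        by (rule range_eqI[of _ _ "[]"]) (simp add: principal_seed_eq clvar_Nil ematrix_Nil)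
    next
      case (mutation s k)
      then obtain v where "s = (clvar E v, ematrix E v)" by blast
      then have "seed_mutation k s = (clvar E (v @ [k]), ematrix E (v @ [k]))"
        by (simp add: seed_mutation_pair clvar_snoc ematrix_snoc)
      then show ?case by blast
    qed
  qed
  have "(clvar E v, ematrix E v) \<in> seeds (exchange_matrix A E)" for v
  proof (induction v rule: rev_induct)
    case Nil
    show ?case using seeds.initial[of "exchange_matrix A E"] run_eq[of "[]" E] by (simp add: principal_seed_eq)
  next
    case (snoc k v)
    then show ?case
      unfolding clvar_snoc ematrix_snoc seed_mutation_pair[symmetric] by (rule seeds.mutation)
  qed
  then show "range (\<lambda>v. (clvar E v, ematrix E v)) \<subseteq> seeds (exchange_matrix A E)" by blast
qed

lemma clusters_words: "clusters (exchange_matrix A E) = range (\<lambda>v. range (clvar E v))"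
  unfolding clusters_def seeds_words by auto

lemma cluster_variables_words: "cluster_variables (exchange_matrix A E) = (\<Union>v. range (clvar E v))"
  unfolding cluster_variables_def clusters_words by simp

text \<open>By \<open>same_tuple\<close> a cluster is a function of its tuple, and there are
  finitely many valid tuples.\<close>

lemma finite_cluster_variables:
  assumes o: "orient E"
  shows "finite (cluster_variables (exchange_matrix A E))"
proof -
  define f where "f X = clvar E (SOME v. ctuple E v = X)" for X
  have "clvar E v = f (ctuple E v)" for v
  proof -
    define u where "u = (SOME u. ctuple E u = ctuple E v)"
    have "ctuple E u = ctuple E v" unfolding u_def by (rule someI[of _ v]) simp
    then have "clvar E v i = clvar E u i" for i
      using same_tuple[OF o bij_id, of v u i] by simp
    then show ?thesis by (simp add: f_def u_def fun_eq_iff)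
  qed
  then have "(\<Union>v. range (clvar E v)) \<subseteq> (\<Union>X\<in>range (ctuple E). range (f X))" by auto
  moreover have "finite (\<Union>X\<in>range (ctuple E). range (f X))"
    by (intro finite_UN_I finite_tuples o) simp
  ultimately show ?thesis
    unfolding cluster_variables_words by (rule finite_subset)
qed

section \<open>Tropical values and coefficients along source sequences\<close>

definition rpairing :: "(real, 'n) vec \<Rightarrow> 'n int_vector \<Rightarrow> real" where
  "rpairing w x = w \<bullet> real_vector x"

lemma rpairing_alt: "rpairing w x = (\<Sum>i\<in>UNIV. w $ i * of_int (x $ i))"
  by (simp add: rpairing_def real_vector_def inner_vec_def)

lemma rpairing_axis [simp]: "rpairing w (axis k 1) = w $ k"
proof -
  have "rpairing w (axis k 1) = (\<Sum>i\<in>UNIV. if i = k then w $ k else 0)"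
    unfolding rpairing_alt by (intro sum.cong) (auto simp: axis_def)
  then show ?thesis by simp
qed

lemma rpairing_right: "rpairing w (x + y) = rpairing w x + rpairing w y" "rpairing w (- x) = - rpairing w x" "rpairing w (c *s x) = of_int c * rpairing w x"
  by (simp_all add: rpairing_alt algebra_simps sum.distrib sum_negf sum_distrib_left)

lemma rpairing_left: "rpairing (v + w) x = rpairing v x + rpairing w x" "rpairing (v - w) x = rpairing v x - rpairing w x" "rpairing (r *\<^sub>R w) x = r * rpairing w x" "rpairing (- w) x = - rpairing w x"
  by (simp_all add: rpairing_def algebra_simps)

lemma rpairing_sum_left: "rpairing (sum f I) x = (\<Sum>i\<in>I. rpairing (f i) x)"
  by (simp add: rpairing_def inner_sum_left)

lemma rpairing_lincomb: "rpairing w (lincomb x X) = (\<Sum>l\<in>UNIV. of_int (x l) * rpairing w (X l))"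
proof -
  have "rpairing w (lincomb x X) = (\<Sum>i\<in>UNIV. \<Sum>l\<in>UNIV. of_int (x l) * (w $ i * of_int (X l $ i)))"
    by (simp add: rpairing_alt lincomb_nth sum_distrib_left mult_ac)
  also have "\<dots> = (\<Sum>l\<in>UNIV. of_int (x l) * rpairing w (X l))"
    by (subst sum.swap) (simp add: rpairing_alt sum_distrib_left)
  finally show ?thesis .
qed

definition trop :: "('n \<times> 'n) set \<Rightarrow> 'n list \<Rightarrow> 'n \<Rightarrow> (real, 'n) vec \<Rightarrow> real" where
  "trop E u i w = val (frow w) (clvar E u i)"

text \<open>Tropical value of the coefficients usually written y-hat: in column \<open>k\<close>,
  the difference of the weights of the two exchange monomials.\<close>

definition trop_coeff :: "('n \<times> 'n) set \<Rightarrow> 'n list \<Rightarrow> (real, 'n) vec \<Rightarrow> (real, 'n) vec" where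
  "trop_coeff E u w = (\<chi> k. (\<Sum>i\<in>UNIV. of_int (ematrix E u $ MutVar i $ k) * trop E u i w) + (\<Sum>i\<in>UNIV. of_int (ematrix E u $ FrozVar i $ k) * w $ i))"

text \<open>The weight of the monomial with the negative entries; the tropical exchange relation
  becomes this value plus a truncated coefficient.\<close>

definition trop_low :: "('n \<times> 'n) set \<Rightarrow> 'n list \<Rightarrow> 'n \<Rightarrow> (real, 'n) vec \<Rightarrow> real" where
  "trop_low E u k w = (\<Sum>i\<in>UNIV. max 0 (- of_int (ematrix E u $ MutVar i $ k)) * trop E u i w) + (\<Sum>i\<in>UNIV. max 0 (- of_int (ematrix E u $ FrozVar i $ k)) * w $ i)"

lemma trop_Nil [simp]: "trop E [] i w = 0"
  by (simp add: trop_def clvar_Nil val_gen additive_frow frow_alt lookup_single when_def)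

lemma trop_coeff_Nil [simp]: "trop_coeff E [] w = w"
proof -
  have "(\<Sum>i\<in>UNIV. of_int (if i = k then 1 else 0) * w $ i) = (\<Sum>i\<in>UNIV. if i = k then w $ k else 0)" for k
    by (intro sum.cong) auto
  then show ?thesis
    by (simp add: trop_coeff_def vec_eq_iff ematrix_Nil mat0_nth)
qed

lemma yval_frow: "yval (frow w) i = w $ i"
proof -
  have "yval (frow w) i = (\<Sum>j\<in>UNIV. if j = i then w $ i else 0)"
    unfolding yval_def frow_alt by (intro sum.cong) (auto simp: lookup_single when_def)
  then show ?thesis by simp
qed

lemma trop_snoc_other: "i \<noteq> k \<Longrightarrow> trop E (u @ [k]) i w = trop E u i w"
  by (simp add: trop_def clvar_snoc)

lemma trop_snoc: "trop E (u @ [k]) k w = trop_low E u k w + max 0 (trop_coeff E u w $ k) - trop E u k w"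
proof -
  let ?a = "\<lambda>i. val (frow w) (clvar E u i)" and ?b = "ematrix E u" and ?y = "yval (frow w)"
  have n: "tside ?y ?a (- ?b) k = trop_low E u k w"
    by (simp add: tside_def trop_low_def trop_def yval_frow)
  have "max 0 x * t - max 0 (- x) * t = x * t" for x t :: real
    by (simp add: max_def)
  then have p: "tside ?y ?a ?b k - tside ?y ?a (- ?b) k = trop_coeff E u w $ k"
    by (simp add: tside_def trop_coeff_def trop_def yval_frow add_diff_add sum_subtractf[symmetric])
  have "trop E (u @ [k]) k w = max (tside ?y ?a ?b k) (tside ?y ?a (- ?b) k) - ?a k"
    unfolding trop_def clvar_snoc fun_upd_same by (rule val_exchanged[OF additive_frow clvar_Pos])
  then show ?thesis
    using p n by (simp add: trop_def max_def)
qed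

text \<open>At a source, column \<open>k\<close> is nonpositive and row \<open>k\<close>
  nonnegative, so the product terms of matrix mutation vanish and only signs change.\<close>

lemma ematrix_admissible:
  assumes o: "orient E" and u: "admissible E u"
  shows "ematrix E u $ MutVar i $ j = exchange_matrix A (fold flipE u E) $ i $ j"
  using u
proof (induction u arbitrary: i j rule: rev_induct)
  case Nil
  then show ?case by (simp add: ematrix_Nil mat0_nth)
next
  case (snoc k u)
  define F where "F = fold flipE u E"
  have F: "orient F" unfolding F_def by (rule orient_fold[OF o])
  have s: "(j, k) \<notin> F" for j
    using snoc.prems by (simp add: admissible_append F_def is_source_def)
  have IH: "ematrix E u $ MutVar i $ j = exchange_matrix A F $ i $ j" for i j
    using snoc by (simp add: admissible_append F_def)
  have "exchange_matrix A F $ i $ k \<le> 0" "exchange_matrix A F $ k $ j \<ge> 0"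
    using s offdiag[of i k] offdiag[of k j] orientD(1)[OF F] by (auto simp: exchange_matrix_def)
  then have "ematrix E (u @ [k]) $ MutVar i $ j =
      (if i = k \<or> j = k then - exchange_matrix A F $ i $ j else exchange_matrix A F $ i $ j)"
    by (simp add: ematrix_snoc matrix_mutation_nth IH max_def)
  also have "\<dots> = exchange_matrix A (flipE k F) $ i $ j"
    using s orientD(1)[OF F, of k k] by (auto simp: exchange_matrix_def flipE_iff)
  finally show ?case by (simp add: F_def)
qed

lemma ematrix_admissible_row:
  assumes o: "orient E" and u: "admissible E u" and s: "is_source (fold flipE u E) k" and j: "j \<noteq> k"
  shows "ematrix E u $ MutVar k $ j = - (A $ k $ j)"
  using orientD(3)[OF orient_fold[OF o, of u], of k j] s j
  by (auto simp: ematrix_admissible[OF o u] exchange_matrix_def is_source_def)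

text \<open>The tropical mutation of coefficients at a source has two linear pieces: a sign change
  of one coordinate where the \<open>k\<close>-th coefficient is nonnegative, the adjoint of the
  reflection where it is nonpositive. They correspond to the two branches of
  \<open>move\<close>.\<close>

lemma trop_coeff_snoc:
  assumes o: "orient E" and u: "admissible E u" and s: "is_source (fold flipE u E) k"
  shows "trop_coeff E (u @ [k]) w $ j = (if j = k then - trop_coeff E u w $ k else trop_coeff E u w $ j - of_int (A $ k $ j) * min 0 (trop_coeff E u w $ k))"
proof (cases "j = k")
  case True
  have "(\<Sum>i\<in>UNIV. of_int (ematrix E u $ MutVar i $ k) * trop E (u @ [k]) i w) = (\<Sum>i\<in>UNIV. of_int (ematrix E u $ MutVar i $ k) * trop E u i w)"
    using ematrix_diag[OF o, of u k] by (intro sum.cong refl, case_tac "x = k") (auto simp: trop_snoc_other)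
  then show ?thesis
    using True by (simp add: trop_coeff_def ematrix_snoc matrix_mutation_nth sum_negf)
next
  case False
  define c where "c = - real_of_int (A $ k $ j)"
  define b where "b = ematrix E u"
  have c: "c \<ge> 0" using offdiag[of k j] False by (simp add: c_def)
  have bk: "real_of_int (b $ MutVar k $ j) = c" "b $ MutVar k $ k = 0"
    by (simp_all add: b_def ematrix_admissible_row[OF o u s False] c_def ematrix_diag[OF o])
  then have b0: "b $ MutVar k $ j \<ge> 0" using c by linarith
  have m: "real_of_int (ematrix E (u @ [k]) $ v $ j) = (if v = MutVar k then - c else of_int (b $ v $ j) + c * max 0 (of_int (b $ v $ k)))" for v
    using False b0 bk by (simp add: ematrix_snoc matrix_mutation_nth b_def[symmetric] of_int_max)
  let ?H = "trop E u" and ?H' = "trop E (u @ [k])"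
  have "of_int (ematrix E (u @ [k]) $ MutVar i $ j) * ?H' i w =
      of_int (b $ MutVar i $ j) * ?H i w + c * (max 0 (of_int (b $ MutVar i $ k)) * ?H i w)
      + (if i = k then - c * (?H k w + ?H' k w) else 0)" for i
    by (cases "i = k") (simp_all add: m bk trop_snoc_other algebra_simps)
  then have "trop_coeff E (u @ [k]) w $ j = trop_coeff E u w $ j - c * (?H k w + ?H' k w)
      + c * ((\<Sum>i\<in>UNIV. max 0 (of_int (b $ MutVar i $ k)) * ?H i w) + (\<Sum>i\<in>UNIV. max 0 (of_int (b $ FrozVar i $ k)) * w $ i))"
    unfolding trop_coeff_def vec_lambda_beta by (simp add: m sum.distrib sum_distrib_left algebra_simps b_def[symmetric])
  also have "(\<Sum>i\<in>UNIV. max 0 (of_int (b $ MutVar i $ k)) * ?H i w) + (\<Sum>i\<in>UNIV. max 0 (of_int (b $ FrozVar i $ k)) * w $ i)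
      = trop_low E u k w + trop_coeff E u w $ k"
  proof -
    have e: "(\<Sum>i\<in>UNIV. max 0 (f i) * t i) = (\<Sum>i\<in>UNIV. max 0 (- f i) * t i) + (\<Sum>i\<in>UNIV. f i * t i)" for f t :: "'n \<Rightarrow> real"
      unfolding sum.distrib[symmetric] by (intro sum.cong refl) (simp add: max_def)
    show ?thesis
      using e[of "\<lambda>i. of_int (b $ MutVar i $ k)" "\<lambda>i. ?H i w"] e[of "\<lambda>i. of_int (b $ FrozVar i $ k)" "\<lambda>i. w $ i"]
      by (simp add: trop_low_def trop_coeff_def b_def)
  qed
  also have "trop_coeff E u w $ j - c * (?H k w + ?H' k w) + c * (trop_low E u k w + trop_coeff E u w $ k) = trop_coeff E u w $ j + c * min 0 (trop_coeff E u w $ k)"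
    unfolding trop_snoc by (simp add: max_def min_def algebra_simps)
  finally show ?thesis using False by (simp add: c_def)
qed

section \<open>Linearity on the cones dual to valid tuples\<close>

definition cone_of :: "('n \<Rightarrow> 'n int_vector) \<Rightarrow> (real, 'n) vec set" where
  "cone_of X = {w. \<forall>l. rpairing w (X l) \<ge> 0}"

lemma rpairing_neg_at: "rpairing (\<chi> j. if j = k then - y $ k else y $ j) (neg_at k x) = rpairing y x"
  unfolding rpairing_alt by (intro sum.cong) (auto simp: neg_at_nth)

lemma rpairing_refl_at: "rpairing (\<chi> j. y $ j - of_int (A $ k $ j) * y $ k) (refl_at k x) = rpairing y x"
proof -
  let ?s = "\<Sum>j\<in>UNIV. A $ k $ j * x $ j"
  let ?z = "\<chi> j. y $ j - of_int (A $ k $ j) * y $ k"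
  have "refl_at k x = x + (- ?s) *s axis k 1"
    by (simp add: refl_at_def vec_eq_iff)
  then have "rpairing ?z (refl_at k x) = rpairing ?z x + y $ k * of_int ?s"
    by (simp only: rpairing_right rpairing_axis) (simp add: diag)
  also have "rpairing ?z x = rpairing y x - y $ k * of_int ?s"
    by (simp add: rpairing_alt algebra_simps sum_subtractf sum_distrib_left)
  finally show ?thesis by simp
qed

text \<open>The \<open>k\<close>-th coordinate has constant sign on the cone, either because it is
  one of the defining inequalities or by \<open>row_sign\<close>. The applicable tropical piece is
  thus the one matching the branch of \<open>move\<close>.\<close>

lemma cone_sign:
  assumes o: "orient E" and s: "is_source E k" and v: "valid E X" and w: "w \<in> cone_of X"
  shows "(\<exists>i. X i = axis k 1) \<Longrightarrow> w $ k \<ge> 0" "\<not> (\<exists>i. X i = axis k 1) \<Longrightarrow> w $ k \<le> 0"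
proof -
  have X: "rpairing w (X l) \<ge> 0" for l using w by (simp add: cone_of_def)
  show "w $ k \<ge> 0" if "\<exists>i. X i = axis k 1"
    using that X by (metis rpairing_axis)
  assume "\<not> (\<exists>i. X i = axis k 1)"
  then have ne: "X i \<noteq> axis k 1" for i by blast
  obtain x where x: "axis k 1 = lincomb x X"
    using validD(2)[OF v] unfolding spans_def by blast
  have "w $ k = (\<Sum>l\<in>UNIV. of_int (x l) * rpairing w (X l))"
    unfolding rpairing_lincomb[symmetric] x[symmetric] by simp
  also have "\<dots> \<le> 0"
    using row_sign[OF o s v ne x] X by (intro sum_nonpos mult_nonpos_nonneg) simp_all
  finally show "w $ k \<le> 0" .
qed

text \<open>By \<open>cone_sign\<close> each step acts on the coefficients by the map adjoint to the
  move, so pairings with the moved tuple are preserved.\<close>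

lemma trop_coeff_cone:
  assumes o: "orient E" and u: "admissible E u" and v: "valid E X" and w: "w \<in> cone_of X"
  shows "rpairing (trop_coeff E u w) (fold move u X l) = rpairing w (X l)"
  using u
proof (induction u arbitrary: l rule: rev_induct)
  case (snoc k u)
  define F where "F = fold flipE u E"
  define Z where "Z = fold move u X"
  define y where "y = trop_coeff E u w"
  have F: "orient F" unfolding F_def by (rule orient_fold[OF o])
  have u: "admissible E u" and s: "is_source F k"
    using snoc.prems by (simp_all add: admissible_append F_def)
  have Z: "valid F Z" unfolding F_def Z_def by (rule valid_moves[OF o u v])
  have IH: "rpairing y (Z l) = rpairing w (X l)" for l
    using snoc.IH[OF u] by (simp add: y_def Z_def)
  then have y: "y \<in> cone_of Z" using w by (simp add: cone_of_def)
  note step = trop_coeff_snoc[OF o u s[unfolded F_def], of w, folded y_def]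
  have "rpairing (trop_coeff E (u @ [k]) w) (move k Z l) = rpairing y (Z l)"
  proof (cases "\<exists>i. Z i = axis k 1")
    case True
    then obtain i where i: "Z i = axis k 1" by blast
    have "trop_coeff E (u @ [k]) w = (\<chi> j. if j = k then - y $ k else y $ j)"
      using cone_sign(1)[OF F s Z y True] by (simp add: vec_eq_iff step)
    then show ?thesis unfolding move_neg_at[of Z, OF i] by (simp only: rpairing_neg_at)
  next
    case False
    then have ne: "Z i \<noteq> axis k 1" for i by blast
    have "trop_coeff E (u @ [k]) w = (\<chi> j. y $ j - of_int (A $ k $ j) * y $ k)"
      using cone_sign(2)[OF F s Z y False] by (simp add: vec_eq_iff step diag min_def)
    then show ?thesis unfolding move_refl_at[of Z, OF ne] by (simp only: rpairing_refl_at)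
  qed
  then show ?case unfolding IH by (simp add: Z_def)
qed simp

text \<open>Each tropical exchange relation contains a single truncation, whose sign is fixed on the
  cone; everything else is linear by induction.\<close>

lemma trop_linear:
  assumes o: "orient E" and u: "admissible E u" and v: "valid E X"
  shows "\<exists>f. \<forall>w\<in>cone_of X. trop E u i w = w \<bullet> f"
  using u
proof (induction u arbitrary: i rule: rev_induct)
  case Nil
  show ?case by (rule exI[of _ 0]) simp
next
  case (snoc k u)
  define F where "F = fold flipE u E"
  define Z where "Z = fold move u X"
  have F: "orient F" unfolding F_def by (rule orient_fold[OF o])
  have u: "admissible E u" and s: "is_source F k"
    using snoc.prems by (simp_all add: admissible_append F_def)
  have Z: "valid F Z" unfolding F_def Z_def by (rule valid_moves[OF o u v])
  have "\<forall>i. \<exists>f. \<forall>w\<in>cone_of X. trop E u i w = w \<bullet> f"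
    using snoc.IH[OF u] by blast
  from choice[OF this] obtain f where f: "\<And>i w. w \<in> cone_of X \<Longrightarrow> trop E u i w = w \<bullet> f i" by blast
  show ?case
  proof (cases "i = k")
    case False
    then show ?thesis using f by (intro exI[of _ "f i"]) (simp add: trop_snoc_other)
  next
    case True
    define lin where "lin g = (\<Sum>i\<in>UNIV. g (MutVar i) *\<^sub>R f i) + (\<Sum>i\<in>UNIV. g (FrozVar i) *\<^sub>R axis i 1)" for g :: "'n var \<Rightarrow> real"
    have lin: "w \<bullet> lin g = (\<Sum>i\<in>UNIV. g (MutVar i) * trop E u i w) + (\<Sum>i\<in>UNIV. g (FrozVar i) * w $ i)"
      if "w \<in> cone_of X" for w g
      using f[OF that] by (simp add: lin_def inner_add_right inner_sum_right inner_axis)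
    define n where "n = lin (\<lambda>v. max 0 (- of_int (ematrix E u $ v $ k)))"
    define y where "y = lin (\<lambda>v. of_int (ematrix E u $ v $ k))"
    have n: "trop_low E u k w = w \<bullet> n" and y: "trop_coeff E u w $ k = w \<bullet> y" if "w \<in> cone_of X" for w
      by (simp_all add: n_def y_def lin[OF that] trop_low_def trop_coeff_def)
    have c: "trop_coeff E u w \<in> cone_of Z" if "w \<in> cone_of X" for w
      using that trop_coeff_cone[OF o u v that] by (simp add: cone_of_def Z_def)
    show ?thesis
    proof (cases "\<exists>i. Z i = axis k 1")
      case a: True
      have "trop E (u @ [k]) i w = w \<bullet> (n + y - f k)" if w: "w \<in> cone_of X" for w
        using cone_sign(1)[OF F s Z c[OF w] a] n[OF w] y[OF w] f[OF w]
        by (simp add: True trop_snoc inner_add_right inner_diff_right)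
      then show ?thesis by blast
    next
      case a: False
      have "trop E (u @ [k]) i w = w \<bullet> (n - f k)" if w: "w \<in> cone_of X" for w
        using cone_sign(2)[OF F s Z c[OF w] a] n[OF w] y[OF w] f[OF w]
        by (simp add: True trop_snoc inner_diff_right)
      then show ?thesis by blast
    qed
  qed
qed

section \<open>The belt\<close>

text \<open>Tropical exchange relations are explicit only along source sequences, so the support
  function is first formed from these variables; \<open>clvar_belt\<close> shows that none is
  missing.\<close>

definition belt :: "('n \<times> 'n) set \<Rightarrow> 'n ratfun set" where
  "belt E = {clvar E u i | u i. admissible E u}"

lemma belt_subset: "belt E \<subseteq> cluster_variables (exchange_matrix A E)"
  unfolding belt_def cluster_variables_words by blast

lemma finite_belt: "orient E \<Longrightarrow> finite (belt E)"
  using finite_subset[OF belt_subset finite_cluster_variables] .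

definition belt_support :: "('n \<times> 'n) set \<Rightarrow> (real, 'n) vec \<Rightarrow> real" where
  "belt_support E w = (\<Sum>\<gamma>\<in>belt E. val (frow w) \<gamma>)"

lemma belt_support_linear:
  assumes o: "orient E" and v: "valid E X"
  shows "\<exists>f. \<forall>w\<in>cone_of X. belt_support E w = w \<bullet> f"
proof -
  have "\<exists>f. \<gamma> \<in> belt E \<longrightarrow> (\<forall>w\<in>cone_of X. val (frow w) \<gamma> = w \<bullet> f)" for \<gamma>
  proof (cases "\<gamma> \<in> belt E")
    case True
    then obtain u i where u: "admissible E u" "\<gamma> = clvar E u i" by (auto simp: belt_def)
    then show ?thesis using trop_linear[OF o u(1) v, of i] by (simp add: trop_def)
  qed simp
  then have "\<forall>\<gamma>. \<exists>f. \<gamma> \<in> belt E \<longrightarrow> (\<forall>w\<in>cone_of X. val (frow w) \<gamma> = w \<bullet> f)" by blast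
  from choice[OF this] obtain f where f: "\<And>\<gamma> w. \<gamma> \<in> belt E \<Longrightarrow> w \<in> cone_of X \<Longrightarrow> val (frow w) \<gamma> = w \<bullet> f \<gamma>"
    by blast
  have "belt_support E w = w \<bullet> (\<Sum>\<gamma>\<in>belt E. f \<gamma>)" if "w \<in> cone_of X" for w
    using f[OF _ that] by (simp add: belt_support_def inner_sum_right)
  then show ?thesis by blast
qed

text \<open>The gradient of the support function on the cone of \<open>X\<close>; it turns out to be
  the point of the Minkowski sum with that cone as its normal cone.\<close>

definition vertex :: "('n \<times> 'n) set \<Rightarrow> ('n \<Rightarrow> 'n int_vector) \<Rightarrow> (real, 'n) vec" where
  "vertex E X = (SOME f. \<forall>w\<in>cone_of X. belt_support E w = w \<bullet> f)"

lemma vertex: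
  assumes "orient E" "valid E X" "w \<in> cone_of X"
  shows "belt_support E w = w \<bullet> vertex E X"
  using someI_ex[OF belt_support_linear[OF assms(1,2)]] assms(3) unfolding vertex_def by blast

definition ray :: "('n \<Rightarrow> 'n int_vector) \<Rightarrow> 'n \<Rightarrow> (real, 'n) vec" where
  "ray X l = real_vector (dual X l)"

lemma rpairing_ray: "valid E X \<Longrightarrow> rpairing (ray X l) (X j) = (if l = j then 1 else 0)"
proof -
  assume v: "valid E X"
  have "rpairing (ray X l) (X j) = of_int (pairing (dual X l) (X j))"
    by (simp add: rpairing_alt ray_def real_vector_def pairing_def)
  also have "pairing (dual X l) (X j) = (if l = j then 1 else 0)"
    using dual_spec[OF validD(2)[OF v]] unfolding dual_to_def by blast
  finally show ?thesis by simp
qed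

lemma ray_expand:
  assumes "valid E X"
  shows "x = (\<Sum>l\<in>UNIV. (ray X l \<bullet> x) *\<^sub>R real_vector (X l))"
proof -
  have L: "linear (\<lambda>x. \<Sum>l\<in>UNIV. (ray X l \<bullet> x) *\<^sub>R real_vector (X l))"
    by (intro linearI) (simp_all add: inner_add_right scaleR_left_distrib sum.distrib scaleR_sum_right)
  have e: "axis i 1 = (\<Sum>l\<in>UNIV. (ray X l \<bullet> axis i 1) *\<^sub>R real_vector (X l))" for i
  proof -
    have "lincomb (\<lambda>l. pairing (dual X l) (axis i 1)) X = axis i 1"
      using dual_spec[OF validD(2)[OF assms]] unfolding dual_to_def by blast
    then have "(\<Sum>l\<in>UNIV. dual X l $ i * X l $ j) = axis i 1 $ j" for j
      unfolding pairing_axis lincomb_nth[symmetric] by simp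
    then have e: "(\<Sum>l\<in>UNIV. of_int (dual X l $ i) * of_int (X l $ j)) = (axis i 1 :: (real, 'n) vec) $ j" for j
      unfolding of_int_mult[symmetric] of_int_sum[symmetric] by (simp add: axis_def)
    have "ray X l \<bullet> axis i 1 = of_int (dual X l $ i)" for l
      by (simp add: ray_def real_vector_def inner_axis)
    then show ?thesis
      by (simp add: vec_eq_iff sum_component real_vector_def e)
  qed
  have "(\<lambda>x. x) = (\<lambda>x. \<Sum>l\<in>UNIV. (ray X l \<bullet> x) *\<^sub>R real_vector (X l))"
  proof (rule linear_eq_stdbasis[OF linear_ident L])
    fix b :: "(real, 'n) vec" assume "b \<in> Basis"
    then obtain i where "b = axis i 1" by (auto simp: Basis_vec_def)
    then show "b = (\<Sum>l\<in>UNIV. (ray X l \<bullet> b) *\<^sub>R real_vector (X l))" by (simp only: e[symmetric])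
  qed
  from fun_cong[OF this] show ?thesis .
qed

text \<open>A maximum of linear functions is convex; the midpoint form suits the second differences
  in \<open>jump\<close>.\<close>

lemma trop_midpoint:
  assumes o: "orient E" and s: "w + w' = 2 *\<^sub>R s"
  shows "2 * trop E u i s \<le> trop E u i w + trop E u i w'"
proof -
  obtain m where m: "m \<in> Poly_Mapping.keys (clexp E u i)" "maxw (frow s) (clexp E u i) = frow s m"
    using maxw_attained[OF clexp_nonzero[OF o, of u i], of "frow s"] by (auto dest: HOL.sym)
  have "2 * frow s m = frow w m + frow w' m"
    unfolding frow_def inner_add_left[symmetric] s by simp
  then show ?thesis
    using maxw_ge[OF m(1), of "frow w"] maxw_ge[OF m(1), of "frow w'"]
    by (simp add: trop_def val_clvar[OF o additive_frow] m(2))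
qed

lemma trop_low_midpoint:
  assumes o: "orient E" and s: "w + w' = 2 *\<^sub>R s"
  shows "2 * trop_low E u k s \<le> trop_low E u k w + trop_low E u k w'"
proof -
  have "c * (2 * trop E u i s) \<le> c * (trop E u i w + trop E u i w')" if "c \<ge> 0" for c i
    by (rule mult_left_mono[OF trop_midpoint[OF o s] that])
  then have "(\<Sum>i\<in>UNIV. max 0 (- of_int (ematrix E u $ MutVar i $ k)) * (2 * trop E u i s)) \<le>
      (\<Sum>i\<in>UNIV. max 0 (- of_int (ematrix E u $ MutVar i $ k)) * (trop E u i w + trop E u i w'))"
    by (intro sum_mono) simp
  moreover have "(\<Sum>i\<in>UNIV. max 0 (- of_int (ematrix E u $ FrozVar i $ k)) * (2 * s $ i)) =
      (\<Sum>i\<in>UNIV. max 0 (- of_int (ematrix E u $ FrozVar i $ k)) * (w $ i + w' $ i))"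
    using s by (simp add: vec_eq_iff)
  ultimately show ?thesis
    by (simp add: trop_low_def sum.distrib algebra_simps sum_distrib_left)
qed

text \<open>Neighbouring cones share the facet spanned by the rays other than \<open>l\<close>, so
  the two gradients agree there and differ by a multiple of \<open>X l\<close>. The multiple is a
  second difference of the support function across the facet. It is positive because a source
  sequence making \<open>X l\<close> simple ends at an exchange relation whose truncated coefficient
  is exactly the pairing with \<open>X l\<close>.\<close>

lemma jump:
  assumes o: "orient E" and v: "valid E X"
  shows "\<exists>c>0. vertex E X - vertex E (mut E l X) = c *\<^sub>R real_vector (X l)"
proof -
  define Y where "Y = mut E l X"
  have vY: "valid E Y" unfolding Y_def by (rule valid_mut[OF o v])
  define g where "g = ray X"
  have g: "rpairing (g i) (X j) = (if i = j then 1 else 0)" for i j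
    unfolding g_def by (rule rpairing_ray[OF v])
  have Yl: "rpairing w (Y l) = - rpairing w (X l)" and Yj: "j \<noteq> l \<Longrightarrow> rpairing w (Y j) = rpairing w (X j) + of_int (mult E X l j) * rpairing w (X l)" for w j
    by (simp_all add: Y_def mut_def rpairing_right)
  have facet: "g j \<bullet> (vertex E X - vertex E Y) = 0" if "j \<noteq> l" for j
  proof -
    have "g j \<in> cone_of X" by (simp add: cone_of_def g)
    moreover have "rpairing (g j) (Y i) \<ge> 0" for i
      using that by (cases "i = l") (simp_all add: Yl Yj g)
    then have "g j \<in> cone_of Y" by (simp add: cone_of_def)
    ultimately show ?thesis
      using vertex[OF o v, of "g j"] vertex[OF o vY, of "g j"] by (simp add: inner_diff_right)
  qed
  define c where "c = g l \<bullet> (vertex E X - vertex E Y)"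
  have "vertex E X - vertex E Y = (\<Sum>j\<in>UNIV. if j = l then c *\<^sub>R real_vector (X l) else 0)"
    by (subst ray_expand[OF v]) (intro sum.cong refl, simp add: g_def[symmetric] facet c_def)
  then have jump: "vertex E X - vertex E Y = c *\<^sub>R real_vector (X l)" by simp
  obtain N :: real where N: "of_int (mult E X l j) \<le> N" for j
  proof -
    have "of_int (mult E X l j) \<le> (\<Sum>j\<in>UNIV. real_of_int (mult E X l j))" for j
      by (rule member_le_sum) (simp_all add: mult_nonneg)
    then show ?thesis by (rule that)
  qed
  have N0: "N \<ge> 0" using N[of l] mult_nonneg[of E X l l] by (meson of_int_0_le_iff order_trans)
  \<comment> \<open>\<open>N\<close> bounds all multiplicities, which keeps \<open>q\<close> in the
    cone of the mutated tuple: for \<open>j\<close> other than \<open>l\<close> its pairing with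
    \<open>Y j\<close> is \<open>N\<close> minus a multiplicity.\<close>
  define s where "s = (\<Sum>j\<in>UNIV - {l}. N *\<^sub>R g j)"
  have sX: "rpairing s (X j) = (if j = l then 0 else N)" for j
  proof -
    have "rpairing s (X j) = (\<Sum>i\<in>UNIV - {l}. if i = j then N else 0)"
      unfolding s_def rpairing_sum_left by (intro sum.cong) (simp_all add: rpairing_left g)
    then show ?thesis by simp
  qed
  define p where "p = s + g l"
  define q where "q = s - g l"
  have pq: "p + q = 2 *\<^sub>R s" by (simp add: p_def q_def scaleR_2)
  have cones: "p \<in> cone_of X" "q \<in> cone_of Y" "s \<in> cone_of X" "s \<in> cone_of Y"
  proof -
    show "p \<in> cone_of X" "s \<in> cone_of X"
      using N0 by (simp_all add: cone_of_def p_def rpairing_left sX g)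
    have "rpairing s (Y j) \<ge> 0" "rpairing q (Y j) \<ge> 0" for j
      using N0 N[of j] by (cases "j = l"; simp add: q_def Yl Yj rpairing_left sX g)+
    then show "q \<in> cone_of Y" "s \<in> cone_of Y" by (simp_all add: cone_of_def)
  qed
  have c: "c = belt_support E p + belt_support E q - 2 * belt_support E s"
  proof -
    have "s \<bullet> vertex E X = s \<bullet> vertex E Y"
      using vertex[OF o v cones(3)] vertex[OF o vY cones(4)] by simp
    then show ?thesis
      unfolding vertex[OF o v cones(1)] vertex[OF o vY cones(2)] vertex[OF o v cones(3)]
      by (simp add: p_def q_def c_def inner_add_left inner_diff_left inner_diff_right)
  qed
  define D where "D \<gamma> = val (frow p) \<gamma> + val (frow q) \<gamma> - 2 * val (frow s) \<gamma>" for \<gamma>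
  have cD: "c = (\<Sum>\<gamma>\<in>belt E. D \<gamma>)"
    unfolding c belt_support_def D_def by (simp add: sum.distrib sum_subtractf sum_distrib_left)
  have Dhh: "D (clvar E u i) = trop E u i p + trop E u i q - 2 * trop E u i s" for u i
    by (simp add: D_def trop_def)
  have D0: "D (clvar E u i) \<ge> 0" for u i
    using trop_midpoint[OF o pq, of u i] by (simp add: Dhh)
  obtain u k where u: "admissible E u" "is_source (fold flipE u E) k" "fold move u X l = axis k 1"
    using hits_simple_root[OF o v] unfolding hits_def by blast
  have uY: "fold move u Y l = - axis k 1"
    unfolding Y_def moves_mut[OF o u(1) v] by (simp add: mut_def u(3))
  have yX: "trop_coeff E u w $ k = rpairing w (X l)" if "w \<in> cone_of X" for w
    using trop_coeff_cone[OF o u(1) v that, of l] by (simp add: u(3))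
  have yY: "trop_coeff E u w $ k = rpairing w (X l)" if "w \<in> cone_of Y" for w
    using trop_coeff_cone[OF o u(1) vY that, of l] by (simp add: uY rpairing_right Yl)
  have "trop_coeff E u p $ k = 1" "trop_coeff E u q $ k = - 1" "trop_coeff E u s $ k = 0"
    using yX[OF cones(1)] yY[OF cones(2)] yX[OF cones(3)] by (simp_all add: p_def q_def rpairing_left sX g)
  \<comment> \<open>The truncated coefficient takes the values \<open>1\<close>, \<open>0\<close>,
    \<open>0\<close> at \<open>p\<close>, \<open>q\<close>, \<open>s\<close>, which gives the
    summand \<open>1\<close>; the rest is a second difference of a convex function.\<close>
  then have "D (clvar E u k) + D (clvar E (u @ [k]) k) = 1 + (trop_low E u k p + trop_low E u k q - 2 * trop_low E u k s)"
    unfolding Dhh trop_snoc by simp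
  then have "D (clvar E u k) > 0 \<or> D (clvar E (u @ [k]) k) > 0"
    using trop_low_midpoint[OF o pq, of u k] by linarith
  moreover have "clvar E u k \<in> belt E" "clvar E (u @ [k]) k \<in> belt E"
    using u by (auto simp: belt_def admissible_append)
  ultimately obtain \<gamma> where \<gamma>: "\<gamma> \<in> belt E" "D \<gamma> > 0" by blast
  have "c > 0"
    unfolding cD
  proof (rule sum_pos2[of _ \<gamma>])
    show "finite (belt E)" by (rule finite_belt[OF o])
    show "\<gamma> \<in> belt E" "0 < D \<gamma>" by (rule \<gamma>)+

    fix \<gamma>' assume "\<gamma>' \<in> belt E"
    then show "0 \<le> D \<gamma>'" using D0 by (auto simp: belt_def)
  qed
  then show ?thesis using jump unfolding Y_def by blast
qed

section \<open>Every cluster variable occurs along a source sequence\<close>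

lemma ctuple_append: "orient E \<Longrightarrow> ctuple E (v @ w) = fold (mut E) w (ctuple E v)"
proof (induction w rule: rev_induct)
  case (snoc k w)
  then show ?case
    using link(3)[of E "v @ w" k] by simp
qed simp

lemma moves_muts:
  assumes "orient E" "admissible E u" "valid E X"
  shows "fold move u (fold (mut E) w X) = fold (mut (fold flipE u E)) w (fold move u X)"
  using assms(3)
proof (induction w arbitrary: X)
  case (Cons l w)
  then show ?case
    using Cons.IH[OF valid_mut[OF assms(1) Cons.prems, of l]] by (simp add: moves_mut[OF assms(1,2)])
qed simp

lemma refl_at_axis: "refl_at k (axis j 1) = axis j 1 - A $ k $ j *s axis k 1"
  unfolding refl_at_def sum_A_axis ..

lemma mut_initial:
  assumes o: "orient E" and s: "is_source E k"
  shows "mut E k (\<lambda>i. axis i 1) = (\<lambda>i. refl_at k (axis i 1))"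
proof
  fix j
  show "mut E k (\<lambda>i. axis i 1) j = refl_at k (axis j 1)"
  proof (cases "j = k")
    case True
    then show ?thesis by (simp add: mut_def refl_at_axis_same)
  next
    case False
    have "exchange_matrix A E $ k $ j = - (A $ k $ j)"
      using False s orientD(3)[OF o, of k j] by (auto simp: exchange_matrix_def is_source_def)
    then have "mult E (\<lambda>i. axis i 1) k j = - (A $ k $ j)"
      using offdiag[of k j] False by (simp add: mult_def exch_initial[OF o] posv_axis)
    then show ?thesis
      using False by (simp add: mut_def refl_at_axis vec_eq_iff)
  qed
qed

text \<open>Mutating the initial tuple at a source reflects the simple roots, and the move reflects
  them back. A source sequence applied as mutations is thus undone by the same sequence applied as
  moves.\<close>

lemma moves_back:
  assumes "orient E" "admissible E u"
  shows "fold move u (ctuple E u) = (\<lambda>i. axis i 1)"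
  using assms
proof (induction u arbitrary: E)
  case Nil
  then show ?case by (simp add: ctuple_Nil)
next
  case (Cons k u)
  let ?e = "\<lambda>i. axis i 1 :: 'n int_vector"
  note o = Cons.prems(1)
  have s: "is_source E k" and u: "admissible (flipE k E) u" using Cons.prems(2) by simp_all
  have k: "admissible E [k]" using s by simp
  have v: "valid E (mut E k ?e)"
    by (rule valid_mut[OF o valid_initial[OF o]])
  have "refl_at k (axis i 1) \<noteq> axis k 1" for i
  proof
    assume "refl_at k (axis i 1) = axis k 1"
    then have "axis i 1 = - (axis k 1 :: 'n int_vector)" by (simp add: refl_at_eq_axis)
    then have "axis i 1 $ i = - (axis k 1 :: 'n int_vector) $ i" by simp
    then show False by (simp add: axis_def split: if_splits)
  qed
  then have m: "move k (mut E k ?e) = ?e"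
    unfolding mut_initial[OF o s] by (simp add: move_refl_at)
  have "ctuple E (k # u) = fold (mut E) u (mut E k ?e)"
    using ctuple_append[OF o, of "[k]" u] link(3)[OF o, of "[]" k] by (simp add: ctuple_Nil)
  then have "move k (ctuple E (k # u)) = fold (mut (flipE k E)) u ?e"
    using moves_muts[OF o k v, of u] m by simp
  also have "\<dots> = ctuple (flipE k E) u"
    using ctuple_append[OF orient_flipE[OF o], of k "[]" u] by (simp add: ctuple_Nil)
  finally show ?case
    using Cons.IH[OF orient_flipE[OF o] u] by simp
qed

lemma valid_permute:
  assumes v: "valid E X" and p: "bij p" and d: "\<And>i. d (p i) = d i"
  shows "valid E (\<lambda>i. X (p i))"
proof -
  have "isroot i (X (p i))" for i
    using validD(1)[OF v, of "p i"] d[of i] by (simp add: isroot_def in_lat_def)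
  moreover have "spans (\<lambda>i. X (p i))"
    unfolding spans_def
  proof
    fix x
    obtain c where "x = lincomb c X" using validD(2)[OF v] unfolding spans_def by blast
    then have "x = lincomb (\<lambda>i. c (p i)) (\<lambda>i. X (p i))"
      unfolding lincomb_def using sum_bij[OF p, of "\<lambda>i. c i *s X i"] by simp
    then show "\<exists>c. x = lincomb c (\<lambda>i. X (p i))" by blast
  qed
  moreover have "i \<noteq> j \<Longrightarrow> p i \<noteq> p j" for i j
    using p by (auto simp: bij_def inj_def)
  ultimately show ?thesis
    using validD(3-5)[OF v, of "p i" "p j" for i j] unfolding valid_def by simp
qed

text \<open>Walk through clusters containing the given variable in the direction in which the sum of the
  coordinates of \<open>vertex\<close> increases; it ends at the cluster of the admissible word.\<close>

theorem clvar_belt: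
  assumes o: "orient E"
  shows "clvar E q i \<in> belt E"
proof -
  obtain u k where u: "admissible E u" "is_source (fold flipE u E) k" "fold move u (ctuple E q) i = axis k 1"
    using hits_simple_root[OF o link(1)[OF o, of q], of i] unfolding hits_def by blast
  define F where "F = fold flipE u E"
  have F: "orient F" unfolding F_def by (rule orient_fold[OF o])
  have k: "is_source F k" using u(2) by (simp add: F_def)
  define Z where "Z r = fold move u (ctuple E (q @ r))" for r
  have Z: "valid F (Z r)" for r
    unfolding Z_def F_def by (rule valid_moves[OF o u(1) link(1)[OF o]])
  have Zs: "Z (r @ [l]) = mut F l (Z r)" for r l
    using link(3)[OF o, of "q @ r" l] by (simp add: Z_def F_def moves_mut[OF o u(1) link(1)[OF o]])
  \<comment> \<open>Mutations away from \<open>i\<close> keep both the simple root at the source and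
    the cluster variable.\<close>
  have Zi: "Z r i = axis k 1" and qi: "clvar E (q @ r) i = clvar E q i" if "i \<notin> set r" for r
    using that
  proof (induction r rule: rev_induct)
    case Nil
    show "Z [] i = axis k 1" "clvar E (q @ []) i = clvar E q i" using u(3) by (simp_all add: Z_def)
  next
    case (snoc l r)
    case 1
    then show ?case using snoc.IH(1) mut_source_fixed[OF F k Z, of r i l] by (auto simp: Zs)
    case 2
    then show ?case using snoc.IH(2) clvar_snoc[of E "q @ r" l] by simp
  qed
  define \<phi> where "\<phi> X = (\<Sum>a\<in>UNIV. vertex F X $ a)" for X
  define R where "R = {r. i \<notin> set r}"
  have fin: "finite ((\<lambda>r. \<phi> (Z r)) ` R)"
  proof (rule finite_subset)
    show "(\<lambda>r. \<phi> (Z r)) ` R \<subseteq> \<phi> ` {X. valid F X}" using Z by blast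
    show "finite (\<phi> ` {X. valid F X})" by (intro finite_imageI finite_valid)
  qed
  have "[] \<in> R" by (simp add: R_def)
  then have "Max ((\<lambda>r. \<phi> (Z r)) ` R) \<in> (\<lambda>r. \<phi> (Z r)) ` R"
    by (intro Max_in fin) blast
  then obtain r where r: "i \<notin> set r" and r': "Max ((\<lambda>r. \<phi> (Z r)) ` R) = \<phi> (Z r)"
    by (auto simp: R_def)
  have max: "\<phi> (Z r') \<le> \<phi> (Z r)" if "i \<notin> set r'" for r'
    unfolding r'[symmetric] using that by (intro Max_ge fin) (simp add: R_def)
  \<comment> \<open>A negative member would permit a further mutation, at an index other than
    \<open>i\<close>, that increases the coordinate sum, against maximality.\<close>
  have pos: "posv (Z r l)" for l
  proof (rule ccontr)
    assume np: "\<not> posv (Z r l)"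
    then have n: "negv (Z r l)" using valid_sign[OF F Z] by blast
    have "l \<noteq> i" using np Zi[OF r] posv_axis[of k] by auto
    then have le: "\<phi> (Z (r @ [l])) \<le> \<phi> (Z r)" using r by (intro max) simp
    obtain c where c: "c > 0" "vertex F (Z r) - vertex F (Z (r @ [l])) = c *\<^sub>R real_vector (Z r l)"
      using jump[OF F Z[of r], of l] by (auto simp: Zs)
    have "\<phi> (Z r) - \<phi> (Z (r @ [l])) = (\<Sum>a\<in>UNIV. (vertex F (Z r) - vertex F (Z (r @ [l]))) $ a)"
      by (simp add: \<phi>_def sum_subtractf)
    also have "\<dots> = c * (\<Sum>a\<in>UNIV. of_int (Z r l $ a))"
      unfolding c(2) by (simp add: real_vector_def sum_distrib_left)
    also have "\<dots> < 0"
    proof -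
      obtain a where a: "Z r l $ a \<noteq> 0"
        using root_nonzero[OF validD(1)[OF Z[of r], of l]] by (auto simp: vec_eq_iff)
      have n': "Z r l $ b \<le> 0" for b using n by (simp add: negv_def)
      have "(\<Sum>a\<in>UNIV. - real_of_int (Z r l $ a)) > 0"
        by (rule sum_pos2[of _ a]) (use a n' order.not_eq_order_implies_strict[OF a n'] in auto)
      then show ?thesis using c(1) by (simp add: sum_negf mult_less_0_iff)
    qed
    finally show False using le by simp
  qed
  obtain p where p: "bij p" "\<And>l. Z r l = axis (p l) 1"
    using all_pos_permutation[OF F Z pos] by blast
  have dp: "d (p l) = d l" for l
    using isroot_same_length[OF F validD(1)[OF Z[of r], of l], of "p l"] p(2)[of l] by simp
  \<comment> \<open>The moved tuples of \<open>q @ r\<close> and of \<open>u\<close> differ by a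
    permutation, and moves are injective on valid tuples.\<close>
  have "fold move u (\<lambda>l. ctuple E u (p l)) = (\<lambda>l. fold move u (ctuple E u) (p l))"
    by (rule moves_comp[OF p(1)])
  also have "\<dots> = fold move u (ctuple E (q @ r))"
    unfolding moves_back[OF o u(1)] Z_def[symmetric] p(2)[symmetric] ..
  finally have "ctuple E (q @ r) = (\<lambda>l. ctuple E u (p l))"
    using moves_inj[OF o u(1) link(1)[OF o] valid_permute[OF link(1)[OF o] p(1) dp], of "q @ r" u] by simp
  then have "clvar E (q @ r) i = clvar E u (p i)"
    by (rule same_tuple[OF o p(1)])
  then show ?thesis using qi[OF r] u(1) by (auto simp: belt_def)
qed

corollary belt_eq: "orient E \<Longrightarrow> belt E = cluster_variables (exchange_matrix A E)"
  using belt_subset clvar_belt unfolding cluster_variables_words by blast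

section \<open>The normal fan\<close>

lemma support_newton_polytope:
  assumes o: "orient E" and \<gamma>: "\<gamma> \<in> cluster_variables (exchange_matrix A E)"
  shows "x \<in> newton_polytope (F_polynomial \<gamma>) \<Longrightarrow> w \<bullet> x \<le> val (frow w) \<gamma>"
    "\<exists>x\<in>newton_polytope (F_polynomial \<gamma>). w \<bullet> x = val (frow w) \<gamma>"
proof -
  obtain v i where v: "\<gamma> = clvar E v i" using \<gamma> unfolding cluster_variables_words by blast
  have val: "val (frow w) \<gamma> = maxw (frow w) (clexp E v i)"
    unfolding v by (rule val_clvar[OF o additive_frow])
  have P: "newton_polytope (F_polynomial \<gamma>) = convex hull (yvec ` Poly_Mapping.keys (clexp E v i))"
    unfolding v by (rule newton_polytope_clvar[OF o])
  have "yvec ` Poly_Mapping.keys (clexp E v i) \<subseteq> {x. w \<bullet> x \<le> val (frow w) \<gamma>}"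
    using maxw_ge[of _ "clexp E v i" "frow w"] by (auto simp: val frow_def)
  then have "newton_polytope (F_polynomial \<gamma>) \<subseteq> {x. w \<bullet> x \<le> val (frow w) \<gamma>}"
    unfolding P by (rule hull_minimal) (rule convex_halfspace_le)
  then show "w \<bullet> x \<le> val (frow w) \<gamma>" if "x \<in> newton_polytope (F_polynomial \<gamma>)"
    using that by auto
  obtain m where m: "m \<in> Poly_Mapping.keys (clexp E v i)" "frow w m = maxw (frow w) (clexp E v i)"
    using maxw_attained[OF clexp_nonzero[OF o, of v i], of "frow w"] by blast
  have "yvec m \<in> newton_polytope (F_polynomial \<gamma>)"
    unfolding P using m(1) by (intro hull_inc) simp
  then show "\<exists>x\<in>newton_polytope (F_polynomial \<gamma>). w \<bullet> x = val (frow w) \<gamma>"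
    using m(2) unfolding val frow_def by blast
qed

definition newton_sum :: "('n \<times> 'n) set \<Rightarrow> (real, 'n) vec set" where
  "newton_sum E = (\<Sum>\<gamma>\<in>cluster_variables (exchange_matrix A E). newton_polytope (F_polynomial \<gamma>))"

lemma polytope_newton_sum: "polytope (newton_sum E)"
proof -
  have "finite (\<Sum>\<gamma>\<in>cluster_variables (exchange_matrix A E).
      (\<lambda>m. \<chi> i. real_of_int (lkp m i)) ` Poly_Mapping.keys (F_polynomial \<gamma>))"
    by (intro finite_set_sum) simp
  then show ?thesis
    unfolding polytope_def newton_sum_def newton_polytope_def convex_hull_set_sum[symmetric] by blast
qed

lemma support_newton_sum:
  assumes o: "orient E"
  shows "x \<in> newton_sum E \<Longrightarrow> w \<bullet> x \<le> belt_support E w" "\<exists>x\<in>newton_sum E. w \<bullet> x = belt_support E w"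
proof -
  let ?P = "\<lambda>\<gamma>. newton_polytope (F_polynomial \<gamma>)" and ?C = "cluster_variables (exchange_matrix A E)"
  have M: "newton_sum E = {sum s ?C | s. \<forall>\<gamma>\<in>?C. s \<gamma> \<in> ?P \<gamma>}"
    unfolding newton_sum_def by (rule set_sum_alt[OF finite_cluster_variables[OF o]])
  have H: "belt_support E w = (\<Sum>\<gamma>\<in>?C. val (frow w) \<gamma>)"
    by (simp add: belt_support_def belt_eq[OF o])
  show "w \<bullet> x \<le> belt_support E w" if x: "x \<in> newton_sum E"
  proof -
    obtain s where s: "x = sum s ?C" "\<forall>\<gamma>\<in>?C. s \<gamma> \<in> ?P \<gamma>"
      using x unfolding M by blast
    show ?thesis
      unfolding s(1) inner_sum_right H using s(2)
      by (intro sum_mono support_newton_polytope(1)[OF o]) simp_all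
  qed
  have "\<forall>\<gamma>\<in>?C. \<exists>x. x \<in> ?P \<gamma> \<and> w \<bullet> x = val (frow w) \<gamma>"
    using support_newton_polytope(2)[OF o] by blast
  from bchoice[OF this] obtain s where s: "\<forall>\<gamma>\<in>?C. s \<gamma> \<in> ?P \<gamma> \<and> w \<bullet> s \<gamma> = val (frow w) \<gamma>"
    by blast
  then have "sum s ?C \<in> newton_sum E" unfolding M by blast
  moreover have "w \<bullet> sum s ?C = belt_support E w"
    unfolding inner_sum_right H using s by (intro sum.cong) simp_all
  ultimately show "\<exists>x\<in>newton_sum E. w \<bullet> x = belt_support E w" by blast
qed

lemma ray_expand_dual:
  assumes "valid E X"
  shows "w = (\<Sum>l\<in>UNIV. rpairing w (X l) *\<^sub>R ray X l)"
proof -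
  have "w \<bullet> x = (\<Sum>l\<in>UNIV. rpairing w (X l) *\<^sub>R ray X l) \<bullet> x" for x
  proof -
    have "w \<bullet> x = (\<Sum>l\<in>UNIV. (ray X l \<bullet> x) * rpairing w (X l))"
      by (subst ray_expand[OF assms, of x]) (simp add: inner_sum_right rpairing_def)
    then show ?thesis by (simp add: inner_sum_left mult.commute)
  qed
  then have "\<forall>x. w \<bullet> x = (\<Sum>l\<in>UNIV. rpairing w (X l) *\<^sub>R ray X l) \<bullet> x" ..
  then show ?thesis unfolding vector_eq_rdot .
qed

text \<open>Take a maximiser for the sum of the rays. On each ray its value is bounded by that of
  \<open>vertex E X\<close>, so equality for the sum gives equality for every ray, and the rays form
  a basis.\<close>

lemma vertex_in_newton_sum:
  assumes o: "orient E" and v: "valid E X"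
  shows "vertex E X \<in> newton_sum E"
proof -
  have g: "ray X l \<in> cone_of X" for l by (simp add: cone_of_def rpairing_ray[OF v])
  have s: "(\<Sum>l\<in>UNIV. ray X l) \<in> cone_of X"
    by (simp add: cone_of_def rpairing_sum_left rpairing_ray[OF v])
  obtain x where x: "x \<in> newton_sum E" "(\<Sum>l\<in>UNIV. ray X l) \<bullet> x = belt_support E (\<Sum>l\<in>UNIV. ray X l)"
    using support_newton_sum(2)[OF o] by blast
  have le: "ray X l \<bullet> (vertex E X - x) \<ge> 0" for l
    using support_newton_sum(1)[OF o x(1), of "ray X l"] vertex[OF o v g] by (simp add: inner_diff_right)
  have "(\<Sum>l\<in>UNIV. ray X l \<bullet> (vertex E X - x)) = 0"
    using x(2) unfolding vertex[OF o v s] inner_sum_left[symmetric] by (simp add: inner_diff_right)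
  then have "ray X l \<bullet> (vertex E X - x) = 0" for l
    using le by (simp add: sum_nonneg_eq_0_iff)
  then have "vertex E X - x = 0"
    by (subst ray_expand[OF v]) simp
  then show ?thesis using x(1) by simp
qed

text \<open>The vertices of mutated tuples lie in the Minkowski sum and differ from this one by
  positive multiples of the members, so maximality at the vertex already gives all defining
  inequalities of the cone.\<close>

lemma cone_of_iff:
  assumes o: "orient E" and v: "valid E X"
  shows "w \<in> cone_of X \<longleftrightarrow> w \<bullet> vertex E X = belt_support E w"
proof
  assume w: "w \<bullet> vertex E X = belt_support E w"
  have "rpairing w (X l) \<ge> 0" for l
  proof -
    obtain c where c: "c > 0" "vertex E X - vertex E (mut E l X) = c *\<^sub>R real_vector (X l)"
      using jump[OF o v, of l] by blast
    have "w \<bullet> (vertex E X - vertex E (mut E l X)) \<ge> 0"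
      using support_newton_sum(1)[OF o vertex_in_newton_sum[OF o valid_mut[OF o v]], of w l] w by (simp add: inner_diff_right)
    then show ?thesis
      unfolding c(2) using c(1) by (simp add: rpairing_def zero_le_mult_iff)
  qed
  then show "w \<in> cone_of X" by (simp add: cone_of_def)
qed (simp add: vertex[OF o v])

text \<open>Among the finitely many tuples take one whose vertex maximises \<open>w\<close>.
  Comparison with its mutations yields the inequalities, a local optimality test as in linear
  programming.\<close>

lemma cones_complete:
  assumes o: "orient E"
  shows "\<exists>v. w \<in> cone_of (ctuple E v)"
proof -
  let ?f = "\<lambda>X. w \<bullet> vertex E X"
  have fin: "finite (?f ` range (ctuple E))" by (intro finite_imageI finite_tuples[OF o])
  then have "Max (?f ` range (ctuple E)) \<in> ?f ` range (ctuple E)" by (intro Max_in) auto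
  then obtain v where v: "Max (?f ` range (ctuple E)) = ?f (ctuple E v)" by blast
  have max: "?f (ctuple E u) \<le> ?f (ctuple E v)" for u
    unfolding v[symmetric] by (intro Max_ge fin) simp
  have "rpairing w (ctuple E v l) \<ge> 0" for l
  proof -
    obtain c where c: "c > 0" "vertex E (ctuple E v) - vertex E (mut E l (ctuple E v)) = c *\<^sub>R real_vector (ctuple E v l)"
      using jump[OF o link(1)[OF o], of v l] by blast
    have "w \<bullet> (vertex E (ctuple E v) - vertex E (mut E l (ctuple E v))) \<ge> 0"
      using max[of "v @ [l]"] unfolding link(3)[OF o] by (simp add: inner_diff_right)
    then show ?thesis
      unfolding c(2) using c(1) by (simp add: rpairing_def zero_le_mult_iff)
  qed
  then show ?thesis by (auto simp: cone_of_def)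
qed

text \<open>The exposed face contains the vertices across all walls through \<open>w\<close>, which
  forces the corresponding pairings to vanish. Conversely, every point of the face satisfies
  complementary slackness with the rays that occur in \<open>w\<close>.\<close>

lemma normal_cone_exposed:
  assumes o: "orient E" and v: "valid E X" and w: "w \<in> cone_of X"
  shows "outer_normal_cone (newton_sum E) (newton_sum E \<inter> {x. w \<bullet> x = belt_support E w}) =
    {w' \<in> cone_of X. \<forall>l. rpairing w (X l) = 0 \<longrightarrow> rpairing w' (X l) = 0}"
proof -
  let ?F = "newton_sum E \<inter> {x. w \<bullet> x = belt_support E w}"
  have vF: "vertex E X \<in> ?F"
    using vertex_in_newton_sum[OF o v] vertex[OF o v w] by simp
  have N: "outer_normal_cone (newton_sum E) ?F = {w'. \<forall>x\<in>?F. w' \<bullet> x = belt_support E w'}"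
  proof -
    have "(\<forall>y\<in>newton_sum E. w' \<bullet> y \<le> w' \<bullet> x) \<longleftrightarrow> w' \<bullet> x = belt_support E w'" if "x \<in> newton_sum E" for x w'
    proof
      assume le: "\<forall>y\<in>newton_sum E. w' \<bullet> y \<le> w' \<bullet> x"
      obtain y where "y \<in> newton_sum E" "w' \<bullet> y = belt_support E w'" using support_newton_sum(2)[OF o] by blast
      then show "w' \<bullet> x = belt_support E w'" using le support_newton_sum(1)[OF o that, of w'] by fastforce
    qed (use support_newton_sum(1)[OF o] in simp)
    then show ?thesis unfolding outer_normal_cone_def by blast
  qed
  show ?thesis
    unfolding N
  proof (intro equalityI subsetI CollectI)
    fix w' assume "w' \<in> {w'. \<forall>x\<in>?F. w' \<bullet> x = belt_support E w'}"
    then have w': "w' \<bullet> x = belt_support E w'" if "x \<in> ?F" for x using that by blast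
    have c': "w' \<in> cone_of X" unfolding cone_of_iff[OF o v] by (rule w'[OF vF])
    have "rpairing w' (X l) = 0" if z: "rpairing w (X l) = 0" for l
    proof -
      obtain c where c: "c > 0" "vertex E X - vertex E (mut E l X) = c *\<^sub>R real_vector (X l)"
        using jump[OF o v, of l] by blast
      have "w \<bullet> (vertex E X - vertex E (mut E l X)) = 0"
        unfolding c(2) using z by (simp add: rpairing_def)
      then have "vertex E (mut E l X) \<in> ?F"
        using vertex_in_newton_sum[OF o valid_mut[OF o v]] vertex[OF o v w] by (simp add: inner_diff_right)
      then have "w' \<bullet> (vertex E X - vertex E (mut E l X)) = 0"
        using w' w'[OF vF] by (simp add: inner_diff_right)
      then show ?thesis
        unfolding c(2) using c(1) by (simp add: rpairing_def)
    qed
    then show "w' \<in> cone_of X \<and> (\<forall>l. rpairing w (X l) = 0 \<longrightarrow> rpairing w' (X l) = 0)" using c' by blast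
  next
    fix w' assume "w' \<in> {w' \<in> cone_of X. \<forall>l. rpairing w (X l) = 0 \<longrightarrow> rpairing w' (X l) = 0}"
    then have c': "w' \<in> cone_of X" and z: "\<And>l. rpairing w (X l) = 0 \<Longrightarrow> rpairing w' (X l) = 0" by auto
    show "\<forall>x\<in>?F. w' \<bullet> x = belt_support E w'"
    proof
      fix x assume x: "x \<in> ?F"
      have g: "ray X l \<in> cone_of X" for l by (simp add: cone_of_def rpairing_ray[OF v])
      have le: "ray X l \<bullet> (vertex E X - x) \<ge> 0" for l
        using support_newton_sum(1)[OF o, of x "ray X l"] x vertex[OF o v g] by (simp add: inner_diff_right)
      have e: "w \<bullet> y = (\<Sum>l\<in>UNIV. rpairing w (X l) * (ray X l \<bullet> y))" for w y
        by (subst ray_expand_dual[OF v, of w]) (simp add: inner_sum_left)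
      have "w \<bullet> (vertex E X - x) = 0"
        using x vertex[OF o v w] by (simp add: inner_diff_right)
      then have "(\<Sum>l\<in>UNIV. rpairing w (X l) * (ray X l \<bullet> (vertex E X - x))) = 0"
        unfolding e[of w] .
      moreover have "rpairing w (X l) * (ray X l \<bullet> (vertex E X - x)) \<ge> 0" for l
        using le w by (simp add: cone_of_def)
      ultimately have "rpairing w (X l) * (ray X l \<bullet> (vertex E X - x)) = 0" for l
        by (simp add: sum_nonneg_eq_0_iff)
      then have "rpairing w' (X l) * (ray X l \<bullet> (vertex E X - x)) = 0" for l
        using z[of l] by fastforce
      then have "w' \<bullet> (vertex E X - x) = 0"
        unfolding e[of w'] by (intro sum.neutral ballI)
      then show "w' \<bullet> x = belt_support E w'"
        using vertex[OF o v c'] by (simp add: inner_diff_right)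
    qed
  qed
qed

text \<open>Coordinates in the basis of rays are the pairings with the members of the tuple.\<close>

lemma cone_generators:
  assumes v: "valid E X"
  shows "convex_cone hull (ray X ` S) = {w \<in> cone_of X. \<forall>l. l \<notin> S \<longrightarrow> rpairing w (X l) = 0}"
proof
  show "convex_cone hull (ray X ` S) \<subseteq> {w \<in> cone_of X. \<forall>l. l \<notin> S \<longrightarrow> rpairing w (X l) = 0}"
  proof (rule hull_minimal)
    show "ray X ` S \<subseteq> {w \<in> cone_of X. \<forall>l. l \<notin> S \<longrightarrow> rpairing w (X l) = 0}"
      by (auto simp: cone_of_def rpairing_ray[OF v])
    show "convex_cone {w \<in> cone_of X. \<forall>l. l \<notin> S \<longrightarrow> rpairing w (X l) = 0}"
      unfolding convex_cone_iff by (auto simp: cone_of_def rpairing_left) (simp_all add: rpairing_def)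
  qed
  show "{w \<in> cone_of X. \<forall>l. l \<notin> S \<longrightarrow> rpairing w (X l) = 0} \<subseteq> convex_cone hull (ray X ` S)"
  proof
    fix w assume "w \<in> {w \<in> cone_of X. \<forall>l. l \<notin> S \<longrightarrow> rpairing w (X l) = 0}"
    then have w: "\<And>l. rpairing w (X l) \<ge> 0" "\<And>l. l \<notin> S \<Longrightarrow> rpairing w (X l) = 0" by (auto simp: cone_of_def)
    have t: "rpairing w (X l) *\<^sub>R ray X l \<in> convex_cone hull (ray X ` S)" for l
    proof (cases "l \<in> S")
      case True
      then show ?thesis by (intro convex_cone_hull_mul w(1) hull_inc) simp
    next
      case False
      then show ?thesis by (simp add: w(2) convex_cone_hull_contains_0)
    qed
    have "(\<Sum>l\<in>T. rpairing w (X l) *\<^sub>R ray X l) \<in> convex_cone hull (ray X ` S)" for T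
      by (induction T rule: infinite_finite_induct) (simp_all add: convex_cone_hull_contains_0 convex_cone_hull_add t)
    then show "w \<in> convex_cone hull (ray X ` S)"
      by (subst ray_expand_dual[OF v, of w])
  qed
qed

text \<open>Every face of a polytope is exposed, by a functional that lies in some cone by
  completeness; conversely the sum of the rays in \<open>S\<close> exposes the face whose normal
  cone they span.\<close>

theorem normal_fan_newton_sum:
  assumes o: "orient E"
  shows "outer_normal_fan (newton_sum E) = {convex_cone hull (ray (ctuple E v) ` S) | v S. True}"
proof (intro equalityI subsetI)
  fix N assume "N \<in> outer_normal_fan (newton_sum E)"
  then obtain F where F: "F face_of newton_sum E" "F \<noteq> {}" "N = outer_normal_cone (newton_sum E) F"
    unfolding outer_normal_fan_def by blast
  have "F exposed_face_of newton_sum E"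
    using F(1) polytope_newton_sum exposed_face_of_polyhedron polytope_imp_polyhedron by blast
  then obtain w b where wb: "newton_sum E \<subseteq> {x. w \<bullet> x \<le> b}" "F = newton_sum E \<inter> {x. w \<bullet> x = b}"
    unfolding exposed_face_of_def by blast
  have "b = belt_support E w"
  proof (rule antisym)
    show "b \<le> belt_support E w" using F(2) wb(2) support_newton_sum(1)[OF o, of _ w] by auto
    show "belt_support E w \<le> b" using support_newton_sum(2)[OF o, of w] wb(1) by auto
  qed
  then have F': "F = newton_sum E \<inter> {x. w \<bullet> x = belt_support E w}" using wb(2) by simp
  obtain v where v: "w \<in> cone_of (ctuple E v)" using cones_complete[OF o] by blast
  have "N = convex_cone hull (ray (ctuple E v) ` {l. rpairing w (ctuple E v l) \<noteq> 0})"
    unfolding F(3) F' normal_cone_exposed[OF o link(1)[OF o] v] cone_generators[OF link(1)[OF o]] by simp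
  then show "N \<in> {convex_cone hull (ray (ctuple E v) ` S) | v S. True}" by blast
next
  fix N assume "N \<in> {convex_cone hull (ray (ctuple E v) ` S) | v S. True}"
  then obtain v S where N: "N = convex_cone hull (ray (ctuple E v) ` S)" by blast
  define X where "X = ctuple E v"
  have v: "valid E X" unfolding X_def by (rule link(1)[OF o])
  define w where "w = (\<Sum>l\<in>S. ray X l)"
  have rw: "rpairing w (X l) = (if l \<in> S then 1 else 0)" for l
    by (simp add: w_def rpairing_sum_left rpairing_ray[OF v])
  then have w: "w \<in> cone_of X" by (simp add: cone_of_def)
  let ?F = "newton_sum E \<inter> {x. w \<bullet> x = belt_support E w}"
  have "N = outer_normal_cone (newton_sum E) ?F"
    unfolding N X_def[symmetric] normal_cone_exposed[OF o v w] cone_generators[OF v] by (simp add: rw)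
  moreover have "?F face_of newton_sum E"
    by (intro face_of_Int_supporting_hyperplane_le support_newton_sum(1)[OF o] polytope_imp_convex polytope_newton_sum)
  moreover have "?F \<noteq> {}" using support_newton_sum(2)[OF o, of w] by blast
  ultimately show "N \<in> outer_normal_fan (newton_sum E)"
    unfolding outer_normal_fan_def by blast
qed

section \<open>The dual diagram\<close>

lemma lcartan_transpose: "lcartan (transpose A) (\<lambda>i. 1 / d i)"
proof
  have t: "transpose A $ i $ j = A $ j $ i" for i j by (simp add: transpose_def)
  have s: "of_int (A $ j $ i) / d i = of_int (A $ i $ j) / d j" for i j
    using sym[of i j] d_pos[of i] d_pos[of j] by (simp add: field_simps)
  show "1 / d i > 0" for i using d_pos[of i] by simp
  show "1 / d i * of_int (transpose A $ i $ j) = 1 / d j * of_int (transpose A $ j $ i)" for i j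
    using s[of j i] by (simp add: t)
  show "transpose A $ i $ i = 2" for i by (simp add: t diag)
  show "transpose A $ i $ j \<le> 0" if "i \<noteq> j" for i j using offdiag[of j i] that by (simp add: t)
  fix v :: "(real, 'n) vec" assume v: "v \<noteq> 0"
  \<comment> \<open>Dividing by \<open>d i\<close> turns the form of the transposed matrix with
    inverse weights into the original form.\<close>
  define u :: "(real, 'n) vec" where "u = (\<chi> i. v $ i / d i)"
  have "u $ i = 0 \<longleftrightarrow> v $ i = 0" for i using d_pos[of i] by (simp add: u_def)
  then have "u \<noteq> 0" using v by (auto simp: vec_eq_iff)
  have "d i * of_int (A $ i $ j) * u $ i * u $ j = 1 / d i * of_int (transpose A $ i $ j) * v $ i * v $ j" for i j
    using s[of j i] d_pos[of i] d_pos[of j] by (simp add: u_def t field_simps)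
  then show "(\<Sum>i\<in>UNIV. \<Sum>j\<in>UNIV. 1 / d i * of_int (transpose A $ i $ j) * v $ i * v $ j) > 0"
    using posdef[OF \<open>u \<noteq> 0\<close>] by simp
qed

lemma orient_transpose: "diagram_orientation (transpose A) E \<longleftrightarrow> orient E"
proof -
  have "diagram_edges (transpose A) = diagram_edges A"
    using A_zero_sym by (auto simp: diagram_edges_def transpose_def)
  then show ?thesis by (simp add: diagram_orientation_def)
qed

text \<open>The two initial matrices are conjugate by the diagonal of \<open>d\<close>, with frozen
  row \<open>i\<close> scaled like mutable row \<open>i\<close>, and mutation commutes with positive
  rescaling of this kind.\<close>

lemma ematrix_transpose:
  fixes E :: "('n \<times> 'n) set" and v :: "'n list"
  defines "b \<equiv> fold matrix_mutation v (snd (principal_seed (exchange_matrix (transpose A) E)))"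
  shows "d j * of_int (b $ MutVar i $ j) = d i * of_int (ematrix E v $ MutVar i $ j)"
    and "d j * of_int (b $ FrozVar i $ j) = d i * of_int (ematrix E v $ FrozVar i $ j)"
proof -
  define D where "D u = (case u of MutVar i \<Rightarrow> d i | FrozVar i \<Rightarrow> d i)" for u :: "'n var"
  have D0: "D u > 0" for u using d_pos by (cases u) (simp_all add: D_def)
  have "d j * of_int (b $ u $ j) = D u * of_int (ematrix E v $ u $ j)" for u j
    unfolding b_def
  proof (induction v arbitrary: u j rule: rev_induct)
    case Nil
    show ?case
    proof (cases u)
      case (MutVar i)
      have "d j * of_int (A $ j $ i) = d i * of_int (A $ i $ j)" by (rule sym)
      then show ?thesis using MutVar
        by (simp add: D_def ematrix_Nil mat0_nth principal_seed_def exchange_matrix_def transpose_def)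
    next
      case (FrozVar i)
      then show ?thesis by (simp add: D_def ematrix_Nil mat0_nth principal_seed_def)
    qed
  next
    case (snoc k v)
    let ?b = "fold matrix_mutation v (snd (principal_seed (exchange_matrix (transpose A) E)))" and ?c = "ematrix E v"
    have b: "of_int (?b $ u $ j) = D u / d j * of_int (?c $ u $ j)" for u j
      using snoc.IH[of j u] d_pos[of j] by (simp add: field_simps)
    have m: "max 0 (c * x) = c * max 0 x" if "c > 0" for c x :: real
      using that by (simp add: max_mult_distrib_left)
    have Dk: "D (MutVar k) = d k" by (simp add: D_def)
    have p: "D u / d k > 0" "d k / d j > 0" using D0[of u] d_pos[of k] d_pos[of j] by simp_all
    have m1: "max 0 (of_int (?b $ u $ k)) = D u / d k * max 0 (of_int (?c $ u $ k))"
      "max 0 (- of_int (?b $ u $ k)) = D u / d k * max 0 (- of_int (?c $ u $ k))"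
      "max 0 (of_int (?b $ MutVar k $ j)) = d k / d j * max 0 (of_int (?c $ MutVar k $ j))"
      "max 0 (- of_int (?b $ MutVar k $ j)) = d k / d j * max 0 (- of_int (?c $ MutVar k $ j))"
      unfolding b Dk m[OF p(1), symmetric] m[OF p(2), symmetric] by simp_all
    show ?case
    proof (cases "u = MutVar k \<or> j = k")
      case True
      then show ?thesis using snoc.IH[of j u] by (auto simp: matrix_mutation_nth ematrix_snoc)
    next
      case False
      then have "real_of_int (matrix_mutation k ?b $ u $ j) = of_int (?b $ u $ j)
          + max 0 (of_int (?b $ u $ k)) * max 0 (of_int (?b $ MutVar k $ j))
          - max 0 (- of_int (?b $ u $ k)) * max 0 (- of_int (?b $ MutVar k $ j))"
        by (simp add: matrix_mutation_nth of_int_max)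
      also have "\<dots> = D u / d j * (of_int (?c $ u $ j)
          + max 0 (of_int (?c $ u $ k)) * max 0 (of_int (?c $ MutVar k $ j))
          - max 0 (- of_int (?c $ u $ k)) * max 0 (- of_int (?c $ MutVar k $ j)))"
        unfolding m1 b[of u j] using d_pos[of k] by (simp add: algebra_simps)
      also have "\<dots> = D u / d j * of_int (matrix_mutation k ?c $ u $ j)"
        using False by (simp add: matrix_mutation_nth of_int_max)
      finally show ?thesis
        using d_pos[of j] by (simp add: ematrix_snoc)
    qed
  qed
  from this[of j "MutVar i"] this[of j "FrozVar i"]
  show "d j * of_int (b $ MutVar i $ j) = d i * of_int (ematrix E v $ MutVar i $ j)"
    "d j * of_int (b $ FrozVar i $ j) = d i * of_int (ematrix E v $ FrozVar i $ j)"
    by (simp_all add: D_def)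
qed

text \<open>Duality in the transposed diagram uses the weights \<open>1 / d r\<close>, and its
  c-vectors are the original ones scaled by \<open>d r / d j\<close>. The factors \<open>d r\<close>
  cancel, so its g-vectors form the plain dual basis of the original c-vectors, that is, the
  rays.\<close>

lemma cluster_fan_transpose:
  assumes o: "orient E"
  shows "cluster_fan (exchange_matrix (transpose A) E) = {convex_cone hull (ray (ctuple E v) ` S) | v S. True}"
proof -
  interpret T: lcartan "transpose A" "\<lambda>i. 1 / d i" by (rule lcartan_transpose)
  have oT: "T.orient E" using o by (simp add: orient_transpose)
  have g: "real_vector (g_vector (exchange_matrix (transpose A) E) (T.clvar E v i)) = ray (ctuple E v) i" for v i
  proof -
    obtain G where G: "T.gdata E v G" using T.gdata_exists[OF oT] by blast
    have ctuple: "of_int (T.ctuple E v j $ r) = d r / d j * of_int (ctuple E v j $ r)" for j r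
      using ematrix_transpose(2)[of j v E r] d_pos[of j]
      by (simp add: ctuple_def T.ctuple_def T.ematrix_def T.mat0_def field_simps)
    have "pairing (G i) (ctuple E v j) = (if i = j then 1 else 0)" for i j
    proof -
      have "(\<Sum>r\<in>UNIV. 1 / d r * of_int (G i $ r) * of_int (T.ctuple E v j $ r)) = (if i = j then 1 / d j else 0)"
        using G unfolding T.gdata_def T.dpairing_def by blast
      moreover have "1 / d r * of_int (G i $ r) * of_int (T.ctuple E v j $ r) = 1 / d j * (of_int (G i $ r) * of_int (ctuple E v j $ r))" for r
        unfolding ctuple using d_pos[of r] by simp
      ultimately have "1 / d j * of_int (pairing (G i) (ctuple E v j)) = (if i = j then 1 / d j else 0)"
        unfolding pairing_def by (simp add: sum_distrib_left)
      then show ?thesis using d_pos[of j] by (auto split: if_splits)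
    qed
    moreover have "lincomb (\<lambda>l. pairing (G l) x) (ctuple E v) = x" for x
    proof -
      obtain c where c: "x = lincomb c (ctuple E v)"
        using validD(2)[OF link(1)[OF o, of v]] unfolding spans_def by blast
      have "pairing (G l) x = (\<Sum>j\<in>UNIV. if l = j then c l else 0)" for l
        unfolding c pairing_lincomb by (intro sum.cong) (simp_all add: calculation)
      then show ?thesis by (simp add: c)
    qed
    ultimately have "dual_to G (ctuple E v)" unfolding dual_to_def by blast
    then show ?thesis
      unfolding T.g_vector_clvar[OF oT G] ray_def by (simp add: dual_eqI)
  qed
  have "(\<lambda>f. real_vector (g_vector (exchange_matrix (transpose A) E) f)) ` (T.clvar E v ` S) = ray (ctuple E v) ` S" for v S
    unfolding image_image g ..
  note im = this
  show ?thesis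
  proof (intro equalityI subsetI)
    fix N assume "N \<in> cluster_fan (exchange_matrix (transpose A) E)"
    then obtain S C where S: "N = convex_cone hull ((\<lambda>f. real_vector (g_vector (exchange_matrix (transpose A) E) f)) ` S)"
      "C \<in> clusters (exchange_matrix (transpose A) E)" "S \<subseteq> C"
      unfolding cluster_fan_def by blast
    then obtain v where "S \<subseteq> range (T.clvar E v)"
      unfolding T.clusters_words by blast
    then obtain S' where "S = T.clvar E v ` S'" by (rule subset_imageE)
    then have "N = convex_cone hull (ray (ctuple E v) ` S')" using S(1) im by simp
    then show "N \<in> {convex_cone hull (ray (ctuple E v) ` S) | v S. True}" by blast
  next
    fix N assume "N \<in> {convex_cone hull (ray (ctuple E v) ` S) | v S. True}"
    then obtain v S where "N = convex_cone hull (ray (ctuple E v) ` S)" by blast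
    then have "N = convex_cone hull ((\<lambda>f. real_vector (g_vector (exchange_matrix (transpose A) E) f)) ` (T.clvar E v ` S))"
      by (simp only: im)
    moreover have "range (T.clvar E v) \<in> clusters (exchange_matrix (transpose A) E)"
      unfolding T.clusters_words by blast
    ultimately show "N \<in> cluster_fan (exchange_matrix (transpose A) E)"
      unfolding cluster_fan_def by blast
  qed
qed

end

theorem theorem2p4:
  fixes A :: "'n::{finite,linorder} int_matrix"
    and E :: "('n \<times> 'n) set"
    and B Bdual :: "'n int_matrix"
  assumes "finite_type_dynkin A"
    and "diagram_orientation A E"
    and "B = exchange_matrix A E"
    and "Bdual = exchange_matrix (transpose A) E"
  shows "outer_normal_fan (\<Sum>\<gamma>\<in>cluster_variables B. newton_polytope (F_polynomial \<gamma>))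
           = cluster_fan Bdual"
proof -
  obtain d :: "'n \<Rightarrow> real" where d: "\<And>i. d i > 0"
    "\<And>i j. d i * real_of_int (A $ i $ j) = d j * real_of_int (A $ j $ i)"
    "\<And>v :: (real, 'n) vec. v \<noteq> 0 \<Longrightarrow> (\<Sum>i\<in>UNIV. \<Sum>j\<in>UNIV. d i * real_of_int (A $ i $ j) * v $ i * v $ j) > 0"
    using assms(1) unfolding finite_type_dynkin_def finite_type_matrix_def by blast
  interpret lcartan A d
    by standard (use d assms(1) in \<open>auto simp: finite_type_dynkin_def generalized_cartan_matrix_def\<close>)
  show ?thesis
    unfolding assms(3,4) cluster_fan_transpose[OF assms(2)] normal_fan_newton_sum[OF assms(2), unfolded newton_sum_def] ..
qed

end
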